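(* Let $n\ge2$, $m\ge1$, $2\le q<p<n$, let $\Omega\subset\mathbb{R}^n$ be a bounded open set, and let $G$ satisfy hypotheses H.1 and H.2 (stated in the context) with exponent $q$. For $\varepsilon\in(0,1]$ let $u_\varepsilon\in W^{1,p}(\Omega,\mathbb{R}^m)$ be a local minimizer of the functional $\mathcal{F}_\varepsilon(\cdot,\Omega)$ defined in the context. Then $|\nabla u_\varepsilon|\in L^{\frac{2^*}{2}q}_{loc}(\Omega)$, where $2^*=\frac{2n}{n-2}$.
   Context: Notation: $\mathbb{R}^m_{+,0}=[0,+\infty)^m$; $u=(u^1,\dots,u^m)$. For $0<\varepsilon\le1$, $$\mathcal{F}_\varepsilon(u,\Omega)=\int_\Omega\varepsilon\sum_{\alpha=1}^m|\nabla u^\alpha|^p+G\left(\sqrt{|u^1|^2+\varepsilon},\dots,\sqrt{|u^m|^2+\varepsilon},\sqrt{|\nabla u^1|^2+\varepsilon},\dots,\sqrt{|\nabla u^m|^2+\varepsilon}\right)dx.$$ H.1: $G:\mathbb{R}^m_{+,0}\times\mathbb{R}^m_{+,0}\to\mathbb{R}$ is strictly convex, and there are a constant $L_0>1$ and a measurable function $a:\Omega\to[0,\infty)$ such that for every $s,\xi\in\mathbb{R}^m_{+,0}$ (and a.e. $x\in\Omega$) $$\sum_{\alpha=1}^m(\xi^\alpha)^q+\sum_{\alpha=1}^m(s^\alpha)^q\le G(s,\xi)\le L_0\Big[\sum_{\alpha=1}^m(\xi^\alpha)^q+\sum_{\alpha=1}^m(s^\alpha)^q+a(x)\Big].$$ H.2: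 $G\in C^2(\mathbb{R}^m_{+,0}\times\mathbb{R}^m_{+,0})$ and there is $\vartheta>0$ such that $$\sum_{\alpha,\beta=1}^m\Big(\partial_{s^\beta s^\alpha}G(s,\xi)\lambda^\alpha\lambda^\beta+\partial_{\xi^\beta s^\alpha}G(s,\xi)\lambda^\alpha\mu^\beta+\partial_{s^\beta\xi^\alpha}G(s,\xi)\mu^\alpha\lambda^\beta+\partial_{\xi^\beta\xi^\alpha}G(s,\xi)\mu^\alpha\mu^\beta\Big)\ge\vartheta\left(|s|^{q-2}+|\xi|^{q-2}\right)\left(|\lambda|^2+|\mu|^2\right)$$ for every $(s,\xi)\in\mathbb{R}^m_{+,0}\times\mathbb{R}^m_{+,0}$ and every $(\lambda,\mu)\in\mathbb{R}^m\times\mathbb{R}^m$. Moreover there is $L_1>1$ such that for all $\alpha,\beta=1,\dots,m$ and all $(s,\xi)\in\mathbb{R}^m_{+,0}\times\mathbb{R}^m_{+,0}$: $0\le\partial_{\xi^\alpha}G(s,\xi)\le L_1[|s|^{q-1}+|\xi|^{q-1}]$, $0\le\partial_{s^\alpha}G(s,\xi)\le L_1[|s|^{q-1}+|\xi|^{q-1}]$, and each of $|\partial_{s^\beta s^\alpha}G(s,\xi)|$, $|\partial_{s^\beta\xi^\alpha}G(s,\xi)|$, $|\partial_{\xi^\beta\xi^\alpha}G(s,\xi)|$ is $\le L_1[|s|^{q-2}+|\xi|^{q-2}]$. A function $u\in W^{1,p}(\Omega,\mathbb{R}^m)$ is a local minimizer of $\mathcal{F}_\varepsilon$ if $\mathcal{F}_\varepsilon(u,\Sigma)\le\mathcal{F}_\varepsilon(u+\varphi,\Sigma)$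 for every open $\Sigma\subset\subset\Omega$ and every $\varphi\in W^{1,p}_0(\Sigma,\mathbb{R}^m)$, where $\mathcal{F}_\varepsilon(\cdot,\Sigma)$ is the same integral over $\Sigma$. *)

theory Defs
  imports "HOL-Analysis.Analysis"
begin

(* For a convex S with nonempty interior the Frechet derivative within S is unique at every point
   of S, boundary points included, so the choice operator in frechet_derivative is harmless. *)
definition partial_on ::
    "'a::euclidean_space set \<Rightarrow> 'a \<Rightarrow> ('a \<Rightarrow> 'b::real_normed_vector) \<Rightarrow> 'a \<Rightarrow> 'b" where
  "partial_on S b f x = frechet_derivative f (at x within S) b"

primrec Ck_on ::
    "nat \<Rightarrow> 'a::euclidean_space set \<Rightarrow> ('a \<Rightarrow> 'b::real_normed_vector) \<Rightarrow> bool" where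
  "Ck_on 0 S f \<longleftrightarrow> continuous_on S f"
| "Ck_on (Suc k) S f \<longleftrightarrow> f differentiable_on S \<and> (\<forall>b\<in>Basis. Ck_on k S (partial_on S b f))"

definition test_functions ::
    "'a::euclidean_space set \<Rightarrow> ('a \<Rightarrow> 'b::real_normed_vector) set" where
  "test_functions \<Omega> = {\<phi>. (\<forall>k. Ck_on k UNIV \<phi>) \<and>
     compact (closure {x. \<phi> x \<noteq> 0}) \<and> closure {x. \<phi> x \<noteq> 0} \<subseteq> \<Omega>}"

definition compactly_inside :: "'a::euclidean_space set \<Rightarrow> 'a set \<Rightarrow> bool" where
  "compactly_inside S \<Omega> \<longleftrightarrow> compact (closure S) \<and> closure S \<subseteq> \<Omega>"

definition Lp ::
    "real \<Rightarrow> 'a::euclidean_space set \<Rightarrow> ('a \<Rightarrow> 'b::euclidean_space) set" where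
  "Lp p \<Omega> = {f. set_borel_measurable lebesgue \<Omega> f \<and>
                set_integrable lebesgue \<Omega> (\<lambda>x. norm (f x) powr p)}"

definition Lp_loc ::
    "real \<Rightarrow> 'a::euclidean_space set \<Rightarrow> ('a \<Rightarrow> 'b::euclidean_space) set" where
  "Lp_loc p \<Omega> = {f. \<forall>K. compact K \<and> K \<subseteq> \<Omega> \<longrightarrow> f \<in> Lp p K}"

(* D x $ \<alpha> is the gradient at x of the component u\<^sup>\<alpha>; norm (D x) is the Frobenius norm. *)
definition has_weak_gradient ::
    "(real^'n) set \<Rightarrow> (real^'n \<Rightarrow> real^'m) \<Rightarrow> (real^'n \<Rightarrow> real^'n^'m) \<Rightarrow> bool" where
  "has_weak_gradient \<Omega> u D \<longleftrightarrow> u \<in> Lp_loc 1 \<Omega> \<and> D \<in> Lp_loc 1 \<Omega> \<and>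
     (\<forall>\<phi>\<in>test_functions \<Omega>. \<forall>\<alpha> i.
        (LINT x:\<Omega>|lebesgue. u x $ \<alpha> * partial_on UNIV (axis i 1) \<phi> x) =
        - (LINT x:\<Omega>|lebesgue. D x $ \<alpha> $ i * \<phi> x))"

(* A representative; weak gradients are unique up to null subsets of \<Omega>. *)
definition weak_gradient ::
    "(real^'n) set \<Rightarrow> (real^'n \<Rightarrow> real^'m) \<Rightarrow> real^'n \<Rightarrow> real^'n^'m" where
  "weak_gradient \<Omega> u = (SOME D. has_weak_gradient \<Omega> u D)"

definition W1p :: "real \<Rightarrow> (real^'n) set \<Rightarrow> (real^'n \<Rightarrow> real^'m) set" where
  "W1p p \<Omega> = {u. u \<in> Lp p \<Omega> \<and> (\<exists>D. has_weak_gradient \<Omega> u D \<and> D \<in> Lp p \<Omega>)}"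

definition W1p_norm :: "real \<Rightarrow> (real^'n) set \<Rightarrow> (real^'n \<Rightarrow> real^'m) \<Rightarrow> real" where
  "W1p_norm p \<Omega> u =
     ((LINT x:\<Omega>|lebesgue. norm (u x) powr p) +
      (LINT x:\<Omega>|lebesgue. norm (weak_gradient \<Omega> u x) powr p)) powr (1 / p)"

definition W1p_0 :: "real \<Rightarrow> (real^'n) set \<Rightarrow> (real^'n \<Rightarrow> real^'m) set" where
  "W1p_0 p \<Omega> = {u \<in> W1p p \<Omega>.
     \<forall>e>0. \<exists>\<psi>\<in>test_functions \<Omega>. W1p_norm p \<Omega> (\<lambda>x. u x - \<psi> x) < e}"

definition orthant :: "(real^'m) set" where
  "orthant = {s. \<forall>\<alpha>. 0 \<le> s $ \<alpha>}"

definition strictly_convex_on :: "'a::real_vector set \<Rightarrow> ('a \<Rightarrow> real) \<Rightarrow> bool" where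
  "strictly_convex_on S f \<longleftrightarrow> convex S \<and>
     (\<forall>x\<in>S. \<forall>y\<in>S. \<forall>t. x \<noteq> y \<and> 0 < t \<and> t < 1 \<longrightarrow>
        f ((1 - t) *\<^sub>R x + t *\<^sub>R y) < (1 - t) * f x + t * f y)"

definition hyp_H1 :: "(real^'n) set \<Rightarrow> real \<Rightarrow> ((real^'m) \<times> (real^'m) \<Rightarrow> real) \<Rightarrow> bool" where
  "hyp_H1 \<Omega> q G \<longleftrightarrow> strictly_convex_on (orthant \<times> orthant) G \<and>
     (\<exists>L0 > 1. \<exists>a :: real^'n \<Rightarrow> real.
        set_borel_measurable lebesgue \<Omega> a \<and> (\<forall>x\<in>\<Omega>. 0 \<le> a x) \<and>
        (\<forall>s\<in>orthant. \<forall>\<xi>\<in>orthant. AE x in lebesgue. x \<in> \<Omega> \<longrightarrow>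
           (\<Sum>\<alpha>\<in>UNIV. (\<xi> $ \<alpha>) powr q) + (\<Sum>\<alpha>\<in>UNIV. (s $ \<alpha>) powr q) \<le> G (s, \<xi>) \<and>
           G (s, \<xi>) \<le>
             L0 * ((\<Sum>\<alpha>\<in>UNIV. (\<xi> $ \<alpha>) powr q) + (\<Sum>\<alpha>\<in>UNIV. (s $ \<alpha>) powr q) + a x)))"

(* Since 0 powr 0 = 0, powr would give the wrong value of |s|^(q-2) when q = 2 and s = 0. *)
definition rpow :: "real \<Rightarrow> real \<Rightarrow> real" where
  "rpow x r = (if r = 0 then 1 else x powr r)"

definition d_s ::
    "'m \<Rightarrow> ((real^'m) \<times> (real^'m) \<Rightarrow> real) \<Rightarrow> (real^'m) \<times> (real^'m) \<Rightarrow> real" where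
  "d_s \<alpha> = partial_on (orthant \<times> orthant) (axis \<alpha> 1, 0)"

definition d_xi ::
    "'m \<Rightarrow> ((real^'m) \<times> (real^'m) \<Rightarrow> real) \<Rightarrow> (real^'m) \<times> (real^'m) \<Rightarrow> real" where
  "d_xi \<alpha> = partial_on (orthant \<times> orthant) (0, axis \<alpha> 1)"

definition hyp_H2 :: "real \<Rightarrow> ((real^'m) \<times> (real^'m) \<Rightarrow> real) \<Rightarrow> bool" where
  "hyp_H2 q G \<longleftrightarrow> Ck_on 2 (orthant \<times> orthant) G \<and>
     (\<exists>\<theta> > 0. \<forall>s\<in>orthant. \<forall>\<xi>\<in>orthant. \<forall>lam mu :: real^'m.
        (\<Sum>\<alpha>\<in>UNIV. \<Sum>\<beta>\<in>UNIV.
            d_s \<beta> (d_s \<alpha> G) (s, \<xi>) * lam $ \<alpha> * lam $ \<beta>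
          + d_xi \<beta> (d_s \<alpha> G) (s, \<xi>) * lam $ \<alpha> * mu $ \<beta>
          + d_s \<beta> (d_xi \<alpha> G) (s, \<xi>) * mu $ \<alpha> * lam $ \<beta>
          + d_xi \<beta> (d_xi \<alpha> G) (s, \<xi>) * mu $ \<alpha> * mu $ \<beta>)
        \<ge> \<theta> * (rpow (norm s) (q - 2) + rpow (norm \<xi>) (q - 2)) * ((norm lam)\<^sup>2 + (norm mu)\<^sup>2)) \<and>
     (\<exists>L1 > 1. \<forall>\<alpha> \<beta>. \<forall>s\<in>orthant. \<forall>\<xi>\<in>orthant.
        0 \<le> d_xi \<alpha> G (s, \<xi>) \<and>
        d_xi \<alpha> G (s, \<xi>) \<le> L1 * (rpow (norm s) (q - 1) + rpow (norm \<xi>) (q - 1)) \<and>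
        0 \<le> d_s \<alpha> G (s, \<xi>) \<and>
        d_s \<alpha> G (s, \<xi>) \<le> L1 * (rpow (norm s) (q - 1) + rpow (norm \<xi>) (q - 1)) \<and>
        \<bar>d_s \<beta> (d_s \<alpha> G) (s, \<xi>)\<bar> \<le> L1 * (rpow (norm s) (q - 2) + rpow (norm \<xi>) (q - 2)) \<and>
        \<bar>d_s \<beta> (d_xi \<alpha> G) (s, \<xi>)\<bar> \<le> L1 * (rpow (norm s) (q - 2) + rpow (norm \<xi>) (q - 2)) \<and>
        \<bar>d_xi \<beta> (d_xi \<alpha> G) (s, \<xi>)\<bar> \<le> L1 * (rpow (norm s) (q - 2) + rpow (norm \<xi>) (q - 2)))"

(* For bounded \<Omega>, q \<le> p and v in W1p p \<Omega>, the growth bounds on G make the integrand integrable,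
   so the value 0 of the Bochner integral on non-integrable functions plays no role. *)
definition F_eps ::
    "real \<Rightarrow> ((real^'m) \<times> (real^'m) \<Rightarrow> real) \<Rightarrow> real \<Rightarrow>
     (real^'n \<Rightarrow> real^'m) \<Rightarrow> (real^'n) set \<Rightarrow> real" where
  "F_eps p G \<epsilon> v \<Omega> = (LINT x:\<Omega>|lebesgue.
     \<epsilon> * (\<Sum>\<alpha>\<in>UNIV. norm (weak_gradient \<Omega> v x $ \<alpha>) powr p) +
     G (\<chi> \<alpha>. sqrt (\<bar>v x $ \<alpha>\<bar>\<^sup>2 + \<epsilon>), \<chi> \<alpha>. sqrt ((norm (weak_gradient \<Omega> v x $ \<alpha>))\<^sup>2 + \<epsilon>)))"

definition local_minimizer ::
    "real \<Rightarrow> ((real^'m) \<times> (real^'m) \<Rightarrow> real) \<Rightarrow> real \<Rightarrow>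
     (real^'n) set \<Rightarrow> (real^'n \<Rightarrow> real^'m) \<Rightarrow> bool" where
  "local_minimizer p G \<epsilon> \<Omega> u \<longleftrightarrow> u \<in> W1p p \<Omega> \<and>
     (\<forall>S \<phi>. open S \<and> compactly_inside S \<Omega> \<and> \<phi> \<in> W1p_0 p S \<longrightarrow>
        F_eps p G \<epsilon> u S \<le> F_eps p G \<epsilon> (\<lambda>x. u x + \<phi> x) S)"

end

theory Submission
  imports Defs
begin

text \<open>The minimizer \<open>u\<close> with weak gradient \<open>D\<close> is compared directly with an average of
  localised translates of itself.

  Fix a ball inside \<open>\<Omega>\<close>, a cutoff function \<open>\<zeta>\<close> and a small vector \<open>h\<close>. The map \<open>y - \<zeta>(y) h\<close> is a diffeomorphism. Composing \<open>u\<close>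
  with its inverse gives a map that is the translate of \<open>u\<close> by \<open>h\<close> where \<open>\<zeta> = 1\<close> and equals \<open>u\<close> where \<open>\<zeta> = 0\<close>. The
  competitor is the mean of the two maps that belong to \<open>h\<close> and \<open>-h\<close> (\<open>mean_competitor\<close>). Two facts about the energy density are played
  against each other.

  Gain. \<open>G\<close> is convex and nondecreasing in each variable, and \<open>sqrt (|v|\<^sup>2 + \<epsilon>)\<close> is convex in \<open>v\<close>; together with Clarkson's inequality
  for the term \<open>\<epsilon> |\<nabla>u|\<^sup>p\<close> this shows that the energy of the mean is below the mean of the two energies, at least by \<open>\<epsilon>\<close> times
  the integral of the \<open>p\<close>-th powers of half the difference of the two gradients (\<open>integrand_midpoint\<close>).

  Loss. A change of variables writes the two energies as integrals of the density at slightly changed gradients, weighted with the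
  Jacobians. The terms of first order in \<open>h\<close> have opposite signs and cancel in the sum, and the upper bounds on the second
  derivatives of \<open>G\<close> leave an error of order \<open>|h|\<^sup>2\<close> (\<open>shifted_integrand_le\<close>). A single translate would leave an error of order
  \<open>|h|\<close>, which is too weak.

  Minimality now yields that the integral of \<open>|D(x+h) - D(x-h)|\<^sup>p\<close> over a smaller ball is at most \<open>C |h|\<^sup>2\<close>
  (\<open>symmetric_difference_estimate\<close>). So \<open>D\<close> has fractional smoothness \<open>2/p\<close> in \<open>L\<^sup>p\<close>, and telescoping its averages over balls of dyadic
  radii shows that it lies locally in \<open>L\<^sup>s\<close> for every \<open>s < p n / (n - 2)\<close> (\<open>higher_integrability\<close>). As \<open>q < p\<close>, the exponent
  \<open>q n / (n - 2)\<close> is among these.\<close>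

section \<open>Smooth functions\<close>

lemma partial_on_UNIV:
  "(f has_derivative f') (at x) \<Longrightarrow> partial_on UNIV b f x = f' b"
  by (simp add: partial_on_def frechet_derivative_at[symmetric])

lemma has_derivative_partial_on:
  "f differentiable (at x) \<Longrightarrow> (f has_derivative (\<lambda>b. partial_on UNIV b f x)) (at x)"
  by (simp add: partial_on_def frechet_derivative_works[symmetric])

lemma Ck_Suc_imp_Ck: "Ck_on (Suc k) UNIV f \<Longrightarrow> Ck_on k UNIV f"
proof (induction k arbitrary: f)
  case 0
  then show ?case by (auto intro: differentiable_imp_continuous_on)
next
  case (Suc k)
  then show ?case by (metis Ck_on.simps(2))
qed

lemma Ck_const: "Ck_on k UNIV (\<lambda>x. c)"
proof (induction k arbitrary: c)
  case (Suc k)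
  have "partial_on UNIV b (\<lambda>x. c) = (\<lambda>x. 0)" for b :: 'a
    by (rule ext, rule partial_on_UNIV) auto
  then show ?case using Suc by auto
qed auto

text \<open>Closure properties of \<open>Ck_on\<close> go by induction on the order, and the partial derivatives must be recognised as
  functions of known class. Exhibiting the full derivative first makes every partial derivative explicit at once.\<close>

lemma Ck_SucI:
  assumes "\<And>x. (f has_derivative f' x) (at x)" "\<And>b. b \<in> Basis \<Longrightarrow> Ck_on k UNIV (\<lambda>x. f' x b)"
  shows "Ck_on (Suc k) UNIV f"
proof -
  have "partial_on UNIV b f = (\<lambda>x. f' x b)" for b
    using assms(1) partial_on_UNIV by blast
  then show ?thesis using assms by (auto simp: differentiable_on_def differentiable_def)
qed

lemma Ck_SucD:
  assumes "Ck_on (Suc k) UNIV f"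
  shows "(f has_derivative (\<lambda>b. partial_on UNIV b f x)) (at x)"
    "b \<in> Basis \<Longrightarrow> Ck_on k UNIV (\<lambda>x. partial_on UNIV b f x)"
  using assms by (auto simp: differentiable_on_def intro: has_derivative_partial_on)

lemma Ck_bounded_linear: "bounded_linear f \<Longrightarrow> Ck_on k UNIV f"
proof (cases k)
  case 0
  assume "bounded_linear f" then show ?thesis using 0 by (simp add: linear_continuous_on)
next
  case (Suc j)
  assume b: "bounded_linear f" show ?thesis unfolding Suc
    by (rule Ck_SucI[where f'="\<lambda>x. f"]) (auto intro: bounded_linear_imp_has_derivative b Ck_const)
qed

lemma Ck_linear_compose:
  assumes "bounded_linear L" "Ck_on k UNIV f" shows "Ck_on k UNIV (\<lambda>x. L (f x))"
  using assms(2)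
proof (induction k arbitrary: f)
  case 0
  then show ?case using assms(1) by (auto intro: bounded_linear.continuous_on)
next
  case (Suc k)
  show ?case
    by (rule Ck_SucI[where f'="\<lambda>x b. L (partial_on UNIV b f x)"])
      (rule bounded_linear.has_derivative[OF assms(1) Ck_SucD(1)[OF Suc.prems]] Suc.IH[OF Ck_SucD(2)[OF Suc.prems]], assumption?)+
qed

lemma Ck_add:
  assumes "Ck_on k UNIV f" "Ck_on k UNIV g" shows "Ck_on k UNIV (\<lambda>x. f x + g x)"
  using assms
proof (induction k arbitrary: f g)
  case 0
  then show ?case by (auto intro: continuous_intros)
next
  case (Suc k)
  show ?case
    by (rule Ck_SucI[where f'="\<lambda>x b. partial_on UNIV b f x + partial_on UNIV b g x"])
      (rule has_derivative_add[OF Ck_SucD(1)[OF Suc.prems(1)] Ck_SucD(1)[OF Suc.prems(2)]]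
        Suc.IH[OF Ck_SucD(2)[OF Suc.prems(1)] Ck_SucD(2)[OF Suc.prems(2)]], assumption?, assumption?)+
qed

lemma Ck_diff:
  assumes "Ck_on k UNIV f" "Ck_on k UNIV g" shows "Ck_on k UNIV (\<lambda>x. f x - g x)"
  using Ck_add[OF assms(1) Ck_linear_compose[OF bounded_linear_minus[OF bounded_linear_ident] assms(2)]] by simp

lemma Ck_sum:
  "(\<And>i. i \<in> I \<Longrightarrow> Ck_on k UNIV (f i)) \<Longrightarrow> Ck_on k UNIV (\<lambda>x. \<Sum>i\<in>I. f i x)"
  by (induction I rule: infinite_finite_induct) (auto intro: Ck_const Ck_add)

lemma Ck_scaleR:
  assumes "Ck_on k UNIV f" "Ck_on k UNIV g" shows "Ck_on k UNIV (\<lambda>x. f x *\<^sub>R g x)"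
  using assms
proof (induction k arbitrary: f g)
  case 0
  then show ?case by (auto intro: continuous_intros)
next
  case (Suc k)
  show ?case
    by (rule Ck_SucI[where f'="\<lambda>x b. f x *\<^sub>R partial_on UNIV b g x + partial_on UNIV b f x *\<^sub>R g x"])
      (rule has_derivative_scaleR[OF Ck_SucD(1)[OF Suc.prems(1)] Ck_SucD(1)[OF Suc.prems(2)]]
        Ck_add[OF Suc.IH[OF Ck_Suc_imp_Ck[OF Suc.prems(1)] Ck_SucD(2)[OF Suc.prems(2)]]
          Suc.IH[OF Ck_SucD(2)[OF Suc.prems(1)] Ck_Suc_imp_Ck[OF Suc.prems(2)]]], assumption?, assumption?)+
qed

lemma Ck_mult:
  fixes f g :: "'a::euclidean_space \<Rightarrow> real"
  assumes "Ck_on k UNIV f" "Ck_on k UNIV g" shows "Ck_on k UNIV (\<lambda>x. f x * g x)"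
  using Ck_scaleR[OF assms] by simp

text \<open>By the chain rule a partial derivative of the composition is a sum of products of components of \<open>\<partial>\<^sub>b g\<close> with
  \<open>\<partial>\<^sub>i f \<circ> g\<close>; the induction therefore varies \<open>f\<close> and keeps \<open>g\<close> fixed.\<close>

lemma Ck_compose:
  fixes f :: "'b::euclidean_space \<Rightarrow> 'c::real_normed_vector" and g :: "'a::euclidean_space \<Rightarrow> 'b"
  assumes "Ck_on k UNIV f" "Ck_on k UNIV g" shows "Ck_on k UNIV (\<lambda>x. f (g x))"
  using assms
proof (induction k arbitrary: f)
  case 0
  then show ?case using continuous_on_compose2[of UNIV f UNIV g] by auto
next
  case (Suc k)
  have lin: "partial_on UNIV v f y = (\<Sum>i\<in>Basis. (v \<bullet> i) *\<^sub>R partial_on UNIV i f y)" for v y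
  proof -
    have "linear (\<lambda>b. partial_on UNIV b f y)"
      using Ck_SucD(1)[OF Suc.prems(1)] has_derivative_linear by blast
    from linear_sum[OF this, of "\<lambda>i. (v \<bullet> i) *\<^sub>R i" Basis] show ?thesis
      by (simp add: euclidean_representation linear_scale[OF \<open>linear _\<close>])
  qed
  show ?case
  proof (rule Ck_SucI[where f'="\<lambda>x b. partial_on UNIV (partial_on UNIV b g x) f (g x)"])
    show "((\<lambda>x. f (g x)) has_derivative (\<lambda>b. partial_on UNIV (partial_on UNIV b g x) f (g x))) (at x)" for x
      using has_derivative_compose[OF Ck_SucD(1)[OF Suc.prems(2)] Ck_SucD(1)[OF Suc.prems(1)]] .
    fix b :: 'a assume b: "b \<in> Basis"
    show "Ck_on k UNIV (\<lambda>x. partial_on UNIV (partial_on UNIV b g x) f (g x))"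
      unfolding lin[of "partial_on UNIV b g _"]
      by (intro Ck_sum Ck_scaleR Suc.IH Ck_linear_compose[OF bounded_linear_inner_left]
          Ck_SucD(2)[OF Suc.prems(2) b] Ck_SucD(2)[OF Suc.prems(1)] Ck_Suc_imp_Ck[OF Suc.prems(2)])
  qed
qed

abbreviation smooth :: "('a::euclidean_space \<Rightarrow> 'b::real_normed_vector) \<Rightarrow> bool" where
  "smooth f \<equiv> \<forall>k. Ck_on k UNIV f"

lemma smooth_has_derivative:
  "smooth f \<Longrightarrow> (f has_derivative (\<lambda>b. partial_on UNIV b f x)) (at x)"
  using Ck_SucD(1)[of 0 f] by blast

lemma smooth_continuous: "smooth f \<Longrightarrow> continuous_on UNIV f"
  using Ck_on.simps(1) by blast

lemma smooth_partial_linear: "smooth f \<Longrightarrow> linear (\<lambda>b. partial_on UNIV b f x)"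
  using smooth_has_derivative has_derivative_linear by blast

lemma smooth_partial_Basis_sum:
  assumes "smooth f"
  shows "partial_on UNIV v f y = (\<Sum>i\<in>Basis. (v \<bullet> i) *\<^sub>R partial_on UNIV i f y)"
proof -
  note l = smooth_partial_linear[OF assms, of y]
  from linear_sum[OF this, of "\<lambda>i. (v \<bullet> i) *\<^sub>R i" Basis] show ?thesis
    by (simp add: euclidean_representation linear_scale[OF l])
qed

lemma smooth_partial:
  assumes "smooth f" shows "smooth (\<lambda>x. partial_on UNIV v f x)"
proof
  fix k show "Ck_on k UNIV (\<lambda>x. partial_on UNIV v f x)"
    unfolding smooth_partial_Basis_sum[OF assms, of v]
    using assms Ck_SucD(2) by (intro Ck_sum Ck_scaleR Ck_const) blast
qed

subsection \<open>A smooth bump\<close>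

text \<open>The family of all functions \<open>P(1/x) exp(-1/x)\<close>, extended by zero to \<open>x \<le> 0\<close>, is closed under differentiation,
  so that smoothness at the origin is proved for the whole family in one induction.\<close>

definition flat :: "real poly \<Rightarrow> real \<Rightarrow> real" where
  "flat P x = (if x \<le> 0 then 0 else poly P (1/x) * exp (- (1/x)))"

lemma poly_exp_tendsto_0: "((\<lambda>x::real. poly P x * exp (-x)) \<longlongrightarrow> 0) at_top"
proof (induction P)
  case (pCons a P)
  have *: "((\<lambda>x::real. x ^ k * exp (-x)) \<longlongrightarrow> 0) at_top" for k
    using tendsto_power_div_exp_0[of k] by (simp add: exp_minus field_simps)
  have "((\<lambda>x::real. (\<Sum>i\<le>degree (pCons a P). coeff (pCons a P) i * (x ^ i * exp (-x)))) \<longlongrightarrow> (\<Sum>i\<le>degree (pCons a P). coeff (pCons a P) i * 0)) at_top"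
    by (intro tendsto_sum tendsto_mult tendsto_const *)
  then show ?case by (simp add: poly_altdef sum_distrib_right mult.assoc del: coeff_pCons_Suc)
qed auto

lemma flat_has_derivative:
  "(flat P has_real_derivative flat ([:0,0,1:] * (P - pderiv P)) x) (at x)"
proof -
  consider "x < 0" | "x > 0" | "x = 0" by linarith
  then show ?thesis
  proof cases
    case 1
    have "((\<lambda>x. 0) has_real_derivative 0) (at x)" by simp
    then have "(flat P has_real_derivative 0) (at x)"
      by (rule has_field_derivative_transform_within_open[where S="{..<0}"]) (use 1 in \<open>auto simp: flat_def\<close>)
    then show ?thesis using 1 by (simp add: flat_def)
  next
    case 2
    have "((\<lambda>x. poly P (1/x) * exp (- (1/x))) has_real_derivative
      poly P (1/x) * (exp (- (1/x)) * (1/x^2)) + poly (pderiv P) (1/x) * (- 1/x^2) * exp (- (1/x))) (at x)"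
      using 2 by (auto intro!: derivative_eq_intros DERIV_chain2[OF poly_DERIV] simp: power2_eq_square field_simps)
    then have "(flat P has_real_derivative
        poly P (1/x) * (exp (- (1/x)) * (1/x^2)) + poly (pderiv P) (1/x) * (- 1/x^2) * exp (- (1/x))) (at x)"
      by (rule has_field_derivative_transform_within_open[where S="{0<..}"]) (use 2 in \<open>auto simp: flat_def\<close>)
    moreover have "poly P (1/x) * (exp (- (1/x)) * (1/x^2)) + poly (pderiv P) (1/x) * (- 1/x^2) * exp (- (1/x)) = flat ([:0,0,1:] * (P - pderiv P)) x"
      using 2 by (simp add: flat_def power2_eq_square field_simps)
    ultimately show ?thesis by simp
  next
    case 3
    have r: "((\<lambda>h. flat P h / h) \<longlongrightarrow> 0) (at_right 0)"
    proof -
      have "((\<lambda>h. poly (pCons 0 P) (inverse h) * exp (- (inverse h))) \<longlongrightarrow> 0) (at_right (0::real))"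
        by (rule filterlim_compose[OF poly_exp_tendsto_0 filterlim_inverse_at_top_right])
      then show ?thesis
        by (rule Lim_transform_eventually)
          (auto simp: eventually_at_right[of 0 1] flat_def field_simps intro!: exI[of _ 1])
    qed
    have l: "((\<lambda>h. flat P h / h) \<longlongrightarrow> 0) (at_left 0)"
      by (rule Lim_transform_eventually[where f="\<lambda>x. 0"])
        (auto simp: eventually_at_left[of "-1" 0] flat_def intro!: exI[of _ "-1"])
    have "((\<lambda>h. flat P h / h) \<longlongrightarrow> 0) (at 0)"
      using l r by (simp add: filterlim_split_at)
    then show ?thesis using 3 by (simp add: DERIV_def flat_def)
  qed
qed

lemma Ck_flat: "Ck_on k UNIV (flat P)"
proof (induction k arbitrary: P)
  case 0
  then show ?case using flat_has_derivative
    by (auto intro!: continuous_at_imp_continuous_on DERIV_isCont)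
next
  case (Suc k)
  show ?case
    by (rule Ck_SucI[where f'="\<lambda>x b. flat ([:0,0,1:] * (P - pderiv P)) x * b"])
      (use flat_has_derivative Suc.IH in \<open>auto simp: has_field_derivative_def\<close>)
qed

lemma exists_bump:
  "\<exists>\<rho> :: 'a::euclidean_space \<Rightarrow> real. smooth \<rho> \<and> (\<forall>x. 0 \<le> \<rho> x) \<and> (\<forall>x. norm x \<ge> 1 \<longrightarrow> \<rho> x = 0) \<and> (\<forall>x. norm x < 1 \<longrightarrow> \<rho> x > 0)"
proof (intro exI conjI allI)
  let ?r = "\<lambda>x::'a. flat [:1:] (1 - (\<Sum>i\<in>Basis. (x \<bullet> i) * (x \<bullet> i)))"
  have n: "(\<Sum>i\<in>Basis. (x \<bullet> i) * (x \<bullet> i)) = (norm x)^2" for x :: 'a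
    by (simp add: euclidean_inner[symmetric] power2_norm_eq_inner)
  show "Ck_on k UNIV ?r" for k
    by (intro Ck_compose[OF Ck_flat] Ck_diff Ck_sum Ck_const Ck_mult Ck_bounded_linear bounded_linear_inner_left)
  show "0 \<le> ?r x" for x by (simp add: flat_def)
  show "norm x \<ge> 1 \<longrightarrow> ?r x = 0" "norm x < 1 \<longrightarrow> ?r x > 0" for x
    unfolding n by (use one_le_power[of "norm x" 2] power_less_one_iff[of "norm x" 2] in \<open>auto simp: flat_def\<close>)
qed

section \<open>Mollification\<close>

lemma partial_eq_0_off_support:
  assumes "x \<notin> closure {x. f x \<noteq> 0}" shows "partial_on UNIV v f x = 0"
proof (rule partial_on_UNIV[where f'="\<lambda>v. 0"])
  have "((\<lambda>x. 0) has_derivative (\<lambda>v. 0)) (at x)" by simp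
  then show "(f has_derivative (\<lambda>v. 0)) (at x)"
    by (rule has_derivative_transform_within_open[where s="- closure {x. f x \<noteq> 0}"])
      (use assms closure_subset[of "{x. f x \<noteq> 0}"] in \<open>auto intro!: open_Compl\<close>)
qed

abbreviation compact_smooth :: "('a::euclidean_space \<Rightarrow> 'b::real_normed_vector) \<Rightarrow> bool" where
  "compact_smooth f \<equiv> smooth f \<and> bounded {x. f x \<noteq> 0}"

lemma compact_smooth_partial:
  assumes "compact_smooth f" shows "compact_smooth (\<lambda>x. partial_on UNIV v f x)"
proof
  show "smooth (\<lambda>x. partial_on UNIV v f x)" using assms smooth_partial by blast
  have "{x. partial_on UNIV v f x \<noteq> 0} \<subseteq> closure {x. f x \<noteq> 0}"
    using partial_eq_0_off_support by blast
  then show "bounded {x. partial_on UNIV v f x \<noteq> 0}"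
    using assms bounded_closure bounded_subset by blast
qed

lemma compact_support_bounded:
  fixes f :: "'a::euclidean_space \<Rightarrow> 'b::real_normed_vector"
  assumes "continuous_on UNIV f" "bounded {x. f x \<noteq> 0}"
  obtains B where "B > 0" "\<And>x. norm (f x) \<le> B"
proof -
  have "compact (f ` closure {x. f x \<noteq> 0})"
    using assms by (intro compact_continuous_image) (auto intro: continuous_on_subset)
  then obtain B where B: "B > 0" "\<And>y. y \<in> f ` closure {x. f x \<noteq> 0} \<Longrightarrow> norm y \<le> B"
    using compact_imp_bounded bounded_pos by metis
  have "norm (f x) \<le> B" for x
    using B closure_subset[of "{x. f x \<noteq> 0}"] by (cases "f x = 0") auto
  with B that show thesis by blast
qed

lemma compact_support_uniformly_continuous:
  fixes f :: "'a::euclidean_space \<Rightarrow> 'b::real_normed_vector"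
  assumes c: "continuous_on UNIV f" and b: "bounded {x. f x \<noteq> 0}" and e: "e > 0"
  obtains d where "d > 0" "\<And>x y. dist x y < d \<Longrightarrow> dist (f x) (f y) < e"
proof -
  obtain R where R: "\<And>x. f x \<noteq> 0 \<Longrightarrow> norm x \<le> R" using b by (auto simp: bounded_iff)
  have "uniformly_continuous_on (cball 0 (R+1)) f"
    using c by (intro compact_uniformly_continuous) (auto intro: continuous_on_subset)
  then obtain d where d: "d > 0" "\<And>x y. x \<in> cball 0 (R+1) \<Longrightarrow> y \<in> cball 0 (R+1) \<Longrightarrow> dist y x < d \<Longrightarrow> dist (f y) (f x) < e"
    using e unfolding uniformly_continuous_on_def by metis
  have "dist (f x) (f y) < e" if xy: "dist x y < min d 1" for x y
  proof (cases "x \<in> cball 0 (R+1) \<and> y \<in> cball 0 (R+1)")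
    case True then show ?thesis using d(2)[of y x] xy by auto
  next
    case False
    have "\<bar>norm x - norm y\<bar> < 1" using xy norm_triangle_ineq3[of x y] by (simp add: dist_norm)
    with False have "\<not> norm x \<le> R" "\<not> norm y \<le> R" by auto
    then have "f x = 0" "f y = 0" using R by blast+
    then show ?thesis using e by simp
  qed
  moreover have "min d 1 > 0" using d by simp
  ultimately show thesis using that by blast
qed

lemma compact_smooth_uniform_derivative:
  fixes f :: "'a::euclidean_space \<Rightarrow> 'b::real_normed_vector"
  assumes f: "compact_smooth f" and e: "e > 0"
  obtains d where "d > 0" "\<And>x h. norm h < d \<Longrightarrow> norm (f (x + h) - f x - partial_on UNIV h f x) \<le> e * norm h"
proof -
  let ?D = "\<lambda>x h. partial_on UNIV h f x"
  let ?N = "real (card (Basis :: 'a set))"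
  have e': "e / ?N > 0" using e by simp
  have "\<exists>d>0. \<forall>x y. dist x y < d \<longrightarrow> dist (?D x i) (?D y i) < e / ?N" for i :: 'a
  proof -
    have "compact_smooth (\<lambda>x. ?D x i)" using f by (rule compact_smooth_partial)
    then show ?thesis
      using compact_support_uniformly_continuous[OF smooth_continuous _ e', of "\<lambda>x. ?D x i"] by metis
  qed
  then obtain d where d: "\<And>i. d i > 0" "\<And>i x y. dist x y < d i \<Longrightarrow> dist (?D x i) (?D y i) < e / ?N" by metis
  define d0 where "d0 = Min (d ` Basis)"
  have d0: "d0 > 0" "\<And>i. i \<in> Basis \<Longrightarrow> d0 \<le> d i" using d by (auto simp: d0_def)
  have "norm (f (x + h) - f x - ?D x h) \<le> e * norm h" if h: "norm h < d0" for x h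
  proof -
    have "norm (f (x + h) - f x - ?D x (x + h - x)) \<le> norm (x + h - x) * e"
    proof (rule differentiable_bound_linearization[where S="ball x d0" and f'="?D"])
      show "x + t *\<^sub>R (x + h - x) \<in> ball x d0" if "t \<in> {0..1}" for t
        using that h by (auto simp: dist_norm abs_mult) (smt (verit) mult_left_le_one_le norm_ge_zero)
      show "(f has_derivative ?D y) (at y within ball x d0)" for y
        using f smooth_has_derivative has_derivative_at_withinI by blast
      show "x \<in> ball x d0" using d0 by simp
      fix y assume y: "y \<in> ball x d0"
      have "norm (?D y v - ?D x v) \<le> e * norm v" for v
      proof -
        have "norm (?D y v - ?D x v) = norm (\<Sum>i\<in>Basis. (v \<bullet> i) *\<^sub>R (?D y i - ?D x i))"
          using f by (simp add: smooth_partial_Basis_sum[of f v] sum_subtractf scaleR_diff_right)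
        also have "\<dots> \<le> (\<Sum>i\<in>(Basis::'a set). norm v * (e / ?N))"
        proof (rule order_trans[OF norm_sum sum_mono])
          fix i :: 'a assume i: "i \<in> Basis"
          have "dist y x < d i" using y d0(2)[OF i] by (auto simp: dist_commute)
          then have "norm (?D y i - ?D x i) \<le> e / ?N" using d(2) by (fastforce simp: dist_norm)
          then show "norm ((v \<bullet> i) *\<^sub>R (?D y i - ?D x i)) \<le> norm v * (e / ?N)"
            unfolding norm_scaleR using Basis_le_norm[OF i, of v] by (intro mult_mono) auto
        qed
        also have "\<dots> = e * norm v" by simp
        finally show ?thesis .
      qed
      then show "onorm (?D y - ?D x) \<le> e" by (intro onorm_bound) (use e in auto)
    qed
    then show ?thesis by (simp add: mult.commute)
  qed
  with d0 that show thesis by blast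
qed

lemma borel_measurable_smooth: "smooth f \<Longrightarrow> f \<in> borel_measurable borel"
  by (intro borel_measurable_continuous_onI smooth_continuous)

lemma integrable_compact_smooth_scaleR:
  fixes g :: "'a::euclidean_space \<Rightarrow> 'b::euclidean_space"
  assumes f: "compact_smooth f" and g: "integrable lborel g"
  shows "integrable lborel (\<lambda>y. f (x - y) *\<^sub>R g y)"
proof -
  obtain B where B: "B > 0" "\<And>x. norm (f x) \<le> B"
    using compact_support_bounded[OF smooth_continuous, of f] f by auto
  have [measurable]: "f \<in> borel_measurable borel" using f by (intro borel_measurable_smooth) auto
  show ?thesis
  proof (rule Bochner_Integration.integrable_bound[where f="\<lambda>y. B *\<^sub>R g y"])
    show "(\<lambda>y. f (x - y) *\<^sub>R g y) \<in> borel_measurable lborel" using g by measurable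
    show "AE y in lborel. norm (f (x - y) *\<^sub>R g y) \<le> norm (B *\<^sub>R g y)"
      using B by (auto intro!: mult_right_mono)
  qed (use g in auto)
qed

definition convolve :: "('a::euclidean_space \<Rightarrow> real) \<Rightarrow> ('a \<Rightarrow> 'b::euclidean_space) \<Rightarrow> 'a \<Rightarrow> 'b" where
  "convolve f g x = (LINT y|lborel. f (x - y) *\<^sub>R g y)"

text \<open>Differentiation under the integral sign, done by hand: the difference quotients of \<open>f\<close> converge uniformly,
  so that the error is at most a small multiple of the integral of \<open>norm g\<close>.\<close>

lemma convolve_has_derivative:
  fixes g :: "'a::euclidean_space \<Rightarrow> 'b::euclidean_space"
  assumes f: "compact_smooth f" and g: "integrable lborel g"
  shows "(convolve f g has_derivative (\<lambda>v. convolve (partial_on UNIV v f) g x)) (at x)"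
proof -
  let ?D = "\<lambda>x h. partial_on UNIV h f x"
  let ?I = "LINT y|lborel. norm (g y)"
  note i1 = integrable_compact_smooth_scaleR[OF f g]
  have i2: "integrable lborel (\<lambda>y. ?D (x - y) h *\<^sub>R g y)" for x h
    by (rule integrable_compact_smooth_scaleR[OF compact_smooth_partial[OF f] g])
  have l: "linear (\<lambda>h. ?D x h)" for x using f smooth_partial_linear by blast
  have I: "?I \<ge> 0" by simp
  show ?thesis unfolding has_derivative_at_alt
  proof (intro conjI allI impI)
    show "bounded_linear (\<lambda>v. convolve (partial_on UNIV v f) g x)"
      unfolding convolve_def linear_conv_bounded_linear[symmetric]
      by (rule linearI) (simp_all add: linear_add[OF l] linear_scale[OF l] scaleR_add_left
          Bochner_Integration.integral_add[OF i2 i2] flip: scaleR_scaleR integral_scaleR_right)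
    fix e :: real assume e: "e > 0"
    obtain d where d: "d > 0" "\<And>x h. norm h < d \<Longrightarrow> norm (f (x + h) - f x - ?D x h) \<le> e / (?I + 1) * norm h"
      using compact_smooth_uniform_derivative[OF f, of "e / (?I + 1)"] e I by auto
    show "\<exists>d>0. \<forall>y. norm (y - x) < d \<longrightarrow> norm (convolve f g y - convolve f g x - convolve (partial_on UNIV (y-x) f) g x) \<le> e * norm (y - x)"
    proof (intro exI[of _ d] conjI allI impI d)
      fix z assume z: "norm (z - x) < d"
      let ?h = "z - x"
      let ?r = "\<lambda>y. (f (z - y) - f (x - y) - ?D (x - y) ?h) *\<^sub>R g y"
      have eq: "convolve f g z - convolve f g x - convolve (partial_on UNIV ?h f) g x = (LINT y|lborel. ?r y)"
        unfolding convolve_def using i1 i2 by (simp add: scaleR_diff_left)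
      have "norm (LINT y|lborel. ?r y) \<le> (LINT y|lborel. norm (?r y))" by (rule integral_norm_bound)
      also have "\<dots> \<le> (LINT y|lborel. e / (?I + 1) * norm ?h * norm (g y))"
      proof (rule integral_mono)
        show "integrable lborel (\<lambda>y. norm (?r y))" unfolding scaleR_diff_left
          by (intro integrable_norm Bochner_Integration.integrable_diff i1 i2)
        show "integrable lborel (\<lambda>y. e / (?I + 1) * norm ?h * norm (g y))" using g by auto
        fix y
        have "norm (f (x - y + ?h) - f (x - y) - ?D (x - y) ?h) \<le> e / (?I + 1) * norm ?h"
          using d(2)[OF z] .
        moreover have "x - y + ?h = z - y" by simp
        ultimately show "norm (?r y) \<le> e / (?I + 1) * norm ?h * norm (g y)"
          unfolding norm_scaleR by (intro mult_right_mono) auto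
      qed
      also have "\<dots> = e * norm ?h * (?I / (?I + 1))" by simp
      also have "\<dots> \<le> e * norm ?h"
      proof -
        have "a * (w / (w + 1)) \<le> a" if "a \<ge> 0" "w \<ge> 0" for a w :: real
          using mult_left_mono[of "w / (w + 1)" 1 a] that by simp
        then show ?thesis by this (use I e in auto)
      qed
      finally show "norm (convolve f g z - convolve f g x - convolve (partial_on UNIV ?h f) g x) \<le> e * norm ?h" unfolding eq .
    qed
  qed
qed

lemma smooth_convolve:
  fixes g :: "'a::euclidean_space \<Rightarrow> 'b::euclidean_space"
  assumes f: "compact_smooth f" and g: "integrable lborel g"
  shows "smooth (convolve f g)"
proof
  fix k show "Ck_on k UNIV (convolve f g)" using f
  proof (induction k arbitrary: f)
    case 0
    show ?case using convolve_has_derivative[OF 0 g]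
      by (auto intro!: has_derivative_continuous continuous_at_imp_continuous_on)
  next
    case (Suc k)
    show ?case
      by (rule Ck_SucI[OF convolve_has_derivative[OF Suc.prems g]])
        (use Suc.IH[OF compact_smooth_partial[OF Suc.prems]] in \<open>auto simp: eta_contract_eq\<close>)
  qed
qed

lemma convolve_partial:
  assumes "compact_smooth f" "integrable lborel g"
  shows "partial_on UNIV v (convolve f g) x = convolve (partial_on UNIV v f) g x"
  using partial_on_UNIV[OF convolve_has_derivative[OF assms]] .

lemma lborel_integral_shift:
  fixes f :: "'a::euclidean_space \<Rightarrow> 'b::{banach, second_countable_topology}"
  assumes [measurable]: "f \<in> borel_measurable borel"
  shows "(LINT x|lborel. f (x + c)) = (LINT x|lborel. f x)"
proof -
  have "(LINT x|lborel. f x) = (LINT x|distr lborel borel ((+) c). f x)" by (simp add: lborel_distr_plus)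
  also have "\<dots> = (LINT x|lborel. f (c + x))" by (subst integral_distr) auto
  finally show ?thesis by (simp add: add.commute)
qed

lemma nn_integral_lborel_shift:
  fixes f :: "'a::euclidean_space \<Rightarrow> ennreal"
  assumes [measurable]: "f \<in> borel_measurable borel"
  shows "(\<integral>\<^sup>+x. f (x + c) \<partial>lborel) = (\<integral>\<^sup>+x. f x \<partial>lborel)"
proof -
  have "(\<integral>\<^sup>+x. f x \<partial>lborel) = (\<integral>\<^sup>+x. f x \<partial>(distr lborel borel ((+) c)))" by (simp add: lborel_distr_plus)
  also have "\<dots> = (\<integral>\<^sup>+x. f (c + x) \<partial>lborel)" by (subst nn_integral_distr) auto
  finally show ?thesis by (simp add: add.commute)
qed

lemma lborel_integral_reflect:
  fixes f :: "'a::euclidean_space \<Rightarrow> 'b::{banach, second_countable_topology}"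
  assumes [measurable]: "f \<in> borel_measurable borel"
  shows "(LINT y|lborel. f (x - y)) = (LINT z|lborel. f z)"
proof -
  have eq: "(lborel :: 'a measure) = distr lborel borel (\<lambda>y. x - y)"
    using lborel_affine[of "-1" x] by (simp add: density_1)
  have "(LINT z|lborel. f z) = (LINT z|distr lborel borel (\<lambda>y. x - y). f z)"
    by (simp add: eq[symmetric])
  also have "\<dots> = (LINT y|lborel. f (x - y))" by (subst integral_distr) auto
  finally show ?thesis by simp
qed

lemma integrable_compact_support:
  fixes f :: "'a::euclidean_space \<Rightarrow> 'b::euclidean_space"
  assumes "continuous_on UNIV f" "bounded {x. f x \<noteq> 0}"
  shows "integrable lborel f"
proof -
  have "integrable lborel (\<lambda>x. indicator (closure {x. f x \<noteq> 0}) x *\<^sub>R f x)"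
    using assms borel_integrable_compact[of "closure {x. f x \<noteq> 0}" f]
    by (auto intro: continuous_on_subset simp: set_integrable_def)
  moreover have "(\<lambda>x. indicator (closure {x. f x \<noteq> 0}) x *\<^sub>R f x) = f"
    using closure_subset[of "{x. f x \<noteq> 0}"] by (auto simp: indicator_def fun_eq_iff)
  ultimately show ?thesis by simp
qed

text \<open>By translation invariance, the integral of \<open>f(x + t v) - f(x)\<close> vanishes; its first-order part in \<open>t\<close> is \<open>t\<close> times the integral
  of the derivative, and the remainder is uniformly \<open>o(t)\<close> on a fixed ball.\<close>

lemma integral_partial_compact_smooth_eq_0:
  fixes f :: "'a::euclidean_space \<Rightarrow> real"
  assumes f: "compact_smooth f"
  shows "(LINT x|lborel. partial_on UNIV v f x) = 0"
proof (rule ccontr)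
  let ?D = "\<lambda>x. partial_on UNIV v f x"
  let ?J = "LINT x|lborel. ?D x"
  assume J: "?J \<noteq> 0"
  obtain R where R: "\<And>x. f x \<noteq> 0 \<Longrightarrow> norm x \<le> R" using f by (auto simp: bounded_iff)
  let ?B = "cball (0::'a) (R + norm v + 1)"
  let ?M = "measure lborel ?B * (norm v + 1) + 1"
  have fin: "emeasure lborel ?B < \<infinity>" by (rule emeasure_bounded_finite) simp
  have M: "?M > 0" by (smt (verit) measure_nonneg mult_nonneg_nonneg norm_ge_zero)
  have [measurable]: "f \<in> borel_measurable borel" "?D \<in> borel_measurable borel"
    using f smooth_partial[of f v] by (auto intro!: borel_measurable_smooth)
  have iD: "integrable lborel ?D"
    using compact_smooth_partial[OF f, of v] by (intro integrable_compact_support smooth_continuous) auto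
  have if1: "integrable lborel f"
    using f by (intro integrable_compact_support smooth_continuous) auto
  have if2: "integrable lborel (\<lambda>x. f (x + c))" for c
  proof (rule integrable_compact_support)
    show "continuous_on UNIV (\<lambda>x. f (x + c))"
    proof -
      have "continuous_on UNIV f" using f smooth_continuous by blast
      then show ?thesis by (rule continuous_on_compose2) (auto intro!: continuous_intros)
    qed
    show "bounded {x. f (x + c) \<noteq> 0}"
    proof (rule boundedI[where B="R + norm c"])
      fix x assume "x \<in> {x. f (x + c) \<noteq> 0}"
      then have "norm (x + c) \<le> R" using R by blast
      then show "norm x \<le> R + norm c" using norm_triangle_ineq4[of "x + c" c] by simp
    qed
  qed
  have e: "\<bar>?J\<bar> / (2 * ?M) > 0" using J M by simp
  obtain d where d: "d > 0" "\<And>x h. norm h < d \<Longrightarrow> norm (f (x + h) - f x - partial_on UNIV h f x) \<le> \<bar>?J\<bar> / (2 * ?M) * norm h"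
    using compact_smooth_uniform_derivative[OF f e] by blast
  define t where "t = min 1 (d / (2 * (norm v + 1)))"
  have nv: "norm v + 1 > 0" by (smt (verit) norm_ge_zero)
  have t: "t > 0" "t \<le> 1" using d nv by (auto simp: t_def)
  have "t * (norm v + 1) \<le> d / (2 * (norm v + 1)) * (norm v + 1)"
    using nv by (intro mult_right_mono) (auto simp: t_def)
  also have "\<dots> = d / 2"
  proof -
    have "d / (2 * w) * w = d / 2" if "w > 0" for w using that by simp
    then show ?thesis using nv by blast
  qed
  finally have "t * (norm v + 1) \<le> d / 2" .
  then have td: "norm (t *\<^sub>R v) < d" using t d by (simp add: algebra_simps)
  have lin: "partial_on UNIV (t *\<^sub>R v) f x = t * ?D x" for x
    using linear_scale[OF smooth_partial_linear[of f x], of t v] f by auto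
  let ?r = "\<lambda>x. f (x + t *\<^sub>R v) - f x - t * ?D x"
  have bd: "\<bar>?r x\<bar> \<le> indicator ?B x * (\<bar>?J\<bar> / (2 * ?M) * (t * norm v))" for x
  proof (cases "x \<in> ?B")
    case True
    then show ?thesis using d(2)[OF td, of x] t by (simp add: lin)
  next
    case False
    have "f x = 0" using False R[of x] by (smt (verit) mem_cball_0 norm_ge_zero)
    moreover have "norm (t *\<^sub>R v) \<le> norm v" using t by (simp add: mult_left_le_one_le)
    then have "f (x + t *\<^sub>R v) = 0" using False R[of "x + t *\<^sub>R v"] norm_diff_ineq[of x "t *\<^sub>R v"] by fastforce
    moreover have "x \<notin> closure {x. f x \<noteq> 0}"
    proof
      assume "x \<in> closure {x. f x \<noteq> 0}"
      moreover have "closure {x. f x \<noteq> 0} \<subseteq> cball 0 R" by (rule closure_minimal) (use R in auto)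
      ultimately have "norm x \<le> R" by auto
      then show False using False by (auto simp: not_le) (smt (verit) norm_ge_zero)
    qed
    ultimately show ?thesis using False by (simp add: partial_eq_0_off_support)
  qed
  have "t * \<bar>?J\<bar> = \<bar>LINT x|lborel. ?r x\<bar>"
    using iD if1 if2[of "t *\<^sub>R v"] t lborel_integral_shift[of f "t *\<^sub>R v"] by (simp add: abs_mult)
  also have "\<dots> \<le> (LINT x|lborel. \<bar>?r x\<bar>)" by simp
  also have "\<dots> \<le> (LINT x|lborel. indicator ?B x * (\<bar>?J\<bar> / (2 * ?M) * (t * norm v)))"
  proof (rule integral_mono)
    show "integrable lborel (\<lambda>x. \<bar>?r x\<bar>)" using iD if1 if2 by auto
    show "integrable lborel (\<lambda>x. indicator ?B x * (\<bar>?J\<bar> / (2 * ?M) * (t * norm v)))"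
      using fin by (intro integrable_mult_left integrable_real_indicator) auto
  qed (rule bd)
  also have "\<dots> = measure lborel ?B * (\<bar>?J\<bar> / (2 * ?M) * (t * norm v))"
    using fin by simp
  also have "\<dots> = t * \<bar>?J\<bar> * (measure lborel ?B * norm v / (2 * ?M))" by simp
  also have "\<dots> < t * \<bar>?J\<bar> * 1"
  proof (rule mult_strict_left_mono)
    have "measure lborel ?B * norm v \<le> measure lborel ?B * (norm v + 1)" by (intro mult_left_mono) auto
    then show "measure lborel ?B * norm v / (2 * ?M) < 1"
      using M by (subst pos_divide_less_eq) auto
  qed (use t J in simp)
  finally show False by simp
qed

section \<open>Integrals of powers\<close>

text \<open>The \<open>p\<close>-th power of the \<open>L\<^sup>p\<close> norm on a set. As a nonnegative integral it needs no integrability side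
  conditions, and finiteness can be a conclusion. It is monotone and subadditive up to the factor \<open>2\<^sup>p\<close>, which is all the
  normed structure that the estimates use.\<close>

definition pmass :: "real \<Rightarrow> 'a::euclidean_space set \<Rightarrow> ('a \<Rightarrow> 'b::real_normed_vector) \<Rightarrow> ennreal" where
  "pmass p S f = (\<integral>\<^sup>+x\<in>S. ennreal (norm (f x) powr p) \<partial>lborel)"

lemma powr_norm_add_le:
  fixes a b :: "'a::real_normed_vector"
  assumes "p \<ge> 0"
  shows "norm (a + b) powr p \<le> 2 powr p * (norm a powr p + norm b powr p)"
proof -
  have "norm (a + b) powr p \<le> (2 * max (norm a) (norm b)) powr p"
    by (intro powr_mono2) (use assms norm_triangle_ineq[of a b] in auto)
  also have "\<dots> = 2 powr p * max (norm a) (norm b) powr p" by (simp add: powr_mult)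
  also have "\<dots> \<le> 2 powr p * (norm a powr p + norm b powr p)"
    by (intro mult_left_mono) (auto simp: max_def)
  finally show ?thesis .
qed

lemma pmass_mono_set: "S \<subseteq> T \<Longrightarrow> pmass p S f \<le> pmass p T f"
  unfolding pmass_def by (intro nn_integral_mono) (auto simp: indicator_def)

lemma pmass_mono:
  assumes "\<And>x. x \<in> S \<Longrightarrow> norm (f x) \<le> norm (g x)" "p \<ge> 0" shows "pmass p S f \<le> pmass p S g"
  unfolding pmass_def
  by (intro nn_integral_mono) (use assms in \<open>auto simp: indicator_def intro!: ennreal_leI powr_mono2\<close>)

lemma pmass_cong_AE:
  "AE x in lborel. x \<in> S \<longrightarrow> norm (f x) = norm (g x) \<Longrightarrow> pmass p S f = pmass p S g"
  unfolding pmass_def by (intro nn_integral_cong_AE) (auto elim!: eventually_mono simp: indicator_def)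

lemma pmass_add_le:
  fixes f g :: "'a::euclidean_space \<Rightarrow> 'b::euclidean_space"
  assumes [measurable]: "f \<in> borel_measurable borel" "g \<in> borel_measurable borel" "S \<in> sets borel" and p: "p \<ge> 0"
  shows "pmass p S (\<lambda>x. f x + g x) \<le> ennreal (2 powr p) * (pmass p S f + pmass p S g)"
proof -
  have "pmass p S (\<lambda>x. f x + g x) \<le> (\<integral>\<^sup>+x. ennreal (2 powr p) * (ennreal (norm (f x) powr p) * indicator S x + ennreal (norm (g x) powr p) * indicator S x) \<partial>lborel)"
    unfolding pmass_def
  proof (intro nn_integral_mono)
    fix x
    have "ennreal (norm (f x + g x) powr p) \<le> ennreal (2 powr p) * (ennreal (norm (f x) powr p) + ennreal (norm (g x) powr p))"
      using powr_norm_add_le[OF p, of "f x" "g x"]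
      by (simp add: ennreal_plus[symmetric] ennreal_mult[symmetric] ennreal_leI del: ennreal_plus)
    then show "ennreal (norm (f x + g x) powr p) * indicator S x \<le> ennreal (2 powr p) * (ennreal (norm (f x) powr p) * indicator S x + ennreal (norm (g x) powr p) * indicator S x)"
      by (auto simp: indicator_def)
  qed
  also have "\<dots> = ennreal (2 powr p) * (pmass p S f + pmass p S g)"
    unfolding pmass_def by (subst nn_integral_cmult) (auto simp: nn_integral_add)
  finally show ?thesis .
qed

lemma pmass_minus: "pmass p S (\<lambda>x. - f x) = pmass p S f"
  by (simp add: pmass_def)

lemma pmass_diff_commute: "pmass p S (\<lambda>x. f x - g x) = pmass p S (\<lambda>x. g x - f x)"
  by (simp add: pmass_def norm_minus_commute)

lemma pmass_shift:
  assumes [measurable]: "f \<in> borel_measurable borel"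
  shows "pmass p UNIV (\<lambda>x. f (x + c)) = pmass p UNIV f"
  unfolding pmass_def using nn_integral_lborel_shift[of "\<lambda>x. ennreal (norm (f x) powr p)" c] by simp

lemma pmass_add_le_eps:
  fixes f g :: "'a::euclidean_space \<Rightarrow> 'b::euclidean_space"
  assumes "f \<in> borel_measurable borel" "g \<in> borel_measurable borel" "S \<in> sets borel" "p \<ge> 0" "e \<ge> 0"
    "pmass p S f \<le> ennreal (e / (2 * 2 powr p))" "pmass p S g \<le> ennreal (e / (2 * 2 powr p))"
  shows "pmass p S (\<lambda>x. f x + g x) \<le> ennreal e"
proof -
  have "pmass p S (\<lambda>x. f x + g x) \<le> ennreal (2 powr p) * (ennreal (e / (2 * 2 powr p)) + ennreal (e / (2 * 2 powr p)))"
    by (rule order_trans[OF pmass_add_le]) (use assms in \<open>auto intro!: mult_left_mono add_mono\<close>)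
  also have "\<dots> = ennreal e" using assms(5)
    by (simp add: ennreal_plus[symmetric] ennreal_mult[symmetric] del: ennreal_plus)
  finally show ?thesis .
qed

lemma compact_open_separation:
  fixes K U :: "'a::heine_borel set"
  assumes "compact K" "open U" "K \<subseteq> U"
  obtains d where "d > 0" "\<And>x y. x \<in> K \<Longrightarrow> y \<in> - U \<Longrightarrow> d \<le> dist x y"
proof -
  have "\<exists>d>0. \<forall>x\<in>K. \<forall>y\<in>-U. d \<le> dist x y"
    by (rule separate_compact_closed) (use assms in auto)
  then show thesis using that by blast
qed

section \<open>Continuity of translations\<close>

definition translation_continuous :: "real \<Rightarrow> ('a::euclidean_space \<Rightarrow> 'b::euclidean_space) \<Rightarrow> bool" where
  "translation_continuous p f \<longleftrightarrow> f \<in> borel_measurable borel \<and>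
     (\<forall>e>0. \<exists>d>0. \<forall>z. norm z < d \<longrightarrow> pmass p UNIV (\<lambda>x. f (x + z) - f x) \<le> ennreal e)"

lemma translation_continuous_add:
  assumes "translation_continuous p f" "translation_continuous p g" "p \<ge> 0"
  shows "translation_continuous p (\<lambda>x. f x + g x)"
  unfolding translation_continuous_def
proof (intro conjI allI impI)
  have [measurable]: "f \<in> borel_measurable borel" "g \<in> borel_measurable borel"
    using assms by (auto simp: translation_continuous_def)
  show "(\<lambda>x. f x + g x) \<in> borel_measurable borel" by simp
  fix e :: real assume e: "e > 0"
  then have e': "e / (2 * 2 powr p) > 0" by simp
  obtain d1 where d1: "d1 > 0" "\<And>z. norm z < d1 \<Longrightarrow> pmass p UNIV (\<lambda>x. f (x + z) - f x) \<le> ennreal (e / (2 * 2 powr p))"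
    using assms(1) e' unfolding translation_continuous_def by metis
  obtain d2 where d2: "d2 > 0" "\<And>z. norm z < d2 \<Longrightarrow> pmass p UNIV (\<lambda>x. g (x + z) - g x) \<le> ennreal (e / (2 * 2 powr p))"
    using assms(2) e' unfolding translation_continuous_def by metis
  have "pmass p UNIV (\<lambda>x. f (x + z) + g (x + z) - (f x + g x)) \<le> ennreal e" if z: "norm z < min d1 d2" for z
  proof -
    have "pmass p UNIV (\<lambda>x. (f (x + z) - f x) + (g (x + z) - g x)) \<le> ennreal e"
      by (rule pmass_add_le_eps) (use z d1 d2 e assms in auto)
    moreover have "(\<lambda>x. (f (x + z) - f x) + (g (x + z) - g x)) = (\<lambda>x. f (x + z) + g (x + z) - (f x + g x))"
      by (auto simp: algebra_simps)
    ultimately show ?thesis by simp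
  qed
  then show "\<exists>d>0. \<forall>z. norm z < d \<longrightarrow> pmass p UNIV (\<lambda>x. f (x + z) + g (x + z) - (f x + g x)) \<le> ennreal e"
    using d1 d2 by (intro exI[of _ "min d1 d2"]) auto
qed

text \<open>By regularity the set lies between a compact and an open set whose difference has small measure. A translation by
  less than the distance of the compact set from the complement of the open one moves no point across that gap, so the
  indicator changes only on the difference and on its translate.\<close>

lemma translation_continuous_indicator:
  fixes c :: "'b::euclidean_space"
  assumes [measurable]: "A \<in> sets borel" and fin: "emeasure lborel (A :: 'a::euclidean_space set) < \<infinity>"
  shows "translation_continuous p (\<lambda>x. indicator A x *\<^sub>R c)"
  unfolding translation_continuous_def
proof (intro conjI allI impI)
  show "(\<lambda>x. indicator A x *\<^sub>R c) \<in> borel_measurable borel" by simp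
  fix e :: real assume e: "e > 0"
  define e' where "e' = e / (4 * (norm c powr p + 1))"
  have np: "norm c powr p + 1 > 0" by (smt (verit) powr_ge_zero)
  have e': "e' > 0" unfolding e'_def using e np by (intro divide_pos_pos) auto
  obtain U where U: "open U" "A \<subseteq> U" "emeasure lborel (U - A) < e'"
    using outer_regular_lborel[OF assms(1) e'] .
  let ?M = "density lborel (indicator A)"
  have em: "emeasure ?M B = emeasure lborel (A \<inter> B)" if "B \<in> sets borel" for B
    using that by (subst emeasure_density) (auto simp: indicator_inter_arith[symmetric] simp flip: nn_integral_indicator)
  have "emeasure ?M A = (SUP K \<in> {K. K \<subseteq> A \<and> compact K}. emeasure ?M K)"
    by (rule inner_regular) (use fin em[of UNIV] in \<open>auto simp: less_top\<close>)
  moreover have "emeasure ?M A = emeasure lborel A" using em[of A] by simp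
  ultimately have sup: "emeasure lborel A = (SUP K \<in> {K. K \<subseteq> A \<and> compact K}. emeasure ?M K)" by simp
  have "\<exists>K. K \<subseteq> A \<and> compact K \<and> emeasure lborel (A - K) < e'"
  proof (cases "emeasure lborel A = 0")
    case True then show ?thesis using e' by (intro exI[of _ "{}"]) auto
  next
    case False
    have "emeasure lborel A - e' < emeasure lborel A"
      using False e' fin by (intro ennreal_between) (auto simp: zero_less_iff_neq_zero)
    then obtain K where K: "K \<subseteq> A" "compact K" "emeasure lborel A - e' < emeasure ?M K"
      unfolding sup less_SUP_iff by auto
    have [measurable]: "K \<in> sets borel" using K by (auto intro: borel_compact)
    have MK: "emeasure ?M K = emeasure lborel K" using em[of K] K by (simp add: Int_absorb1)
    have fK: "emeasure lborel K < \<infinity>" using emeasure_compact_finite K by blast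
    have "emeasure lborel (A - K) = emeasure lborel A - emeasure lborel K"
      using K fK by (intro emeasure_Diff) auto
    also have "\<dots> < e'"
      using K(3) fin fK e' unfolding MK
      by (cases "emeasure lborel A"; cases "emeasure lborel K")
        (auto simp: ennreal_minus_if ennreal_less_iff split: if_splits)
    finally show ?thesis using K by auto
  qed
  then obtain K where K: "K \<subseteq> A" "compact K" "emeasure lborel (A - K) < e'" by blast
  obtain d where d: "d > 0" "\<And>x y. x \<in> K \<Longrightarrow> y \<in> - U \<Longrightarrow> d \<le> dist x y"
    using compact_open_separation[of K U] U K by (metis order_trans)
  have [measurable]: "K \<in> sets borel" "U \<in> sets borel" using K U by (auto intro: borel_compact)
  let ?W = "U - K"
  have W: "emeasure lborel ?W \<le> ennreal (2 * e')"
  proof -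
    have "?W = (U - A) \<union> (A - K)" using K U by auto
    then have "emeasure lborel ?W \<le> emeasure lborel (U - A) + emeasure lborel (A - K)"
      by (metis (no_types, lifting) emeasure_subadditive sets.Diff assms(1) sets_lborel \<open>K \<in> sets borel\<close> \<open>U \<in> sets borel\<close>)
    also have "\<dots> \<le> ennreal e' + ennreal e'" using U K by (intro add_mono) auto
    finally show ?thesis using e' by (simp add: ennreal_plus[symmetric] del: ennreal_plus)
  qed
  show "\<exists>d>0. \<forall>z. norm z < d \<longrightarrow> pmass p UNIV (\<lambda>x. indicator A (x + z) *\<^sub>R c - indicator A x *\<^sub>R c) \<le> ennreal e"
  proof (intro exI[of _ d] conjI allI impI d)
    fix z :: 'a assume z: "norm z < d"
    have key: "norm (indicator A (x + z) *\<^sub>R c - indicator A x *\<^sub>R c) powr p \<le> norm c powr p * (indicator ?W x + indicator ?W (x + z))" for x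
    proof (cases "x \<in> ?W \<or> x + z \<in> ?W")
      case True
      have "norm (indicator A (x + z) *\<^sub>R c - indicator A x *\<^sub>R c) powr p \<le> norm c powr p"
        by (auto simp: indicator_def)
      also have "\<dots> \<le> norm c powr p * (indicator ?W x + indicator ?W (x + z))"
        using True by (auto simp: indicator_def)
      finally show ?thesis .
    next
      case False
      have "x \<in> K \<Longrightarrow> x + z \<in> U" "x + z \<in> K \<Longrightarrow> x \<in> U"
        using d(2)[of x "x + z"] d(2)[of "x + z" x] z by (auto simp: dist_norm)
      then have "x \<in> A \<longleftrightarrow> x + z \<in> A" using False K U by blast
      then show ?thesis by (auto simp: indicator_def)
    qed
    have "pmass p UNIV (\<lambda>x. indicator A (x + z) *\<^sub>R c - indicator A x *\<^sub>R c) \<le>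
        (\<integral>\<^sup>+x. ennreal (norm c powr p) * (indicator ?W x + indicator ?W (x + z)) \<partial>lborel)"
      unfolding pmass_def
    proof (intro nn_integral_mono)
      fix x
      have "ennreal (norm (indicator A (x + z) *\<^sub>R c - indicator A x *\<^sub>R c) powr p) \<le> ennreal (norm c powr p * (indicator ?W x + indicator ?W (x + z)))"
        by (intro ennreal_leI key)
      then show "ennreal (norm (indicator A (x + z) *\<^sub>R c - indicator A x *\<^sub>R c) powr p) * indicator UNIV x \<le> ennreal (norm c powr p) * (indicator ?W x + indicator ?W (x + z))"
        by (simp add: ennreal_mult ennreal_indicator)
    qed
    also have "\<dots> = ennreal (norm c powr p) * (emeasure lborel ?W + emeasure lborel ?W)"
      using nn_integral_lborel_shift[of "indicator ?W" z]
      by (subst nn_integral_cmult) (auto simp: nn_integral_add)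
    also have "\<dots> \<le> ennreal (norm c powr p) * (ennreal (2 * e') + ennreal (2 * e'))"
      by (intro mult_left_mono add_mono W) auto
    also have "\<dots> = ennreal (norm c powr p * (4 * e'))"
      using e' by (simp add: ennreal_plus[symmetric] ennreal_mult[symmetric] del: ennreal_plus)
    also have "norm c powr p * (4 * e') = e * (norm c powr p / (norm c powr p + 1))"
      using np by (simp add: e'_def divide_simps)
    also have "ennreal \<dots> \<le> ennreal e"
    proof (rule ennreal_leI)
      have "norm c powr p / (norm c powr p + 1) \<le> 1" using np by (simp add: divide_le_eq_1)
      then show "e * (norm c powr p / (norm c powr p + 1)) \<le> e"
        using e mult_left_mono[of "norm c powr p / (norm c powr p + 1)" 1 e] by simp
    qed
    finally show "pmass p UNIV (\<lambda>x. indicator A (x + z) *\<^sub>R c - indicator A x *\<^sub>R c) \<le> ennreal e" .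
  qed
qed

lemma translation_continuous_sum:
  assumes "finite I" "\<And>i. i \<in> I \<Longrightarrow> translation_continuous p (f i)" "p \<ge> 0"
  shows "translation_continuous p (\<lambda>x. \<Sum>i\<in>I. f i x)"
  using assms(1,2)
proof (induction I)
  case empty
  have "pmass p UNIV (\<lambda>x::'b. 0::'c) = 0" by (simp add: pmass_def)
  then show ?case by (auto simp: translation_continuous_def intro!: exI[of _ 1])
next
  case (insert i I)
  then show ?case using translation_continuous_add[OF _ _ assms(3)] by auto
qed

text \<open>Simple functions are finite sums of indicators, and they approximate \<open>f\<close> by dominated convergence. The approximation
  error is translation invariant, so three small terms suffice.\<close>

theorem pmass_finite_translation_continuous:
  fixes f :: "'a::euclidean_space \<Rightarrow> 'b::euclidean_space"
  assumes [measurable]: "f \<in> borel_measurable borel" and fin: "pmass p UNIV f < \<infinity>" and p: "p > 0"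
  shows "translation_continuous p f"
proof -
  obtain F where F: "\<And>i. simple_function lborel (F i)" "\<And>x. (\<lambda>i. F i x) \<longlonglongrightarrow> f x"
    "\<And>i x. norm (F i x) \<le> 2 * norm (f x)"
    using borel_measurable_implies_sequence_metric[of f lborel 0] by auto
  have Fm [measurable]: "F i \<in> borel_measurable borel" for i using borel_measurable_simple_function[OF F(1)[of i]] by simp
  have bd: "norm (F i x) powr p \<le> 2 powr p * norm (f x) powr p" for i x
    using powr_mono2[OF less_imp_le[OF p] norm_ge_zero F(3)[of i x]] by (simp add: powr_mult)
  have tF: "translation_continuous p (F i)" for i
  proof -
    have "translation_continuous p (\<lambda>x. \<Sum>y\<in>F i ` space lborel. indicator (F i -` {y} \<inter> space lborel) x *\<^sub>R y)"
    proof (rule translation_continuous_sum)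
      show "finite (F i ` space lborel)" using F(1)[of i] by (simp add: simple_function_def)
      fix y assume "y \<in> F i ` space lborel"
      let ?A = "F i -` {y} \<inter> space lborel"
      have "{y} \<in> sets borel" by simp
      from measurable_sets_borel[OF Fm this] have A: "F i -` {y} \<in> sets borel" .
      show "translation_continuous p (\<lambda>x. indicator ?A x *\<^sub>R y)"
      proof (cases "y = 0")
        case True
        then show ?thesis by (auto simp: translation_continuous_def pmass_def intro!: exI[of _ 1])
      next
        case False
        have "ennreal (norm y powr p) * emeasure lborel ?A = (\<integral>\<^sup>+x. ennreal (norm y powr p) * indicator ?A x \<partial>lborel)"
          by (subst nn_integral_cmult_indicator) (simp_all add: A)
        also have "\<dots> \<le> (\<integral>\<^sup>+x. ennreal (2 powr p) * ennreal (norm (f x) powr p) \<partial>lborel)"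
          using bd[of i] by (intro nn_integral_mono) (auto simp: indicator_def ennreal_mult[symmetric] intro!: ennreal_leI)
        also have "\<dots> = ennreal (2 powr p) * pmass p UNIV f" by (subst nn_integral_cmult) (auto simp: pmass_def)
        also have "\<dots> < \<infinity>" using fin by (simp add: ennreal_mult_less_top)
        finally have "emeasure lborel ?A < \<infinity>" using False by (simp add: ennreal_mult_less_top) (elim disjE; simp)
        then show ?thesis by (intro translation_continuous_indicator) (simp_all add: A)
      qed
    qed (use p in simp)
    moreover have "(\<lambda>x. \<Sum>y\<in>F i ` space lborel. indicator (F i -` {y} \<inter> space lborel) x *\<^sub>R y) = F i"
      by (intro ext) (rule simple_function_indicator_representation_banach[OF F(1), symmetric], simp)
    ultimately show ?thesis by simp
  qed
  have lim: "(\<lambda>i. pmass p UNIV (\<lambda>x. F i x - f x)) \<longlonglongrightarrow> 0"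
  proof -
    have "(\<lambda>i. \<integral>\<^sup>+x. ennreal (norm (F i x - f x) powr p) \<partial>lborel) \<longlonglongrightarrow> (\<integral>\<^sup>+x. (0::ennreal) \<partial>(lborel :: 'a measure))"
    proof (rule nn_integral_dominated_convergence[where w="\<lambda>x. ennreal (2 powr p * (2 powr p + 1)) * ennreal (norm (f x) powr p)"])
      have "norm (F i x - f x) powr p \<le> 2 powr p * (2 powr p + 1) * norm (f x) powr p" for i x
      proof -
        have "norm (F i x - f x) powr p \<le> 2 powr p * (norm (F i x) powr p + norm (f x) powr p)"
          using powr_norm_add_le[of p "F i x" "- f x"] p by simp
        also have "\<dots> \<le> 2 powr p * (2 powr p * norm (f x) powr p + norm (f x) powr p)"
          using bd[of i x] by (intro mult_left_mono) auto
        finally show ?thesis by (simp add: algebra_simps)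
      qed
      then show "AE x in lborel. ennreal (norm (F i x - f x) powr p) \<le> ennreal (2 powr p * (2 powr p + 1)) * ennreal (norm (f x) powr p)" for i
        by (intro AE_I2) (simp add: ennreal_mult[symmetric] ennreal_leI)
      have "(\<integral>\<^sup>+x. ennreal (2 powr p * (2 powr p + 1)) * ennreal (norm (f x) powr p) \<partial>lborel) = ennreal (2 powr p * (2 powr p + 1)) * pmass p UNIV f"
        by (subst nn_integral_cmult) (auto simp: pmass_def)
      also have "\<dots> < \<infinity>" using fin by (simp add: ennreal_mult_less_top)
      finally show "(\<integral>\<^sup>+x. ennreal (2 powr p * (2 powr p + 1)) * ennreal (norm (f x) powr p) \<partial>lborel) < \<infinity>" .
      show "AE x in lborel. (\<lambda>i. ennreal (norm (F i x - f x) powr p)) \<longlonglongrightarrow> 0"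
      proof (intro AE_I2)
        fix x
        have "(\<lambda>i. norm (F i x - f x)) \<longlonglongrightarrow> 0" using F(2)[of x] LIM_zero tendsto_norm_zero by blast
        then have "(\<lambda>i. norm (F i x - f x) powr p) \<longlonglongrightarrow> 0"
          using tendsto_powr'[of "\<lambda>i. norm (F i x - f x)" 0 sequentially "\<lambda>_. p" p] p by auto
        then show "(\<lambda>i. ennreal (norm (F i x - f x) powr p)) \<longlonglongrightarrow> 0"
          using tendsto_ennrealI by fastforce
      qed
    qed auto
    then show ?thesis by (simp add: pmass_def)
  qed
  show ?thesis unfolding translation_continuous_def
  proof (intro conjI allI impI)
    fix e :: real assume e: "e > 0"
    define e1 where "e1 = e / (2 * 2 powr p)"
    define e2 where "e2 = e1 / (2 * 2 powr p)"
    have e12: "e1 > 0" "e2 > 0" using e by (auto simp: e1_def e2_def)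
    have "\<forall>\<^sub>F i in sequentially. pmass p UNIV (\<lambda>x. F i x - f x) < ennreal e2"
      using order_tendstoD(2)[OF lim] e12 by auto
    then obtain i where i: "pmass p UNIV (\<lambda>x. F i x - f x) < ennreal e2" by (auto simp: eventually_sequentially)
    have e21: "ennreal e2 \<le> ennreal e1"
      using e12 p by (intro ennreal_leI) (auto simp: e2_def divide_le_eq intro!: ge_one_powr_ge_zero mult_ge1_I)
    obtain d where d: "d > 0" "\<And>z. norm z < d \<Longrightarrow> pmass p UNIV (\<lambda>x. F i (x + z) - F i x) \<le> ennreal e2"
      using tF[of i] e12 unfolding translation_continuous_def by metis
    show "\<exists>d>0. \<forall>z. norm z < d \<longrightarrow> pmass p UNIV (\<lambda>x. f (x + z) - f x) \<le> ennreal e"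
    proof (intro exI[of _ d] conjI allI impI d)
      fix z :: 'a assume z: "norm z < d"
      have A: "pmass p UNIV (\<lambda>x. (F i x - f x) + (F i (x + z) - F i x)) \<le> ennreal e1"
        by (rule pmass_add_le_eps) (use d(2)[OF z] i e12 p in \<open>auto simp: e2_def\<close>)
      have "pmass p UNIV (\<lambda>x. f (x + z) - F i (x + z)) = pmass p UNIV (\<lambda>x. f x - F i x)"
        using pmass_shift[of "\<lambda>x. f x - F i x" p z] by simp
      then have B: "pmass p UNIV (\<lambda>x. f (x + z) - F i (x + z)) \<le> ennreal e1"
        using i e21 by (simp add: pmass_diff_commute[of _ _ f])
      have "pmass p UNIV (\<lambda>x. (f (x + z) - F i (x + z)) + ((F i x - f x) + (F i (x + z) - F i x))) \<le> ennreal e"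
        by (rule pmass_add_le_eps) (use A B p e in \<open>auto simp: e1_def\<close>)
      moreover have "(\<lambda>x. (f (x + z) - F i (x + z)) + ((F i x - f x) + (F i (x + z) - F i x))) = (\<lambda>x. f (x + z) - f x)"
        by auto
      ultimately show "pmass p UNIV (\<lambda>x. f (x + z) - f x) \<le> ennreal e" by simp
    qed
  qed auto
qed

section \<open>Jensen's inequality for powers\<close>

text \<open>The graph of a convex power lies above its tangent at \<open>M\<close>.\<close>

lemma powr_tangent:
  fixes a M p :: real
  assumes "a \<ge> 0" "M \<ge> 0" "p \<ge> 1"
  shows "M powr p + p * M powr (p - 1) * (a - M) \<le> a powr p"
proof (cases "p = 1 \<or> M = 0")
  case True
  then show ?thesis using assms by (cases "M = 0") auto
next
  case False
  then have p: "p > 1" and M: "M > 0" using assms by auto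
  have "a * M powr (p - 1) \<le> a powr p / p + (M powr (p - 1)) powr (p / (p - 1)) / (p / (p - 1))"
    by (rule Youngs_inequality) (use p assms in \<open>auto simp: field_simps\<close>)
  also have "(M powr (p - 1)) powr (p / (p - 1)) = M powr p" using p by (simp add: powr_powr)
  finally have "a * M powr (p - 1) \<le> a powr p / p + M powr p * (p - 1) / p" by simp
  then have "p * (a * M powr (p - 1)) \<le> p * (a powr p / p + M powr p * (p - 1) / p)"
    using p by (intro mult_left_mono) auto
  also have "\<dots> = a powr p + M powr p * (p - 1)" using p by (simp add: distrib_left)
  finally have "p * a * M powr (p - 1) \<le> a powr p + M powr p * (p - 1)" by simp
  moreover have "M powr (p - 1) * M = M powr p" using M by (simp add: powr_mult_base powr_diff)
  ultimately show ?thesis by (simp add: algebra_simps)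
qed

text \<open>Integrating the tangent inequality at \<open>m = \<integral> w norm g\<close> against the weight makes the linear term vanish.\<close>

lemma Jensen_powr:
  fixes g :: "'a \<Rightarrow> 'b::euclidean_space"
  assumes [measurable]: "w \<in> borel_measurable M" "g \<in> borel_measurable M"
    and w: "\<And>x. 0 \<le> w x" "integrable M w" "(LINT x|M. w x) = 1"
    and i: "integrable M (\<lambda>x. w x *\<^sub>R g x)" and p: "p \<ge> 1"
  shows "ennreal (norm (LINT x|M. w x *\<^sub>R g x) powr p) \<le> (\<integral>\<^sup>+x. ennreal (w x) * ennreal (norm (g x) powr p) \<partial>M)"
proof (cases "(\<integral>\<^sup>+x. ennreal (w x) * ennreal (norm (g x) powr p) \<partial>M) = \<infinity>")
  case False
  define m where "m = (LINT x|M. w x * norm (g x))"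
  have im: "integrable M (\<lambda>x. w x * norm (g x))" using integrable_norm[OF i] w by simp
  have m0: "m \<ge> 0" unfolding m_def using w by (intro integral_nonneg_AE) auto
  have "norm (LINT x|M. w x *\<^sub>R g x) \<le> (LINT x|M. norm (w x *\<^sub>R g x))" by (rule integral_norm_bound)
  also have "\<dots> = m" using w by (simp add: m_def)
  finally have le: "norm (LINT x|M. w x *\<^sub>R g x) powr p \<le> m powr p" using p by (intro powr_mono2) auto
  have ip: "integrable M (\<lambda>x. w x * norm (g x) powr p)"
    by (rule integrableI_nonneg) (use False w in \<open>auto simp: ennreal_mult less_top\<close>)
  have "m powr p = (LINT x|M. w x * (m powr p) + p * m powr (p - 1) * (w x * norm (g x) - m * w x))"
    using w im by (simp add: m_def[symmetric])
  also have "\<dots> \<le> (LINT x|M. w x * norm (g x) powr p)"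
  proof (rule integral_mono)
    show "integrable M (\<lambda>x. w x * (m powr p) + p * m powr (p - 1) * (w x * norm (g x) - m * w x))"
      using w im by auto
    fix x
    have "w x * (m powr p + p * m powr (p - 1) * (norm (g x) - m)) \<le> w x * norm (g x) powr p"
      by (intro mult_left_mono powr_tangent) (use w m0 p in auto)
    then show "w x * (m powr p) + p * m powr (p - 1) * (w x * norm (g x) - m * w x) \<le> w x * norm (g x) powr p"
      by (simp add: algebra_simps)
  qed (rule ip)
  finally have "norm (LINT x|M. w x *\<^sub>R g x) powr p \<le> (LINT x|M. w x * norm (g x) powr p)" using le by simp
  moreover have "ennreal (LINT x|M. w x * norm (g x) powr p) = (\<integral>\<^sup>+x. ennreal (w x * norm (g x) powr p) \<partial>M)"
    using w by (intro nn_integral_eq_integral[symmetric] ip) auto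
  ultimately show ?thesis using w by (simp add: ennreal_mult[symmetric]) (metis ennreal_leI)
qed auto

section \<open>Mollifiers and cutoff functions\<close>

definition mollifier :: "real \<Rightarrow> ('a::euclidean_space \<Rightarrow> real) \<Rightarrow> bool" where
  "mollifier d \<eta> \<longleftrightarrow> smooth \<eta> \<and> (\<forall>x. 0 \<le> \<eta> x) \<and> (\<forall>x. d \<le> norm x \<longrightarrow> \<eta> x = 0) \<and> (LINT x|lborel. \<eta> x) = 1"

lemma mollifier_compact_smooth: "mollifier d \<eta> \<Longrightarrow> compact_smooth \<eta>"
  unfolding mollifier_def
proof (elim conjE, intro conjI)
  assume "\<forall>x. d \<le> norm x \<longrightarrow> \<eta> x = 0"
  then show "bounded {x. \<eta> x \<noteq> 0}" by (intro boundedI[where B=d]) (meson linear mem_Collect_eq)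
qed

lemma mollifier_integrable: "mollifier d \<eta> \<Longrightarrow> integrable lborel \<eta>"
  using mollifier_compact_smooth integrable_compact_support smooth_continuous by blast

lemma exists_mollifier:
  assumes d: "d > 0" shows "\<exists>\<eta> :: 'a::euclidean_space \<Rightarrow> real. mollifier d \<eta>"
proof -
  obtain \<rho> :: "'a \<Rightarrow> real" where r: "smooth \<rho>" "\<And>x. 0 \<le> \<rho> x" "\<And>x. norm x \<ge> 1 \<Longrightarrow> \<rho> x = 0" "\<And>x. norm x < 1 \<Longrightarrow> \<rho> x > 0"
    using exists_bump by blast
  define f where "f x = \<rho> ((1/d) *\<^sub>R x)" for x
  have sf: "smooth f" unfolding f_def
  proof
    fix k show "Ck_on k UNIV (\<lambda>x. \<rho> ((1/d) *\<^sub>R x))"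
      by (rule Ck_compose[OF _ Ck_bounded_linear[OF bounded_linear_scaleR_right]]) (rule r(1)[rule_format])
  qed
  have f0: "f x = 0" if "d \<le> norm x" for x using that d by (auto simp: f_def field_simps intro!: r(3))
  have fpos: "f x > 0" if "norm x < d" for x using that d by (auto simp: f_def field_simps intro!: r(4))
  have fnn: "f x \<ge> 0" for x using r by (simp add: f_def)
  have "bounded {x. f x \<noteq> 0}" using f0 by (intro boundedI[where B=d]) (meson linear mem_Collect_eq)
  then have fi: "integrable lborel f" using sf by (intro integrable_compact_support smooth_continuous)
  have "(LINT x|lborel. f x) \<noteq> 0"
  proof
    assume "(LINT x|lborel. f x) = 0"
    then have "AE x in lborel. f x = 0" using integral_nonneg_eq_0_iff_AE[OF fi] fnn by auto
    then have "AE x in lborel. x \<notin> ball (0::'a) d" by (rule eventually_mono) (use fpos in force)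
    then have "emeasure lborel (ball (0::'a) d) = 0" by (subst (asm) AE_iff_measurable[where N="ball 0 d"]) auto
    then show False using content_ball_pos[OF d, of "0::'a"] by (simp add: measure_def)
  qed
  moreover have "(LINT x|lborel. f x) \<ge> 0" using fnn by simp
  ultimately have c: "(LINT x|lborel. f x) > 0" by simp
  have "mollifier d (\<lambda>x. (1 / (LINT x|lborel. f x)) * f x)"
    unfolding mollifier_def
  proof (intro conjI allI impI)
    fix k show "Ck_on k UNIV (\<lambda>x. (1 / (LINT x|lborel. f x)) * f x)"
      by (rule Ck_mult[OF Ck_const]) (rule sf[rule_format])
  qed (use c fnn f0 in auto)
  then show ?thesis by blast
qed

text \<open>The mollification minus \<open>g\<close> is a weighted mean of translation differences of \<open>g\<close>; Jensen and Tonelli bound its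
  \<open>L\<^sup>p\<close> size by the largest of theirs.\<close>

lemma convolve_pmass_le:
  fixes g :: "'a::euclidean_space \<Rightarrow> 'b::euclidean_space"
  assumes m: "mollifier d \<eta>" and g: "integrable lborel g" and p: "p \<ge> 1"
    and E: "\<And>z. norm z < d \<Longrightarrow> pmass p UNIV (\<lambda>x. g (x + z) - g x) \<le> E"
  shows "pmass p UNIV (\<lambda>x. convolve \<eta> g x - g x) \<le> E"
proof -
  have [measurable]: "g \<in> borel_measurable borel" using g by auto
  have s: "smooth \<eta>" "\<And>x. 0 \<le> \<eta> x" "\<And>x. d \<le> norm x \<Longrightarrow> \<eta> x = 0" "(LINT x|lborel. \<eta> x) = 1"
    using m by (auto simp: mollifier_def)
  have [measurable]: "\<eta> \<in> borel_measurable borel" using s by (intro borel_measurable_smooth) auto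
  have ie: "integrable lborel \<eta>" using m by (rule mollifier_integrable)
  have ig: "integrable lborel (\<lambda>z. \<eta> z *\<^sub>R g (x - z))" for x
  proof -
    have "integrable lborel (\<lambda>y. \<eta> (x - y) *\<^sub>R g y)"
      by (rule integrable_compact_smooth_scaleR[OF mollifier_compact_smooth[OF m] g])
    moreover have eq: "(lborel :: 'a measure) = distr lborel borel (\<lambda>y. x - y)"
      using lborel_affine[of "-1" x] by (simp add: density_1)
    ultimately have "integrable (distr lborel borel (\<lambda>y. x - y)) (\<lambda>y. \<eta> (x - y) *\<^sub>R g y)" by simp
    then show ?thesis by (subst (asm) integrable_distr_eq) auto
  qed
  have eq: "convolve \<eta> g x - g x = (LINT z|lborel. \<eta> z *\<^sub>R (g (x - z) - g x))" for x
  proof -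
    have "convolve \<eta> g x = (LINT y|lborel. (\<lambda>z. \<eta> z *\<^sub>R g (x - z)) (x - y))" by (simp add: convolve_def)
    also have "\<dots> = (LINT z|lborel. \<eta> z *\<^sub>R g (x - z))" by (rule lborel_integral_reflect) simp
    finally show ?thesis using ig[of x] ie s(4) by (simp add: scaleR_diff_right)
  qed
  have "pmass p UNIV (\<lambda>x. convolve \<eta> g x - g x) \<le> (\<integral>\<^sup>+x. \<integral>\<^sup>+z. ennreal (\<eta> z) * ennreal (norm (g (x - z) - g x) powr p) \<partial>lborel \<partial>lborel)"
    unfolding pmass_def
  proof (intro nn_integral_mono)
    fix x
    show "ennreal (norm (convolve \<eta> g x - g x) powr p) * indicator UNIV x \<le> (\<integral>\<^sup>+z. ennreal (\<eta> z) * ennreal (norm (g (x - z) - g x) powr p) \<partial>lborel)"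
      unfolding eq indicator_UNIV mult_1_right
      by (rule Jensen_powr) (use s ie ig p in \<open>auto simp: scaleR_diff_right\<close>)
  qed
  also have "\<dots> = (\<integral>\<^sup>+z. \<integral>\<^sup>+x. ennreal (\<eta> z) * ennreal (norm (g (x - z) - g x) powr p) \<partial>lborel \<partial>lborel)"
    by (rule lborel_pair.Fubini') measurable
  also have "\<dots> = (\<integral>\<^sup>+z. ennreal (\<eta> z) * pmass p UNIV (\<lambda>x. g (x + (- z)) - g x) \<partial>lborel)"
    unfolding pmass_def by (subst nn_integral_cmult) auto
  also have "\<dots> \<le> (\<integral>\<^sup>+z. ennreal (\<eta> z) * E \<partial>lborel)"
  proof (intro nn_integral_mono)
    fix z show "ennreal (\<eta> z) * pmass p UNIV (\<lambda>x. g (x + (- z)) - g x) \<le> ennreal (\<eta> z) * E"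
      using E[of "-z"] s(3)[of z] by (cases "norm z < d") (auto intro: mult_left_mono)
  qed
  also have "\<dots> = (\<integral>\<^sup>+z. ennreal (\<eta> z) \<partial>lborel) * E" by (subst nn_integral_multc) auto
  also have "(\<integral>\<^sup>+z. ennreal (\<eta> z) \<partial>lborel) = 1"
    using s by (subst nn_integral_eq_integral[OF ie]) auto
  finally show ?thesis by simp
qed

theorem mollification_tendsto:
  fixes g :: "'a::euclidean_space \<Rightarrow> 'b::euclidean_space"
  assumes g: "integrable lborel g" "pmass p UNIV g < \<infinity>" and p: "p \<ge> 1" and e: "e > 0"
  obtains d0 where "d0 > 0" "\<And>d \<eta>. d \<le> d0 \<Longrightarrow> mollifier d \<eta> \<Longrightarrow> pmass p UNIV (\<lambda>x. convolve \<eta> g x - g x) \<le> ennreal e"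
proof -
  have "translation_continuous p g" using g p by (intro pmass_finite_translation_continuous) auto
  then obtain d0 where "d0 > 0" "\<And>z. norm z < d0 \<Longrightarrow> pmass p UNIV (\<lambda>x. g (x + z) - g x) \<le> ennreal e"
    using e unfolding translation_continuous_def by metis
  then show thesis using convolve_pmass_le[OF _ g(1) p] that[of d0] by fastforce
qed

text \<open>Mollify the indicator of a neighbourhood of \<open>K\<close>. With \<open>d\<close> a lower bound for the distance of \<open>K\<close> from the complement of \<open>U\<close>, a neighbourhood
  of width \<open>d/3\<close> and a mollifier of radius \<open>d/3\<close> leave the support within \<open>2d/3\<close> of \<open>K\<close>.\<close>

lemma exists_cutoff:
  fixes K U :: "'a::euclidean_space set"
  assumes K: "compact K" and U: "open U" "K \<subseteq> U"
  obtains f :: "'a \<Rightarrow> real" where "smooth f" "\<And>x. 0 \<le> f x" "\<And>x. f x \<le> 1" "\<And>x. x \<in> K \<Longrightarrow> f x = 1"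
    "compact (closure {x. f x \<noteq> 0})" "closure {x. f x \<noteq> 0} \<subseteq> U"
proof -
  obtain d where d: "d > 0" "\<And>x y. x \<in> K \<Longrightarrow> y \<in> - U \<Longrightarrow> d \<le> dist x y"
    using compact_open_separation[of K U] U K by (metis order_trans)
  define A where "A = (\<Union>x\<in>K. ball x (d/3))"
  define C where "C = (\<Union>x\<in>K. \<Union>y\<in>cball 0 (2*d/3). {x + y})"
  have [measurable]: "A \<in> sets borel" unfolding A_def by (intro borel_open open_UN ballI open_ball)
  have C: "compact C" unfolding C_def by (intro compact_sums' K) auto
  have AC: "A \<subseteq> C"
  proof
    fix z assume "z \<in> A"
    then obtain x where x: "x \<in> K" "dist x z < d/3" by (auto simp: A_def)
    then show "z \<in> C" using d unfolding C_def
      by (intro UN_I[of x] UN_I[of "z - x"]) (auto simp: dist_norm norm_minus_commute)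
  qed
  have fin: "emeasure lborel A < \<infinity>"
    using emeasure_bounded_finite bounded_subset[OF compact_imp_bounded[OF C] AC] by blast
  obtain \<eta> :: "'a \<Rightarrow> real" where m: "mollifier (d/3) \<eta>" using exists_mollifier[of "d/3"] d by auto
  then have s: "\<And>x. 0 \<le> \<eta> x" "\<And>x. d/3 \<le> norm x \<Longrightarrow> \<eta> x = 0" "(LINT x|lborel. \<eta> x) = 1" "smooth \<eta>"
    by (auto simp: mollifier_def)
  have [measurable]: "\<eta> \<in> borel_measurable borel" using s by (intro borel_measurable_smooth) auto
  let ?g = "indicator A :: 'a \<Rightarrow> real"
  have ig: "integrable lborel ?g" using fin by (intro integrable_real_indicator) auto
  note ie = mollifier_integrable[OF m]
  have one: "(LINT y|lborel. \<eta> (x - y)) = 1" for x using lborel_integral_reflect[of \<eta> x] s by simp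
  have ie': "integrable lborel (\<lambda>y. \<eta> (x - y))" for x
    using one[of x] not_integrable_integral_eq by fastforce
  have ii: "integrable lborel (\<lambda>y. \<eta> (x - y) *\<^sub>R ?g y)" for x
    by (rule integrable_compact_smooth_scaleR[OF mollifier_compact_smooth[OF m] ig])
  show thesis
  proof (rule that[of "convolve \<eta> ?g"])
    show "smooth (convolve \<eta> ?g)" by (rule smooth_convolve[OF mollifier_compact_smooth[OF m] ig])
    show "0 \<le> convolve \<eta> ?g x" for x unfolding convolve_def using s by (intro integral_nonneg_AE) auto
    show "convolve \<eta> ?g x \<le> 1" for x
    proof -
      have "convolve \<eta> ?g x \<le> (LINT y|lborel. \<eta> (x - y))" unfolding convolve_def
        by (rule integral_mono[OF ii ie']) (use s in \<open>auto simp: indicator_def\<close>)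
      then show ?thesis using one by simp
    qed
    show "convolve \<eta> ?g x = 1" if x: "x \<in> K" for x
    proof -
      have "\<eta> (x - y) *\<^sub>R ?g y = \<eta> (x - y)" for y
      proof (cases "norm (x - y) < d/3")
        case True
        then have "y \<in> A" using x by (auto simp: A_def dist_norm)
        then show ?thesis by simp
      qed (use s in auto)
      then have "(\<lambda>y. \<eta> (x - y) *\<^sub>R ?g y) = (\<lambda>y. \<eta> (x - y))" by blast
      then show ?thesis using one[of x] unfolding convolve_def by presburger
    qed
    have "{x. convolve \<eta> ?g x \<noteq> 0} \<subseteq> C"
    proof (rule ccontr)
      assume "\<not> ?thesis"
      then obtain x where x: "convolve \<eta> ?g x \<noteq> 0" "x \<notin> C" by auto
      have "\<eta> (x - y) *\<^sub>R ?g y = 0" for y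
      proof (rule ccontr)
        assume "\<not> ?thesis"
        then have "y \<in> A" and n: "norm (x - y) < d/3" using s(2)[of "x - y"] by (force simp: indicator_def split: if_splits)+
        then obtain k where k: "k \<in> K" "dist k y < d/3" by (auto simp: A_def)
        have "norm (x - k) \<le> 2*d/3" using n k(2) norm_triangle_ineq[of "x - y" "y - k"] by (simp add: dist_norm norm_minus_commute)
        then have "x \<in> C" unfolding C_def by (intro UN_I[of k] UN_I[of "x - k"]) (use k in auto)
        then show False using x by simp
      qed
      then have "(\<lambda>y. \<eta> (x - y) *\<^sub>R ?g y) = (\<lambda>y. 0)" by blast
      then have "convolve \<eta> ?g x = 0" unfolding convolve_def by (simp only: integral_zero)
      then show False using x by simp
    qed
    then have cl: "closure {x. convolve \<eta> ?g x \<noteq> 0} \<subseteq> C" using C by (intro closure_minimal compact_imp_closed)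
    show "compact (closure {x. convolve \<eta> ?g x \<noteq> 0})"
      using cl C by (metis closed_closure compact_Int_closed inf.absorb2)
    have "C \<subseteq> U"
    proof
      fix z assume "z \<in> C"
      then obtain x y where xy: "x \<in> K" "norm y \<le> 2*d/3" "z = x + y" by (auto simp: C_def)
      show "z \<in> U"
      proof (rule ccontr)
        assume "z \<notin> U"
        then have "d \<le> dist x z" using d(2)[of x z] xy by auto
        then show False using xy d by (simp add: dist_norm)
      qed
    qed
    then show "closure {x. convolve \<eta> ?g x \<noteq> 0} \<subseteq> U" using cl by blast
  qed
qed

section \<open>Weak gradients\<close>

lemma borel_measurable_vec_component [measurable (raw)]:
  fixes f :: "'a \<Rightarrow> ('b::euclidean_space)^'m"
  assumes "f \<in> borel_measurable M" shows "(\<lambda>x. f x $ i) \<in> borel_measurable M"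
  using assms
  by (rule measurable_compose) (intro borel_measurable_continuous_onI continuous_intros)

lemma set_integral_lebesgue_lborel:
  fixes f :: "'a::euclidean_space \<Rightarrow> 'b::euclidean_space"
  assumes [measurable]: "f \<in> borel_measurable borel" "S \<in> sets borel"
  shows "(LINT x:S|lebesgue. f x) = (LINT x:S|lborel. f x)"
  unfolding set_lebesgue_integral_def by (rule integral_completion) measurable

lemma indicator_scaleR_powr: "indicator S x *\<^sub>R (norm (f x) powr p) = norm (indicator S x *\<^sub>R f x) powr p"
  by (simp add: indicator_def)

lemma Lp_AE_imp:
  fixes f g :: "'a::euclidean_space \<Rightarrow> 'b::euclidean_space"
  assumes ae: "AE x in lborel. x \<in> S \<longrightarrow> f x = g x" and f: "f \<in> Lp p S"
  shows "g \<in> Lp p S"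
proof -
  have ae': "AE x in lebesgue. indicator S x *\<^sub>R f x = indicator S x *\<^sub>R g x"
    using AE_completion[OF ae] by (rule eventually_mono) (auto simp: indicator_def)
  have f1: "(\<lambda>x. indicator S x *\<^sub>R f x) \<in> borel_measurable lebesgue"
    and f2: "integrable lebesgue (\<lambda>x. norm (indicator S x *\<^sub>R f x) powr p)"
    using f unfolding Lp_def set_borel_measurable_def set_integrable_def indicator_scaleR_powr by auto
  have g1: "(\<lambda>x. indicator S x *\<^sub>R g x) \<in> borel_measurable lebesgue"
    by (rule borel_measurable_AE[OF f1 ae'])
  have "integrable lebesgue (\<lambda>x. norm (indicator S x *\<^sub>R g x) powr p)"
  proof (rule integrable_cong_AE_imp[OF f2])
    show "(\<lambda>x. norm (indicator S x *\<^sub>R g x) powr p) \<in> borel_measurable lebesgue" using g1 by measurable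
    show "AE x in lebesgue. norm (indicator S x *\<^sub>R f x) powr p = norm (indicator S x *\<^sub>R g x) powr p"
      using ae' by (rule eventually_mono) presburger
  qed
  then show ?thesis using g1
    unfolding Lp_def set_borel_measurable_def set_integrable_def indicator_scaleR_powr by auto
qed

lemma Lp_AE_cong:
  fixes f g :: "'a::euclidean_space \<Rightarrow> 'b::euclidean_space"
  assumes "AE x in lborel. x \<in> S \<longrightarrow> f x = g x"
  shows "f \<in> Lp p S \<longleftrightarrow> g \<in> Lp p S"
proof
  assume "g \<in> Lp p S"
  moreover have "AE x in lborel. x \<in> S \<longrightarrow> g x = f x" using assms by (rule eventually_mono) simp
  ultimately show "f \<in> Lp p S" using Lp_AE_imp by blast
qed (rule Lp_AE_imp[OF assms])

lemma Lp_Borel_iff: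
  fixes f :: "'a::euclidean_space \<Rightarrow> 'b::euclidean_space"
  assumes [measurable]: "f \<in> borel_measurable borel" "S \<in> sets borel"
  shows "f \<in> Lp p S \<longleftrightarrow> pmass p S f < \<infinity>"
proof -
  have m: "(\<lambda>x. indicator S x *\<^sub>R f x) \<in> borel_measurable lebesgue"
    using measurable_completion[of "\<lambda>x. indicator S x *\<^sub>R f x" lborel borel] by simp
  have "integrable lebesgue (\<lambda>x. indicator S x *\<^sub>R (norm (f x) powr p)) \<longleftrightarrow> integrable lborel (\<lambda>x. indicator S x *\<^sub>R (norm (f x) powr p))"
    by (rule integrable_completion) measurable
  also have "\<dots> \<longleftrightarrow> pmass p S f < \<infinity>"
    unfolding integrable_iff_bounded pmass_def
    by (auto intro!: arg_cong[where f="\<lambda>x. x < top"] nn_integral_cong simp: indicator_def)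
  finally show ?thesis using m by (simp add: Lp_def set_borel_measurable_def set_integrable_def)
qed

lemma Borel_representative:
  fixes f :: "'a::euclidean_space \<Rightarrow> 'b::euclidean_space"
  assumes f: "set_borel_measurable lebesgue S f" and [measurable]: "S \<in> sets borel"
  obtains f' where "f' \<in> borel_measurable borel" "\<And>x. x \<notin> S \<Longrightarrow> f' x = 0" "AE x in lborel. x \<in> S \<longrightarrow> f x = f' x"
proof -
  have [measurable]: "(\<lambda>x. indicator S x *\<^sub>R f x) \<in> borel_measurable lebesgue"
    using f by (simp add: set_borel_measurable_def)
  have "\<exists>g. g \<in> borel_measurable lborel \<and> (AE x in lborel. (indicator S x *\<^sub>R f x) \<bullet> b = g x)" for b
  proof -
    have "(\<lambda>x. (indicator S x *\<^sub>R f x) \<bullet> b) \<in> borel_measurable lebesgue" by measurable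
    from completion_ex_borel_measurable_real[OF this] show ?thesis by blast
  qed
  then obtain g where g: "\<And>b. g b \<in> borel_measurable lborel" "\<And>b. AE x in lborel. (indicator S x *\<^sub>R f x) \<bullet> b = g b x" by metis
  have [measurable]: "g b \<in> borel_measurable borel" for b using g(1)[of b] by simp
  have "AE x in lborel. \<forall>b\<in>Basis. (indicator S x *\<^sub>R f x) \<bullet> b = g b x"
    using g(2) by (intro AE_finite_allI) auto
  then have "AE x in lborel. x \<in> S \<longrightarrow> f x = indicator S x *\<^sub>R (\<Sum>b\<in>Basis. g b x *\<^sub>R b)"
  proof (rule eventually_mono)
    fix x assume "\<forall>b\<in>Basis. (indicator S x *\<^sub>R f x) \<bullet> b = g b x"
    then have "x \<in> S \<longrightarrow> f x = (\<Sum>b\<in>Basis. g b x *\<^sub>R b)"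
      by (auto simp: euclidean_representation intro!: euclidean_eqI[of "f x"] simp flip: inner_sum_left)
    then show "x \<in> S \<longrightarrow> f x = indicator S x *\<^sub>R (\<Sum>b\<in>Basis. g b x *\<^sub>R b)" by simp
  qed
  then show thesis by (intro that[of "\<lambda>x. indicator S x *\<^sub>R (\<Sum>b\<in>Basis. g b x *\<^sub>R b)"]) auto
qed

lemma test_functions_compact_smooth:
  "\<phi> \<in> test_functions S \<Longrightarrow> compact_smooth \<phi>"
  using bounded_subset[OF compact_imp_bounded closure_subset] by (auto simp: test_functions_def)

lemma test_functions_mono: "S \<subseteq> T \<Longrightarrow> test_functions S \<subseteq> test_functions T"
  by (auto simp: test_functions_def)

lemma test_function_zero_off:
  assumes "\<phi> \<in> test_functions S" "x \<notin> S"
  shows "\<phi> x = 0" "partial_on UNIV v \<phi> x = 0"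
proof -
  have "x \<notin> closure {x. \<phi> x \<noteq> 0}" using assms by (auto simp: test_functions_def)
  then show "\<phi> x = 0" "partial_on UNIV v \<phi> x = 0"
    using closure_subset[of "{x. \<phi> x \<noteq> 0}"] by (auto intro: partial_eq_0_off_support)
qed

lemma set_integral_AE_cong:
  fixes f g :: "'a::euclidean_space \<Rightarrow> real"
  assumes "AE x in lborel. x \<in> S \<longrightarrow> f x = g x" "set_borel_measurable lebesgue S f"
  shows "(LINT x:S|lebesgue. f x) = (LINT x:S|lebesgue. g x)"
proof -
  have ae': "AE x in lebesgue. indicator S x *\<^sub>R f x = indicator S x *\<^sub>R g x"
    using AE_completion[OF assms(1)] by (rule eventually_mono) (auto simp: indicator_def)
  have f1: "(\<lambda>x. indicator S x *\<^sub>R f x) \<in> borel_measurable lebesgue"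
    using assms(2) by (simp add: set_borel_measurable_def)
  show ?thesis unfolding set_lebesgue_integral_def
    by (rule integral_cong_AE[OF f1 borel_measurable_AE[OF f1 ae'] ae'])
qed

lemma pmass_1_integrable:
  fixes f :: "'a::euclidean_space \<Rightarrow> 'b::euclidean_space"
  assumes [measurable]: "f \<in> borel_measurable borel" "S \<in> sets borel"
  shows "set_integrable lborel S f \<longleftrightarrow> pmass 1 S f < \<infinity>"
  unfolding set_integrable_def integrable_iff_bounded pmass_def
  by (auto intro!: arg_cong[where f="\<lambda>x. x < top"] nn_integral_cong simp: indicator_def)

text \<open>Weak gradients of functions that are Borel measurable on the whole space, tested with integrals over Lebesgue-Borel
  measure. Composition with a homeomorphism and Tonelli arguments preserve Borel measurability without any
  null-set discussion, whereas Lebesgue measurability is not stable under composition; every Sobolev function has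
  such a representative.\<close>

definition Borel_weak_gradient ::
    "(real^'n) set \<Rightarrow> (real^'n \<Rightarrow> real^'m) \<Rightarrow> (real^'n \<Rightarrow> real^'n^'m) \<Rightarrow> bool" where
  "Borel_weak_gradient S u D \<longleftrightarrow> u \<in> borel_measurable borel \<and> D \<in> borel_measurable borel \<and>
     (\<forall>K. compact K \<and> K \<subseteq> S \<longrightarrow> pmass 1 K u < \<infinity> \<and> pmass 1 K D < \<infinity>) \<and>
     (\<forall>\<phi>\<in>test_functions S. \<forall>\<alpha> i.
        (LINT x|lborel. u x $ \<alpha> * partial_on UNIV (axis i 1) \<phi> x) = - (LINT x|lborel. D x $ \<alpha> $ i * \<phi> x))"

lemma Borel_weak_gradientD:
  assumes "Borel_weak_gradient S u D"
  shows "u \<in> borel_measurable borel" "D \<in> borel_measurable borel"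
    "\<And>K. compact K \<Longrightarrow> K \<subseteq> S \<Longrightarrow> pmass 1 K u < \<infinity>" "\<And>K. compact K \<Longrightarrow> K \<subseteq> S \<Longrightarrow> pmass 1 K D < \<infinity>"
    "\<And>\<phi> \<alpha> i. \<phi> \<in> test_functions S \<Longrightarrow>
      (LINT x|lborel. u x $ \<alpha> * partial_on UNIV (axis i 1) \<phi> x) = - (LINT x|lborel. D x $ \<alpha> $ i * \<phi> x)"
  using assms unfolding Borel_weak_gradient_def by auto

lemma has_weak_gradient_Borel_iff:
  fixes u :: "real^'n \<Rightarrow> real^'m" and D :: "real^'n \<Rightarrow> real^'n^'m"
  assumes [measurable]: "u \<in> borel_measurable borel" "D \<in> borel_measurable borel" "S \<in> sets borel"
  shows "has_weak_gradient S u D \<longleftrightarrow> Borel_weak_gradient S u D"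
proof -
  have 1: "u \<in> Lp_loc 1 S \<longleftrightarrow> (\<forall>K. compact K \<and> K \<subseteq> S \<longrightarrow> pmass 1 K u < \<infinity>)"
    "D \<in> Lp_loc 1 S \<longleftrightarrow> (\<forall>K. compact K \<and> K \<subseteq> S \<longrightarrow> pmass 1 K D < \<infinity>)"
    by (auto simp: Lp_loc_def Lp_Borel_iff borel_compact)
  have 2: "(LINT x:S|lebesgue. u x $ \<alpha> * partial_on UNIV (axis i 1) \<phi> x) = (LINT x|lborel. u x $ \<alpha> * partial_on UNIV (axis i 1) \<phi> x)"
    "(LINT x:S|lebesgue. D x $ \<alpha> $ i * \<phi> x) = (LINT x|lborel. D x $ \<alpha> $ i * \<phi> x)"
    if p: "\<phi> \<in> test_functions S" for \<phi> \<alpha> i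
  proof -
    have s: "smooth \<phi>" using test_functions_compact_smooth[OF p] by blast
    have [measurable]: "\<phi> \<in> borel_measurable borel" "partial_on UNIV (axis i 1) \<phi> \<in> borel_measurable borel"
      by (rule borel_measurable_smooth[OF s], rule borel_measurable_smooth[OF smooth_partial[OF s]])
    have e: "indicator S x *\<^sub>R (c * partial_on UNIV (axis i 1) \<phi> x) = c * partial_on UNIV (axis i 1) \<phi> x"
      "indicator S x *\<^sub>R (c * \<phi> x) = c * \<phi> x" for x c
      using test_function_zero_off[OF p, of x] by (auto simp: indicator_def)
    show "(LINT x:S|lebesgue. u x $ \<alpha> * partial_on UNIV (axis i 1) \<phi> x) = (LINT x|lborel. u x $ \<alpha> * partial_on UNIV (axis i 1) \<phi> x)"
      by (subst set_integral_lebesgue_lborel) (simp_all only: set_lebesgue_integral_def e, measurable)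
    show "(LINT x:S|lebesgue. D x $ \<alpha> $ i * \<phi> x) = (LINT x|lborel. D x $ \<alpha> $ i * \<phi> x)"
      by (subst set_integral_lebesgue_lborel) (simp_all only: set_lebesgue_integral_def e, measurable)
  qed
  show ?thesis unfolding has_weak_gradient_def Borel_weak_gradient_def 1 using 2 by auto
qed

lemma Lp_loc_set_borel_measurable:
  fixes u :: "'a::euclidean_space \<Rightarrow> 'b::euclidean_space"
  assumes u: "u \<in> Lp_loc p S" and S: "open S"
  shows "set_borel_measurable lebesgue S u"
proof -
  obtain C where C: "\<And>n. compact (C n)" "\<And>n. C n \<subseteq> S" "\<And>n. C n \<subseteq> interior (C (Suc n))" "\<Union>(range C) = S"
    "\<And>K. compact K \<Longrightarrow> K \<subseteq> S \<Longrightarrow> \<exists>N. \<forall>n\<ge>N. K \<subseteq> C n"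
    using open_Union_compact_subsets[OF S] by metis
  have m: "(\<lambda>x. indicator (C n) x *\<^sub>R u x) \<in> borel_measurable lebesgue" for n
    using u C(1,2)[of n] by (auto simp: Lp_loc_def Lp_def set_borel_measurable_def)
  have "(\<lambda>n. indicator (C n) x *\<^sub>R u x) \<longlonglongrightarrow> indicator S x *\<^sub>R u x" for x
  proof (cases "x \<in> S")
    case True
    obtain N where N: "\<forall>n\<ge>N. {x} \<subseteq> C n" using C(5)[of "{x}"] True by auto
    have "\<forall>\<^sub>F n in sequentially. indicator (C n) x *\<^sub>R u x = indicator S x *\<^sub>R u x"
      using N True by (auto simp: eventually_sequentially intro!: exI[of _ N])
    then show ?thesis by (rule tendsto_eventually)
  next
    case False
    then have "x \<notin> C n" for n using C(2) by blast
    then show ?thesis using False by simp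
  qed
  then show ?thesis unfolding set_borel_measurable_def
    by (intro borel_measurable_LIMSEQ_metric[OF m]) auto
qed

lemma set_borel_measurable_mult:
  fixes f :: "'a \<Rightarrow> real"
  assumes "set_borel_measurable M S f" "g \<in> borel_measurable M"
  shows "set_borel_measurable M S (\<lambda>x. f x * g x)"
proof -
  have "(\<lambda>x. (indicator S x *\<^sub>R f x) * g x) \<in> borel_measurable M"
    using assms unfolding set_borel_measurable_def by (rule borel_measurable_times)
  then show ?thesis by (simp add: set_borel_measurable_def mult.assoc)
qed

lemma set_borel_measurable_bounded_linear:
  fixes f :: "'a \<Rightarrow> 'b::euclidean_space" and L :: "'b \<Rightarrow> 'c::euclidean_space"
  assumes "set_borel_measurable M S f" "bounded_linear L"
  shows "set_borel_measurable M S (\<lambda>x. L (f x))"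
proof -
  have "(\<lambda>x. L (indicator S x *\<^sub>R f x)) \<in> borel_measurable M"
    using assms bounded_linear.continuous_on[OF assms(2) continuous_on_id]
    unfolding set_borel_measurable_def
    by (intro measurable_compose[OF assms(1)[unfolded set_borel_measurable_def] borel_measurable_continuous_onI]) auto
  then show ?thesis using assms(2) by (simp add: set_borel_measurable_def linear_simps(5))
qed

text \<open>Weak differentiability only sees equivalence classes modulo null sets. Every set on which integrability is
  required is compact in \<open>S\<close>, and test functions vanish outside \<open>S\<close>.\<close>

lemma has_weak_gradient_AE_imp:
  fixes u v :: "real^'n \<Rightarrow> real^'m"
  assumes S: "open S" and u: "AE x in lborel. x \<in> S \<longrightarrow> u x = v x" and D: "AE x in lborel. x \<in> S \<longrightarrow> D x = E x"
    and h: "has_weak_gradient S u D"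
  shows "has_weak_gradient S v E"
  unfolding has_weak_gradient_def
proof (intro conjI ballI allI)
  have h': "u \<in> Lp_loc 1 S" "D \<in> Lp_loc 1 S" using h by (auto simp: has_weak_gradient_def)
  show "v \<in> Lp_loc 1 S" unfolding Lp_loc_def
  proof (intro CollectI allI impI)
    fix K assume K: "compact K \<and> K \<subseteq> S"
    show "v \<in> Lp 1 K" by (rule Lp_AE_imp[of K u v]) (use K u h' in \<open>auto simp: Lp_loc_def elim!: eventually_mono\<close>)
  qed
  show "E \<in> Lp_loc 1 S" unfolding Lp_loc_def
  proof (intro CollectI allI impI)
    fix K assume K: "compact K \<and> K \<subseteq> S"
    show "E \<in> Lp 1 K" by (rule Lp_AE_imp[of K D E]) (use K D h' in \<open>auto simp: Lp_loc_def elim!: eventually_mono\<close>)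
  qed
  fix \<phi> :: "real^'n \<Rightarrow> real" and \<alpha> i assume p: "\<phi> \<in> test_functions S"
  have s: "smooth \<phi>" using test_functions_compact_smooth[OF p] by blast
  have pm: "\<phi> \<in> borel_measurable lebesgue" "partial_on UNIV (axis i 1) \<phi> \<in> borel_measurable lebesgue"
    using borel_measurable_smooth[OF s] borel_measurable_smooth[OF smooth_partial[OF s]]
    by (auto intro!: measurable_completion)
  have "(LINT x:S|lebesgue. v x $ \<alpha> * partial_on UNIV (axis i 1) \<phi> x) = (LINT x:S|lebesgue. u x $ \<alpha> * partial_on UNIV (axis i 1) \<phi> x)"
    by (rule set_integral_AE_cong[symmetric], rule eventually_mono[OF u], simp)
      (intro set_borel_measurable_mult set_borel_measurable_bounded_linear[OF _ bounded_linear_vec_nth] Lp_loc_set_borel_measurable[OF h'(1) S] pm)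
  also have "\<dots> = - (LINT x:S|lebesgue. D x $ \<alpha> $ i * \<phi> x)" using h p by (auto simp: has_weak_gradient_def)
  also have "(LINT x:S|lebesgue. D x $ \<alpha> $ i * \<phi> x) = (LINT x:S|lebesgue. E x $ \<alpha> $ i * \<phi> x)"
    by (rule set_integral_AE_cong, rule eventually_mono[OF D], simp)
      (intro set_borel_measurable_mult set_borel_measurable_bounded_linear[OF _ bounded_linear_vec_nth] Lp_loc_set_borel_measurable[OF h'(2) S] pm)
  finally show "(LINT x:S|lebesgue. v x $ \<alpha> * partial_on UNIV (axis i 1) \<phi> x) = - (LINT x:S|lebesgue. E x $ \<alpha> $ i * \<phi> x)" .
qed

lemma has_weak_gradient_Borel_representatives:
  fixes u :: "real^'n \<Rightarrow> real^'m"
  assumes S: "open S" and h: "has_weak_gradient S u D"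
  obtains u' D' where "Borel_weak_gradient S u' D'" "\<forall>x. x \<notin> S \<longrightarrow> u' x = 0" "\<forall>x. x \<notin> S \<longrightarrow> D' x = 0"
    "AE x in lborel. x \<in> S \<longrightarrow> u x = u' x" "AE x in lborel. x \<in> S \<longrightarrow> D x = D' x"
proof -
  have h': "set_borel_measurable lebesgue S u" "set_borel_measurable lebesgue S D"
    using h S by (auto simp: has_weak_gradient_def intro: Lp_loc_set_borel_measurable)
  obtain u' where u': "u' \<in> borel_measurable borel" "\<And>x. x \<notin> S \<Longrightarrow> u' x = 0" "AE x in lborel. x \<in> S \<longrightarrow> u x = u' x"
    using Borel_representative[OF h'(1)] S by auto
  obtain D' where D': "D' \<in> borel_measurable borel" "\<And>x. x \<notin> S \<Longrightarrow> D' x = 0" "AE x in lborel. x \<in> S \<longrightarrow> D x = D' x"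
    using Borel_representative[OF h'(2)] S by auto
  have "has_weak_gradient S u' D'" by (rule has_weak_gradient_AE_imp[OF S u'(3) D'(3) h])
  then have "Borel_weak_gradient S u' D'"
    using has_weak_gradient_Borel_iff[OF u'(1) D'(1) borel_open[OF S]] by simp
  then show thesis using that u' D' by blast
qed

section \<open>Uniqueness of weak gradients\<close>

lemma convolve_vec_nth:
  fixes g :: "real^'n \<Rightarrow> ('b::euclidean_space)^'m"
  assumes "compact_smooth f" "integrable lborel g"
  shows "convolve f g x $ \<alpha> = convolve f (\<lambda>y. g y $ \<alpha>) x"
  using integral_bounded_linear[OF bounded_linear_vec_nth[of \<alpha>] integrable_compact_smooth_scaleR[OF assms, of x]]
  by (simp add: convolve_def)

text \<open>The value at \<open>x\<close> of a mollification is an integral against this test function. So the weak gradient can be tested with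
  mollifiers, provided that the mollification radius is below the distance to the boundary.\<close>

lemma reflected_test_function:
  fixes \<eta> :: "'a::euclidean_space \<Rightarrow> real"
  assumes m: "mollifier d \<eta>" and c: "cball x d \<subseteq> S"
  shows "(\<lambda>y. \<eta> (x - y)) \<in> test_functions S"
    "partial_on UNIV v (\<lambda>y. \<eta> (x - y)) y = - partial_on UNIV v \<eta> (x - y)"
proof -
  have s: "smooth \<eta>" "\<And>x. d \<le> norm x \<Longrightarrow> \<eta> x = 0" using m by (auto simp: mollifier_def)
  have "{y. \<eta> (x - y) \<noteq> 0} \<subseteq> cball x d" using s(2) by (auto simp: dist_norm) (meson linear)
  then have cl: "closure {y. \<eta> (x - y) \<noteq> 0} \<subseteq> cball x d" by (intro closure_minimal) auto
  then have "compact (closure {y. \<eta> (x - y) \<noteq> 0})"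
    by (metis bounded_cball bounded_subset closed_closure compact_eq_bounded_closed)
  moreover have "Ck_on k UNIV (\<lambda>y. \<eta> (x - y))" for k
    by (rule Ck_compose[OF s(1)[rule_format] Ck_diff[OF Ck_const Ck_bounded_linear[OF bounded_linear_ident]]])
  ultimately show "(\<lambda>y. \<eta> (x - y)) \<in> test_functions S" using cl c by (auto simp: test_functions_def)
  have "((\<lambda>y. x - y) has_derivative (\<lambda>v. - v)) (at y)" by (auto intro!: derivative_eq_intros)
  from has_derivative_compose[OF this smooth_has_derivative[OF s(1)]]
  have "partial_on UNIV v (\<lambda>y. \<eta> (x - y)) y = partial_on UNIV (- v) \<eta> (x - y)" by (rule partial_on_UNIV)
  also have "\<dots> = - partial_on UNIV v \<eta> (x - y)" using linear_neg[OF smooth_partial_linear[OF s(1)]] .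
  finally show "partial_on UNIV v (\<lambda>y. \<eta> (x - y)) y = - partial_on UNIV v \<eta> (x - y)" .
qed

lemma ennreal_pos_between:
  assumes "(x::ennreal) \<noteq> 0" obtains e where "e > 0" "ennreal e < x"
proof (cases x rule: ennreal_cases)
  case (real r)
  then have "r > 0" using assms by (cases "r = 0") auto
  then show thesis using that[of "r/2"] real by (auto simp: ennreal_less_iff)
next
  case top
  then show thesis using that[of 1] by auto
qed

text \<open>Near a compact set \<open>K\<close> a mollification of \<open>g\<close>, cut off outside a slightly larger compact set, is an integral against a
  test function and vanishes. Mollifications converge in \<open>L\<^sup>1\<close>, so \<open>g\<close> vanishes on \<open>K\<close>; finally \<open>S\<close> is a countable union
  of compact sets.\<close>

lemma fundamental_lemma:
  fixes g :: "'a::euclidean_space \<Rightarrow> real"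
  assumes S: "open S" and [measurable]: "g \<in> borel_measurable borel"
    and loc: "\<And>K. compact K \<Longrightarrow> K \<subseteq> S \<Longrightarrow> pmass 1 K g < \<infinity>"
    and z: "\<And>\<phi>. \<phi> \<in> test_functions S \<Longrightarrow> (LINT x|lborel. \<phi> x * g x) = 0"
  shows "AE x in lborel. x \<in> S \<longrightarrow> g x = 0"
proof -
  have K0: "AE x in lborel. x \<in> K \<longrightarrow> g x = 0" if K: "compact K" "K \<subseteq> S" for K
  proof -
    obtain d where d: "d > 0" "\<And>x y. x \<in> K \<Longrightarrow> y \<in> - S \<Longrightarrow> d \<le> dist x y"
      using compact_open_separation[OF K(1) S K(2)] by blast
    define C where "C = (\<Union>x\<in>K. \<Union>y\<in>cball 0 (d/2). {x + y})"
    have C: "compact C" unfolding C_def by (intro compact_sums' K) auto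
    have CS: "C \<subseteq> S"
    proof
      fix z assume "z \<in> C"
      then obtain x y where xy: "x \<in> K" "norm y \<le> d/2" "z = x + y" by (auto simp: C_def)
      then show "z \<in> S" using d(2)[of x z] d(1) by (auto simp: dist_norm)
    qed
    have cb: "cball x (d/2) \<subseteq> C" if "x \<in> K" for x
    proof
      fix z assume "z \<in> cball x (d/2)"
      then show "z \<in> C" unfolding C_def using that by (intro UN_I[of x] UN_I[of "z - x"]) (auto simp: dist_norm norm_minus_commute)
    qed
    have KC: "K \<subseteq> C" using cb d(1) by fastforce
    have [measurable]: "C \<in> sets borel" "K \<in> sets borel" using C K by (auto intro: borel_compact)
    let ?g = "\<lambda>x. indicator C x * g x"
    have fin: "pmass 1 UNIV ?g < \<infinity>"
    proof -
      have "pmass 1 UNIV ?g = pmass 1 C g" unfolding pmass_def by (intro nn_integral_cong) (auto simp: indicator_def)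
      then show ?thesis using loc[OF C CS] by simp
    qed
    then have ig: "integrable lborel ?g" using pmass_1_integrable[of ?g UNIV] by (simp add: set_integrable_def)
    have small: "pmass 1 K g \<le> ennreal e" if e: "e > 0" for e
    proof -
      obtain d0 where d0: "d0 > 0" "\<And>d \<eta>. d \<le> d0 \<Longrightarrow> mollifier d \<eta> \<Longrightarrow> pmass 1 UNIV (\<lambda>x. convolve \<eta> ?g x - ?g x) \<le> ennreal e"
        using mollification_tendsto[OF ig fin order.refl e] by blast
      define r where "r = min d0 (d/2)"
      have r: "r > 0" "r \<le> d0" "r \<le> d/2" using d0 d by (auto simp: r_def)
      obtain \<eta> :: "'a \<Rightarrow> real" where m: "mollifier r \<eta>" using exists_mollifier[OF r(1)] by blast
      have c0: "convolve \<eta> ?g x = 0" if x: "x \<in> K" for x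
      proof -
        have xr: "cball x r \<subseteq> C" using cb[OF x] r by auto
        have tf: "(\<lambda>y. \<eta> (x - y)) \<in> test_functions S"
          by (rule reflected_test_function(1)[OF m]) (use xr CS in auto)
        have eqy: "\<eta> (x - y) * (indicator C y * g y) = \<eta> (x - y) * g y" for y
        proof (cases "y \<in> C")
          case False
          then have "\<not> norm (x - y) < r" using xr by (auto simp: dist_norm subset_iff)
          then have "r \<le> norm (x - y)" by simp
          then have "\<eta> (x - y) = 0" using m by (auto simp: mollifier_def)
          then show ?thesis by simp
        qed simp
        have "(\<lambda>y. \<eta> (x - y) * (indicator C y * g y)) = (\<lambda>y. \<eta> (x - y) * g y)" using eqy by blast
        then show ?thesis using z[OF tf] unfolding convolve_def real_scaleR_def by presburger
      qed
      have "pmass 1 K g = pmass 1 K (\<lambda>x. convolve \<eta> ?g x - ?g x)"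
        unfolding pmass_def
      proof (intro nn_integral_cong)
        fix x show "ennreal (norm (g x) powr 1) * indicator K x = ennreal (norm (convolve \<eta> ?g x - ?g x) powr 1) * indicator K x"
          using c0[of x] KC by (auto simp: indicator_def)
      qed
      also have "\<dots> \<le> ennreal e" using d0(2)[OF r(2) m] pmass_mono_set[of K UNIV] by (metis (no_types, lifting) order_trans subset_UNIV)
      finally show ?thesis .
    qed
    have "pmass 1 K g = 0"
    proof (rule ccontr)
      assume "pmass 1 K g \<noteq> 0"
      then obtain e where "e > 0" "ennreal e < pmass 1 K g"
        using ennreal_pos_between by blast
      then show False using small[of e] by simp
    qed
    then have "AE x in lborel. ennreal (norm (g x) powr 1) * indicator K x = 0"
      unfolding pmass_def by (subst (asm) nn_integral_0_iff_AE) auto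
    then show ?thesis by (rule eventually_mono) (auto simp: indicator_def split: if_splits)
  qed
  obtain C where C: "\<And>n. compact (C n)" "\<And>n. C n \<subseteq> S" "\<And>n. C n \<subseteq> interior (C (Suc n))" "\<Union>(range C) = S"
    "\<And>K. compact K \<Longrightarrow> K \<subseteq> S \<Longrightarrow> \<exists>N. \<forall>n\<ge>N. K \<subseteq> C n"
    using open_Union_compact_subsets[OF S] by metis
  have "AE x in lborel. \<forall>n. x \<in> C n \<longrightarrow> g x = 0" using K0[OF C(1,2)] unfolding AE_all_countable by blast
  then show ?thesis by (rule eventually_mono) (use C(4) in auto)
qed

lemma pmass_1_vec_nth_finite:
  fixes g :: "'a::euclidean_space \<Rightarrow> ('b::euclidean_space)^'m"
  assumes "pmass 1 K g < \<infinity>" shows "pmass 1 K (\<lambda>x. g x $ \<alpha>) < \<infinity>"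
  by (rule le_less_trans[OF pmass_mono assms]) (auto intro: Finite_Cartesian_Product.norm_nth_le)

lemma integrable_test_function_mult:
  fixes g :: "'a::euclidean_space \<Rightarrow> real"
  assumes [measurable]: "g \<in> borel_measurable borel" and loc: "\<And>K. compact K \<Longrightarrow> K \<subseteq> S \<Longrightarrow> pmass 1 K g < \<infinity>"
    and f: "continuous_on UNIV f" "compact (closure {x. f x \<noteq> 0})" "closure {x. f x \<noteq> 0} \<subseteq> S"
  shows "integrable lborel (\<lambda>x. g x * f x)"
proof -
  let ?C = "closure {x. f x \<noteq> 0}"
  have [measurable]: "?C \<in> sets borel" "f \<in> borel_measurable borel"
    using f by (auto intro: borel_compact borel_measurable_continuous_onI)
  obtain B where B: "B > 0" "\<And>x. norm (f x) \<le> B"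
    using compact_support_bounded[OF f(1)] bounded_subset[OF compact_imp_bounded[OF f(2)] closure_subset] by blast
  have "integrable lborel (\<lambda>x. indicator ?C x *\<^sub>R g x)"
    using loc[OF f(2,3)] pmass_1_integrable[of g ?C] by (simp add: set_integrable_def)
  then have "integrable lborel (\<lambda>x. B * (indicator ?C x *\<^sub>R g x))" by simp
  then show ?thesis
  proof (rule Bochner_Integration.integrable_bound)
    have "norm (g x * f x) \<le> norm (B * (indicator ?C x *\<^sub>R g x))" for x
    proof (cases "f x = 0")
      case False
      then have "x \<in> ?C" using closure_subset[of "{x. f x \<noteq> 0}"] by auto
      then show ?thesis using B(2)[of x] B(1) by (simp add: abs_mult mult.commute mult_right_mono)
    qed simp
    then show "AE x in lborel. norm (g x * f x) \<le> norm (B * (indicator ?C x *\<^sub>R g x))" by simp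
  qed simp
qed

lemma test_function_closure:
  assumes p: "\<phi> \<in> test_functions S"
  shows "continuous_on UNIV \<phi>" "compact (closure {x. \<phi> x \<noteq> 0})" "closure {x. \<phi> x \<noteq> 0} \<subseteq> S"
    "continuous_on UNIV (\<lambda>x. partial_on UNIV v \<phi> x)"
    "compact (closure {x. partial_on UNIV v \<phi> x \<noteq> 0})" "closure {x. partial_on UNIV v \<phi> x \<noteq> 0} \<subseteq> S"
proof -
  have s: "smooth \<phi>" using test_functions_compact_smooth[OF p] by blast
  show 1: "continuous_on UNIV \<phi>" "continuous_on UNIV (\<lambda>x. partial_on UNIV v \<phi> x)"
    using smooth_continuous[OF s] smooth_continuous[OF smooth_partial[OF s]] by auto
  show 2: "compact (closure {x. \<phi> x \<noteq> 0})" "closure {x. \<phi> x \<noteq> 0} \<subseteq> S" using p by (auto simp: test_functions_def)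
  have 3: "closure {x. partial_on UNIV v \<phi> x \<noteq> 0} \<subseteq> closure {x. \<phi> x \<noteq> 0}"
    using partial_eq_0_off_support by (intro closure_minimal) blast+
  then show "closure {x. partial_on UNIV v \<phi> x \<noteq> 0} \<subseteq> S" using 2 by blast
  show "compact (closure {x. partial_on UNIV v \<phi> x \<noteq> 0})"
    using 3 2 by (metis closed_closure compact_Int_closed inf.absorb2)
qed

lemma Borel_weak_gradient_unique:
  fixes u :: "real^'n \<Rightarrow> real^'m"
  assumes S: "open S" and D: "Borel_weak_gradient S u D" and E: "Borel_weak_gradient S u E"
  shows "AE x in lborel. x \<in> S \<longrightarrow> D x = E x"
proof -
  have [measurable]: "D \<in> borel_measurable borel" "E \<in> borel_measurable borel" using D E by (auto simp: Borel_weak_gradient_def)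
  have "AE x in lborel. x \<in> S \<longrightarrow> D x $ \<alpha> $ i - E x $ \<alpha> $ i = 0" for \<alpha> i
  proof (rule fundamental_lemma[OF S])
    have lD: "pmass 1 K (\<lambda>x. D x $ \<alpha> $ i) < \<infinity>" "pmass 1 K (\<lambda>x. E x $ \<alpha> $ i) < \<infinity>" if "compact K" "K \<subseteq> S" for K
    proof -
      have DE: "pmass 1 K D < \<infinity>" "pmass 1 K E < \<infinity>" by (intro Borel_weak_gradientD[OF D] that, intro Borel_weak_gradientD[OF E] that)
      show "pmass 1 K (\<lambda>x. D x $ \<alpha> $ i) < \<infinity>" "pmass 1 K (\<lambda>x. E x $ \<alpha> $ i) < \<infinity>"
        by (rule pmass_1_vec_nth_finite[OF pmass_1_vec_nth_finite[OF DE(1)]],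
            rule pmass_1_vec_nth_finite[OF pmass_1_vec_nth_finite[OF DE(2)]])
    qed
    show "pmass 1 K (\<lambda>x. D x $ \<alpha> $ i - E x $ \<alpha> $ i) < \<infinity>" if K: "compact K" "K \<subseteq> S" for K
    proof -
      have "pmass 1 K (\<lambda>x. D x $ \<alpha> $ i + - (E x $ \<alpha> $ i)) \<le> ennreal (2 powr 1) * (pmass 1 K (\<lambda>x. D x $ \<alpha> $ i) + pmass 1 K (\<lambda>x. - (E x $ \<alpha> $ i)))"
        by (rule pmass_add_le) (use K in \<open>auto intro: borel_compact\<close>)
      also have "\<dots> < \<infinity>" using lD[OF K] by (simp add: pmass_minus ennreal_mult_less_top)
      finally show ?thesis by simp
    qed
    fix \<phi> :: "real^'n \<Rightarrow> real" assume p: "\<phi> \<in> test_functions S"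
    have "(LINT x|lborel. D x $ \<alpha> $ i * \<phi> x) = (LINT x|lborel. E x $ \<alpha> $ i * \<phi> x)"
    proof -
      have "(LINT x|lborel. u x $ \<alpha> * partial_on UNIV (axis i 1) \<phi> x) = - (LINT x|lborel. D x $ \<alpha> $ i * \<phi> x)"
        "(LINT x|lborel. u x $ \<alpha> * partial_on UNIV (axis i 1) \<phi> x) = - (LINT x|lborel. E x $ \<alpha> $ i * \<phi> x)"
        by (rule Borel_weak_gradientD(5)[OF D p], rule Borel_weak_gradientD(5)[OF E p])
      then show ?thesis by linarith
    qed
    moreover have "integrable lborel (\<lambda>x. D x $ \<alpha> $ i * \<phi> x)"
      by (rule integrable_test_function_mult[OF _ lD(1) test_function_closure(1-3)[OF p]]) measurable
    moreover have "integrable lborel (\<lambda>x. E x $ \<alpha> $ i * \<phi> x)"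
      by (rule integrable_test_function_mult[OF _ lD(2) test_function_closure(1-3)[OF p]]) measurable
    ultimately show "(LINT x|lborel. \<phi> x * (D x $ \<alpha> $ i - E x $ \<alpha> $ i)) = 0"
      by (simp add: algebra_simps)
  qed auto
  then have "AE x in lborel. \<forall>\<alpha>\<in>UNIV. \<forall>i\<in>UNIV. x \<in> S \<longrightarrow> D x $ \<alpha> $ i - E x $ \<alpha> $ i = 0"
    by (intro AE_finite_allI) simp_all
  then show ?thesis by (rule eventually_mono) (auto simp: vec_eq_iff)
qed

text \<open>The chosen representative in \<open>weak_gradient\<close> may be replaced by any weak gradient at hand.\<close>

lemma weak_gradient_eq_AE:
  fixes u :: "real^'n \<Rightarrow> real^'m"
  assumes S: "open S" and h: "has_weak_gradient S u D"
  shows "AE x in lborel. x \<in> S \<longrightarrow> weak_gradient S u x = D x"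
proof -
  have w: "has_weak_gradient S u (weak_gradient S u)" unfolding weak_gradient_def by (rule someI[of _ D]) (rule h)
  obtain u1 D1 where 1: "Borel_weak_gradient S u1 D1" "\<forall>x. x \<notin> S \<longrightarrow> u1 x = 0" "\<forall>x. x \<notin> S \<longrightarrow> D1 x = 0" "AE x in lborel. x \<in> S \<longrightarrow> u x = u1 x" "AE x in lborel. x \<in> S \<longrightarrow> D x = D1 x"
    by (rule has_weak_gradient_Borel_representatives[OF S h])
  obtain u2 D2 where 2: "Borel_weak_gradient S u2 D2" "\<forall>x. x \<notin> S \<longrightarrow> u2 x = 0" "\<forall>x. x \<notin> S \<longrightarrow> D2 x = 0" "AE x in lborel. x \<in> S \<longrightarrow> u x = u2 x" "AE x in lborel. x \<in> S \<longrightarrow> weak_gradient S u x = D2 x"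
    by (rule has_weak_gradient_Borel_representatives[OF S w])
  have m: "u1 \<in> borel_measurable borel" "D1 \<in> borel_measurable borel" "u2 \<in> borel_measurable borel" "D2 \<in> borel_measurable borel"
    using 1 2 by (auto simp: Borel_weak_gradient_def)
  have ae: "AE x in lborel. x \<in> S \<longrightarrow> u2 x = u1 x" using 1(4) 2(4) by eventually_elim auto
  have "has_weak_gradient S u2 D2" using has_weak_gradient_Borel_iff[OF m(3,4) borel_open[OF S]] 2(1) by simp
  then have "has_weak_gradient S u1 D2" by (intro has_weak_gradient_AE_imp[OF S ae]) auto
  then have "Borel_weak_gradient S u1 D2" using has_weak_gradient_Borel_iff[OF m(1,4) borel_open[OF S]] by simp
  from Borel_weak_gradient_unique[OF S 1(1) this] 1(5) 2(5) show ?thesis by eventually_elim auto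
qed

section \<open>Smooth approximation\<close>

lemma has_weak_gradient_subset:
  assumes h: "has_weak_gradient S u D" and T: "T \<subseteq> S" "open T" and S: "open S"
  shows "has_weak_gradient T u D"
proof -
  obtain u' D' where 1: "Borel_weak_gradient S u' D'" "\<forall>x. x \<notin> S \<longrightarrow> u' x = 0" "\<forall>x. x \<notin> S \<longrightarrow> D' x = 0"
    "AE x in lborel. x \<in> S \<longrightarrow> u x = u' x" "AE x in lborel. x \<in> S \<longrightarrow> D x = D' x"
    by (rule has_weak_gradient_Borel_representatives[OF S h])
  have m: "u' \<in> borel_measurable borel" "D' \<in> borel_measurable borel" using 1 by (auto simp: Borel_weak_gradient_def)
  have "Borel_weak_gradient T u' D'" using 1(1) T test_functions_mono[OF T(1)] unfolding Borel_weak_gradient_def by blast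
  then have "has_weak_gradient T u' D'" using has_weak_gradient_Borel_iff[OF m borel_open[OF T(2)]] by simp
  moreover have "AE x in lborel. x \<in> T \<longrightarrow> u' x = u x" using 1(4) by eventually_elim (use T in auto)
  moreover have "AE x in lborel. x \<in> T \<longrightarrow> D' x = D x" using 1(5) by eventually_elim (use T in auto)
  ultimately show ?thesis using has_weak_gradient_AE_imp[OF T(2)] by blast
qed

lemma Borel_weak_gradient_add:
  assumes u: "Borel_weak_gradient S u D" and v: "Borel_weak_gradient S v E"
  shows "Borel_weak_gradient S (\<lambda>x. u x + v x) (\<lambda>x. D x + E x)"
proof -
  have m [measurable]: "u \<in> borel_measurable borel" "D \<in> borel_measurable borel" "v \<in> borel_measurable borel" "E \<in> borel_measurable borel"
    using u v by (auto simp: Borel_weak_gradient_def)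
  have fin: "pmass 1 K u < \<infinity>" "pmass 1 K D < \<infinity>" "pmass 1 K v < \<infinity>" "pmass 1 K E < \<infinity>" if "compact K" "K \<subseteq> S" for K
    using Borel_weak_gradientD(3,4)[OF u that] Borel_weak_gradientD(3,4)[OF v that] by auto
  show ?thesis unfolding Borel_weak_gradient_def
  proof (intro conjI allI impI ballI)
    fix K assume K: "compact K \<and> K \<subseteq> S"
    have [measurable]: "K \<in> sets borel" using K by (auto intro: borel_compact)
    show "pmass 1 K (\<lambda>x. u x + v x) < \<infinity>" "pmass 1 K (\<lambda>x. D x + E x) < \<infinity>"
      using fin[of K] K
      by (auto intro!: le_less_trans[OF pmass_add_le] simp: ennreal_mult_less_top)
  next
    fix \<phi> :: "real^'a \<Rightarrow> real" and \<alpha> i assume p: "\<phi> \<in> test_functions S"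
    note tc = test_function_closure[OF p]
    have i: "integrable lborel (\<lambda>x. u x $ \<alpha> * partial_on UNIV (axis i 1) \<phi> x)" "integrable lborel (\<lambda>x. v x $ \<alpha> * partial_on UNIV (axis i 1) \<phi> x)"
      "integrable lborel (\<lambda>x. D x $ \<alpha> $ i * \<phi> x)" "integrable lborel (\<lambda>x. E x $ \<alpha> $ i * \<phi> x)"
      by (intro integrable_test_function_mult[OF _ _ tc(4-6)] integrable_test_function_mult[OF _ _ tc(1-3)] pmass_1_vec_nth_finite fin; measurable)+
    have e: "(LINT x|lborel. u x $ \<alpha> * partial_on UNIV (axis i 1) \<phi> x) = - (LINT x|lborel. D x $ \<alpha> $ i * \<phi> x)"
      "(LINT x|lborel. v x $ \<alpha> * partial_on UNIV (axis i 1) \<phi> x) = - (LINT x|lborel. E x $ \<alpha> $ i * \<phi> x)"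
      by (rule Borel_weak_gradientD(5)[OF u p], rule Borel_weak_gradientD(5)[OF v p])
    show "(LINT x|lborel. (u x + v x) $ \<alpha> * partial_on UNIV (axis i 1) \<phi> x) = - (LINT x|lborel. (D x + E x) $ \<alpha> $ i * \<phi> x)"
      using i e by (simp add: distrib_right)
  qed (use m in auto)
qed

definition gradient :: "(real^'n \<Rightarrow> real^'m) \<Rightarrow> real^'n \<Rightarrow> real^'n^'m" where
  "gradient \<psi> x = (\<chi> \<alpha> i. partial_on UNIV (axis i 1) \<psi> x $ \<alpha>)"

lemma gradient_nth: "smooth \<psi> \<Longrightarrow> gradient \<psi> x $ \<alpha> $ i = partial_on UNIV (axis i 1) (\<lambda>x. \<psi> x $ \<alpha>) x"
proof -
  assume s: "smooth \<psi>"
  have "((\<lambda>x. \<psi> x $ \<alpha>) has_derivative (\<lambda>b. partial_on UNIV b \<psi> x $ \<alpha>)) (at x)"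
    by (rule bounded_linear.has_derivative[OF bounded_linear_vec_nth smooth_has_derivative[OF s]])
  from partial_on_UNIV[OF this] show ?thesis by (simp add: gradient_def)
qed

lemma smooth_vec_nth: "smooth \<psi> \<Longrightarrow> smooth (\<lambda>x. \<psi> x $ \<alpha>)"
  using Ck_linear_compose[OF bounded_linear_vec_nth] by blast

lemma continuous_gradient: "smooth \<psi> \<Longrightarrow> continuous_on UNIV (gradient \<psi>)"
  unfolding gradient_def
  by (intro continuous_intros smooth_continuous smooth_partial)

lemma gradient_diff:
  assumes "smooth f" "smooth g" shows "gradient (\<lambda>x. f x - g x) x = gradient f x - gradient g x"
proof -
  have "partial_on UNIV v (\<lambda>x. f x - g x) x = partial_on UNIV v f x - partial_on UNIV v g x" for v
    by (rule partial_on_UNIV[OF has_derivative_diff[OF smooth_has_derivative[OF assms(1)] smooth_has_derivative[OF assms(2)]]])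
  then show ?thesis by (simp add: gradient_def vec_eq_iff)
qed

lemma gradient_add:
  assumes "smooth f" "smooth g" shows "gradient (\<lambda>x. f x + g x) x = gradient f x + gradient g x"
proof -
  have "partial_on UNIV v (\<lambda>x. f x + g x) x = partial_on UNIV v f x + partial_on UNIV v g x" for v
    by (rule partial_on_UNIV[OF has_derivative_add[OF smooth_has_derivative[OF assms(1)] smooth_has_derivative[OF assms(2)]]])
  then show ?thesis by (simp add: gradient_def vec_eq_iff)
qed

lemma gradient_scaleR:
  assumes "smooth f" shows "gradient (\<lambda>x. c *\<^sub>R f x) x = c *\<^sub>R gradient f x"
proof -
  have "partial_on UNIV v (\<lambda>x. c *\<^sub>R f x) x = c *\<^sub>R partial_on UNIV v f x" for v
    by (rule partial_on_UNIV[OF has_derivative_scaleR_right[OF smooth_has_derivative[OF assms(1)]]])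
  then show ?thesis by (simp add: gradient_def vec_eq_iff)
qed

lemma continuous_pmass_finite:
  fixes f :: "'a::euclidean_space \<Rightarrow> 'b::euclidean_space"
  assumes "continuous_on UNIV f" "bounded S" "p \<ge> 0"
  shows "pmass p S f < \<infinity>"
proof -
  let ?K = "closure S"
  have K: "compact ?K" using assms by (simp add: compact_closure)
  obtain B where B: "\<And>x. x \<in> ?K \<Longrightarrow> norm (f x) \<le> B"
    using compact_imp_bounded[OF compact_continuous_image[OF continuous_on_subset[OF assms(1)] K]] by (auto simp: bounded_iff)
  have "pmass p S f \<le> pmass p ?K f" by (rule pmass_mono_set[OF closure_subset])
  also have "\<dots> \<le> (\<integral>\<^sup>+x. ennreal (\<bar>B\<bar> powr p) * indicator ?K x \<partial>lborel)"
    unfolding pmass_def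
  proof (intro nn_integral_mono)
    fix x show "ennreal (norm (f x) powr p) * indicator ?K x \<le> ennreal (\<bar>B\<bar> powr p) * indicator ?K x"
      using B[of x] assms(3) by (auto simp: indicator_def intro!: ennreal_leI powr_mono2)
  qed
  also have "\<dots> = ennreal (\<bar>B\<bar> powr p) * emeasure lborel ?K" by (subst nn_integral_cmult_indicator) auto
  also have "\<dots> < \<infinity>" using emeasure_compact_finite[OF K] by (simp add: ennreal_mult_less_top)
  finally show ?thesis .
qed

text \<open>Integration by parts: the product with a test function has compact support, so its derivatives integrate to zero.\<close>

lemma smooth_Borel_weak_gradient:
  assumes s: "smooth \<psi>" shows "Borel_weak_gradient S \<psi> (gradient \<psi>)"
  unfolding Borel_weak_gradient_def
proof (intro conjI allI impI ballI)
  show "\<psi> \<in> borel_measurable borel" by (rule borel_measurable_smooth[OF s])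
  show "gradient \<psi> \<in> borel_measurable borel" by (rule borel_measurable_continuous_onI[OF continuous_gradient[OF s]])
  fix K :: "(real^'a) set" assume K: "compact K \<and> K \<subseteq> S"
  show "pmass 1 K \<psi> < \<infinity>" "pmass 1 K (gradient \<psi>) < \<infinity>"
  proof -
    have "bounded K" using K compact_imp_bounded by blast
    then show "pmass 1 K \<psi> < \<infinity>" "pmass 1 K (gradient \<psi>) < \<infinity>"
      using continuous_pmass_finite[OF smooth_continuous[OF s], of K 1]
        continuous_pmass_finite[OF continuous_gradient[OF s], of K 1] by auto
  qed
next
  fix \<phi> :: "real^'a \<Rightarrow> real" and \<alpha> :: 'b and i assume p: "\<phi> \<in> test_functions S"
  have sp: "compact_smooth \<phi>" by (rule test_functions_compact_smooth[OF p])
  note sa = smooth_vec_nth[OF s, of \<alpha>]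
  let ?e = "axis i 1 :: real^'a"
  have b1: "bounded {x. \<psi> x $ \<alpha> * \<phi> x \<noteq> 0}" using sp by (rule_tac bounded_subset[of "{x. \<phi> x \<noteq> 0}"]) auto
  have prod: "compact_smooth (\<lambda>x. \<psi> x $ \<alpha> * \<phi> x)"
    using b1 Ck_mult sa sp by blast
  have der: "partial_on UNIV ?e (\<lambda>x. \<psi> x $ \<alpha> * \<phi> x) x = \<psi> x $ \<alpha> * partial_on UNIV ?e \<phi> x + gradient \<psi> x $ \<alpha> $ i * \<phi> x" for x
    unfolding gradient_nth[OF s]
    using partial_on_UNIV[OF has_derivative_mult[OF smooth_has_derivative[OF sa] smooth_has_derivative[of \<phi>]], of ?e x] sp by blast
  have c: "continuous_on UNIV (\<lambda>x. \<psi> x $ \<alpha>)" "continuous_on UNIV (\<lambda>x. gradient \<psi> x $ \<alpha> $ i)"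
    using smooth_continuous[OF sa] continuous_gradient[OF s] by (auto intro!: continuous_intros)
  note tc = test_function_closure[OF p]
  have i: "integrable lborel (\<lambda>x. \<psi> x $ \<alpha> * partial_on UNIV ?e \<phi> x)" "integrable lborel (\<lambda>x. gradient \<psi> x $ \<alpha> $ i * \<phi> x)"
    by (intro integrable_test_function_mult[OF _ _ tc(4-6)] integrable_test_function_mult[OF _ _ tc(1-3)]
        continuous_pmass_finite[OF c(1)] continuous_pmass_finite[OF c(2)] borel_measurable_continuous_onI c compact_imp_bounded; simp)+
  from integral_partial_compact_smooth_eq_0[OF prod, of ?e]
  have "(LINT x|lborel. \<psi> x $ \<alpha> * partial_on UNIV ?e \<phi> x) + (LINT x|lborel. gradient \<psi> x $ \<alpha> $ i * \<phi> x) = 0"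
    unfolding der using i by simp
  then show "(LINT x|lborel. \<psi> x $ \<alpha> * partial_on UNIV ?e \<phi> x) = - (LINT x|lborel. gradient \<psi> x $ \<alpha> $ i * \<phi> x)" by simp
qed

text \<open>Approximation in two exponents at once: the exponent 1 passes weak derivatives to the limit, and
  the exponent \<open>p\<close> is the one in the Sobolev norm.\<close>

definition approximated :: "real \<Rightarrow> (real^'n) set \<Rightarrow> (real^'n \<Rightarrow> real^'m) set \<Rightarrow> (real^'n \<Rightarrow> real^'m) \<Rightarrow> (real^'n \<Rightarrow> real^'n^'m) \<Rightarrow> bool" where
  "approximated p S \<Psi> u D \<longleftrightarrow> (\<forall>e>0. \<exists>\<psi>\<in>\<Psi>. \<forall>r\<in>{1,p}. pmass r S (\<lambda>x. u x - \<psi> x) \<le> ennreal e \<and> pmass r S (\<lambda>x. D x - gradient \<psi> x) \<le> ennreal e)"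

lemma approximatedE:
  assumes "approximated p S \<Psi> u D" "e > 0"
  obtains \<psi> where "\<psi> \<in> \<Psi>" "\<forall>r\<in>{1,p}. pmass r S (\<lambda>x. u x - \<psi> x) \<le> ennreal e"
    "\<forall>r\<in>{1,p}. pmass r S (\<lambda>x. D x - gradient \<psi> x) \<le> ennreal e"
  using assms(1)[unfolded approximated_def, rule_format, OF assms(2)] by (elim bexE) auto

lemma approximatedI:
  assumes "\<And>e. e > 0 \<Longrightarrow> \<exists>\<psi>\<in>\<Psi>. \<forall>r\<in>{1,p}. pmass r S (\<lambda>x. u x - \<psi> x) \<le> ennreal e \<and> pmass r S (\<lambda>x. D x - gradient \<psi> x) \<le> ennreal e"
  shows "approximated p S \<Psi> u D"
  unfolding approximated_def by (intro allI impI) (rule assms)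

lemma approximated_mono:
  assumes "approximated p S \<Psi> u D" "\<Psi> \<subseteq> \<Psi>'" shows "approximated p S \<Psi>' u D"
proof (rule approximatedI)
  fix e :: real assume e: "e > 0"
  obtain \<psi> where "\<psi> \<in> \<Psi>" "\<forall>r\<in>{1,p}. pmass r S (\<lambda>x. u x - \<psi> x) \<le> ennreal e"
    "\<forall>r\<in>{1,p}. pmass r S (\<lambda>x. D x - gradient \<psi> x) \<le> ennreal e"
    by (rule approximatedE[OF assms(1) e])
  then show "\<exists>\<psi>\<in>\<Psi>'. \<forall>r\<in>{1,p}. pmass r S (\<lambda>x. u x - \<psi> x) \<le> ennreal e \<and> pmass r S (\<lambda>x. D x - gradient \<psi> x) \<le> ennreal e"
    using assms(2) by (intro bexI[of _ \<psi>] ballI conjI) auto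
qed

lemma integral_diff_le_pmass:
  fixes g h f :: "'a::euclidean_space \<Rightarrow> real"
  assumes [measurable]: "g \<in> borel_measurable borel" "h \<in> borel_measurable borel" "S \<in> sets borel"
    and f: "continuous_on UNIV f" "\<And>x. x \<notin> S \<Longrightarrow> f x = 0" "\<And>x. norm (f x) \<le> B"
    and i: "integrable lborel (\<lambda>x. g x * f x)" "integrable lborel (\<lambda>x. h x * f x)"
    and e: "pmass 1 S (\<lambda>x. g x - h x) \<le> ennreal e" "e \<ge> 0"
  shows "\<bar>(LINT x|lborel. g x * f x) - (LINT x|lborel. h x * f x)\<bar> \<le> B * e"
proof -
  have [measurable]: "f \<in> borel_measurable borel" by (rule borel_measurable_continuous_onI[OF f(1)])
  have B: "B \<ge> 0" using f(3) norm_ge_zero order_trans by blast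
  have "\<bar>(LINT x|lborel. g x * f x) - (LINT x|lborel. h x * f x)\<bar> = norm (LINT x|lborel. g x * f x - h x * f x)"
    using i by simp
  also have "ennreal \<dots> \<le> (\<integral>\<^sup>+x. ennreal (norm (g x * f x - h x * f x)) \<partial>lborel)"
    by (rule integral_norm_bound_ennreal) (use i in auto)
  also have "\<dots> \<le> (\<integral>\<^sup>+x. ennreal B * (ennreal (norm (g x - h x) powr 1) * indicator S x) \<partial>lborel)"
  proof (intro nn_integral_mono)
    fix x
    have "norm (g x * f x - h x * f x) = \<bar>g x - h x\<bar> * norm (f x)" by (simp add: abs_mult flip: left_diff_distrib)
    also have "\<dots> \<le> B * norm (g x - h x)"
      using mult_left_mono[OF f(3)[of x], of "\<bar>g x - h x\<bar>"] by (simp add: mult.commute)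
    finally have "norm (g x * f x - h x * f x) \<le> B * norm (g x - h x)" .
    then show "ennreal (norm (g x * f x - h x * f x)) \<le> ennreal B * (ennreal (norm (g x - h x) powr 1) * indicator S x)"
      using f(2)[of x] B by (cases "x \<in> S") (auto simp: ennreal_mult[symmetric] intro!: ennreal_leI)
  qed
  also have "\<dots> = ennreal B * pmass 1 S (\<lambda>x. g x - h x)" unfolding pmass_def by (rule nn_integral_cmult) measurable
  also have "\<dots> \<le> ennreal B * ennreal e" by (intro mult_left_mono e) simp
  also have "\<dots> = ennreal (B * e)" using B e by (simp add: ennreal_mult)
  finally show ?thesis using B e by (simp add: ennreal_le_iff)
qed

lemma pmass_1_vec_nth_le:
  fixes g :: "'a::euclidean_space \<Rightarrow> ('b::euclidean_space)^'m"
  shows "pmass 1 K (\<lambda>x. g x $ \<alpha>) \<le> pmass 1 K g"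
  by (rule pmass_mono) (auto intro: Finite_Cartesian_Product.norm_nth_le)

text \<open>Both sides of the integration by parts formula are continuous in \<open>L\<^sup>1\<close> because test functions and their derivatives
  are bounded.\<close>

lemma approximated_Borel_weak_gradient:
  fixes u :: "real^'n \<Rightarrow> real^'m"
  assumes [measurable]: "u \<in> borel_measurable borel" "D \<in> borel_measurable borel" and S: "open S"
    and fin: "pmass 1 S u < \<infinity>" "pmass 1 S D < \<infinity>"
    and app: "approximated p S {\<psi>. smooth \<psi>} u D"
  shows "Borel_weak_gradient S u D"
  unfolding Borel_weak_gradient_def
proof (intro conjI allI impI ballI)
  fix K :: "(real^'n) set" assume K: "compact K \<and> K \<subseteq> S"
  show "pmass 1 K u < \<infinity>" "pmass 1 K D < \<infinity>" using K fin pmass_mono_set[of K S] le_less_trans by blast+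
next
  fix \<phi> :: "real^'n \<Rightarrow> real" and \<alpha> :: 'm and i assume p: "\<phi> \<in> test_functions S"
  have [measurable]: "S \<in> sets borel" using S by auto
  let ?e = "axis i 1 :: real^'n"
  note tc = test_function_closure[OF p]
  note cs = compact_smooth_partial[OF test_functions_compact_smooth[OF p], of ?e]
  obtain B1 where B1: "B1 > 0" "\<And>x. norm (\<phi> x) \<le> B1"
    using compact_support_bounded[OF tc(1)] test_functions_compact_smooth[OF p] by blast
  obtain B2 where B2: "B2 > 0" "\<And>x. norm (partial_on UNIV ?e \<phi> x) \<le> B2"
    using compact_support_bounded[OF tc(4)] cs by blast
  define J where "J = (LINT x|lborel. u x $ \<alpha> * partial_on UNIV ?e \<phi> x) + (LINT x|lborel. D x $ \<alpha> $ i * \<phi> x)"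
  have fK: "pmass 1 K (\<lambda>x. u x $ \<alpha>) < \<infinity>" "pmass 1 K (\<lambda>x. D x $ \<alpha> $ i) < \<infinity>" if "compact K" "K \<subseteq> S" for K
    using fin pmass_mono_set[OF that(2)] le_less_trans by (intro pmass_1_vec_nth_finite; blast)+
  have iu: "integrable lborel (\<lambda>x. u x $ \<alpha> * partial_on UNIV ?e \<phi> x)" "integrable lborel (\<lambda>x. D x $ \<alpha> $ i * \<phi> x)"
    by (rule integrable_test_function_mult[OF _ _ tc(4-6)]; (rule fK)?; measurable)
      (rule integrable_test_function_mult[OF _ _ tc(1-3)]; (rule fK)?; measurable)
  have "\<bar>J\<bar> \<le> (B1 + B2) * e" if e: "e > 0" for e
  proof -
    obtain \<psi> where s: "\<psi> \<in> {\<psi>. smooth \<psi>}" and a': "\<forall>r\<in>{1,p}. pmass r S (\<lambda>x. u x - \<psi> x) \<le> ennreal e"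
      "\<forall>r\<in>{1,p}. pmass r S (\<lambda>x. D x - gradient \<psi> x) \<le> ennreal e"
      by (rule approximatedE[OF app e])
    have s: "smooth \<psi>" using s by simp
    have a: "pmass 1 S (\<lambda>x. u x - \<psi> x) \<le> ennreal e" "pmass 1 S (\<lambda>x. D x - gradient \<psi> x) \<le> ennreal e"
      using a' by auto
    have w: "Borel_weak_gradient S \<psi> (gradient \<psi>)" by (rule smooth_Borel_weak_gradient[OF s])
    note m [measurable] = Borel_weak_gradientD(1,2)[OF w]
    note fK' = Borel_weak_gradientD(3,4)[OF w]
    note eq = Borel_weak_gradientD(5)[OF w p, of \<alpha> i]
    have ip: "integrable lborel (\<lambda>x. \<psi> x $ \<alpha> * partial_on UNIV ?e \<phi> x)" "integrable lborel (\<lambda>x. gradient \<psi> x $ \<alpha> $ i * \<phi> x)"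
      by (rule integrable_test_function_mult[OF _ pmass_1_vec_nth_finite[OF fK'(1)] tc(4-6)], measurable)
        (rule integrable_test_function_mult[OF _ pmass_1_vec_nth_finite[OF pmass_1_vec_nth_finite[OF fK'(2)]] tc(1-3)], measurable)
    have a1: "pmass 1 S (\<lambda>x. u x $ \<alpha> - \<psi> x $ \<alpha>) \<le> ennreal e"
      using pmass_1_vec_nth_le[of S "\<lambda>x. u x - \<psi> x" \<alpha>] a(1) by simp
    have a2: "pmass 1 S (\<lambda>x. D x $ \<alpha> $ i - gradient \<psi> x $ \<alpha> $ i) \<le> ennreal e"
      using pmass_1_vec_nth_le[of S "\<lambda>x. D x - gradient \<psi> x" \<alpha>] pmass_1_vec_nth_le[of S "\<lambda>x. (D x - gradient \<psi> x) $ \<alpha>" i] a(2) by simp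
    have "\<bar>(LINT x|lborel. u x $ \<alpha> * partial_on UNIV ?e \<phi> x) - (LINT x|lborel. \<psi> x $ \<alpha> * partial_on UNIV ?e \<phi> x)\<bar> \<le> B2 * e"
      by (rule integral_diff_le_pmass[where S=S]) (use iu ip a1 B2 e tc test_function_zero_off[OF p] in auto)
    moreover have "\<bar>(LINT x|lborel. D x $ \<alpha> $ i * \<phi> x) - (LINT x|lborel. gradient \<psi> x $ \<alpha> $ i * \<phi> x)\<bar> \<le> B1 * e"
      by (rule integral_diff_le_pmass[where S=S]) (use iu ip a2 B1 e tc test_function_zero_off[OF p] in auto)
    ultimately show ?thesis using eq unfolding J_def by (simp add: algebra_simps)
  qed
  note small = this
  have "J = 0"
  proof (rule ccontr)
    assume "J \<noteq> 0"
    then have "\<bar>J\<bar> / (2 * (B1 + B2)) > 0" using B1 B2 by simp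
    have "c * (a / (2 * c)) = a / 2" if "c > 0" for a c :: real using that by simp
    from small[OF \<open>\<bar>J\<bar> / (2 * (B1 + B2)) > 0\<close>] this[of "B1 + B2" "\<bar>J\<bar>"] have "\<bar>J\<bar> \<le> \<bar>J\<bar> / 2" using B1 B2 by linarith
    then show False using \<open>J \<noteq> 0\<close> by simp
  qed
  then show "(LINT x|lborel. u x $ \<alpha> * partial_on UNIV ?e \<phi> x) = - (LINT x|lborel. D x $ \<alpha> $ i * \<phi> x)" by (simp add: J_def)
qed auto

lemma test_functions_smooth: "\<psi> \<in> test_functions S \<Longrightarrow> smooth \<psi>"
  by (simp add: test_functions_def)

lemma set_integral_eq_pmass:
  fixes f :: "'a::euclidean_space \<Rightarrow> 'b::euclidean_space"
  assumes [measurable]: "f \<in> borel_measurable borel" "S \<in> sets borel"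
  shows "(LINT x:S|lebesgue. norm (f x) powr p) = enn2real (pmass p S f)"
proof -
  have "(LINT x:S|lebesgue. norm (f x) powr p) = (LINT x|lborel. indicator S x * norm (f x) powr p)"
    by (subst set_integral_lebesgue_lborel) (auto simp: set_lebesgue_integral_def)
  also have "\<dots> = enn2real (\<integral>\<^sup>+x. ennreal (indicator S x * norm (f x) powr p) \<partial>lborel)"
    by (rule integral_eq_nn_integral) auto
  also have "(\<integral>\<^sup>+x. ennreal (indicator S x * norm (f x) powr p) \<partial>lborel) = pmass p S f"
    unfolding pmass_def by (intro nn_integral_cong) (auto simp: indicator_def)
  finally show ?thesis .
qed

text \<open>The approximating functions are smooth, so their difference from \<open>w\<close> has a known weak gradient; by uniqueness the
  Sobolev norm, which is defined by a chosen weak gradient, can be computed from it.\<close>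

lemma approximated_W1p_0:
  fixes w :: "real^'n \<Rightarrow> real^'m"
  assumes [measurable]: "w \<in> borel_measurable borel" "W \<in> borel_measurable borel" and S: "open S" and p: "p \<ge> 1"
    and fin: "\<And>r. r \<in> {1,p} \<Longrightarrow> pmass r S w < \<infinity>" "\<And>r. r \<in> {1,p} \<Longrightarrow> pmass r S W < \<infinity>"
    and app: "approximated p S (test_functions S) w W"
  shows "Borel_weak_gradient S w W" "w \<in> W1p_0 p S"
proof -
  have [measurable]: "S \<in> sets borel" using S by auto
  have "approximated p S {\<psi>. smooth \<psi>} w W"
    by (rule approximated_mono[OF app]) (auto simp: test_functions_def)
  then show B: "Borel_weak_gradient S w W"
    using fin S by (intro approximated_Borel_weak_gradient) auto
  then have "has_weak_gradient S w W" by (subst has_weak_gradient_Borel_iff) auto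
  then have W: "w \<in> W1p p S" using fin unfolding W1p_def by (auto simp: Lp_Borel_iff)
  have "\<exists>\<psi>\<in>test_functions S. W1p_norm p S (\<lambda>x. w x - \<psi> x) < e" if e: "e > 0" for e
  proof -
    \<comment> \<open>Two integrals of size at most \<open>e1\<close> make \<open>(2 * e1) powr (1/p) < e\<close>.\<close>
    define e1 where "e1 = e powr p / 4"
    have e1: "e1 > 0" using e by (simp add: e1_def)
    obtain \<psi> where t: "\<psi> \<in> test_functions S" and a': "\<forall>r\<in>{1,p}. pmass r S (\<lambda>x. w x - \<psi> x) \<le> ennreal e1"
      "\<forall>r\<in>{1,p}. pmass r S (\<lambda>x. W x - gradient \<psi> x) \<le> ennreal e1"
      by (rule approximatedE[OF app e1])
    have a: "pmass p S (\<lambda>x. w x - \<psi> x) \<le> ennreal e1" "pmass p S (\<lambda>x. W x - gradient \<psi> x) \<le> ennreal e1"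
      using a' by auto
    have s: "smooth \<psi>" by (rule test_functions_smooth[OF t])
    have [measurable]: "\<psi> \<in> borel_measurable borel" "gradient \<psi> \<in> borel_measurable borel"
      by (rule borel_measurable_smooth[OF s], rule borel_measurable_continuous_onI[OF continuous_gradient[OF s]])
    have sm: "smooth (\<lambda>x. - \<psi> x)" using Ck_linear_compose[OF bounded_linear_minus[OF bounded_linear_ident]] s by blast
    have "gradient (\<lambda>x. - \<psi> x) x = - gradient \<psi> x" for x using gradient_scaleR[OF s, of "-1" x] by simp
    then have "gradient (\<lambda>x. - \<psi> x) = (\<lambda>x. - gradient \<psi> x)" by blast
    then have "Borel_weak_gradient S (\<lambda>x. - \<psi> x) (\<lambda>x. - gradient \<psi> x)"
      using smooth_Borel_weak_gradient[OF sm, of S] by argo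
    from Borel_weak_gradient_add[OF B this] have "has_weak_gradient S (\<lambda>x. w x - \<psi> x) (\<lambda>x. W x - gradient \<psi> x)"
      by (subst has_weak_gradient_Borel_iff) auto
    from weak_gradient_eq_AE[OF S this]
    have ae: "AE x in lborel. x \<in> S \<longrightarrow> W x - gradient \<psi> x = weak_gradient S (\<lambda>x. w x - \<psi> x) x"
      by (rule eventually_mono) simp
    have "(LINT x:S|lebesgue. norm (weak_gradient S (\<lambda>x. w x - \<psi> x) x) powr p) = (LINT x:S|lebesgue. norm (W x - gradient \<psi> x) powr p)"
    proof (rule set_integral_AE_cong[symmetric])
      show "AE x in lborel. x \<in> S \<longrightarrow> norm (W x - gradient \<psi> x) powr p = norm (weak_gradient S (\<lambda>x. w x - \<psi> x) x) powr p"
        using ae by (rule eventually_mono) simp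
      have "(\<lambda>x. indicator S x *\<^sub>R norm (W x - gradient \<psi> x) powr p) \<in> borel_measurable borel" by measurable
      then show "set_borel_measurable lebesgue S (\<lambda>x. norm (W x - gradient \<psi> x) powr p)"
        unfolding set_borel_measurable_def by (intro measurable_completion) simp
    qed
    also have "\<dots> = enn2real (pmass p S (\<lambda>x. W x - gradient \<psi> x))" by (rule set_integral_eq_pmass) measurable
    also have "\<dots> \<le> e1" using a(2) e1 by (metis enn2real_leI less_imp_le)
    finally have 1: "(LINT x:S|lebesgue. norm (weak_gradient S (\<lambda>x. w x - \<psi> x) x) powr p) \<le> e1" .
    have "(LINT x:S|lebesgue. norm (w x - \<psi> x) powr p) = enn2real (pmass p S (\<lambda>x. w x - \<psi> x))" by (rule set_integral_eq_pmass) measurable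
    also have "\<dots> \<le> e1" using a(1) e1 by (metis enn2real_leI less_imp_le)
    finally have 2: "(LINT x:S|lebesgue. norm (w x - \<psi> x) powr p) \<le> e1" .
    have nn: "0 \<le> (LINT x:S|lebesgue. norm (f x) powr p)" for f :: "real^'n \<Rightarrow> 'z::real_normed_vector"
      unfolding set_lebesgue_integral_def by (intro integral_nonneg_AE) auto
    have "W1p_norm p S (\<lambda>x. w x - \<psi> x) \<le> (2 * e1) powr (1/p)"
      unfolding W1p_norm_def using 1 2 p by (intro powr_mono2 add_nonneg_nonneg nn) auto
    also have "\<dots> < (e powr p) powr (1/p)"
      using e1 e p by (intro powr_less_mono2) (auto simp: e1_def)
    also have "\<dots> = e" using e p by (simp add: powr_powr)
    finally show ?thesis using t by blast
  qed
  then show "w \<in> W1p_0 p S" using W by (auto simp: W1p_0_def)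
qed

text \<open>Mollifications of \<open>u\<close> approximate \<open>u\<close>. At points that are farther from the boundary of \<open>\<Omega>\<close> than the mollification radius,
  the classical gradient of the mollification is the mollification of the weak gradient \<open>D\<close>, so it approximates \<open>D\<close>.\<close>

lemma local_smooth_approximation:
  fixes u :: "real^'n \<Rightarrow> real^'m"
  assumes w: "Borel_weak_gradient \<Omega> u D" and off: "\<And>x. x \<notin> \<Omega> \<Longrightarrow> u x = 0" "\<And>x. x \<notin> \<Omega> \<Longrightarrow> D x = 0"
    and fin: "\<And>r. r \<in> {1,p} \<Longrightarrow> pmass r \<Omega> u < \<infinity>" "\<And>r. r \<in> {1,p} \<Longrightarrow> pmass r \<Omega> D < \<infinity>"
    and O: "open \<Omega>" and p: "p \<ge> 1" and S: "compact (closure S)" "closure S \<subseteq> \<Omega>"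
  shows "approximated p S {\<psi>. smooth \<psi>} u D"
  unfolding approximated_def
proof (intro allI impI)
  fix e :: real assume e: "e > 0"
  have m [measurable]: "u \<in> borel_measurable borel" "D \<in> borel_measurable borel" using w by (auto simp: Borel_weak_gradient_def)
  have U: "pmass r UNIV u = pmass r \<Omega> u" "pmass r UNIV D = pmass r \<Omega> D" for r
    unfolding pmass_def using off by (auto intro!: nn_integral_cong simp: indicator_def)
  have fin': "pmass r UNIV u < \<infinity>" "pmass r UNIV D < \<infinity>" if "r \<in> {1,p}" for r using fin[OF that] by (simp_all add: U)
  have i: "integrable lborel u" "integrable lborel D"
    using pmass_1_integrable[of u UNIV] pmass_1_integrable[of D UNIV] fin'[of 1] m by (auto simp: set_integrable_def)
  have ex: "\<exists>d0>0. \<forall>d \<eta>. d \<le> d0 \<longrightarrow> mollifier d \<eta> \<longrightarrow> pmass r UNIV (\<lambda>x. convolve \<eta> u x - u x) \<le> ennreal e \<and> pmass r UNIV (\<lambda>x. convolve \<eta> D x - D x) \<le> ennreal e" if r: "r \<in> {1,p}" for r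
  proof -
    have r1: "r \<ge> 1" using r p by auto
    obtain d1 where d1: "d1 > 0" "\<And>d \<eta>. d \<le> d1 \<Longrightarrow> mollifier d \<eta> \<Longrightarrow> pmass r UNIV (\<lambda>x. convolve \<eta> u x - u x) \<le> ennreal e"
      using mollification_tendsto[OF i(1) fin'(1)[OF r] r1 e] by blast
    obtain d2 where d2: "d2 > 0" "\<And>d \<eta>. d \<le> d2 \<Longrightarrow> mollifier d \<eta> \<Longrightarrow> pmass r UNIV (\<lambda>x. convolve \<eta> D x - D x) \<le> ennreal e"
      using mollification_tendsto[OF i(2) fin'(2)[OF r] r1 e] by blast
    show ?thesis using d1 d2 by (intro exI[of _ "min d1 d2"]) auto
  qed
  obtain d1 where d1: "d1 > 0" "\<And>d \<eta>. d \<le> d1 \<Longrightarrow> mollifier d \<eta> \<Longrightarrow> pmass 1 UNIV (\<lambda>x. convolve \<eta> u x - u x) \<le> ennreal e \<and> pmass 1 UNIV (\<lambda>x. convolve \<eta> D x - D x) \<le> ennreal e"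
    using ex[of 1] by auto
  obtain d2 where d2: "d2 > 0" "\<And>d \<eta>. d \<le> d2 \<Longrightarrow> mollifier d \<eta> \<Longrightarrow> pmass p UNIV (\<lambda>x. convolve \<eta> u x - u x) \<le> ennreal e \<and> pmass p UNIV (\<lambda>x. convolve \<eta> D x - D x) \<le> ennreal e"
    using ex[of p] by auto
  obtain d3 where d3: "d3 > 0" "\<And>x y. x \<in> closure S \<Longrightarrow> y \<in> - \<Omega> \<Longrightarrow> d3 \<le> dist x y"
    using compact_open_separation[OF S(1) O S(2)] by blast
  define d where "d = min (min d1 d2) (d3/2)"
  have d: "d > 0" "d \<le> d1" "d \<le> d2" "d < d3" using d1 d2 d3 by (auto simp: d_def)
  obtain \<eta> :: "real^'n \<Rightarrow> real" where m: "mollifier d \<eta>" using exists_mollifier[OF d(1)] by blast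
  note cs = mollifier_compact_smooth[OF m]
  let ?\<psi> = "convolve \<eta> u"
  have s: "smooth ?\<psi>" by (rule smooth_convolve[OF cs i(1)])
  have g: "gradient ?\<psi> x = convolve \<eta> D x" if x: "x \<in> S" for x
  proof -
    have "gradient ?\<psi> x $ \<alpha> $ k = convolve \<eta> D x $ \<alpha> $ k" for \<alpha> k
    proof -
      let ?e = "axis k 1 :: real^'n"
      have cb: "cball x d \<subseteq> \<Omega>"
      proof
        fix y assume y: "y \<in> cball x d"
        show "y \<in> \<Omega>"
        proof (rule ccontr)
          assume "y \<notin> \<Omega>"
          moreover have "x \<in> closure S" using x closure_subset[of S] by auto
          ultimately have "d3 \<le> dist x y" using d3(2) by blast
          then show False using y d by simp
        qed
      qed
      note rt = reflected_test_function[OF m cb]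
      have iD: "integrable lborel (\<lambda>y. D y $ \<alpha>)" using integrable_bounded_linear[OF bounded_linear_vec_nth i(2)] .
      have "gradient ?\<psi> x $ \<alpha> $ k = convolve (partial_on UNIV ?e \<eta>) u x $ \<alpha>"
        by (simp add: gradient_def convolve_partial[OF cs i(1)])
      also have "\<dots> = convolve (partial_on UNIV ?e \<eta>) (\<lambda>y. u y $ \<alpha>) x"
        by (rule convolve_vec_nth[OF compact_smooth_partial[OF cs] i(1)])
      also have "\<dots> = - (LINT y|lborel. u y $ \<alpha> * partial_on UNIV ?e (\<lambda>y. \<eta> (x - y)) y)"
        unfolding rt(2) convolve_def by (simp add: mult.commute)
      also have "\<dots> = (LINT y|lborel. D y $ \<alpha> $ k * \<eta> (x - y))"
        using Borel_weak_gradientD(5)[OF w rt(1), of \<alpha> k] by simp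
      also have "\<dots> = convolve \<eta> (\<lambda>y. D y $ \<alpha> $ k) x" unfolding convolve_def by (simp add: mult.commute)
      also have "\<dots> = convolve \<eta> (\<lambda>y. D y $ \<alpha>) x $ k" by (rule convolve_vec_nth[OF cs iD, symmetric])
      also have "convolve \<eta> (\<lambda>y. D y $ \<alpha>) x = convolve \<eta> D x $ \<alpha>" by (rule convolve_vec_nth[OF cs i(2), symmetric])
      finally show ?thesis .
    qed
    then show ?thesis by (simp add: vec_eq_iff)
  qed
  have "pmass r S (\<lambda>x. u x - ?\<psi> x) \<le> ennreal e \<and> pmass r S (\<lambda>x. D x - gradient ?\<psi> x) \<le> ennreal e" if r: "r \<in> {1,p}" for r
  proof
    have *: "pmass r UNIV (\<lambda>x. ?\<psi> x - u x) \<le> ennreal e" "pmass r UNIV (\<lambda>x. convolve \<eta> D x - D x) \<le> ennreal e"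
      using d1(2)[OF d(2) m] d2(2)[OF d(3) m] r by auto
    show "pmass r S (\<lambda>x. u x - ?\<psi> x) \<le> ennreal e"
      using *(1) pmass_mono_set[of S UNIV r "\<lambda>x. ?\<psi> x - u x"] by (simp add: pmass_diff_commute[of r S u])
    have "pmass r S (\<lambda>x. D x - gradient ?\<psi> x) = pmass r S (\<lambda>x. convolve \<eta> D x - D x)"
      unfolding pmass_diff_commute[of r S D] by (rule pmass_cong_AE) (simp add: g)
    then show "pmass r S (\<lambda>x. D x - gradient ?\<psi> x) \<le> ennreal e"
      using *(2) pmass_mono_set[of S UNIV r "\<lambda>x. convolve \<eta> D x - D x"] by simp
  qed
  then show "\<exists>\<psi>\<in>{\<psi>. smooth \<psi>}. \<forall>r\<in>{1,p}. pmass r S (\<lambda>x. u x - \<psi> x) \<le> ennreal e \<and> pmass r S (\<lambda>x. D x - gradient \<psi> x) \<le> ennreal e"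
    using s by blast
qed

section \<open>Localised translations\<close>

lemma Ck_inverse:
  fixes f :: "'a::euclidean_space \<Rightarrow> real"
  assumes "Ck_on k UNIV f" "\<And>x. f x \<noteq> 0" shows "Ck_on k UNIV (\<lambda>x. inverse (f x))"
  using assms(1)
proof (induction k)
  case 0
  then show ?case using assms(2) by (auto intro!: continuous_intros)
next
  case (Suc k)
  note I = Suc.IH[OF Ck_Suc_imp_Ck[OF Suc.prems]]
  show ?case
  proof (rule Ck_SucI[where f'="\<lambda>x b. - (inverse (f x) * partial_on UNIV b f x * inverse (f x))"])
    show "((\<lambda>x. inverse (f x)) has_derivative (\<lambda>b. - (inverse (f x) * partial_on UNIV b f x * inverse (f x)))) (at x)" for x
      by (rule Deriv.has_derivative_inverse[OF assms(2) Ck_SucD(1)[OF Suc.prems]])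
    fix b :: 'a assume b: "b \<in> Basis"
    show "Ck_on k UNIV (\<lambda>x. - (inverse (f x) * partial_on UNIV b f x * inverse (f x)))"
      by (rule Ck_linear_compose[OF bounded_linear_minus[OF bounded_linear_ident] Ck_mult[OF Ck_mult[OF I Ck_SucD(2)[OF Suc.prems b]] I]])
  qed
qed

definition grad :: "(real^'n \<Rightarrow> real) \<Rightarrow> real^'n \<Rightarrow> real^'n" where
  "grad \<zeta> y = (\<chi> i. partial_on UNIV (axis i 1) \<zeta> y)"

lemma partial_axis_sum:
  fixes f :: "real^'n \<Rightarrow> 'b::real_normed_vector"
  assumes s: "smooth f"
  shows "partial_on UNIV v f y = (\<Sum>i\<in>UNIV. (v $ i) *\<^sub>R partial_on UNIV (axis i 1) f y)"
proof -
  note l = smooth_partial_linear[OF s, of y]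
  have v: "v = (\<Sum>i\<in>UNIV. (v $ i) *\<^sub>R axis i 1)"
    using basis_expansion[of v] by (simp add: scalar_mult_eq_scaleR)
  have "partial_on UNIV v f y = partial_on UNIV (\<Sum>i\<in>UNIV. (v $ i) *\<^sub>R axis i 1) f y" using v by simp
  also have "\<dots> = (\<Sum>i\<in>UNIV. partial_on UNIV ((v $ i) *\<^sub>R axis i 1) f y)" by (rule linear_sum[OF l])
  finally show ?thesis by (simp add: linear_scale[OF l])
qed

lemma partial_eq_inner_grad: "smooth \<zeta> \<Longrightarrow> partial_on UNIV v \<zeta> y = v \<bullet> grad \<zeta> y"
  by (subst partial_axis_sum) (simp_all add: grad_def inner_vec_def)

lemma partial_nth_eq_inner_gradient:
  assumes s: "smooth \<psi>" shows "partial_on UNIV v \<psi> y $ \<alpha> = v \<bullet> (gradient \<psi> y $ \<alpha>)"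
  by (subst partial_axis_sum[OF s]) (simp add: gradient_def inner_vec_def)

text \<open>Change of variables for the map \<open>y - \<zeta>(y) h\<close>, whose Jacobian determinant is \<open>1 - \<partial>\<^sub>h \<zeta>\<close>. Along the homotopy
  \<open>y - s \<zeta>(y) h\<close> the derivative in \<open>s\<close> of the transformed integrand is the derivative of \<open>- \<zeta>(y) F(y - s \<zeta>(y) h)\<close> in the
  fixed direction \<open>h\<close>, so its integral vanishes and the integral does not depend on \<open>s\<close>.\<close>

lemma integral_partial_field_shift:
  fixes F :: "real^'n \<Rightarrow> real" and \<zeta> :: "real^'n \<Rightarrow> real"
  assumes F: "compact_smooth F" and c: "compact_smooth \<zeta>"
  shows "(LINT y|lborel. F (y - \<zeta> y *\<^sub>R h) * (1 - partial_on UNIV h \<zeta> y)) = (LINT y|lborel. F y)"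
proof -
  let ?P = "\<lambda>s y. y - (s * \<zeta> y) *\<^sub>R h"
  let ?d = "\<lambda>y. partial_on UNIV h \<zeta> y"
  let ?w = "\<lambda>s y. F (?P s y) * (1 - s * ?d y)"
  let ?fx = "\<lambda>s y. - (partial_on UNIV h F (?P s y) * \<zeta> y * (1 - s * ?d y)) - F (?P s y) * ?d y"
  have sF: "smooth F" and sc: "smooth \<zeta>" and sdF: "smooth (\<lambda>y. partial_on UNIV h F y)" and sdc: "smooth ?d"
    using F c compact_smooth_partial[OF F, of h] compact_smooth_partial[OF c, of h] by blast+
  have cF: "continuous_on A F" and cc: "continuous_on A \<zeta>" and cdF: "continuous_on A (\<lambda>y. partial_on UNIV h F y)" and cdc: "continuous_on A ?d" for A
    using smooth_continuous[OF sF] smooth_continuous[OF sc] smooth_continuous[OF sdF] smooth_continuous[OF sdc] continuous_on_subset by blast+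
  obtain R where R: "\<And>x. F x \<noteq> 0 \<Longrightarrow> norm x \<le> R" using F by (auto simp: bounded_iff)
  obtain B where B: "B > 0" "\<And>x. norm (\<zeta> x) \<le> B"
    using compact_support_bounded[OF smooth_continuous[OF sc]] c by blast
  have clF: "norm x \<le> R" if "x \<in> closure {x. F x \<noteq> 0}" for x
  proof -
    have "closure {x. F x \<noteq> 0} \<subseteq> cball 0 R" by (rule closure_minimal) (use R in auto)
    then show ?thesis using that by auto
  qed
  define Q where "Q = R + B * norm h"
  have far: "F (?P s y) = 0 \<and> partial_on UNIV h F (?P s y) = 0" if s: "s \<in> {0..1}" and y: "norm y > Q" for s y
  proof -
    have "norm ((s * \<zeta> y) *\<^sub>R h) \<le> B * norm h"
    proof -
      have "\<bar>s * \<zeta> y\<bar> \<le> 1 * B" unfolding abs_mult using s B by (intro mult_mono) auto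
      then show ?thesis by (simp add: mult_right_mono)
    qed
    then have "norm (?P s y) > R" using y norm_triangle_ineq2[of y "(s * \<zeta> y) *\<^sub>R h"] by (simp add: Q_def)
    then show ?thesis using R[of "?P s y"] clF[of "?P s y"] partial_eq_0_off_support[of "?P s y" F] by fastforce
  qed
  obtain a b where ab: "cball 0 Q \<subseteq> cbox a (b :: real^'n)" using bounded_subset_cbox_symmetric[OF bounded_cball, of 0 Q] by metis
  have hk: "integral (cbox a b) g = (LINT y|lborel. g y)" if g: "continuous_on UNIV g" "\<And>y. norm y > Q \<Longrightarrow> g y = 0" for g :: "real^'n \<Rightarrow> real"
  proof -
    have "bounded {y. g y \<noteq> 0}" using g(2) by (intro boundedI[where B=Q]) (meson linorder_not_less mem_Collect_eq)
    then have "integrable lborel g" using g(1) integrable_compact_support by blast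
    then have "(LINT y|lborel. g y) = integral UNIV g" by (rule integral_lborel[symmetric])
    also have "\<dots> = integral UNIV (\<lambda>y. if y \<in> cbox a b then g y else 0)"
    proof (rule arg_cong[where f="integral UNIV"], rule ext)
      fix y show "g y = (if y \<in> cbox a b then g y else 0)" using g(2)[of y] subsetD[OF ab, of y] by (cases "norm y > Q") auto
    qed
    also have "\<dots> = integral (cbox a b) g" by (rule integral_restrict_UNIV)
    finally show ?thesis by simp
  qed
  have cP: "continuous_on A (\<lambda>y. ?P s y)" for s A by (intro continuous_intros cc)
  have cw: "continuous_on A (?w s)" for s A
    by (intro continuous_intros cdc continuous_on_compose2[OF cF[of UNIV] cP]) auto
  have "((\<lambda>s. integral (cbox a b) (?w s)) has_field_derivative 0) (at s within {0..1})" if s: "s \<in> {0..1}" for s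
  proof -
    have "((\<lambda>s. integral (cbox a b) (?w s)) has_field_derivative integral (cbox a b) (?fx s)) (at s within {0..1})"
    proof (rule leibniz_rule_field_derivative[OF _ _ _ s])
      fix s y
      have "((\<lambda>s. F (?P s y)) has_derivative (\<lambda>t. partial_on UNIV (- (t * \<zeta> y) *\<^sub>R h) F (?P s y))) (at s within {0..1})"
      proof (rule has_derivative_compose[where g=F])
        show "((\<lambda>s. ?P s y) has_derivative (\<lambda>t. - (t * \<zeta> y) *\<^sub>R h)) (at s within {0..1})"
          by (auto intro!: derivative_eq_intros)
        show "(F has_derivative (\<lambda>v. partial_on UNIV v F (?P s y))) (at (?P s y))" by (rule smooth_has_derivative[OF sF])
      qed
      note H = this
      have E: "partial_on UNIV (- (t * \<zeta> y) *\<^sub>R h) F (?P s y) = (- \<zeta> y * partial_on UNIV h F (?P s y)) * t" for t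
        using linear_scale[OF smooth_partial_linear[OF sF, of "?P s y"], of "- (t * \<zeta> y)" h] by simp
      have "((\<lambda>s. F (?P s y)) has_field_derivative (- \<zeta> y * partial_on UNIV h F (?P s y))) (at s within {0..1})"
        unfolding has_field_derivative_def by (rule has_derivative_eq_rhs[OF H]) (simp only: E)
      moreover have "((\<lambda>s. 1 - s * ?d y) has_field_derivative (- ?d y)) (at s within {0..1})"
        by (auto intro!: derivative_eq_intros)
      ultimately have "((\<lambda>s. F (?P s y) * (1 - s * ?d y)) has_field_derivative (- \<zeta> y * partial_on UNIV h F (?P s y)) * (1 - s * ?d y) + (- ?d y) * F (?P s y)) (at s within {0..1})"
        by (rule DERIV_mult)
      then show "((\<lambda>s. ?w s y) has_field_derivative ?fx s y) (at s within {0..1})" by (simp add: algebra_simps)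
    next
      fix s show "?w s integrable_on cbox a b" by (intro integrable_continuous cw)
    next
      have cP2: "continuous_on A (\<lambda>(s,y). ?P s y)" for A
        unfolding case_prod_beta by (intro continuous_intros continuous_on_compose2[OF cc[of UNIV]]) auto
      have *: "continuous_on A (\<lambda>z. g (snd z))" if "continuous_on UNIV g" for g :: "real^'n \<Rightarrow> real" and A :: "(real \<times> (real^'n)) set"
        by (rule continuous_on_compose2[OF that continuous_on_snd]) (auto intro: continuous_on_id)
      have **: "continuous_on A (\<lambda>z. g (snd z - (fst z * \<zeta> (snd z)) *\<^sub>R h))" if "continuous_on UNIV g" for g :: "real^'n \<Rightarrow> real" and A :: "(real \<times> (real^'n)) set"
        by (rule continuous_on_compose2[OF that]) (use cP2[of A] in \<open>auto simp: case_prod_beta\<close>)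
      show "continuous_on ({0..1} \<times> cbox a b) (\<lambda>(s,y). ?fx s y)"
        unfolding case_prod_beta
        by (intro continuous_intros *[OF cc] *[OF cdc] **[OF cF] **[OF cdF])
    qed auto
    moreover have "integral (cbox a b) (?fx s) = 0"
    proof -
      let ?g = "\<lambda>y. \<zeta> y * F (?P s y)"
      have sP: "smooth (\<lambda>y. ?P s y)"
      proof
        fix k show "Ck_on k UNIV (\<lambda>y. ?P s y)"
          by (rule Ck_diff[OF Ck_bounded_linear[OF bounded_linear_ident] Ck_scaleR[OF Ck_mult[OF Ck_const sc[rule_format]] Ck_const]])
      qed
      have sFP: "smooth (\<lambda>y. F (?P s y))"
      proof
        fix k show "Ck_on k UNIV (\<lambda>y. F (?P s y))" by (rule Ck_compose[OF sF[rule_format] sP[rule_format]])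
      qed
      have "smooth ?g"
      proof
        fix k show "Ck_on k UNIV ?g" by (rule Ck_mult[OF sc[rule_format] sFP[rule_format]])
      qed
      moreover have "bounded {y. ?g y \<noteq> 0}" by (rule bounded_subset[of "{y. \<zeta> y \<noteq> 0}"]) (use c in auto)
      ultimately have cs: "compact_smooth ?g" by blast
      have "partial_on UNIV h ?g y = - ?fx s y" for y
      proof -
        have "((\<lambda>y. ?P s y) has_derivative (\<lambda>v. v - (s * partial_on UNIV v \<zeta> y) *\<^sub>R h)) (at y)"
          by (auto intro!: derivative_eq_intros smooth_has_derivative[OF sc])
        from has_derivative_compose[OF this smooth_has_derivative[OF sF]]
        have "((\<lambda>y. F (?P s y)) has_derivative (\<lambda>v. partial_on UNIV (v - (s * partial_on UNIV v \<zeta> y) *\<^sub>R h) F (?P s y))) (at y)" .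
        from partial_on_UNIV[OF has_derivative_mult[OF smooth_has_derivative[OF sc] this]]
        have "partial_on UNIV h ?g y = \<zeta> y * partial_on UNIV (h - (s * ?d y) *\<^sub>R h) F (?P s y) + ?d y * F (?P s y)" .
        also have "h - (s * ?d y) *\<^sub>R h = (1 - s * ?d y) *\<^sub>R h" by (simp add: scaleR_diff_left)
        also have "partial_on UNIV \<dots> F (?P s y) = (1 - s * ?d y) * partial_on UNIV h F (?P s y)"
          using linear_scale[OF smooth_partial_linear[OF sF, of "?P s y"], of "1 - s * ?d y" h] by simp
        finally show ?thesis by (simp add: algebra_simps)
      qed
      then have "(LINT y|lborel. ?fx s y) = (LINT y|lborel. - partial_on UNIV h ?g y)"
        by (intro Bochner_Integration.integral_cong) auto
      also have "\<dots> = 0" using integral_partial_compact_smooth_eq_0[OF cs, of h] by simp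
      finally have "(LINT y|lborel. ?fx s y) = 0" .
      moreover have "integral (cbox a b) (?fx s) = (LINT y|lborel. ?fx s y)"
      proof (rule hk)
        show "continuous_on UNIV (?fx s)"
          by (intro continuous_intros cc cdc continuous_on_compose2[OF cF[of UNIV] cP] continuous_on_compose2[OF cdF[of UNIV] cP]) auto
        show "?fx s y = 0" if "norm y > Q" for y using far[OF s that] by simp
      qed
      ultimately show ?thesis by simp
    qed
    ultimately show ?thesis by simp
  qed
  then obtain c where c: "\<And>s. s \<in> {0..1} \<Longrightarrow> integral (cbox a b) (?w s) = c"
    using has_field_derivative_zero_constant[OF convex_real_interval(5), of 0 1 "\<lambda>s. integral (cbox a b) (?w s)"] by blast
  have "integral (cbox a b) (?w 1) = integral (cbox a b) (?w 0)" using c[of 0] c[of 1] by simp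
  note c01 = this
  have li: "integral (cbox a b) (?w s) = (LINT y|lborel. ?w s y)" if "s \<in> {0..1}" for s
  proof (rule hk[OF cw])
    show "?w s y = 0" if "norm y > Q" for y using far[OF \<open>s \<in> {0..1}\<close> that] by simp
  qed
  have "(LINT y|lborel. ?w 1 y) = (LINT y|lborel. ?w 0 y)" using c01 li[of 0] li[of 1] by simp
  then show ?thesis by simp
qed

text \<open>The map \<open>push y = y - \<zeta>(y) h\<close> is a translation where \<open>\<zeta> = 1\<close> and the identity where \<open>\<zeta> = 0\<close>. If \<open>norm h * L\<close> is at most
  \<open>1/2\<close> it is a perturbation of the identity by a contraction, hence bijective. Its inverse is \<open>pull\<close>, and \<open>u \<circ> pull\<close> is a
  translate of \<open>u\<close> on the first region and \<open>u\<close> itself on the second.\<close>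

locale localised_shift =
  fixes \<zeta> :: "real^'n \<Rightarrow> real" and h :: "real^'n" and L :: real
  assumes cutoff: "compact_smooth \<zeta>" and L: "\<And>y. norm (grad \<zeta> y) \<le> L" and small: "norm h * L \<le> 1/2"
begin

lemma smooth_cutoff: "smooth \<zeta>" using cutoff by blast

lemma inner_grad_le: "\<bar>h \<bullet> grad \<zeta> y\<bar> \<le> 1/2"
  using Cauchy_Schwarz_ineq2[of h "grad \<zeta> y"] mult_left_mono[OF L[of y], of "norm h"] small by simp

lemma cutoff_Lipschitz: "\<bar>\<zeta> x - \<zeta> y\<bar> \<le> L * norm (x - y)"
proof -
  have "norm (\<zeta> x - \<zeta> y) \<le> L * norm (x - y)"
  proof (rule differentiable_bound[of UNIV _ "\<lambda>x v. partial_on UNIV v \<zeta> x"])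
    show "(\<zeta> has_derivative (\<lambda>v. partial_on UNIV v \<zeta> x)) (at x within UNIV)" for x by (rule smooth_has_derivative[OF smooth_cutoff])
    show "onorm (\<lambda>v. partial_on UNIV v \<zeta> x) \<le> L" for x
    proof (rule onorm_bound)
      show "L \<ge> 0" using L norm_ge_zero order_trans by blast
      fix v show "norm (partial_on UNIV v \<zeta> x) \<le> L * norm v"
        unfolding partial_eq_inner_grad[OF smooth_cutoff]
        using Cauchy_Schwarz_ineq2[of v "grad \<zeta> x"] mult_left_mono[OF L[of x], of "norm v"] by (simp add: mult.commute)
    qed
  qed auto
  then show ?thesis by simp
qed

definition push :: "real^'n \<Rightarrow> real^'n" where "push y = y - \<zeta> y *\<^sub>R h"
definition pull :: "real^'n \<Rightarrow> real^'n" where "pull x = (THE y. push y = x)"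
definition jac :: "real^'n \<Rightarrow> real" where "jac y = 1 - h \<bullet> grad \<zeta> y"

lemma jac_bounds: "1/2 \<le> jac y" "jac y \<le> 3/2"
  using inner_grad_le[of y] by (auto simp: jac_def)

lemma push_ex1: "\<exists>!y. push y = x"
proof -
  have "\<exists>!y. x + \<zeta> y *\<^sub>R h = y"
  proof (rule banach_fix_type[of "1/2"])
    show "\<forall>y. \<forall>z. dist (x + \<zeta> y *\<^sub>R h) (x + \<zeta> z *\<^sub>R h) \<le> 1/2 * dist y z"
    proof (intro allI)
      fix y z
      have "dist (x + \<zeta> y *\<^sub>R h) (x + \<zeta> z *\<^sub>R h) = \<bar>\<zeta> y - \<zeta> z\<bar> * norm h"
        by (simp add: dist_norm flip: scaleR_diff_left)
      also have "\<dots> \<le> L * norm (y - z) * norm h" by (intro mult_right_mono cutoff_Lipschitz) auto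
      also have "\<dots> \<le> 1/2 * norm (y - z)" using mult_right_mono[OF small, of "norm (y - z)"] by (simp add: mult.commute mult.left_commute)
      finally show "dist (x + \<zeta> y *\<^sub>R h) (x + \<zeta> z *\<^sub>R h) \<le> 1/2 * dist y z" by (simp add: dist_norm)
    qed
  qed auto
  moreover have "(x + \<zeta> y *\<^sub>R h = y) = (push y = x)" for y unfolding push_def by (metis add_diff_cancel_right' diff_add_cancel)
  ultimately show ?thesis by simp
qed

lemma push_pull: "push (pull x) = x" unfolding pull_def by (rule theI'[OF push_ex1])
lemma pull_push: "pull (push y) = y" unfolding pull_def using push_ex1 by (intro the1_equality) auto
lemma pull_eq: "pull x = x + \<zeta> (pull x) *\<^sub>R h" using push_pull[of x] by (simp add: push_def algebra_simps)

lemma pull_Lipschitz: "norm (pull x - pull y) \<le> 2 * norm (x - y)"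
proof -
  have "norm (pull x - pull y) \<le> norm (x - y) + norm ((\<zeta> (pull x) - \<zeta> (pull y)) *\<^sub>R h)"
    using norm_triangle_ineq[of "x - y" "(\<zeta> (pull x) - \<zeta> (pull y)) *\<^sub>R h"]
    by (subst pull_eq, subst pull_eq[of y]) (simp add: algebra_simps)
  also have "norm ((\<zeta> (pull x) - \<zeta> (pull y)) *\<^sub>R h) \<le> L * norm (pull x - pull y) * norm h"
    by (simp add: cutoff_Lipschitz mult_right_mono)
  also have "\<dots> \<le> 1/2 * norm (pull x - pull y)"
    using mult_right_mono[OF small, of "norm (pull x - pull y)"] by (simp add: mult.commute mult.left_commute)
  finally show ?thesis by simp
qed

lemma continuous_pull: "isCont pull x"
  unfolding continuous_at_eps_delta
proof (intro allI impI)
  fix e :: real assume "e > 0"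
  moreover have "dist (pull y) (pull x) \<le> 2 * dist y x" for y using pull_Lipschitz[of y x] by (simp add: dist_norm)
  ultimately show "\<exists>d>0. \<forall>y. dist y x < d \<longrightarrow> dist (pull y) (pull x) < e"
    by (intro exI[of _ "e/2"] conjI allI impI le_less_trans[OF \<open>\<And>y. dist (pull y) (pull x) \<le> 2 * dist y x\<close>]) auto
qed

text \<open>The derivative of \<open>push\<close> is the identity plus an operator of rank one, so the Sherman-Morrison formula gives its inverse.\<close>

definition dpull :: "real^'n \<Rightarrow> real^'n \<Rightarrow> real^'n" where
  "dpull y v = v + ((v \<bullet> grad \<zeta> y) * inverse (jac y)) *\<^sub>R h"

lemma pull_has_derivative: "(pull has_derivative dpull (pull x)) (at x)"
proof -
  let ?y = "pull x"
  have j: "jac ?y > 0" using jac_bounds[of ?y] by simp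
  show ?thesis
  proof (rule has_derivative_inverse_basic[where f=push and f'="\<lambda>v. v - (v \<bullet> grad \<zeta> ?y) *\<^sub>R h" and T=UNIV])
    show "(push has_derivative (\<lambda>v. v - (v \<bullet> grad \<zeta> ?y) *\<^sub>R h)) (at ?y)"
      unfolding push_def[abs_def]
      using smooth_has_derivative[OF smooth_cutoff, of ?y]
      by (auto intro!: derivative_eq_intros simp: partial_eq_inner_grad[OF smooth_cutoff])
    show "bounded_linear (dpull ?y)" unfolding dpull_def[abs_def]
      by (intro bounded_linear_add bounded_linear_ident bounded_linear_scaleR_left[THEN bounded_linear_compose]
        bounded_linear_mult_left[THEN bounded_linear_compose] bounded_linear_inner_left)
    show "dpull ?y \<circ> (\<lambda>v. v - (v \<bullet> grad \<zeta> ?y) *\<^sub>R h) = id"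
    proof
      fix v
      let ?a = "v \<bullet> grad \<zeta> ?y"
      have "(v - ?a *\<^sub>R h) \<bullet> grad \<zeta> ?y = ?a * jac ?y" by (simp add: inner_diff_left jac_def algebra_simps)
      then show "(dpull ?y \<circ> (\<lambda>v. v - (v \<bullet> grad \<zeta> ?y) *\<^sub>R h)) v = id v"
        using j by (simp add: dpull_def)
    qed
    show "continuous (at x) pull" by (rule continuous_pull)
  qed (auto simp: push_pull)
qed

lemma smooth_grad: "smooth (\<lambda>y. v \<bullet> grad \<zeta> y)"
  using smooth_partial[OF smooth_cutoff, of v] by (simp add: partial_eq_inner_grad[OF smooth_cutoff])

lemma smooth_inverse_jac: "smooth (\<lambda>y. inverse (jac y))"
proof
  fix k
  have "jac y \<noteq> 0" for y using jac_bounds[of y] by simp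
  then show "Ck_on k UNIV (\<lambda>y. inverse (jac y))"
    unfolding jac_def by (intro Ck_inverse Ck_diff Ck_const smooth_grad[rule_format]) auto
qed

text \<open>The derivative of \<open>pull\<close> is a smooth function of \<open>pull\<close> itself, so that each order of differentiability yields the next.\<close>

lemma smooth_pull: "smooth pull"
proof
  fix k show "Ck_on k UNIV pull"
  proof (induction k)
    case 0
    show ?case using continuous_pull by (auto intro: continuous_at_imp_continuous_on)
  next
    case (Suc k)
    show ?case
    proof (rule Ck_SucI[OF pull_has_derivative])
      fix b
      have *: "Ck_on k UNIV (\<lambda>y. dpull y b)" unfolding dpull_def
        by (rule Ck_add[OF Ck_const Ck_scaleR[OF Ck_mult[OF smooth_grad[rule_format] smooth_inverse_jac[rule_format]] Ck_const]])
      show "Ck_on k UNIV (\<lambda>x. dpull (pull x) b)" by (rule Ck_compose[OF * Suc.IH])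
    qed
  qed
qed

lemma measurable_push [measurable]: "push \<in> borel_measurable borel"
  unfolding push_def[abs_def] using borel_measurable_smooth[OF smooth_cutoff] by measurable

lemma measurable_pull [measurable]: "pull \<in> borel_measurable borel"
  by (rule borel_measurable_smooth[OF smooth_pull])

lemma measurable_jac [measurable]: "jac \<in> borel_measurable borel"
  unfolding jac_def[abs_def] using borel_measurable_smooth[OF smooth_grad[of h]] by measurable

text \<open>The change of variables formula for smooth functions identifies the integrals of all smooth compactly supported
  functions under both measures. Cutoff functions of compact exhaustions of an open set bound the measure of
  the set under one measure by that under the other, and boxes determine Lebesgue-Borel measure.\<close>

lemma distr_push: "distr (density lborel (\<lambda>y. ennreal (jac y))) borel push = lborel" (is "?M = _")
proof -
  have F: "(\<integral>\<^sup>+x. ennreal (F x) \<partial>?M) = (\<integral>\<^sup>+x. ennreal (F x) \<partial>lborel)" if F: "compact_smooth F" "\<And>x. F x \<ge> 0" for F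
  proof -
    have [measurable]: "F \<in> borel_measurable borel" using F by (intro borel_measurable_smooth) blast
    have sFP: "continuous_on UNIV (\<lambda>y. F (push y) * jac y)"
    proof -
      have c: "continuous_on UNIV F" "continuous_on UNIV \<zeta>" "continuous_on UNIV (\<lambda>y. h \<bullet> grad \<zeta> y)"
        by (rule smooth_continuous[OF conjunct1[OF F(1)]], rule smooth_continuous[OF smooth_cutoff], rule smooth_continuous[OF smooth_grad])
      have "continuous_on UNIV push" unfolding push_def[abs_def] by (intro continuous_intros c)
      then have "continuous_on UNIV (\<lambda>y. F (push y))" by (rule continuous_on_compose2[OF c(1)]) simp
      moreover have "continuous_on UNIV jac" unfolding jac_def[abs_def] by (intro continuous_intros c)
      ultimately show ?thesis by (rule continuous_on_mult)
    qed
    obtain R where R: "\<And>x. F x \<noteq> 0 \<Longrightarrow> norm x \<le> R" using F by (auto simp: bounded_iff)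
    obtain B where B: "B > 0" "\<And>x. norm (\<zeta> x) \<le> B"
      using compact_support_bounded[OF smooth_continuous[OF smooth_cutoff]] cutoff by blast
    have "bounded {y. F (push y) * jac y \<noteq> 0}"
    proof (rule boundedI[where B="R + B * norm h"])
      fix y assume "y \<in> {y. F (push y) * jac y \<noteq> 0}"
      then have "norm (push y) \<le> R" using R by auto
      moreover have "norm (\<zeta> y *\<^sub>R h) \<le> B * norm h" using B(2)[of y] by (simp add: mult_right_mono)
      moreover have "norm y \<le> norm (push y) + norm (\<zeta> y *\<^sub>R h)"
        using norm_triangle_ineq[of "push y" "\<zeta> y *\<^sub>R h"] by (simp add: push_def)
      ultimately show "norm y \<le> R + B * norm h" by simp
    qed
    then have i1: "integrable lborel (\<lambda>y. F (push y) * jac y)" by (rule integrable_compact_support[OF sFP])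
    have i2: "integrable lborel F" using F by (intro integrable_compact_support smooth_continuous) blast+
    have "(\<integral>\<^sup>+x. ennreal (F x) \<partial>?M) = (\<integral>\<^sup>+y. ennreal (F (push y)) \<partial>density lborel (\<lambda>y. ennreal (jac y)))"
      by (subst nn_integral_distr) auto
    also have "\<dots> = (\<integral>\<^sup>+y. ennreal (jac y) * ennreal (F (push y)) \<partial>lborel)" by (subst nn_integral_density) auto
    also have "\<dots> = (\<integral>\<^sup>+y. ennreal (F (push y) * jac y) \<partial>lborel)"
    proof (intro nn_integral_cong)
      fix y have "jac y \<ge> 0" using jac_bounds[of y] by simp
      then show "ennreal (jac y) * ennreal (F (push y)) = ennreal (F (push y) * jac y)" using F(2) by (simp add: ennreal_mult mult.commute)
    qed
    also have "\<dots> = ennreal (LINT y|lborel. F (push y) * jac y)"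
    proof (rule nn_integral_eq_integral[OF i1], intro AE_I2)
      fix y have "jac y \<ge> 0" using jac_bounds[of y] by simp
      then show "0 \<le> F (push y) * jac y" using F(2) by simp
    qed
    also have "(LINT y|lborel. F (push y) * jac y) = (LINT y|lborel. F y)"
      using integral_partial_field_shift[OF F(1) cutoff, of h]
      by (simp add: push_def jac_def partial_eq_inner_grad[OF smooth_cutoff])
    also have "ennreal \<dots> = (\<integral>\<^sup>+x. ennreal (F x) \<partial>lborel)"
      using F(2) by (intro nn_integral_eq_integral[symmetric] i2) auto
    finally show ?thesis .
  qed
  have le: "emeasure M1 U \<le> emeasure M2 U"
    if U: "open U" and s: "sets M1 = sets borel" "sets M2 = sets borel"
      and eq: "\<And>F. compact_smooth F \<Longrightarrow> (\<And>x. F x \<ge> 0) \<Longrightarrow> (\<integral>\<^sup>+x. ennreal (F x) \<partial>M1) = (\<integral>\<^sup>+x. ennreal (F x) \<partial>M2)"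
    for U :: "(real^'n) set" and M1 M2 :: "(real^'n) measure"
  proof -
    obtain C where C: "\<And>n. compact (C n)" "\<And>n. C n \<subseteq> U" "\<And>n. C n \<subseteq> interior (C (Suc n))" "\<Union>(range C) = U"
      "\<And>K. compact K \<Longrightarrow> K \<subseteq> U \<Longrightarrow> \<exists>N. \<forall>n\<ge>N. K \<subseteq> C n"
      using open_Union_compact_subsets[OF U] by metis
    have inc: "incseq C" using C(3) interior_subset by (intro incseq_SucI) blast
    have "emeasure M1 (C n) \<le> emeasure M2 U" for n
    proof -
      obtain f :: "real^'n \<Rightarrow> real" where f: "smooth f" "\<And>x. 0 \<le> f x" "\<And>x. f x \<le> 1" "\<And>x. x \<in> C n \<Longrightarrow> f x = 1"
        "compact (closure {x. f x \<noteq> 0})" "closure {x. f x \<noteq> 0} \<subseteq> U"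
        by (rule exists_cutoff[OF C(1)[of n] U C(2)[of n]]) blast
      have cs: "compact_smooth f" using f(1) bounded_subset[OF compact_imp_bounded[OF f(5)] closure_subset] by blast
      have fU: "f x = 0" if "x \<notin> U" for x using that f(6) closure_subset[of "{x. f x \<noteq> 0}"] by auto
      have "emeasure M1 (C n) = (\<integral>\<^sup>+x. indicator (C n) x \<partial>M1)" using C(1) s by (subst nn_integral_indicator) (auto intro: borel_compact)
      also have "\<dots> \<le> (\<integral>\<^sup>+x. ennreal (f x) \<partial>M1)" using f by (intro nn_integral_mono) (auto simp: indicator_def)
      also have "\<dots> = (\<integral>\<^sup>+x. ennreal (f x) \<partial>M2)" by (rule eq[OF cs f(2)])
      also have "\<dots> \<le> (\<integral>\<^sup>+x. indicator U x \<partial>M2)" using f fU by (intro nn_integral_mono) (auto simp: indicator_def)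
      also have "\<dots> = emeasure M2 U" using U s by (subst nn_integral_indicator) auto
      finally show ?thesis .
    qed
    moreover have "emeasure M1 U = (SUP n. emeasure M1 (C n))"
    proof -
      have "range C \<subseteq> sets M1" using C(1) s by (auto intro: borel_compact)
      from SUP_emeasure_incseq[OF this inc] show ?thesis by (simp add: C(4))
    qed
    ultimately show ?thesis by (simp add: SUP_least)
  qed
  have "lborel = ?M"
  proof (rule lborel_eqI)
    fix l u :: "real^'n" assume b: "\<And>b. b \<in> Basis \<Longrightarrow> l \<bullet> b \<le> u \<bullet> b"
    have "emeasure ?M (box l u) \<le> emeasure lborel (box l u)" by (rule le) (use F in auto)
    moreover have "emeasure lborel (box l u) \<le> emeasure ?M (box l u)" by (rule le) (use F in auto)
    ultimately have "emeasure ?M (box l u) = emeasure lborel (box l u)" by simp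
    then show "emeasure ?M (box l u) = ennreal (\<Prod>b\<in>Basis. (u - l) \<bullet> b)" using b by simp
  qed simp
  then show ?thesis by simp
qed

theorem nn_integral_pull:
  assumes [measurable]: "f \<in> borel_measurable borel"
  shows "(\<integral>\<^sup>+x. f (pull x) \<partial>lborel) = (\<integral>\<^sup>+y. ennreal (jac y) * f y \<partial>lborel)"
proof -
  have "(\<integral>\<^sup>+x. f (pull x) \<partial>lborel) = (\<integral>\<^sup>+x. f (pull x) \<partial>(distr (density lborel (\<lambda>y. ennreal (jac y))) borel push))"
    by (simp only: distr_push)
  also have "\<dots> = (\<integral>\<^sup>+y. f y \<partial>density lborel (\<lambda>y. ennreal (jac y)))"
    by (subst nn_integral_distr) (auto simp: pull_push)
  also have "\<dots> = (\<integral>\<^sup>+y. ennreal (jac y) * f y \<partial>lborel)" by (subst nn_integral_density) auto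
  finally show ?thesis .
qed

lemma push_mem_iff:
  assumes "{x. \<zeta> x \<noteq> 0} \<subseteq> S" shows "push y \<in> S \<longleftrightarrow> y \<in> S"
proof -
  have off: "push y = y" if "\<zeta> y = 0" for y using that by (simp add: push_def)
  have "\<zeta> (push y) \<noteq> 0" if "\<zeta> y \<noteq> 0"
  proof
    assume "\<zeta> (push y) = 0"
    then have "push (push y) = push y" by (rule off)
    then have "push y = y" using push_ex1 by blast
    then show False using \<open>\<zeta> (push y) = 0\<close> that by simp
  qed
  then show ?thesis using assms off[of y] by (cases "\<zeta> y = 0") auto
qed

lemma pull_mem_iff:
  assumes "{x. \<zeta> x \<noteq> 0} \<subseteq> S" shows "pull x \<in> S \<longleftrightarrow> x \<in> S"
  using push_mem_iff[OF assms, of "pull x"] by (simp add: push_pull)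

lemma pull_off: "\<zeta> x = 0 \<Longrightarrow> pull x = x"
  using pull_push[of x] by (simp add: push_def)

lemma set_nn_integral_pull:
  assumes [measurable]: "f \<in> borel_measurable borel" "S \<in> sets borel" and S: "{x. \<zeta> x \<noteq> 0} \<subseteq> S"
  shows "(\<integral>\<^sup>+x\<in>S. f (pull x) \<partial>lborel) = (\<integral>\<^sup>+y\<in>S. ennreal (jac y) * f y \<partial>lborel)"
proof -
  have "(\<integral>\<^sup>+x\<in>S. f (pull x) \<partial>lborel) = (\<integral>\<^sup>+x. (\<lambda>y. f y * indicator S y) (pull x) \<partial>lborel)"
    by (intro nn_integral_cong) (simp add: indicator_def pull_mem_iff[OF S])
  also have "\<dots> = (\<integral>\<^sup>+y. ennreal (jac y) * (f y * indicator S y) \<partial>lborel)" by (rule nn_integral_pull) measurable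
  finally show ?thesis by (simp add: mult.assoc)
qed

lemma pmass_pull_le:
  fixes f :: "real^'n \<Rightarrow> 'b::euclidean_space"
  assumes [measurable]: "f \<in> borel_measurable borel" "S \<in> sets borel" and S: "{x. \<zeta> x \<noteq> 0} \<subseteq> S"
  shows "pmass r S (\<lambda>x. f (pull x)) \<le> 2 * pmass r S f"
proof -
  have "pmass r S (\<lambda>x. f (pull x)) = (\<integral>\<^sup>+y\<in>S. ennreal (jac y) * ennreal (norm (f y) powr r) \<partial>lborel)"
    unfolding pmass_def by (rule set_nn_integral_pull[OF _ _ S]) measurable
  also have "\<dots> \<le> (\<integral>\<^sup>+y. 2 * (ennreal (norm (f y) powr r) * indicator S y) \<partial>lborel)"
  proof (intro nn_integral_mono)
    fix y
    have "jac y \<le> 2" using jac_bounds[of y] by simp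
    then have "ennreal (jac y) \<le> ennreal 2" by (rule ennreal_leI)
    then have "ennreal (jac y) \<le> 2" by simp
    then show "ennreal (jac y) * ennreal (norm (f y) powr r) * indicator S y \<le> 2 * (ennreal (norm (f y) powr r) * indicator S y)"
      unfolding mult.assoc by (rule mult_right_mono) simp
  qed
  also have "\<dots> = 2 * pmass r S f" unfolding pmass_def by (rule nn_integral_cmult) measurable
  finally show ?thesis .
qed

text \<open>What the chain rule makes of a gradient when a map is composed with \<open>pull\<close>: with \<open>g\<close> the gradient at \<open>y\<close>, it is the gradient
  of the composition at \<open>push y\<close>.\<close>

definition transport :: "real^'n \<Rightarrow> real^'n^'m \<Rightarrow> real^'n^'m" where
  "transport y g = (\<chi> \<alpha>. g $ \<alpha> + ((h \<bullet> (g $ \<alpha>)) * inverse (jac y)) *\<^sub>R grad \<zeta> y)"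

lemma gradient_pull:
  assumes s: "smooth \<psi>" shows "gradient (\<lambda>x. \<psi> (pull x)) x = transport (pull x) (gradient \<psi> (pull x))"
proof -
  have "partial_on UNIV v (\<lambda>x. \<psi> (pull x)) x = partial_on UNIV (dpull (pull x) v) \<psi> (pull x)" for v
    by (rule partial_on_UNIV[OF has_derivative_compose[OF pull_has_derivative smooth_has_derivative[OF s]]])
  then show ?thesis
    by (simp add: gradient_def[of "\<lambda>x. \<psi> (pull x)"] partial_nth_eq_inner_gradient[OF s] vec_eq_iff transport_def dpull_def
        inner_add_left inner_axis' mult.commute)
qed

lemma transport_diff: "transport y (a - b) = transport y a - transport y b"
  by (simp add: transport_def vec_eq_iff inner_diff_right algebra_simps)

lemma norm_transport_le: "norm (transport y g $ \<alpha>) \<le> 2 * norm (g $ \<alpha>)"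
proof -
  have j: "inverse (jac y) \<le> 2" "inverse (jac y) \<ge> 0" using jac_bounds[of y] by (auto simp: field_simps inverse_eq_divide)
  have "norm (((h \<bullet> (g $ \<alpha>)) * inverse (jac y)) *\<^sub>R grad \<zeta> y) = \<bar>h \<bullet> (g $ \<alpha>)\<bar> * inverse (jac y) * norm (grad \<zeta> y)"
    using j by (simp add: abs_mult)
  also have "\<dots> \<le> (norm h * norm (g $ \<alpha>)) * 2 * L"
    by (intro mult_mono j L Cauchy_Schwarz_ineq2) auto
  also have "\<dots> \<le> norm (g $ \<alpha>)" using mult_right_mono[OF small, of "2 * norm (g $ \<alpha>)"] by (simp add: algebra_simps)
  finally show ?thesis using norm_triangle_ineq[of "g $ \<alpha>" "((h \<bullet> (g $ \<alpha>)) * inverse (jac y)) *\<^sub>R grad \<zeta> y"]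
    by (simp add: transport_def)
qed

lemma norm_transport: "norm (transport y g) \<le> 2 * norm g"
proof -
  have "norm (transport y g) \<le> L2_set (\<lambda>\<alpha>. 2 * norm (g $ \<alpha>)) UNIV"
    unfolding norm_vec_def[of "transport y g"] by (intro L2_set_mono norm_transport_le) simp
  also have "\<dots> = 2 * norm g" unfolding norm_vec_def[of g] by (rule L2_set_right_distrib[symmetric]) simp
  finally show ?thesis .
qed

lemma measurable_grad: "grad \<zeta> \<in> borel_measurable borel"
proof -
  have "continuous_on UNIV (grad \<zeta>)" unfolding grad_def
    by (intro continuous_intros smooth_continuous smooth_partial smooth_cutoff)
  then show ?thesis by (rule borel_measurable_continuous_onI)
qed

lemma measurable_transport:
  fixes D :: "real^'n \<Rightarrow> real^'n^'m"
  assumes [measurable]: "D \<in> borel_measurable borel"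
  shows "(\<lambda>y. transport y (D y)) \<in> borel_measurable borel"
proof -
  have [measurable]: "grad \<zeta> \<in> borel_measurable borel" by (rule measurable_grad)
  have "(\<lambda>y. transport y (D y) \<bullet> b) \<in> borel_measurable borel" if b: "b \<in> Basis" for b :: "real^'n^'m"
  proof -
    obtain \<alpha> :: 'm and c where "b = axis \<alpha> c" using b by (auto simp: Basis_vec_def)
    then show ?thesis by (simp add: inner_axis transport_def)
  qed
  then show ?thesis by (subst borel_measurable_euclidean_space) auto
qed

end

section \<open>The averaged shift as a competitor\<close>

lemma pmass_half_sum_diff_le:
  fixes A B E :: "'a::euclidean_space \<Rightarrow> 'b::euclidean_space"
  assumes [measurable]: "A \<in> borel_measurable borel" "B \<in> borel_measurable borel" "E \<in> borel_measurable borel" "S \<in> sets borel"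
    and r: "0 \<le> r" "r \<le> p"
  shows "pmass r S (\<lambda>x. (1/2) *\<^sub>R (A x + B x) - E x)
    \<le> ennreal (2 powr p) * (ennreal (2 powr p) * (pmass r S A + pmass r S B) + pmass r S E)"
proof -
  have c: "ennreal (2 powr r) \<le> ennreal (2 powr p)" using r by (intro ennreal_leI powr_mono) auto
  have "pmass r S (\<lambda>x. (1/2) *\<^sub>R (A x + B x) + - E x) \<le> ennreal (2 powr r) * (pmass r S (\<lambda>x. (1/2) *\<^sub>R (A x + B x)) + pmass r S (\<lambda>x. - E x))"
    by (rule pmass_add_le) (use r in measurable)
  also have "\<dots> \<le> ennreal (2 powr p) * (ennreal (2 powr p) * (pmass r S A + pmass r S B) + pmass r S E)"
  proof (intro mult_mono c add_mono)
    have "pmass r S (\<lambda>x. (1/2) *\<^sub>R (A x + B x)) \<le> pmass r S (\<lambda>x. A x + B x)"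
      by (rule pmass_mono) (use r in auto)
    also have "\<dots> \<le> ennreal (2 powr r) * (pmass r S A + pmass r S B)" by (rule pmass_add_le) (use r in measurable)
    also have "\<dots> \<le> ennreal (2 powr p) * (pmass r S A + pmass r S B)" by (intro mult_right_mono c) auto
    finally show "pmass r S (\<lambda>x. (1/2) *\<^sub>R (A x + B x)) \<le> ennreal (2 powr p) * (pmass r S A + pmass r S B)" .
  qed (auto simp: pmass_minus)
  finally show ?thesis by simp
qed

locale two_sided_shift = P: localised_shift \<zeta> h L + M: localised_shift \<zeta> "- h" L
  for \<zeta> :: "real^'n \<Rightarrow> real" and h :: "real^'n" and L :: real +
  fixes S :: "(real^'n) set"
  assumes open_S: "open S" and supp: "closure {x. \<zeta> x \<noteq> 0} \<subseteq> S" "compact (closure {x. \<zeta> x \<noteq> 0})"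
begin

lemma supp': "{x. \<zeta> x \<noteq> 0} \<subseteq> S" by (rule order_trans[OF closure_subset supp(1)])

lemma S_borel [measurable]: "S \<in> sets borel" using open_S by simp

definition mean :: "(real^'n \<Rightarrow> real^'m) \<Rightarrow> real^'n \<Rightarrow> real^'m" where
  "mean u x = (1/2) *\<^sub>R (u (P.pull x) + u (M.pull x))"

definition mean_gradient :: "(real^'n \<Rightarrow> real^'n^'m) \<Rightarrow> real^'n \<Rightarrow> real^'n^'m" where
  "mean_gradient D x = (1/2) *\<^sub>R (P.transport (P.pull x) (D (P.pull x)) + M.transport (M.pull x) (D (M.pull x)))"

lemma measurable_mean:
  assumes [measurable]: "u \<in> borel_measurable borel" shows "mean u \<in> borel_measurable borel"
  unfolding mean_def[abs_def] by measurable

lemma measurable_mean_gradient: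
  assumes m: "D \<in> borel_measurable borel" shows "mean_gradient D \<in> borel_measurable borel"
proof -
  have [measurable]: "(\<lambda>y. P.transport y (D y)) \<in> borel_measurable borel" "(\<lambda>y. M.transport y (D y)) \<in> borel_measurable borel"
    using P.measurable_transport[OF m] M.measurable_transport[OF m] by auto
  have "(\<lambda>x. (\<lambda>y. P.transport y (D y)) (P.pull x)) \<in> borel_measurable borel" "(\<lambda>x. (\<lambda>y. M.transport y (D y)) (M.pull x)) \<in> borel_measurable borel"
    by measurable
  then show ?thesis unfolding mean_gradient_def[abs_def] by simp
qed

lemma pmass_mean_diff_le:
  assumes [measurable]: "u \<in> borel_measurable borel" and r: "0 \<le> r" "r \<le> p"
  shows "pmass r S (\<lambda>x. mean u x - u x) \<le> ennreal (4 * (2 powr p)^3 + 2 powr p) * pmass r S u"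
proof -
  have c: "2 powr p \<ge> 1" using r by (auto intro: ge_one_powr_ge_zero)
  have "pmass r S (\<lambda>x. mean u x - u x) \<le> ennreal (2 powr p) * (ennreal (2 powr p) * (pmass r S (\<lambda>x. u (P.pull x)) + pmass r S (\<lambda>x. u (M.pull x))) + pmass r S u)"
    unfolding mean_def by (rule pmass_half_sum_diff_le) (use r in measurable)
  also have "\<dots> \<le> ennreal (2 powr p) * (ennreal (2 powr p) * (2 * pmass r S u + 2 * pmass r S u) + pmass r S u)"
    by (intro mult_left_mono add_mono P.pmass_pull_le M.pmass_pull_le supp') auto
  also have "\<dots> = ennreal (4 * (2 powr p)^2 + 2 powr p) * pmass r S u"
  proof -
    have "ennreal a * (ennreal a * (2 * x + 2 * x) + x) = ennreal (4 * a^2 + a) * x" if "a \<ge> 0" for a and x :: ennreal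
    proof -
      have "2 * x + 2 * x = ennreal 4 * x" by (simp add: distrib_right[symmetric])
      then show ?thesis using that
        by (simp add: ennreal_mult ennreal_plus distrib_left distrib_right power2_eq_square mult_ac)
    qed
    then show ?thesis by simp
  qed
  also have "\<dots> \<le> ennreal (4 * (2 powr p)^3 + 2 powr p) * pmass r S u"
    using c by (intro mult_right_mono ennreal_leI) (auto intro: power_increasing)
  finally show ?thesis .
qed

lemma pmass_mean_gradient_diff_le:
  assumes m [measurable]: "D \<in> borel_measurable borel" and r: "0 \<le> r" "r \<le> p"
  shows "pmass r S (\<lambda>x. mean_gradient D x - D x) \<le> ennreal (4 * (2 powr p)^3 + 2 powr p) * pmass r S D"
proof -
  have m1 [measurable]: "(\<lambda>y. P.transport y (D y)) \<in> borel_measurable borel" by (rule P.measurable_transport[OF m])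
  have m2 [measurable]: "(\<lambda>y. M.transport y (D y)) \<in> borel_measurable borel" by (rule M.measurable_transport[OF m])
  have mm: "(\<lambda>x. (\<lambda>y. P.transport y (D y)) (P.pull x)) \<in> borel_measurable borel" "(\<lambda>x. (\<lambda>y. M.transport y (D y)) (M.pull x)) \<in> borel_measurable borel"
    by measurable
  have s2: "pmass r S (\<lambda>y. 2 *\<^sub>R D y) = ennreal (2 powr r) * pmass r S D"
    unfolding pmass_def by (subst nn_integral_cmult[symmetric]) (auto simp: powr_mult ennreal_mult mult.assoc)
  have c: "ennreal (2 powr r) \<le> ennreal (2 powr p)" using r by (intro ennreal_leI powr_mono) auto
  have p1: "pmass r S (\<lambda>x. P.transport (P.pull x) (D (P.pull x))) \<le> 2 * (ennreal (2 powr p) * pmass r S D)"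
  proof -
    have "pmass r S (\<lambda>x. (\<lambda>y. P.transport y (D y)) (P.pull x)) \<le> 2 * pmass r S (\<lambda>y. P.transport y (D y))"
      by (rule P.pmass_pull_le[OF m1 S_borel supp'])
    also have "pmass r S (\<lambda>y. P.transport y (D y)) \<le> pmass r S (\<lambda>y. 2 *\<^sub>R D y)"
      by (rule pmass_mono) (use r P.norm_transport in auto)
    also have "\<dots> \<le> ennreal (2 powr p) * pmass r S D" unfolding s2 by (intro mult_right_mono c) simp
    finally show ?thesis by (simp add: mult_left_mono)
  qed
  have p2: "pmass r S (\<lambda>x. M.transport (M.pull x) (D (M.pull x))) \<le> 2 * (ennreal (2 powr p) * pmass r S D)"
  proof -
    have "pmass r S (\<lambda>x. (\<lambda>y. M.transport y (D y)) (M.pull x)) \<le> 2 * pmass r S (\<lambda>y. M.transport y (D y))"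
      by (rule M.pmass_pull_le[OF m2 S_borel supp'])
    also have "pmass r S (\<lambda>y. M.transport y (D y)) \<le> pmass r S (\<lambda>y. 2 *\<^sub>R D y)"
      by (rule pmass_mono) (use r M.norm_transport in auto)
    also have "\<dots> \<le> ennreal (2 powr p) * pmass r S D" unfolding s2 by (intro mult_right_mono c) simp
    finally show ?thesis by (simp add: mult_left_mono)
  qed
  have "pmass r S (\<lambda>x. mean_gradient D x - D x) \<le> ennreal (2 powr p) * (ennreal (2 powr p) * (pmass r S (\<lambda>x. P.transport (P.pull x) (D (P.pull x))) + pmass r S (\<lambda>x. M.transport (M.pull x) (D (M.pull x)))) + pmass r S D)"
    unfolding mean_gradient_def by (rule pmass_half_sum_diff_le[OF mm m S_borel r])
  also have "\<dots> \<le> ennreal (2 powr p) * (ennreal (2 powr p) * (2 * (ennreal (2 powr p) * pmass r S D) + 2 * (ennreal (2 powr p) * pmass r S D)) + pmass r S D)"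
    by (intro mult_left_mono add_mono p1 p2) auto
  also have "\<dots> = ennreal (4 * (2 powr p)^3 + 2 powr p) * pmass r S D"
  proof -
    have "ennreal a * (ennreal a * (2 * (ennreal a * x) + 2 * (ennreal a * x)) + x) = ennreal (4 * a^3 + a) * x" if "a \<ge> 0" for a and x :: ennreal
    proof -
      have "2 * (ennreal a * x) + 2 * (ennreal a * x) = ennreal 4 * (ennreal a * x)" by (simp add: distrib_right[symmetric])
      then show ?thesis using that
        by (simp add: ennreal_mult ennreal_plus distrib_left distrib_right power3_eq_cube mult_ac)
    qed
    then show ?thesis by simp
  qed
  finally show ?thesis .
qed

text \<open>Both shifts are the identity where the cutoff vanishes, so the mean differs from \<open>\<psi>\<close> only on the support of the cutoff.\<close>

lemma mean_test_function:
  assumes s: "smooth \<psi>"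
  shows "(\<lambda>x. mean \<psi> x - \<psi> x) \<in> test_functions S"
    "gradient (\<lambda>x. mean \<psi> x - \<psi> x) x = mean_gradient (gradient \<psi>) x - gradient \<psi> x"
proof -
  have s1: "smooth (\<lambda>x. \<psi> (P.pull x))"
  proof
    fix k show "Ck_on k UNIV (\<lambda>x. \<psi> (P.pull x))" by (rule Ck_compose[OF s[rule_format] P.smooth_pull[rule_format]])
  qed
  have s2: "smooth (\<lambda>x. \<psi> (M.pull x))"
  proof
    fix k show "Ck_on k UNIV (\<lambda>x. \<psi> (M.pull x))" by (rule Ck_compose[OF s[rule_format] M.smooth_pull[rule_format]])
  qed
  have s12: "smooth (\<lambda>x. \<psi> (P.pull x) + \<psi> (M.pull x))"
  proof
    fix k show "Ck_on k UNIV (\<lambda>x. \<psi> (P.pull x) + \<psi> (M.pull x))" by (rule Ck_add[OF s1[rule_format] s2[rule_format]])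
  qed
  have s3: "smooth (mean \<psi>)" unfolding mean_def[abs_def]
  proof
    fix k show "Ck_on k UNIV (\<lambda>x. (1/2) *\<^sub>R (\<psi> (P.pull x) + \<psi> (M.pull x)))"
      by (rule Ck_linear_compose[OF bounded_linear_scaleR_right s12[rule_format]])
  qed
  have s4: "smooth (\<lambda>x. mean \<psi> x - \<psi> x)"
  proof
    fix k show "Ck_on k UNIV (\<lambda>x. mean \<psi> x - \<psi> x)" by (rule Ck_diff[OF s3[rule_format] s[rule_format]])
  qed
  have "{x. mean \<psi> x - \<psi> x \<noteq> 0} \<subseteq> {x. \<zeta> x \<noteq> 0}"
  proof
    fix x assume x: "x \<in> {x. mean \<psi> x - \<psi> x \<noteq> 0}"
    have "\<zeta> x = 0 \<Longrightarrow> mean \<psi> x - \<psi> x = 0" by (simp add: mean_def P.pull_off M.pull_off scaleR_2[symmetric])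
    with x show "x \<in> {x. \<zeta> x \<noteq> 0}" by fast
  qed
  then have cl: "closure {x. mean \<psi> x - \<psi> x \<noteq> 0} \<subseteq> closure {x. \<zeta> x \<noteq> 0}" by (rule closure_mono)
  have "compact (closure {x. mean \<psi> x - \<psi> x \<noteq> 0})"
    unfolding compact_eq_bounded_closed using bounded_subset[OF compact_imp_bounded[OF supp(2)] cl] by simp
  then show "(\<lambda>x. mean \<psi> x - \<psi> x) \<in> test_functions S"
    unfolding test_functions_def using order_trans[OF cl supp(1)] by (intro CollectI conjI s4)
  have "gradient (mean \<psi>) x = mean_gradient (gradient \<psi>) x"
    unfolding mean_def[abs_def] gradient_scaleR[OF s12] gradient_add[OF s1 s2] P.gradient_pull[OF s] M.gradient_pull[OF s]
    by (simp add: mean_gradient_def)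
  then show "gradient (\<lambda>x. mean \<psi> x - \<psi> x) x = mean_gradient (gradient \<psi>) x - gradient \<psi> x"
    by (simp add: gradient_diff[OF s3 s])
qed

text \<open>Taking means is linear and bounded in \<open>L\<^sup>r\<close>, so that smooth approximations of \<open>u\<close> become approximations of
  \<open>mean u - u\<close> by test functions.\<close>

lemma mean_diff_approximated:
  assumes m [measurable]: "u \<in> borel_measurable borel" "D \<in> borel_measurable borel" and p: "p \<ge> 1"
    and app: "approximated p S {\<psi>. smooth \<psi>} u D"
  shows "approximated p S (test_functions S) (\<lambda>x. mean u x - u x) (\<lambda>x. mean_gradient D x - D x)"
proof (rule approximatedI)
  fix e :: real assume e: "e > 0"
  \<comment> \<open>The operator bound of both mean operators minus the identity.\<close>
  define C where "C = 4 * (2 powr p)^3 + 2 powr p"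
  have C: "C > 0" unfolding C_def by (intro add_pos_pos) auto
  have "e / C > 0" using e C by simp
  obtain \<psi> where s: "\<psi> \<in> {\<psi>. smooth \<psi>}" and a: "\<forall>r\<in>{1,p}. pmass r S (\<lambda>x. u x - \<psi> x) \<le> ennreal (e / C)"
    "\<forall>r\<in>{1,p}. pmass r S (\<lambda>x. D x - gradient \<psi> x) \<le> ennreal (e / C)"
    by (rule approximatedE[OF app \<open>e / C > 0\<close>])
  have s: "smooth \<psi>" using s by simp
  have m' [measurable]: "\<psi> \<in> borel_measurable borel" "gradient \<psi> \<in> borel_measurable borel"
    by (rule borel_measurable_smooth[OF s], rule borel_measurable_continuous_onI[OF continuous_gradient[OF s]])
  have eC: "ennreal C * ennreal (e / C) = ennreal e" using C e by (simp add: ennreal_mult[symmetric])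
  have "pmass r S (\<lambda>x. (mean u x - u x) - (mean \<psi> x - \<psi> x)) \<le> ennreal e \<and>
      pmass r S (\<lambda>x. (mean_gradient D x - D x) - gradient (\<lambda>x. mean \<psi> x - \<psi> x) x) \<le> ennreal e" if r: "r \<in> {1,p}" for r
  proof
    have r': "0 \<le> r" "r \<le> p" using r p by auto
    have "(\<lambda>x. (mean u x - u x) - (mean \<psi> x - \<psi> x)) = (\<lambda>x. mean (\<lambda>y. u y - \<psi> y) x - (u x - \<psi> x))"
      by (auto simp: mean_def algebra_simps)
    then have "pmass r S (\<lambda>x. (mean u x - u x) - (mean \<psi> x - \<psi> x)) \<le> ennreal C * pmass r S (\<lambda>x. u x - \<psi> x)"
      using pmass_mean_diff_le[OF _ r', of "\<lambda>y. u y - \<psi> y"] by (simp add: C_def)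
    also have "\<dots> \<le> ennreal C * ennreal (e / C)" using a r by (intro mult_left_mono) auto
    finally show "pmass r S (\<lambda>x. (mean u x - u x) - (mean \<psi> x - \<psi> x)) \<le> ennreal e" unfolding eC .
    have "(\<lambda>x. (mean_gradient D x - D x) - gradient (\<lambda>x. mean \<psi> x - \<psi> x) x) =
        (\<lambda>x. mean_gradient (\<lambda>y. D y - gradient \<psi> y) x - (D x - gradient \<psi> x))"
      by (simp add: mean_test_function(2)[OF s] mean_gradient_def P.transport_diff M.transport_diff algebra_simps)
    then have "pmass r S (\<lambda>x. (mean_gradient D x - D x) - gradient (\<lambda>x. mean \<psi> x - \<psi> x) x) \<le> ennreal C * pmass r S (\<lambda>x. D x - gradient \<psi> x)"
      using pmass_mean_gradient_diff_le[OF _ r', of "\<lambda>y. D y - gradient \<psi> y"] by (simp add: C_def)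
    also have "\<dots> \<le> ennreal C * ennreal (e / C)" using a r by (intro mult_left_mono) auto
    finally show "pmass r S (\<lambda>x. (mean_gradient D x - D x) - gradient (\<lambda>x. mean \<psi> x - \<psi> x) x) \<le> ennreal e" unfolding eC .
  qed
  then show "\<exists>\<psi>\<in>test_functions S. \<forall>r\<in>{1,p}. pmass r S (\<lambda>x. (mean u x - u x) - \<psi> x) \<le> ennreal e \<and>
      pmass r S (\<lambda>x. (mean_gradient D x - D x) - gradient \<psi> x) \<le> ennreal e"
    by (intro bexI[OF _ mean_test_function(1)[OF s]]) blast
qed

theorem mean_competitor:
  assumes m: "u \<in> borel_measurable borel" "D \<in> borel_measurable borel" and p: "p \<ge> 1"
    and app: "approximated p S {\<psi>. smooth \<psi>} u D" and fin: "\<And>r. r \<in> {1,p} \<Longrightarrow> pmass r S u < \<infinity>" "\<And>r. r \<in> {1,p} \<Longrightarrow> pmass r S D < \<infinity>"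
  shows "(\<lambda>x. mean u x - u x) \<in> W1p_0 p S" "Borel_weak_gradient S (\<lambda>x. mean u x - u x) (\<lambda>x. mean_gradient D x - D x)"
proof -
  have [measurable]: "u \<in> borel_measurable borel" "D \<in> borel_measurable borel" "mean u \<in> borel_measurable borel" "mean_gradient D \<in> borel_measurable borel"
    using m measurable_mean measurable_mean_gradient by auto
  have f1: "pmass r S (\<lambda>x. mean u x - u x) < \<infinity>" if r: "r \<in> {1,p}" for r
    by (rule le_less_trans[OF pmass_mean_diff_le[of u r p]]) (use r p fin(1)[OF r] in \<open>auto simp: ennreal_mult_less_top\<close>)
  have f2: "pmass r S (\<lambda>x. mean_gradient D x - D x) < \<infinity>" if r: "r \<in> {1,p}" for r
    by (rule le_less_trans[OF pmass_mean_gradient_diff_le[of D r p]]) (use r p fin(2)[OF r] in \<open>auto simp: ennreal_mult_less_top\<close>)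
  note * = approximated_W1p_0[OF _ _ open_S p f1 f2 mean_diff_approximated[OF m p app]]
  show "(\<lambda>x. mean u x - u x) \<in> W1p_0 p S" by (rule *(2)) auto
  show "Borel_weak_gradient S (\<lambda>x. mean u x - u x) (\<lambda>x. mean_gradient D x - D x)" by (rule *(1)) auto
qed

end

section \<open>Convex functions on the orthant\<close>

text \<open>The interior of the orthant. The arguments \<open>sqrt (t\<^sup>2 + \<epsilon>)\<close> of the integrand are positive, so that \<open>G\<close> is only
  evaluated and differentiated at interior points.\<close>

definition pos_orthant :: "(real^'m) set" where "pos_orthant = {s. \<forall>\<alpha>. 0 < s $ \<alpha>}"

abbreviation quadrant :: "((real^'m) \<times> (real^'m)) set" where "quadrant \<equiv> orthant \<times> orthant"

lemma open_positive: "open (pos_orthant :: (real^'m) set)"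
proof -
  have "(pos_orthant :: (real^'m) set) = (\<Inter>\<alpha>\<in>UNIV. {s. 0 < s $ \<alpha>})" by (auto simp: pos_orthant_def)
  moreover have "open (\<Inter>\<alpha>\<in>UNIV. {s :: real^'m. 0 < s $ \<alpha>})"
    by (intro open_INT ballI open_Collect_less continuous_intros) auto
  ultimately show ?thesis by simp
qed

lemma positive_orthant: "pos_orthant \<subseteq> orthant" by (auto simp: pos_orthant_def orthant_def less_imp_le)

lemma convex_positive: "convex (pos_orthant :: (real^'m) set)"
  unfolding convex_def
proof (intro ballI allI impI)
  fix x y :: "real^'m" and u v :: real
  assume h: "x \<in> pos_orthant" "y \<in> pos_orthant" "0 \<le> u" "0 \<le> v" "u + v = 1"
  have "0 < u * x $ \<alpha> + v * y $ \<alpha>" for \<alpha>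
  proof (cases "u = 0")
    case False
    have "0 < x $ \<alpha>" "0 < y $ \<alpha>" using h by (auto simp: pos_orthant_def)
    then show ?thesis using h False by (intro add_pos_nonneg mult_pos_pos mult_nonneg_nonneg) auto
  qed (use h in \<open>auto simp: pos_orthant_def\<close>)
  then show "u *\<^sub>R x + v *\<^sub>R y \<in> pos_orthant" by (simp add: pos_orthant_def)
qed

lemma vec_expansion: "(a :: real^'m) = (\<Sum>\<alpha>\<in>UNIV. (a $ \<alpha>) *\<^sub>R axis \<alpha> 1)"
  using basis_expansion[of a] by (simp add: scalar_mult_eq_scaleR)

lemma has_derivative_on_positive:
  fixes f :: "(real^'m) \<times> (real^'m) \<Rightarrow> real"
  assumes f: "f differentiable_on quadrant" and x: "x \<in> pos_orthant \<times> pos_orthant"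
  shows "(f has_derivative (\<lambda>v. (\<Sum>\<alpha>\<in>UNIV. fst v $ \<alpha> * partial_on quadrant (axis \<alpha> 1, 0) f x)
    + (\<Sum>\<alpha>\<in>UNIV. snd v $ \<alpha> * partial_on quadrant (0, axis \<alpha> 1) f x))) (at x)"
proof -
  have op: "open (pos_orthant \<times> pos_orthant :: ((real^'m) \<times> (real^'m)) set)" by (intro open_Times open_positive)
  have sub: "pos_orthant \<times> pos_orthant \<subseteq> (quadrant :: ((real^'m) \<times> (real^'m)) set)" using positive_orthant by auto
  have at: "at x within quadrant = at x" by (rule at_within_open_subset[OF x op sub])
  have "f differentiable (at x within quadrant)" using f x sub by (auto simp: differentiable_on_def)
  then have d: "(f has_derivative frechet_derivative f (at x within quadrant)) (at x within quadrant)" by (simp add: frechet_derivative_works)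
  let ?f' = "frechet_derivative f (at x within quadrant)"
  have l: "linear ?f'" using d has_derivative_linear by blast
  have "?f' v = (\<Sum>\<alpha>\<in>UNIV. fst v $ \<alpha> * partial_on quadrant (axis \<alpha> 1, 0) f x)
    + (\<Sum>\<alpha>\<in>UNIV. snd v $ \<alpha> * partial_on quadrant (0, axis \<alpha> 1) f x)" for v
  proof -
    have "v = (\<Sum>\<alpha>\<in>UNIV. (fst v $ \<alpha>) *\<^sub>R (axis \<alpha> 1, 0)) + (\<Sum>\<alpha>\<in>UNIV. (snd v $ \<alpha>) *\<^sub>R (0, axis \<alpha> 1))"
      by (rule prod_eqI) (simp_all add: fst_sum snd_sum vec_expansion[symmetric])
    then have "?f' v = ?f' ((\<Sum>\<alpha>\<in>UNIV. (fst v $ \<alpha>) *\<^sub>R (axis \<alpha> 1, 0)) + (\<Sum>\<alpha>\<in>UNIV. (snd v $ \<alpha>) *\<^sub>R (0, axis \<alpha> 1)))" by simp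
    then show ?thesis
      by (simp only: linear_add[OF l] linear_sum[OF l] linear_scale[OF l] partial_on_def real_scaleR_def)
  qed
  then have "?f' = (\<lambda>v. (\<Sum>\<alpha>\<in>UNIV. fst v $ \<alpha> * partial_on quadrant (axis \<alpha> 1, 0) f x)
    + (\<Sum>\<alpha>\<in>UNIV. snd v $ \<alpha> * partial_on quadrant (0, axis \<alpha> 1) f x))" by blast
  with d show ?thesis unfolding at by simp
qed

lemma rpow_le:
  assumes "0 \<le> a" "a \<le> R" "1 \<le> R" "0 \<le> r" shows "rpow a r \<le> R powr r"
  using assms by (auto simp: rpow_def intro: powr_mono2)

text \<open>The properties of \<open>G\<close> on which the difference estimate rests: convexity, monotonicity in each variable (nonnegative first
  derivatives), and growth of order \<open>q - 1\<close> of the first derivatives and \<open>q - 2\<close> of the second derivatives in \<open>\<xi>\<close>.\<close>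

locale convex_integrand =
  fixes G :: "(real^'m) \<times> (real^'m) \<Rightarrow> real" and p q L1 \<epsilon> :: real
  assumes q: "2 \<le> q" "q < p" and eps: "0 < \<epsilon>" "\<epsilon> \<le> 1"
    and convex_G: "strictly_convex_on quadrant G" and G_nonneg: "\<And>s \<xi>. s \<in> orthant \<Longrightarrow> \<xi> \<in> orthant \<Longrightarrow> 0 \<le> G (s, \<xi>)"
    and C2_G: "Ck_on 2 quadrant G" and L1: "L1 > 1"
    and bounds: "\<And>\<alpha> \<beta> s \<xi>. s \<in> orthant \<Longrightarrow> \<xi> \<in> orthant \<Longrightarrow>
        0 \<le> d_xi \<alpha> G (s, \<xi>) \<and>
        d_xi \<alpha> G (s, \<xi>) \<le> L1 * (rpow (norm s) (q - 1) + rpow (norm \<xi>) (q - 1)) \<and>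
        0 \<le> d_s \<alpha> G (s, \<xi>) \<and>
        d_s \<alpha> G (s, \<xi>) \<le> L1 * (rpow (norm s) (q - 1) + rpow (norm \<xi>) (q - 1)) \<and>
        \<bar>d_xi \<beta> (d_xi \<alpha> G) (s, \<xi>)\<bar> \<le> L1 * (rpow (norm s) (q - 2) + rpow (norm \<xi>) (q - 2))"
begin

lemma G_differentiable: "G differentiable_on quadrant" "d_xi \<alpha> G differentiable_on quadrant"
proof -
  have c: "Ck_on (Suc (Suc 0)) quadrant G" using C2_G by (simp add: numeral_2_eq_2)
  show "G differentiable_on quadrant" using c by simp
  have "(0, axis \<alpha> 1) \<in> (Basis :: ((real^'m) \<times> (real^'m)) set)" by (auto simp: Basis_prod_def axis_in_Basis_iff)
  then show "d_xi \<alpha> G differentiable_on quadrant" using c unfolding d_xi_def by (auto simp del: Ck_on.simps(1))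
qed

lemma G_derivative:
  assumes "x \<in> pos_orthant \<times> pos_orthant"
  shows "(G has_derivative (\<lambda>v. (\<Sum>\<alpha>\<in>UNIV. fst v $ \<alpha> * d_s \<alpha> G x) + (\<Sum>\<alpha>\<in>UNIV. snd v $ \<alpha> * d_xi \<alpha> G x))) (at x)"
  using has_derivative_on_positive[OF G_differentiable(1) assms] by (simp add: d_s_def d_xi_def)

lemma segment_positive:
  assumes "a \<in> pos_orthant" "b \<in> pos_orthant" "0 \<le> t" "t \<le> 1" shows "a + t *\<^sub>R (b - a) \<in> (pos_orthant :: (real^'m) set)"
proof -
  have "(1 - t) *\<^sub>R a + t *\<^sub>R b \<in> pos_orthant" using convex_positive assms by (auto simp: convex_def)
  then show ?thesis by (simp add: algebra_simps)
qed

lemma G_line_derivative: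
  assumes "a \<in> pos_orthant" "b \<in> pos_orthant" "a' \<in> pos_orthant" "b' \<in> pos_orthant" "0 \<le> t" "t \<le> 1"
  shows "((\<lambda>t. G (a + t *\<^sub>R (b - a), a' + t *\<^sub>R (b' - a'))) has_real_derivative
    (\<Sum>\<alpha>\<in>UNIV. (b - a) $ \<alpha> * d_s \<alpha> G (a + t *\<^sub>R (b - a), a' + t *\<^sub>R (b' - a')))
    + (\<Sum>\<alpha>\<in>UNIV. (b' - a') $ \<alpha> * d_xi \<alpha> G (a + t *\<^sub>R (b - a), a' + t *\<^sub>R (b' - a')))) (at t)"
proof -
  let ?x = "(a + t *\<^sub>R (b - a), a' + t *\<^sub>R (b' - a'))"
  have x: "?x \<in> pos_orthant \<times> pos_orthant" using assms segment_positive by auto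
  have "((\<lambda>t. (a + t *\<^sub>R (b - a), a' + t *\<^sub>R (b' - a'))) has_derivative (\<lambda>r. (r *\<^sub>R (b - a), r *\<^sub>R (b' - a')))) (at t)"
    by (auto intro!: derivative_eq_intros)
  from has_derivative_compose[OF this G_derivative[OF x]]
  show ?thesis unfolding has_field_derivative_def
    by (rule has_derivative_eq_rhs) (auto simp: fun_eq_iff sum_distrib_left distrib_left mult_ac)
qed

lemma G_mean_value:
  assumes "a \<in> pos_orthant" "b \<in> pos_orthant" "a' \<in> pos_orthant" "b' \<in> pos_orthant"
  obtains t where "0 \<le> t" "t \<le> 1" "G (b, b') - G (a, a') =
    (\<Sum>\<alpha>\<in>UNIV. (b - a) $ \<alpha> * d_s \<alpha> G (a + t *\<^sub>R (b - a), a' + t *\<^sub>R (b' - a')))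
    + (\<Sum>\<alpha>\<in>UNIV. (b' - a') $ \<alpha> * d_xi \<alpha> G (a + t *\<^sub>R (b - a), a' + t *\<^sub>R (b' - a')))"
proof -
  obtain t where "0 < t" "t < 1" "G (a + 1 *\<^sub>R (b - a), a' + 1 *\<^sub>R (b' - a')) - G (a + 0 *\<^sub>R (b - a), a' + 0 *\<^sub>R (b' - a')) = (1 - 0) *
    ((\<Sum>\<alpha>\<in>UNIV. (b - a) $ \<alpha> * d_s \<alpha> G (a + t *\<^sub>R (b - a), a' + t *\<^sub>R (b' - a')))
    + (\<Sum>\<alpha>\<in>UNIV. (b' - a') $ \<alpha> * d_xi \<alpha> G (a + t *\<^sub>R (b - a), a' + t *\<^sub>R (b' - a'))))"
    using MVT2[OF zero_less_one G_line_derivative[OF assms]] by blast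
  then show thesis using that[of t] by simp
qed

text \<open>The first derivatives are nonnegative along the segment.\<close>

lemma G_mono:
  assumes "a \<in> pos_orthant" "b \<in> pos_orthant" "a' \<in> pos_orthant" "b' \<in> pos_orthant" "\<And>\<alpha>. a $ \<alpha> \<le> b $ \<alpha>" "\<And>\<alpha>. a' $ \<alpha> \<le> b' $ \<alpha>"
  shows "G (a, a') \<le> G (b, b')"
proof -
  obtain t where t: "0 \<le> t" "t \<le> 1" "G (b, b') - G (a, a') =
    (\<Sum>\<alpha>\<in>UNIV. (b - a) $ \<alpha> * d_s \<alpha> G (a + t *\<^sub>R (b - a), a' + t *\<^sub>R (b' - a')))
    + (\<Sum>\<alpha>\<in>UNIV. (b' - a') $ \<alpha> * d_xi \<alpha> G (a + t *\<^sub>R (b - a), a' + t *\<^sub>R (b' - a')))"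
    by (rule G_mean_value[OF assms(1-4)])
  have "a + t *\<^sub>R (b - a) \<in> orthant" "a' + t *\<^sub>R (b' - a') \<in> orthant"
    using segment_positive assms t positive_orthant by blast+
  then have "0 \<le> G (b, b') - G (a, a')" unfolding t(3)
    using bounds assms(5,6) by (intro add_nonneg_nonneg sum_nonneg mult_nonneg_nonneg) auto
  then show ?thesis by simp
qed

lemma first_derivative_le:
  assumes "s \<in> orthant" "\<xi> \<in> orthant" "norm s \<le> R" "norm \<xi> \<le> R" "1 \<le> R"
  shows "\<bar>d_s \<alpha> G (s, \<xi>)\<bar> \<le> 2 * L1 * R powr (q - 1)" "\<bar>d_xi \<alpha> G (s, \<xi>)\<bar> \<le> 2 * L1 * R powr (q - 1)"
    "\<bar>d_xi \<beta> (d_xi \<alpha> G) (s, \<xi>)\<bar> \<le> 2 * L1 * R powr (q - 2)"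
proof -
  have r: "rpow (norm s) (q - 1) + rpow (norm \<xi>) (q - 1) \<le> 2 * R powr (q - 1)"
    "rpow (norm s) (q - 2) + rpow (norm \<xi>) (q - 2) \<le> 2 * R powr (q - 2)"
    using rpow_le[of "norm s" R "q - 1"] rpow_le[of "norm \<xi>" R "q - 1"] rpow_le[of "norm s" R "q - 2"] rpow_le[of "norm \<xi>" R "q - 2"] assms q by auto
  have "L1 * (rpow (norm s) (q - 1) + rpow (norm \<xi>) (q - 1)) \<le> L1 * (2 * R powr (q - 1))"
    "L1 * (rpow (norm s) (q - 2) + rpow (norm \<xi>) (q - 2)) \<le> L1 * (2 * R powr (q - 2))"
    using r L1 by (auto intro!: mult_left_mono)
  then show "\<bar>d_s \<alpha> G (s, \<xi>)\<bar> \<le> 2 * L1 * R powr (q - 1)" "\<bar>d_xi \<alpha> G (s, \<xi>)\<bar> \<le> 2 * L1 * R powr (q - 1)"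
    "\<bar>d_xi \<beta> (d_xi \<alpha> G) (s, \<xi>)\<bar> \<le> 2 * L1 * R powr (q - 2)"
    using bounds[OF assms(1,2), of \<alpha> \<beta>] by auto
qed

lemma norm_segment_le:
  fixes a b :: "'a::real_normed_vector"
  assumes "0 \<le> t" "t \<le> 1" "norm a \<le> R" "norm b \<le> R" shows "norm (a + t *\<^sub>R (b - a)) \<le> R"
proof -
  have "a + t *\<^sub>R (b - a) = (1 - t) *\<^sub>R a + t *\<^sub>R b" by (simp add: algebra_simps)
  then have "norm (a + t *\<^sub>R (b - a)) \<le> (1 - t) * norm a + t * norm b"
    using norm_triangle_ineq[of "(1 - t) *\<^sub>R a" "t *\<^sub>R b"] assms by simp
  also have "\<dots> \<le> (1 - t) * R + t * R" using assms by (intro add_mono mult_left_mono) auto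
  finally show ?thesis by (simp add: algebra_simps)
qed

text \<open>Integrate the bound on the first derivatives along the segment from the vector of ones; the bound is stated with a
  common radius \<open>R\<close> so that both arguments can be dominated at once.\<close>

lemma G_growth:
  obtains C where "C \<ge> 0" "\<And>s \<xi> R. s \<in> pos_orthant \<Longrightarrow> \<xi> \<in> pos_orthant \<Longrightarrow> 1 \<le> R \<Longrightarrow> norm s \<le> R \<Longrightarrow> norm \<xi> \<le> R \<Longrightarrow> G (s, \<xi>) \<le> C * R powr q"
proof -
  let ?m = "real CARD('m)"
  let ?one = "(\<chi> \<alpha>. 1) :: real^'m"
  have m: "?m \<ge> 1" by (simp add: Suc_leI)
  have one: "?one \<in> pos_orthant" by (simp add: pos_orthant_def)
  have n1: "norm ?one \<le> ?m" using norm_le_l1_cart[of ?one] by simp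
  define C where "C = \<bar>G (?one, ?one)\<bar> + 8 * ?m * L1 * (1 + ?m) powr q"
  have "C \<ge> 0" using L1 by (simp add: C_def)
  moreover have "G (s, \<xi>) \<le> C * R powr q" if h: "s \<in> pos_orthant" "\<xi> \<in> pos_orthant" "1 \<le> R" "norm s \<le> R" "norm \<xi> \<le> R" for s \<xi> R
  proof -
    let ?R = "(1 + ?m) * R"
    have R1: "1 \<le> ?R" using h(3) m mult_mono[of 1 "1 + ?m" 1 R] by simp
    have R2: "R \<le> ?R" using h(3) m mult_right_mono[of 1 "1 + ?m" R] by simp
    have R3: "?m \<le> ?R"
    proof -
      have "?m * 1 \<le> ?m * R" by (intro mult_left_mono h) simp
      moreover have "?R = R + ?m * R" by (simp add: distrib_right)
      ultimately show ?thesis using h(3) by linarith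
    qed
    obtain t where t: "0 \<le> t" "t \<le> 1" "G (s, \<xi>) - G (?one, ?one) =
      (\<Sum>\<alpha>\<in>UNIV. (s - ?one) $ \<alpha> * d_s \<alpha> G (?one + t *\<^sub>R (s - ?one), ?one + t *\<^sub>R (\<xi> - ?one)))
      + (\<Sum>\<alpha>\<in>UNIV. (\<xi> - ?one) $ \<alpha> * d_xi \<alpha> G (?one + t *\<^sub>R (s - ?one), ?one + t *\<^sub>R (\<xi> - ?one)))"
      by (rule G_mean_value[OF one h(1) one h(2)])
    let ?x = "?one + t *\<^sub>R (s - ?one)" and ?y = "?one + t *\<^sub>R (\<xi> - ?one)"
    have o: "?x \<in> orthant" "?y \<in> orthant" using segment_positive one h t positive_orthant by blast+
    have nR: "norm s \<le> ?R" "norm \<xi> \<le> ?R" "norm ?one \<le> ?R" using h(4,5) R2 R3 n1 by linarith+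
    note nx = norm_segment_le[OF t(1,2) nR(3,1)] norm_segment_le[OF t(1,2) nR(3,2)]
    note fd = first_derivative_le[OF o nx R1]
    have c: "\<bar>(s - ?one) $ \<alpha>\<bar> \<le> 2 * ?R" "\<bar>(\<xi> - ?one) $ \<alpha>\<bar> \<le> 2 * ?R" for \<alpha>
    proof -
      have "\<bar>s $ \<alpha>\<bar> \<le> ?R" "\<bar>\<xi> $ \<alpha>\<bar> \<le> ?R"
        using component_le_norm_cart[of s \<alpha>] component_le_norm_cart[of \<xi> \<alpha>] h(4,5) R2 by linarith+
      then have "\<bar>s $ \<alpha> - 1\<bar> \<le> 2 * ?R" "\<bar>\<xi> $ \<alpha> - 1\<bar> \<le> 2 * ?R" using R1 by linarith+
      then show "\<bar>(s - ?one) $ \<alpha>\<bar> \<le> 2 * ?R" "\<bar>(\<xi> - ?one) $ \<alpha>\<bar> \<le> 2 * ?R" by simp_all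
    qed
    have b1: "(s - ?one) $ \<alpha> * d_s \<alpha> G (?x, ?y) \<le> 2 * ?R * (2 * L1 * ?R powr (q - 1))" for \<alpha>
      using mult_mono[OF c(1)[of \<alpha>] fd(1)[of \<alpha>]] R1 abs_le_D1[of "(s - ?one) $ \<alpha> * d_s \<alpha> G (?x, ?y)"] by (auto simp: abs_mult)
    have b2: "(\<xi> - ?one) $ \<alpha> * d_xi \<alpha> G (?x, ?y) \<le> 2 * ?R * (2 * L1 * ?R powr (q - 1))" for \<alpha>
      using mult_mono[OF c(2)[of \<alpha>] fd(2)[of \<alpha>]] R1 abs_le_D1[of "(\<xi> - ?one) $ \<alpha> * d_xi \<alpha> G (?x, ?y)"] by (auto simp: abs_mult)
    have "G (s, \<xi>) - G (?one, ?one) \<le> (\<Sum>\<alpha>\<in>(UNIV::'m set). 2 * ?R * (2 * L1 * ?R powr (q - 1))) + (\<Sum>\<alpha>\<in>(UNIV::'m set). 2 * ?R * (2 * L1 * ?R powr (q - 1)))"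
      unfolding t(3) by (intro add_mono sum_mono b1 b2)
    also have "\<dots> = 8 * ?m * L1 * (?R * ?R powr (q - 1))" by simp
    also have "?R * ?R powr (q - 1) = ?R powr q" using R1 by (simp add: powr_mult_base)
    also have "\<dots> = (1 + ?m) powr q * R powr q" using h m by (simp add: powr_mult)
    finally have "G (s, \<xi>) \<le> \<bar>G (?one, ?one)\<bar> * 1 + 8 * ?m * L1 * ((1 + ?m) powr q * R powr q)" by simp
    also have "\<dots> \<le> \<bar>G (?one, ?one)\<bar> * R powr q + 8 * ?m * L1 * ((1 + ?m) powr q * R powr q)"
      using h(3) q L1 by (intro add_mono mult_left_mono ge_one_powr_ge_zero) auto
    finally show ?thesis by (simp add: C_def algebra_simps)
  qed
  ultimately show thesis using that by blast
qed

text \<open>Second-order Taylor expansion in \<open>\<xi>\<close> alone; the remainder is controlled by the upper bound on the second derivatives.\<close>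

lemma G_Taylor:
  assumes s: "s \<in> pos_orthant" and a: "a \<in> pos_orthant" and b: "b \<in> pos_orthant" and R: "1 \<le> R" "norm s \<le> R" "norm a \<le> R" "norm b \<le> R"
  shows "G (s, b) \<le> G (s, a) + (\<Sum>\<alpha>\<in>UNIV. (b - a) $ \<alpha> * d_xi \<alpha> G (s, a))
    + (real CARD('m))\<^sup>2 * L1 * R powr (q - 2) * (norm (b - a))\<^sup>2"
proof -
  let ?m = "real CARD('m)"
  let ?d = "b - a"
  define x where "x t = (s, a + t *\<^sub>R ?d)" for t
  define d1 where "d1 t = (\<Sum>\<alpha>\<in>UNIV. ?d $ \<alpha> * d_xi \<alpha> G (x t))" for t
  define d2 where "d2 t = (\<Sum>\<alpha>\<in>UNIV. ?d $ \<alpha> * (\<Sum>\<beta>\<in>UNIV. ?d $ \<beta> * d_xi \<beta> (d_xi \<alpha> G) (x t)))" for t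
  have x: "x t \<in> pos_orthant \<times> pos_orthant" if "0 \<le> t" "t \<le> 1" for t using s segment_positive[OF a b that] by (simp add: x_def)
  have D1: "((\<lambda>t. G (x t)) has_real_derivative d1 t) (at t)" if t: "0 \<le> t" "t \<le> 1" for t
    using G_line_derivative[OF s s a b t] by (simp add: x_def d1_def)
  have xd: "(x has_derivative (\<lambda>r. (0, r *\<^sub>R ?d))) (at t)" for t
    unfolding x_def[abs_def] by (auto intro!: derivative_eq_intros)
  have D2: "(d1 has_real_derivative d2 t) (at t)" if t: "0 \<le> t" "t \<le> 1" for t
  proof -
    have dd: "partial_on quadrant (0, axis \<beta> 1) f = d_xi \<beta> f" for \<beta> and f :: "(real^'m) \<times> (real^'m) \<Rightarrow> real"
      by (simp add: d_xi_def)
    have "((\<lambda>t. d_xi \<alpha> G (x t)) has_real_derivative (\<Sum>\<beta>\<in>UNIV. ?d $ \<beta> * d_xi \<beta> (d_xi \<alpha> G) (x t))) (at t)" for \<alpha>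
      using has_derivative_compose[OF xd has_derivative_on_positive[OF G_differentiable(2) x[OF t], of \<alpha>]]
      unfolding has_field_derivative_def
      by (rule has_derivative_eq_rhs) (auto simp: fun_eq_iff sum_distrib_left dd mult_ac)
    then have "((\<lambda>t. ?d $ \<alpha> * d_xi \<alpha> G (x t)) has_real_derivative ?d $ \<alpha> * (\<Sum>\<beta>\<in>UNIV. ?d $ \<beta> * d_xi \<beta> (d_xi \<alpha> G) (x t))) (at t)" for \<alpha>
      by (rule DERIV_cmult)
    then show ?thesis unfolding d1_def[abs_def] d2_def by (rule DERIV_sum)
  qed
  define df where "df k = (if k = 0 then (\<lambda>t. G (x t)) else if k = 1 then d1 else d2)" for k :: nat
  have "\<exists>t>0. t < 1 \<and> G (x 1) = (\<Sum>k<2. df k 0 / fact k * 1 ^ k) + df 2 t / fact 2 * 1 ^ 2"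
  proof (rule Maclaurin)
    show "\<forall>k t. k < 2 \<and> 0 \<le> t \<and> t \<le> 1 \<longrightarrow> (df k has_real_derivative df (Suc k) t) (at t)"
    proof (intro allI impI)
      fix k t assume h: "(k::nat) < 2 \<and> 0 \<le> (t::real) \<and> t \<le> 1"
      then have "k = 0 \<or> k = 1" by auto
      then show "(df k has_real_derivative df (Suc k) t) (at t)" using D1[of t] D2[of t] h by (auto simp: df_def)
    qed
  qed (auto simp: df_def)
  then obtain t where t: "0 < t" "t < 1" "G (x 1) = G (x 0) + d1 0 + d2 t / 2"
    by (auto simp: df_def numeral_2_eq_2)
  have o: "s \<in> orthant" "a + t *\<^sub>R ?d \<in> orthant" using x[of t] t positive_orthant by (auto simp: x_def)
  have n: "norm (a + t *\<^sub>R ?d) \<le> R" using norm_segment_le[OF _ _ R(3,4), of t] t by simp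
  have "?d $ \<alpha> * (\<Sum>\<beta>\<in>UNIV. ?d $ \<beta> * d_xi \<beta> (d_xi \<alpha> G) (x t)) \<le> norm ?d * (?m * (norm ?d * (2 * L1 * R powr (q - 2))))" for \<alpha>
  proof -
    have "\<bar>\<Sum>\<beta>\<in>UNIV. ?d $ \<beta> * d_xi \<beta> (d_xi \<alpha> G) (x t)\<bar> \<le> (\<Sum>\<beta>\<in>(UNIV::'m set). norm ?d * (2 * L1 * R powr (q - 2)))"
    proof (rule order_trans[OF sum_abs sum_mono])
      fix \<beta>
      show "\<bar>?d $ \<beta> * d_xi \<beta> (d_xi \<alpha> G) (x t)\<bar> \<le> norm ?d * (2 * L1 * R powr (q - 2))"
        unfolding abs_mult x_def
        by (intro mult_mono component_le_norm_cart first_derivative_le(3)[OF o R(2) n R(1)]) auto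
    qed
    also have "\<dots> = ?m * (norm ?d * (2 * L1 * R powr (q - 2)))" by simp
    finally have "\<bar>?d $ \<alpha> * (\<Sum>\<beta>\<in>UNIV. ?d $ \<beta> * d_xi \<beta> (d_xi \<alpha> G) (x t))\<bar> \<le> norm ?d * (?m * (norm ?d * (2 * L1 * R powr (q - 2))))"
      unfolding abs_mult by (intro mult_mono component_le_norm_cart) auto
    then show ?thesis by simp
  qed
  then have "d2 t \<le> (\<Sum>\<alpha>\<in>(UNIV::'m set). norm ?d * (?m * (norm ?d * (2 * L1 * R powr (q - 2)))))"
    unfolding d2_def by (rule sum_mono)
  also have "\<dots> = 2 * (?m\<^sup>2 * L1 * R powr (q - 2) * (norm ?d)\<^sup>2)" by (simp add: power2_eq_square)
  finally have "d2 t / 2 \<le> ?m\<^sup>2 * L1 * R powr (q - 2) * (norm ?d)\<^sup>2" by simp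
  then show ?thesis using t(3) by (simp add: x_def d1_def)
qed

end

section \<open>Power inequalities\<close>

lemma powr_superadditive:
  fixes x y k :: real
  assumes "x \<ge> 0" "y \<ge> 0" "k \<ge> 1" shows "x powr k + y powr k \<le> (x + y) powr k"
proof (cases "x + y = 0")
  case True
  then have "x = 0" "y = 0" using assms by linarith+
  then show ?thesis by simp
next
  case False
  have *: "z powr k \<le> z * (x + y) powr (k - 1)" if "0 \<le> z" "z \<le> x + y" for z
  proof (cases "z = 0")
    case True then show ?thesis by simp
  next
    case False
    then have "z powr k = z * z powr (k - 1)" using that by (simp add: powr_mult_base)
    also have "\<dots> \<le> z * (x + y) powr (k - 1)" using that assms by (intro mult_left_mono powr_mono2) auto
    finally show ?thesis .
  qed
  have "x powr k + y powr k \<le> (x + y) * (x + y) powr (k - 1)"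
    using *[of x] *[of y] assms by (simp add: distrib_right)
  also have "\<dots> = (x + y) powr k" using assms by (simp add: powr_mult_base)
  finally show ?thesis .
qed

lemma powr_midpoint:
  fixes x y k :: real
  assumes "x \<ge> 0" "y \<ge> 0" "k \<ge> 1" shows "((x + y) / 2) powr k \<le> (x powr k + y powr k) / 2"
  using powr_tangent[of x "(x + y) / 2" k] powr_tangent[of y "(x + y) / 2" k] assms
  by (simp add: field_simps)

text \<open>The parallelogram identity gives the case \<open>p = 2\<close>; the power \<open>p/2 \<ge> 1\<close> of it is superadditive and convex. The second term on
  the left is the quantitative gain on which the whole estimate rests.\<close>

lemma Clarkson:
  fixes a b :: "'a::real_inner"
  assumes p: "p \<ge> 2"
  shows "norm ((1/2) *\<^sub>R (a + b)) powr p + norm ((1/2) *\<^sub>R (a - b)) powr p \<le> (norm a powr p + norm b powr p) / 2"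
proof -
  have s: "(norm z)\<^sup>2 powr (p/2) = norm z powr p" for z :: 'a
    by (cases "z = 0") (auto simp: powr_powr powr_half_sqrt_powr simp flip: powr_numeral)
  have par: "(norm ((1/2) *\<^sub>R (a + b)))\<^sup>2 + (norm ((1/2) *\<^sub>R (a - b)))\<^sup>2 = ((norm a)\<^sup>2 + (norm b)\<^sup>2) / 2"
    by (simp add: power2_norm_eq_inner inner_add_left inner_add_right inner_diff_left inner_diff_right inner_commute power_mult_distrib field_simps)
  have "norm ((1/2) *\<^sub>R (a + b)) powr p + norm ((1/2) *\<^sub>R (a - b)) powr p \<le> (((norm a)\<^sup>2 + (norm b)\<^sup>2) / 2) powr (p/2)"
    unfolding s[symmetric] par[symmetric] by (rule powr_superadditive) (use p in auto)
  also have "\<dots> \<le> ((norm a)\<^sup>2 powr (p/2) + (norm b)\<^sup>2 powr (p/2)) / 2" by (rule powr_midpoint) (use p in auto)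
  finally show ?thesis by (simp only: s)
qed

text \<open>Convexity at \<open>1 + y\<close> gives \<open>(1+y)\<^sup>k - 1 \<le> k y (1+y)\<^sup>k\<^sup>-\<^sup>1\<close>, and the last power differs from \<open>1\<close> by a multiple of \<open>y\<close>
  because \<open>1 + y\<close> stays in \<open>{1/4..9/4}\<close>.\<close>

lemma powr_quadratic_upper:
  fixes k y :: real
  assumes k: "k \<ge> 1" and y: "-3/4 \<le> y" "y \<le> 5/4"
  shows "(1 + y) powr k \<le> 1 + k * y + k * ((k - 1) * (16 * 3 powr k)) * y\<^sup>2"
proof -
  let ?C = "(k - 1) * (16 * 3 powr k)"
  have C: "?C \<ge> 0" using k by simp
  have lip: "\<bar>(1 + y) powr (k - 1) - 1 powr (k - 1)\<bar> \<le> ?C * \<bar>(1 + y) - 1\<bar>"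
  proof -
    have "norm ((1 + y) powr (k - 1) - 1 powr (k - 1)) \<le> ?C * norm ((1 + y) - 1)"
    proof (rule field_differentiable_bound[of "{1/4..9/4}" _ "\<lambda>t. (k - 1) * t powr (k - 2)"])
      fix t :: real assume t: "t \<in> {1/4..9/4}"
      have "((\<lambda>t. t powr (k - 1)) has_real_derivative (k - 1) * t powr (k - 1 - 1)) (at t)"
        using t by (intro has_real_derivative_powr) auto
      then show "((\<lambda>t. t powr (k - 1)) has_real_derivative (k - 1) * t powr (k - 2)) (at t within {1/4..9/4})"
        by (simp add: has_field_derivative_at_within)
      have "t powr (k - 2) = t powr k * (1 / t\<^sup>2)" using t by (simp add: powr_diff)
      also have "\<dots> \<le> 3 powr k * 16"
      proof (intro mult_mono powr_mono2)
        have "(1/4)\<^sup>2 \<le> t\<^sup>2" using t by (intro power_mono) auto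
        then show "1 / t\<^sup>2 \<le> 16" using t by (simp add: power2_eq_square field_simps)
      qed (use t k in auto)
      finally have "t powr (k - 2) \<le> 16 * 3 powr k" by simp
      then show "norm ((k - 1) * t powr (k - 2)) \<le> ?C" using k by (simp add: abs_mult mult_left_mono)
    qed (use y in auto)
    then show ?thesis by simp
  qed
  have "(1 + y) powr k + k * (1 + y) powr (k - 1) * (1 - (1 + y)) \<le> 1 powr k"
    by (rule powr_tangent) (use y k in auto)
  then have "(1 + y) powr k \<le> 1 + k * y + k * (y * ((1 + y) powr (k - 1) - 1))" by (simp add: algebra_simps)
  also have "y * ((1 + y) powr (k - 1) - 1) \<le> \<bar>y\<bar> * (?C * \<bar>y\<bar>)"
  proof -
    have "\<bar>y * ((1 + y) powr (k - 1) - 1)\<bar> \<le> \<bar>y\<bar> * (?C * \<bar>y\<bar>)"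
      unfolding abs_mult using lip by (intro mult_left_mono) auto
    then show ?thesis by simp
  qed
  also have "\<bar>y\<bar> * (?C * \<bar>y\<bar>) = ?C * y\<^sup>2" by (simp add: power2_eq_square)
  finally show ?thesis using k by (simp add: mult_left_mono mult.assoc)
qed

text \<open>Write \<open>norm (g + r w)\<^sup>2 = norm g\<^sup>2 (1 + y)\<close> with \<open>y\<close> of order \<open>r d\<close> and expand the power \<open>p/2\<close>. The hypothesis
  \<open>norm w \<le> d norm g\<close> makes every error relative to \<open>norm g powr p\<close>.\<close>

lemma norm_powr_quadratic_upper:
  fixes g w :: "'a::real_inner"
  assumes p: "p \<ge> 2" and w: "norm w \<le> d * norm g" and d: "0 \<le> d" "d \<le> 1/4"
  obtains l where "\<And>r. \<bar>r\<bar> \<le> 2 \<Longrightarrow>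
    norm (g + r *\<^sub>R w) powr p \<le> norm g powr p + l * r + (p + 7 * p * (p * (16 * 3 powr p))) * d\<^sup>2 * norm g powr p * r\<^sup>2"
proof (cases "g = 0")
  case True
  then have "w = 0" using w by simp
  then show ?thesis using that[of 0] True by simp
next
  case False
  define C where "C = p/2 * ((p/2 - 1) * (16 * 3 powr (p/2)))"
  have C: "0 \<le> C" "C \<le> p * (p * (16 * 3 powr p))"
  proof -
    show "0 \<le> C" unfolding C_def using p by simp
    show "C \<le> p * (p * (16 * 3 powr p))" unfolding C_def
      by (intro mult_mono powr_mono mult_nonneg_nonneg) (use p in simp_all)
  qed
  define e where "e = (g \<bullet> w) / (norm g)\<^sup>2"
  define f where "f = (norm w)\<^sup>2 / (norm g)\<^sup>2"
  have g: "norm g > 0" using False by simp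
  have e: "\<bar>e\<bar> \<le> d"
  proof -
    have "\<bar>g \<bullet> w\<bar> \<le> norm g * (d * norm g)" using Cauchy_Schwarz_ineq2[of g w] mult_left_mono[OF w norm_ge_zero[of g]] by linarith
    then show ?thesis using g by (simp add: e_def abs_divide divide_le_eq power2_eq_square mult_ac)
  qed
  have f: "0 \<le> f" "f \<le> d\<^sup>2"
  proof -
    have "(norm w)\<^sup>2 \<le> (d * norm g)\<^sup>2" using w by (intro power_mono) auto
    then show "f \<le> d\<^sup>2" using g by (simp add: f_def divide_le_eq power_mult_distrib)
  qed (simp add: f_def)
  have s: "(norm z)\<^sup>2 powr (p/2) = norm z powr p" for z :: 'a
    by (cases "z = 0") (auto simp: powr_powr simp flip: powr_numeral)
  show ?thesis
  proof (rule that[of "norm g powr p * (p * e)"])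
    fix r :: real assume r: "\<bar>r\<bar> \<le> 2"
    define y where "y = 2 * r * e + r\<^sup>2 * f"
    have sq: "(norm (g + r *\<^sub>R w))\<^sup>2 = (norm g)\<^sup>2 * (1 + y)"
    proof -
      have "(norm (g + r *\<^sub>R w))\<^sup>2 = (norm g)\<^sup>2 + 2 * r * (g \<bullet> w) + r\<^sup>2 * (norm w)\<^sup>2"
        unfolding power2_norm_eq_inner by (simp add: inner_add_left inner_add_right inner_commute power2_eq_square algebra_simps)
      then show ?thesis using g by (simp add: y_def e_def f_def field_simps)
    qed
    have rd: "\<bar>r\<bar> * d \<le> 1/2" using mult_mono[OF r d(2)] d by simp
    have ya: "\<bar>y\<bar> \<le> 5/2 * (\<bar>r\<bar> * d)"
    proof -
      have "\<bar>y\<bar> \<le> 2 * (\<bar>r\<bar> * \<bar>e\<bar>) + r\<^sup>2 * f" unfolding y_def using f by (intro order_trans[OF abs_triangle_ineq]) (simp add: abs_mult)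
      also have "\<dots> \<le> 2 * (\<bar>r\<bar> * d) + r\<^sup>2 * d\<^sup>2" using e f by (intro add_mono mult_left_mono) auto
      also have "r\<^sup>2 * d\<^sup>2 = (\<bar>r\<bar> * d) * (\<bar>r\<bar> * d)" by (simp add: power2_eq_square)
      also have "\<dots> \<le> 1/2 * (\<bar>r\<bar> * d)" using rd d by (intro mult_right_mono) auto
      finally show ?thesis by linarith
    qed
    \<comment> \<open>The constant rounds up \<open>25/4\<close>.\<close>
    have y2: "y\<^sup>2 \<le> 7 * (r\<^sup>2 * d\<^sup>2)"
    proof -
      have "y\<^sup>2 \<le> (5/2 * (\<bar>r\<bar> * d))\<^sup>2" using ya by (metis abs_ge_zero power2_abs power_mono)
      also have "\<dots> = 25/4 * (r\<^sup>2 * d\<^sup>2)" by (simp add: power_mult_distrib power2_eq_square)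
      also have "\<dots> \<le> 7 * (r\<^sup>2 * d\<^sup>2)" by (intro mult_right_mono) auto
      finally show ?thesis .
    qed
    have yl: "-3/4 \<le> y"
    proof -
      have "norm g * (1/2) \<le> norm (g + r *\<^sub>R w)"
      proof -
        have "norm (r *\<^sub>R w) \<le> \<bar>r\<bar> * (d * norm g)" using w by (simp add: mult_left_mono)
        also have "\<dots> \<le> 1/2 * norm g" using mult_right_mono[OF rd, of "norm g"] by (simp add: mult.assoc)
        finally show ?thesis using norm_diff_ineq[of g "r *\<^sub>R w"] by simp
      qed
      then have "(norm g * (1/2))\<^sup>2 \<le> (norm g)\<^sup>2 * (1 + y)" unfolding sq[symmetric] by (intro power_mono) auto
      then have "(norm g)\<^sup>2 * (1/4) \<le> (norm g)\<^sup>2 * (1 + y)" by (simp add: power_mult_distrib power2_eq_square)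
      then have "1/4 \<le> 1 + y" using g by (simp only: mult_le_cancel_left_pos zero_less_power)
      then show ?thesis by simp
    qed
    have yu: "y \<le> 5/4" using ya rd by linarith
    have "norm (g + r *\<^sub>R w) powr p = ((norm g)\<^sup>2 * (1 + y)) powr (p/2)" by (simp only: s[symmetric] sq)
    also have "\<dots> = norm g powr p * (1 + y) powr (p/2)" using yl by (simp add: powr_mult s)
    also have "\<dots> \<le> norm g powr p * (1 + p/2 * y + C * y\<^sup>2)"
      unfolding C_def by (intro mult_left_mono powr_quadratic_upper) (use p yl yu in auto)
    also have "\<dots> \<le> norm g powr p * (1 + p * e * r + (p + 7 * (p * (p * (16 * 3 powr p)))) * d\<^sup>2 * r\<^sup>2)"
    proof (intro mult_left_mono)
      have "p/2 * y = p * e * r + p/2 * (f * r\<^sup>2)" by (simp add: y_def algebra_simps)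
      also have "p/2 * (f * r\<^sup>2) \<le> p * (d\<^sup>2 * r\<^sup>2)" using f p by (intro mult_mono mult_right_mono) auto
      finally have 1: "p/2 * y \<le> p * e * r + p * (d\<^sup>2 * r\<^sup>2)" by simp
      have "C * y\<^sup>2 \<le> p * (p * (16 * 3 powr p)) * (7 * (r\<^sup>2 * d\<^sup>2))" using C y2 p by (intro mult_mono) auto
      with 1 show "1 + p/2 * y + C * y\<^sup>2 \<le> 1 + p * e * r + (p + 7 * (p * (p * (16 * 3 powr p)))) * d\<^sup>2 * r\<^sup>2"
        by (simp add: algebra_simps)
    qed auto
    finally show "norm (g + r *\<^sub>R w) powr p \<le> norm g powr p + norm g powr p * (p * e) * r + (p + 7 * p * (p * (16 * 3 powr p))) * d\<^sup>2 * norm g powr p * r\<^sup>2"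
      by (simp add: algebra_simps)
  qed
qed

section \<open>Regularised moduli\<close>

definition modulus :: "real \<Rightarrow> 'a::real_normed_vector \<Rightarrow> real" where
  "modulus \<epsilon> v = sqrt ((norm v)\<^sup>2 + \<epsilon>)"

text \<open>As the norm of a pair, the regularised modulus inherits convexity and the Lipschitz bound from the triangle inequality.\<close>

lemma modulus_eq_norm: "\<epsilon> \<ge> 0 \<Longrightarrow> modulus \<epsilon> v = norm (v, sqrt \<epsilon>)"
  by (simp add: modulus_def norm_Pair)

lemma modulus_squared: "\<epsilon> \<ge> 0 \<Longrightarrow> (modulus \<epsilon> v)\<^sup>2 = (norm v)\<^sup>2 + \<epsilon>"
  by (simp add: modulus_def)

lemma modulus_pos: "\<epsilon> > 0 \<Longrightarrow> modulus \<epsilon> v > 0"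
  by (simp add: modulus_def add_nonneg_pos)

lemma modulus_ge: "\<epsilon> \<ge> 0 \<Longrightarrow> norm v \<le> modulus \<epsilon> v"
  unfolding modulus_def by (rule real_le_rsqrt) simp

lemma modulus_le:
  assumes "0 \<le> \<epsilon>" "\<epsilon> \<le> 1" shows "modulus \<epsilon> v \<le> norm v + 1"
proof -
  have "modulus \<epsilon> v \<le> sqrt ((norm v + 1)\<^sup>2)" unfolding modulus_def
  proof (rule real_sqrt_le_mono)
    have "0 \<le> norm v" by simp
    then show "(norm v)\<^sup>2 + \<epsilon> \<le> (norm v + 1)\<^sup>2"
      unfolding power2_sum power_one mult_1_right using assms by linarith
  qed
  then show ?thesis by simp
qed

lemma modulus_Lipschitz: "\<epsilon> \<ge> 0 \<Longrightarrow> \<bar>modulus \<epsilon> v - modulus \<epsilon> w\<bar> \<le> norm (v - w)"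
  using norm_triangle_ineq3[of "(v, sqrt \<epsilon>)" "(w, sqrt \<epsilon>)"] by (simp add: modulus_eq_norm norm_Pair)

lemma modulus_midpoint:
  assumes "\<epsilon> \<ge> 0" shows "modulus \<epsilon> ((1/2) *\<^sub>R (v + w)) \<le> (modulus \<epsilon> v + modulus \<epsilon> w) / 2"
proof -
  have e: "((1/2) *\<^sub>R (v + w), sqrt \<epsilon>) = (1/2) *\<^sub>R ((v, sqrt \<epsilon>) + (w, sqrt \<epsilon>))"
    by (simp add: prod_eq_iff)
  have "norm ((1/2) *\<^sub>R (v + w), sqrt \<epsilon>) = 1/2 * norm ((v, sqrt \<epsilon>) + (w, sqrt \<epsilon>))"
    unfolding e norm_scaleR by simp
  also have "\<dots> \<le> 1/2 * (norm (v, sqrt \<epsilon>) + norm (w, sqrt \<epsilon>))"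
    by (intro mult_left_mono norm_triangle_ineq) simp
  finally have "norm ((1/2) *\<^sub>R (v + w), sqrt \<epsilon>) \<le> (norm (v, sqrt \<epsilon>) + norm (w, sqrt \<epsilon>)) / 2" by (simp only: times_divide_eq_left mult_1)
  then show ?thesis using assms by (simp add: modulus_eq_norm)
qed

text \<open>Concavity of the square root: \<open>sqrt (a\<^sup>2 + x) \<le> a + x / (2 a)\<close>. Dividing by \<open>a \<ge> norm g\<close> is harmless because
  \<open>(norm w)\<^sup>2 \<le> d\<^sup>2 (norm g)\<^sup>2\<close>.\<close>

lemma modulus_quadratic_upper:
  fixes g w :: "'a::real_inner"
  assumes e: "\<epsilon> > 0" and w: "norm w \<le> d * norm g" and d: "d \<ge> 0"
  shows "modulus \<epsilon> (g + r *\<^sub>R w) \<le> modulus \<epsilon> g + r * ((g \<bullet> w) / modulus \<epsilon> g) + r\<^sup>2 * (d\<^sup>2 * norm g)"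
proof -
  let ?a = "modulus \<epsilon> g"
  have a: "?a > 0" "norm g \<le> ?a" using modulus_pos[OF e] modulus_ge[of \<epsilon> g] e by auto
  have a2: "?a\<^sup>2 = (norm g)\<^sup>2 + \<epsilon>" using e by (simp add: modulus_def)
  define x where "x = 2 * r * (g \<bullet> w) + r\<^sup>2 * (norm w)\<^sup>2"
  have "(norm (g + r *\<^sub>R w))\<^sup>2 = (norm g)\<^sup>2 + x"
    unfolding power2_norm_eq_inner x_def by (simp add: inner_add_left inner_add_right inner_commute power2_eq_square algebra_simps)
  then have m: "(modulus \<epsilon> (g + r *\<^sub>R w))\<^sup>2 = ?a\<^sup>2 + x" using e a2 by (simp add: modulus_squared)
  have "modulus \<epsilon> (g + r *\<^sub>R w) \<le> ?a + x / (2 * ?a)"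
  proof (rule power2_le_imp_le)
    have x0: "?a\<^sup>2 + x \<ge> 0" using m by (metis zero_le_power2)
    then have "2 * ?a\<^sup>2 + x \<ge> 0" by (smt (verit) zero_le_power2)
    moreover have "?a + x / (2 * ?a) = (2 * ?a\<^sup>2 + x) / (2 * ?a)" using a by (simp add: field_simps power2_eq_square)
    ultimately show "0 \<le> ?a + x / (2 * ?a)" using a by simp
    have "2 * ?a * (x / (2 * ?a)) = x" using a by simp
    then have "(?a + x / (2 * ?a))\<^sup>2 = ?a\<^sup>2 + x + (x / (2 * ?a))\<^sup>2" unfolding power2_sum by linarith
    then show "(modulus \<epsilon> (g + r *\<^sub>R w))\<^sup>2 \<le> (?a + x / (2 * ?a))\<^sup>2" unfolding m by simp
  qed
  also have "x / (2 * ?a) = r * ((g \<bullet> w) / ?a) + r\<^sup>2 * ((norm w)\<^sup>2 / (2 * ?a))"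
    using a by (simp add: x_def field_simps)
  also have "(norm w)\<^sup>2 / (2 * ?a) \<le> d\<^sup>2 * norm g"
  proof -
    have "(norm w)\<^sup>2 \<le> (d * norm g)\<^sup>2" using w by (intro power_mono) auto
    also have "\<dots> = d\<^sup>2 * norm g * norm g" by (simp add: power_mult_distrib power2_eq_square)
    also have "\<dots> \<le> d\<^sup>2 * norm g * (2 * ?a)" using a d by (intro mult_left_mono) auto
    finally show ?thesis using a by (simp add: pos_divide_le_eq)
  qed
  finally show ?thesis by (simp add: mult_left_mono)
qed

definition moduli :: "real \<Rightarrow> ('a::real_normed_vector)^'m \<Rightarrow> real^'m" where
  "moduli \<epsilon> v = (\<chi> \<alpha>. modulus \<epsilon> (v $ \<alpha>))"

lemma moduli_pos: "\<epsilon> > 0 \<Longrightarrow> moduli \<epsilon> v \<in> pos_orthant"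
  by (simp add: moduli_def pos_orthant_def modulus_pos)

lemma norm_moduli_le:
  fixes v :: "('a::real_normed_vector)^'m"
  assumes "0 \<le> \<epsilon>" "\<epsilon> \<le> 1" "\<And>\<alpha>. norm (v $ \<alpha>) \<le> B" shows "norm (moduli \<epsilon> v) \<le> real CARD('m) * (B + 1)"
proof -
  have "norm (moduli \<epsilon> v) \<le> (\<Sum>\<alpha>\<in>UNIV. \<bar>moduli \<epsilon> v $ \<alpha>\<bar>)" by (rule norm_le_l1_cart)
  also have "\<dots> \<le> (\<Sum>\<alpha>\<in>(UNIV::'m set). B + 1)"
  proof (rule sum_mono)
    fix \<alpha>
    have "0 \<le> modulus \<epsilon> (v $ \<alpha>)" using assms by (simp add: modulus_def)
    then show "\<bar>moduli \<epsilon> v $ \<alpha>\<bar> \<le> B + 1" using modulus_le[OF assms(1,2), of "v $ \<alpha>"] assms(3)[of \<alpha>] by (simp add: moduli_def)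
  qed
  finally show ?thesis by simp
qed

lemma norm_le_sum_norm:
  fixes v :: "('a::real_normed_vector)^'m"
  shows "norm v \<le> (\<Sum>\<alpha>\<in>UNIV. norm (v $ \<alpha>))"
  unfolding norm_vec_def by (rule L2_set_le_sum) simp

text \<open>The two factors cancel the denominators of the linear terms, which then have opposite signs. This cancellation turns an
  error of first order in the shift into one of second order.\<close>

lemma perspective_two_sided:
  fixes f :: "real \<Rightarrow> real"
  assumes f: "\<And>r. \<bar>r\<bar> \<le> 2 \<Longrightarrow> f r \<le> a + l * r + M * r\<^sup>2" and c: "\<bar>c\<bar> \<le> 1/2" and M: "M \<ge> 0"
  shows "(1 - c) * f (1 / (1 - c)) + (1 + c) * f (- 1 / (1 + c)) \<le> 2 * a + 4 * M"
proof -
  have p: "1 - c \<ge> 1/2" "1 + c \<ge> 1/2" using c by auto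
  have i: "1 / (1 - c) \<le> 2" "1 / (1 + c) \<le> 2" using p by (auto simp: divide_le_eq)
  have r: "\<bar>1 / (1 - c)\<bar> \<le> 2" "\<bar>- 1 / (1 + c)\<bar> \<le> 2" using p i by (auto simp: abs_if)
  have 1: "(1 - c) * f (1 / (1 - c)) \<le> (1 - c) * (a + l * (1 / (1 - c)) + M * (1 / (1 - c))\<^sup>2)"
    using f[OF r(1)] p by (intro mult_left_mono) auto
  have 2: "(1 + c) * f (- 1 / (1 + c)) \<le> (1 + c) * (a + l * (- 1 / (1 + c)) + M * (- 1 / (1 + c))\<^sup>2)"
    using f[OF r(2)] p by (intro mult_left_mono) auto
  have e: "k * (a + l * (1 / k) + M * (1 / k)\<^sup>2) = k * a + l + M * (1 / k)" if "k > 0" for k l :: real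
    using that by (simp add: field_simps power2_eq_square)
  have e1: "(1 - c) * (a + l * (1 / (1 - c)) + M * (1 / (1 - c))\<^sup>2) = (1 - c) * a + l + M * (1 / (1 - c))"
    using e[of "1 - c" l] p by simp
  have e2: "(1 + c) * (a + l * (- 1 / (1 + c)) + M * (- 1 / (1 + c))\<^sup>2) = (1 + c) * a - l + M * (1 / (1 + c))"
    using e[of "1 + c" "- l"] p by simp
  have "M * (1 / (1 - c)) \<le> M * 2" "M * (1 / (1 + c)) \<le> M * 2" by (intro mult_left_mono i M)+
  with 1 2 show ?thesis unfolding e1 e2 by (simp add: algebra_simps)
qed

lemma powr_le_one_plus:
  fixes a b p q :: real
  assumes "0 \<le> a" "0 \<le> b" "0 \<le> q" "q \<le> p"
  shows "(1 + a + b) powr q \<le> 3 powr p * (1 + a powr p + b powr p)"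
proof -
  have p: "p \<ge> 0" using assms by simp
  have "(1 + a + b) powr q \<le> (1 + a + b) powr p" using assms by (intro powr_mono) auto
  also have "\<dots> \<le> (3 * max 1 (max a b)) powr p" using assms p by (intro powr_mono2) auto
  also have "\<dots> = 3 powr p * max 1 (max a b) powr p" using assms by (simp add: powr_mult)
  also have "\<dots> \<le> 3 powr p * (1 + a powr p + b powr p)"
    by (intro mult_left_mono) (auto simp: max_def)
  finally show ?thesis .
qed

section \<open>The energy density\<close>

context convex_integrand
begin

definition integrand :: "real^'m \<Rightarrow> ('a::euclidean_space)^'m \<Rightarrow> real" where
  "integrand s \<xi> = \<epsilon> * (\<Sum>\<alpha>\<in>UNIV. norm (\<xi> $ \<alpha>) powr p) + G (moduli \<epsilon> s, moduli \<epsilon> \<xi>)"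

lemma moduli_orthant: "moduli \<epsilon> v \<in> orthant"
  by (rule subsetD[OF positive_orthant moduli_pos[OF eps(1)]])

lemma integrand_nonneg: "0 \<le> integrand s \<xi>"
  unfolding integrand_def using eps
  by (intro add_nonneg_nonneg mult_nonneg_nonneg sum_nonneg G_nonneg moduli_orthant) auto

lemma G_midpoint:
  assumes "x \<in> quadrant" "y \<in> quadrant" shows "G ((1/2) *\<^sub>R (x + y)) \<le> (G x + G y) / 2"
proof (cases "x = y")
  case True
  then show ?thesis by (simp add: scaleR_2[symmetric])
next
  case False
  have "G ((1 - 1/2) *\<^sub>R x + (1/2) *\<^sub>R y) < (1 - 1/2) * G x + 1/2 * G y"
    using convex_G[unfolded strictly_convex_on_def, THEN conjunct2, rule_format, OF assms, of "1/2"] False by simp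
  then show ?thesis by (simp add: scaleR_add_right)
qed

text \<open>The regularised moduli are convex and \<open>G\<close> is nondecreasing and convex, so the \<open>G\<close>-part is midpoint convex; the \<open>p\<close>-power part
  contributes the gain of Clarkson's inequality.\<close>

lemma integrand_midpoint:
  "integrand ((1/2) *\<^sub>R (s + s')) ((1/2) *\<^sub>R (\<xi> + \<xi>')) + \<epsilon> * (\<Sum>\<alpha>\<in>UNIV. norm ((1/2) *\<^sub>R (\<xi> $ \<alpha> - \<xi>' $ \<alpha>)) powr p)
    \<le> (integrand s \<xi> + integrand s' \<xi>') / 2"
proof -
  have m: "moduli \<epsilon> v \<in> pos_orthant" for v :: "('c::real_normed_vector)^'m" by (rule moduli_pos[OF eps(1)])
  have half: "(1/2) *\<^sub>R (moduli \<epsilon> v + moduli \<epsilon> w) \<in> pos_orthant" for v w :: "('c::real_normed_vector)^'m"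
    using m[of v] m[of w] by (auto simp: pos_orthant_def intro: add_pos_pos)
  have "G (moduli \<epsilon> ((1/2) *\<^sub>R (s + s')), moduli \<epsilon> ((1/2) *\<^sub>R (\<xi> + \<xi>'))) \<le>
      G ((1/2) *\<^sub>R (moduli \<epsilon> s + moduli \<epsilon> s'), (1/2) *\<^sub>R (moduli \<epsilon> \<xi> + moduli \<epsilon> \<xi>'))"
  proof (rule G_mono[OF m half m half])
    show "moduli \<epsilon> ((1/2) *\<^sub>R (s + s')) $ \<alpha> \<le> ((1/2) *\<^sub>R (moduli \<epsilon> s + moduli \<epsilon> s')) $ \<alpha>" for \<alpha>
      using modulus_midpoint[of \<epsilon> "s $ \<alpha>" "s' $ \<alpha>"] eps by (simp add: moduli_def)
    show "moduli \<epsilon> ((1/2) *\<^sub>R (\<xi> + \<xi>')) $ \<alpha> \<le> ((1/2) *\<^sub>R (moduli \<epsilon> \<xi> + moduli \<epsilon> \<xi>')) $ \<alpha>" for \<alpha>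
      using modulus_midpoint[of \<epsilon> "\<xi> $ \<alpha>" "\<xi>' $ \<alpha>"] eps by (simp add: moduli_def)
  qed
  also have "\<dots> = G ((1/2) *\<^sub>R ((moduli \<epsilon> s, moduli \<epsilon> \<xi>) + (moduli \<epsilon> s', moduli \<epsilon> \<xi>')))" by simp
  also have "\<dots> \<le> (G (moduli \<epsilon> s, moduli \<epsilon> \<xi>) + G (moduli \<epsilon> s', moduli \<epsilon> \<xi>')) / 2"
    by (rule G_midpoint) (auto simp: moduli_orthant)
  finally have 1: "G (moduli \<epsilon> ((1/2) *\<^sub>R (s + s')), moduli \<epsilon> ((1/2) *\<^sub>R (\<xi> + \<xi>'))) \<le> (G (moduli \<epsilon> s, moduli \<epsilon> \<xi>) + G (moduli \<epsilon> s', moduli \<epsilon> \<xi>')) / 2" .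
  have "(\<Sum>\<alpha>\<in>UNIV. norm (((1/2) *\<^sub>R (\<xi> + \<xi>')) $ \<alpha>) powr p + norm ((1/2) *\<^sub>R (\<xi> $ \<alpha> - \<xi>' $ \<alpha>)) powr p) \<le> (\<Sum>\<alpha>\<in>UNIV. (norm (\<xi> $ \<alpha>) powr p + norm (\<xi>' $ \<alpha>) powr p) / 2)"
  proof (rule sum_mono)
    fix \<alpha>
    show "norm (((1/2) *\<^sub>R (\<xi> + \<xi>')) $ \<alpha>) powr p + norm ((1/2) *\<^sub>R (\<xi> $ \<alpha> - \<xi>' $ \<alpha>)) powr p \<le> (norm (\<xi> $ \<alpha>) powr p + norm (\<xi>' $ \<alpha>) powr p) / 2"
      using Clarkson[of p "\<xi> $ \<alpha>" "\<xi>' $ \<alpha>"] q by simp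
  qed
  then have 2: "\<epsilon> * ((\<Sum>\<alpha>\<in>UNIV. norm (((1/2) *\<^sub>R (\<xi> + \<xi>')) $ \<alpha>) powr p) + (\<Sum>\<alpha>\<in>UNIV. norm ((1/2) *\<^sub>R (\<xi> $ \<alpha> - \<xi>' $ \<alpha>)) powr p))
     \<le> \<epsilon> * (((\<Sum>\<alpha>\<in>UNIV. norm (\<xi> $ \<alpha>) powr p) + (\<Sum>\<alpha>\<in>UNIV. norm (\<xi>' $ \<alpha>) powr p)) / 2)"
    using eps by (intro mult_left_mono) (auto simp: sum.distrib sum_divide_distrib[symmetric])
  show ?thesis unfolding integrand_def using 1 2 by (simp add: algebra_simps add_divide_distrib)
qed

lemma integrand_growth:
  obtains C where "C \<ge> 0" "\<And>s (\<xi> :: ('a::euclidean_space)^'m). integrand s \<xi> \<le> C * (1 + norm s powr p + norm \<xi> powr p)"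
proof -
  let ?m = "real CARD('m)"
  obtain C where C: "C \<ge> 0" "\<And>s \<xi> R. s \<in> pos_orthant \<Longrightarrow> \<xi> \<in> pos_orthant \<Longrightarrow> 1 \<le> R \<Longrightarrow> norm s \<le> R \<Longrightarrow> norm \<xi> \<le> R \<Longrightarrow> G (s, \<xi>) \<le> C * R powr q"
    using G_growth by metis
  have m: "?m \<ge> 1" by (simp add: Suc_leI)
  have "integrand s \<xi> \<le> (?m + C * ?m powr q * 3 powr p) * (1 + norm s powr p + norm \<xi> powr p)" for s and \<xi> :: "'a^'m"
  proof -
    let ?R = "?m * (1 + norm s + norm \<xi>)"
    have R: "1 \<le> ?R" using m mult_mono[of 1 ?m 1 "1 + norm s + norm \<xi>"] by simp
    have "norm (moduli \<epsilon> s) \<le> ?m * (norm s + 1)"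
      by (rule norm_moduli_le) (use eps component_le_norm_cart in auto)
    also have "\<dots> \<le> ?R" by (intro mult_left_mono) auto
    finally have n1: "norm (moduli \<epsilon> s) \<le> ?R" .
    have "norm (moduli \<epsilon> \<xi>) \<le> ?m * (norm \<xi> + 1)"
      by (rule norm_moduli_le) (use eps Finite_Cartesian_Product.norm_nth_le in auto)
    also have "\<dots> \<le> ?R" by (intro mult_left_mono) auto
    finally have n2: "norm (moduli \<epsilon> \<xi>) \<le> ?R" .
    have "G (moduli \<epsilon> s, moduli \<epsilon> \<xi>) \<le> C * ?R powr q" by (rule C(2)[OF moduli_pos[OF eps(1)] moduli_pos[OF eps(1)] R n1 n2])
    also have "\<dots> = C * ?m powr q * (1 + norm s + norm \<xi>) powr q" using m by (simp add: powr_mult)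
    also have "\<dots> \<le> C * ?m powr q * (3 powr p * (1 + norm s powr p + norm \<xi> powr p))"
      using C(1) q by (intro mult_left_mono powr_le_one_plus) auto
    finally have 1: "G (moduli \<epsilon> s, moduli \<epsilon> \<xi>) \<le> C * ?m powr q * 3 powr p * (1 + norm s powr p + norm \<xi> powr p)" by simp
    have "(\<Sum>\<alpha>\<in>UNIV. norm (\<xi> $ \<alpha>) powr p) \<le> (\<Sum>\<alpha>\<in>(UNIV::'m set). norm \<xi> powr p)"
      using q by (intro sum_mono powr_mono2 Finite_Cartesian_Product.norm_nth_le) auto
    then have "\<epsilon> * (\<Sum>\<alpha>\<in>UNIV. norm (\<xi> $ \<alpha>) powr p) \<le> 1 * (?m * norm \<xi> powr p)"
      using eps by (intro mult_mono sum_nonneg) auto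
    also have "\<dots> \<le> ?m * (1 + norm s powr p + norm \<xi> powr p)" by (simp add: mult_left_mono)
    finally show ?thesis using 1 unfolding integrand_def by (simp add: distrib_right)
  qed
  then show thesis using that[of "?m + C * ?m powr q * 3 powr p"] C m by auto
qed

text \<open>The quadratic upper bounds for the powers, the moduli and \<open>G\<close> combine; monotonicity of \<open>G\<close> allows the upper bound for the
  moduli to be inserted into the linear term of the expansion of \<open>G\<close>. The growth of order \<open>q\<close> is absorbed into that of order
  \<open>p\<close>. The slope \<open>l\<close> depends on \<open>s\<close>, \<open>g\<close> and \<open>w\<close> but not on \<open>r\<close>, as the cancellation between two shifts requires.\<close>

lemma integrand_line_quadratic_upper:
  obtains K where "K \<ge> 0" "\<And>s (g :: ('a::euclidean_space)^'m) w d. 0 \<le> d \<Longrightarrow> d \<le> 1/4 \<Longrightarrow> (\<And>\<alpha>. norm (w $ \<alpha>) \<le> d * norm (g $ \<alpha>)) \<Longrightarrow>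
    \<exists>l. \<forall>r. \<bar>r\<bar> \<le> 2 \<longrightarrow> integrand s (\<chi> \<alpha>. g $ \<alpha> + r *\<^sub>R w $ \<alpha>) \<le> integrand s g + l * r + K * d\<^sup>2 * (1 + norm s powr p + norm g powr p) * r\<^sup>2"
proof -
  let ?m = "real CARD('m)"
  have m: "?m \<ge> 1" by (simp add: Suc_leI)
  define P where "P = p + 7 * p * (p * (16 * 3 powr p))"
  have P: "P \<ge> 0" using q by (simp add: P_def)
  \<comment> \<open>The vectors of moduli below have norm at most \<open>c * ?R\<close>.\<close>
  define c where "c = 3 * ?m"
  define K1 where "K1 = ?m * 2 * L1 * c powr (q - 1) + ?m\<^sup>2 * L1 * c powr (q - 2) * ?m\<^sup>2"
  have K1: "K1 \<ge> 0" unfolding K1_def using L1 m by simp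
  define K where "K = ?m * P + K1 * 3 powr p"
  have K: "K \<ge> 0" unfolding K_def using m P K1 by simp
  have "\<exists>l. \<forall>r. \<bar>r\<bar> \<le> 2 \<longrightarrow> integrand s (\<chi> \<alpha>. g $ \<alpha> + r *\<^sub>R w $ \<alpha>) \<le> integrand s g + l * r + K * d\<^sup>2 * (1 + norm s powr p + norm g powr p) * r\<^sup>2"
    if d: "0 \<le> d" "d \<le> 1/4" and w: "\<And>\<alpha>. norm (w $ \<alpha>) \<le> d * norm (g $ \<alpha>)" for s and g w :: "'a^'m" and d
  proof -
    let ?R = "1 + norm s + norm g"
    let ?\<sigma> = "moduli \<epsilon> s" and ?\<eta> = "moduli \<epsilon> g"
    have R: "?R \<ge> 1" by simp
    have "1 \<le> c" using m unfolding c_def by linarith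
    then have cR: "c * ?R \<ge> 1" using mult_mono[of 1 c 1 ?R] by simp
    have "\<exists>l. \<forall>r. \<bar>r\<bar> \<le> 2 \<longrightarrow> norm (g $ \<alpha> + r *\<^sub>R w $ \<alpha>) powr p \<le> norm (g $ \<alpha>) powr p + l * r + P * d\<^sup>2 * norm (g $ \<alpha>) powr p * r\<^sup>2" for \<alpha>
    proof -
      have pp: "2 \<le> p" using q by simp
      show ?thesis unfolding P_def by (rule norm_powr_quadratic_upper[OF pp w[of \<alpha>] d]) blast
    qed
    then obtain l1 where l1: "\<And>\<alpha> r. \<bar>r\<bar> \<le> 2 \<Longrightarrow> norm (g $ \<alpha> + r *\<^sub>R w $ \<alpha>) powr p \<le> norm (g $ \<alpha>) powr p + l1 \<alpha> * r + P * d\<^sup>2 * norm (g $ \<alpha>) powr p * r\<^sup>2"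
      by metis
    define l2 where "l2 \<alpha> = (g $ \<alpha> \<bullet> w $ \<alpha>) / modulus \<epsilon> (g $ \<alpha>)" for \<alpha>
    define l where "l = \<epsilon> * (\<Sum>\<alpha>\<in>UNIV. l1 \<alpha>) + (\<Sum>\<alpha>\<in>UNIV. d_xi \<alpha> G (?\<sigma>, ?\<eta>) * l2 \<alpha>)"
    have "integrand s (\<chi> \<alpha>. g $ \<alpha> + r *\<^sub>R w $ \<alpha>) \<le> integrand s g + l * r + K * d\<^sup>2 * (1 + norm s powr p + norm g powr p) * r\<^sup>2" if r: "\<bar>r\<bar> \<le> 2" for r
    proof -
      let ?g = "(\<chi> \<alpha>. g $ \<alpha> + r *\<^sub>R w $ \<alpha>) :: 'a^'m"
      let ?\<eta>' = "moduli \<epsilon> ?g"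
      have rd: "\<bar>r\<bar> * d \<le> 1/2" using mult_mono[OF r d(2)] d by simp
      have rw: "norm (r *\<^sub>R w $ \<alpha>) \<le> \<bar>r\<bar> * d * norm (g $ \<alpha>)" for \<alpha>
        using w[of \<alpha>] by (simp add: mult_left_mono mult.assoc)
      have gn: "norm (?g $ \<alpha>) \<le> 3/2 * norm g" for \<alpha>
      proof -
        have "norm (?g $ \<alpha>) \<le> norm (g $ \<alpha>) + \<bar>r\<bar> * d * norm (g $ \<alpha>)"
          using norm_triangle_ineq[of "g $ \<alpha>" "r *\<^sub>R w $ \<alpha>"] rw[of \<alpha>] by simp
        also have "\<dots> \<le> norm (g $ \<alpha>) + 1/2 * norm (g $ \<alpha>)" using rd by (intro add_left_mono mult_right_mono) auto
        also have "\<dots> \<le> 3/2 * norm g" using Finite_Cartesian_Product.norm_nth_le[of g \<alpha>] by simp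
        finally show ?thesis .
      qed
      have n: "norm ?\<sigma> \<le> c * ?R" "norm ?\<eta> \<le> c * ?R" "norm ?\<eta>' \<le> c * ?R"
      proof -
        have "norm ?\<sigma> \<le> ?m * (norm s + 1)" by (rule norm_moduli_le) (use eps component_le_norm_cart in auto)
        also have "\<dots> \<le> ?m * (3 * ?R)" by (intro mult_left_mono) auto
        also have "\<dots> = c * ?R" by (simp add: c_def)
        finally show "norm ?\<sigma> \<le> c * ?R" .
        have "norm ?\<eta> \<le> ?m * (norm g + 1)" by (rule norm_moduli_le) (use eps Finite_Cartesian_Product.norm_nth_le in auto)
        also have "\<dots> \<le> ?m * (3 * ?R)" by (intro mult_left_mono) auto
        also have "\<dots> = c * ?R" by (simp add: c_def)
        finally show "norm ?\<eta> \<le> c * ?R" .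
        have "norm ?\<eta>' \<le> ?m * (3/2 * norm g + 1)" by (rule norm_moduli_le[OF _ _ gn]) (use eps in auto)
        also have "\<dots> \<le> ?m * (3 * ?R)" by (intro mult_left_mono) auto
        also have "\<dots> = c * ?R" by (simp add: c_def)
        finally show "norm ?\<eta>' \<le> c * ?R" .
      qed
      have T: "G (?\<sigma>, ?\<eta>') \<le> G (?\<sigma>, ?\<eta>) + (\<Sum>\<alpha>\<in>UNIV. (?\<eta>' - ?\<eta>) $ \<alpha> * d_xi \<alpha> G (?\<sigma>, ?\<eta>)) + ?m\<^sup>2 * L1 * (c * ?R) powr (q - 2) * (norm (?\<eta>' - ?\<eta>))\<^sup>2"
        by (rule G_Taylor[OF moduli_pos[OF eps(1)] moduli_pos[OF eps(1)] moduli_pos[OF eps(1)] cR n])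
      have d1: "0 \<le> d_xi \<alpha> G (?\<sigma>, ?\<eta>)" "d_xi \<alpha> G (?\<sigma>, ?\<eta>) \<le> 2 * L1 * (c * ?R) powr (q - 1)" for \<alpha>
        using bounds[OF moduli_orthant moduli_orthant, of \<alpha> s g] first_derivative_le(2)[OF moduli_orthant moduli_orthant n(1,2) cR, of \<alpha>] by auto
      have S1: "(\<Sum>\<alpha>\<in>UNIV. (?\<eta>' - ?\<eta>) $ \<alpha> * d_xi \<alpha> G (?\<sigma>, ?\<eta>)) \<le> (\<Sum>\<alpha>\<in>UNIV. d_xi \<alpha> G (?\<sigma>, ?\<eta>) * l2 \<alpha>) * r + ?m * (2 * L1 * (c * ?R) powr (q - 1)) * (d\<^sup>2 * ?R) * r\<^sup>2"
      proof -
        have "(?\<eta>' - ?\<eta>) $ \<alpha> * d_xi \<alpha> G (?\<sigma>, ?\<eta>) \<le> d_xi \<alpha> G (?\<sigma>, ?\<eta>) * l2 \<alpha> * r + (2 * L1 * (c * ?R) powr (q - 1)) * (r\<^sup>2 * (d\<^sup>2 * ?R))" for \<alpha>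
        proof -
          have "(?\<eta>' - ?\<eta>) $ \<alpha> \<le> r * l2 \<alpha> + r\<^sup>2 * (d\<^sup>2 * norm (g $ \<alpha>))"
            using modulus_quadratic_upper[OF eps(1) w[of \<alpha>] d(1), of r] by (simp add: moduli_def l2_def)
          also have "\<dots> \<le> r * l2 \<alpha> + r\<^sup>2 * (d\<^sup>2 * ?R)"
            using Finite_Cartesian_Product.norm_nth_le[of g \<alpha>] norm_ge_zero[of s] by (intro add_left_mono mult_left_mono) (linarith, auto)
          finally have "(?\<eta>' - ?\<eta>) $ \<alpha> * d_xi \<alpha> G (?\<sigma>, ?\<eta>) \<le> (r * l2 \<alpha> + r\<^sup>2 * (d\<^sup>2 * ?R)) * d_xi \<alpha> G (?\<sigma>, ?\<eta>)"
            by (intro mult_right_mono d1)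
          also have "\<dots> = d_xi \<alpha> G (?\<sigma>, ?\<eta>) * l2 \<alpha> * r + d_xi \<alpha> G (?\<sigma>, ?\<eta>) * (r\<^sup>2 * (d\<^sup>2 * ?R))" by (simp add: algebra_simps)
          also have "\<dots> \<le> d_xi \<alpha> G (?\<sigma>, ?\<eta>) * l2 \<alpha> * r + (2 * L1 * (c * ?R) powr (q - 1)) * (r\<^sup>2 * (d\<^sup>2 * ?R))"
            by (intro add_left_mono mult_right_mono d1) auto
          finally show ?thesis .
        qed
        then have "(\<Sum>\<alpha>\<in>UNIV. (?\<eta>' - ?\<eta>) $ \<alpha> * d_xi \<alpha> G (?\<sigma>, ?\<eta>)) \<le> (\<Sum>\<alpha>\<in>UNIV. d_xi \<alpha> G (?\<sigma>, ?\<eta>) * l2 \<alpha> * r + (2 * L1 * (c * ?R) powr (q - 1)) * (r\<^sup>2 * (d\<^sup>2 * ?R)))"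
          by (rule sum_mono)
        also have "\<dots> = (\<Sum>\<alpha>\<in>UNIV. d_xi \<alpha> G (?\<sigma>, ?\<eta>) * l2 \<alpha>) * r + ?m * (2 * L1 * (c * ?R) powr (q - 1)) * (d\<^sup>2 * ?R) * r\<^sup>2"
          by (simp add: sum.distrib sum_distrib_right)
        finally show ?thesis .
      qed
      have S2: "(norm (?\<eta>' - ?\<eta>))\<^sup>2 \<le> ?m\<^sup>2 * (d\<^sup>2 * ?R\<^sup>2) * r\<^sup>2"
      proof -
        have "norm (?\<eta>' - ?\<eta>) \<le> (\<Sum>\<alpha>\<in>UNIV. \<bar>(?\<eta>' - ?\<eta>) $ \<alpha>\<bar>)" by (rule norm_le_l1_cart)
        also have "\<dots> \<le> (\<Sum>\<alpha>\<in>(UNIV::'m set). \<bar>r\<bar> * d * ?R)"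
        proof (rule sum_mono)
          fix \<alpha>
          have "\<bar>(?\<eta>' - ?\<eta>) $ \<alpha>\<bar> \<le> norm (r *\<^sub>R w $ \<alpha>)"
            using modulus_Lipschitz[of \<epsilon> "g $ \<alpha> + r *\<^sub>R w $ \<alpha>" "g $ \<alpha>"] eps by (simp add: moduli_def)
          also have "\<dots> \<le> \<bar>r\<bar> * d * norm (g $ \<alpha>)" by (rule rw)
          also have "\<dots> \<le> \<bar>r\<bar> * d * ?R"
            using Finite_Cartesian_Product.norm_nth_le[of g \<alpha>] norm_ge_zero[of s] d by (intro mult_left_mono) (linarith, auto)
          finally show "\<bar>(?\<eta>' - ?\<eta>) $ \<alpha>\<bar> \<le> \<bar>r\<bar> * d * ?R" .
        qed
        finally have "norm (?\<eta>' - ?\<eta>) \<le> ?m * (\<bar>r\<bar> * d * ?R)" by simp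
        then have "(norm (?\<eta>' - ?\<eta>))\<^sup>2 \<le> (?m * (\<bar>r\<bar> * d * ?R))\<^sup>2" by (intro power_mono) auto
        then show ?thesis by (simp only: power_mult_distrib power2_abs mult_ac)
      qed
      have "G (?\<sigma>, ?\<eta>') \<le> G (?\<sigma>, ?\<eta>) + (\<Sum>\<alpha>\<in>UNIV. d_xi \<alpha> G (?\<sigma>, ?\<eta>) * l2 \<alpha>) * r + K1 * d\<^sup>2 * ?R powr q * r\<^sup>2"
      proof -
        have p1: "(c * ?R) powr (q - 1) * ?R = c powr (q - 1) * ?R powr q"
        proof -
          have "?R powr (q - 1) * ?R = ?R powr q" using powr_mult_base[of ?R "q - 1"] by (simp add: mult.commute)
          then show ?thesis using m by (simp add: powr_mult c_def mult.assoc)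
        qed
        have p2: "(c * ?R) powr (q - 2) * ?R\<^sup>2 = c powr (q - 2) * ?R powr q"
        proof -
          have "?R powr (q - 2) * ?R powr 2 = ?R powr q" by (subst powr_add[symmetric]) simp
          moreover have "?R powr 2 = ?R\<^sup>2" using powr_numeral[of ?R num.One] R by (simp add: powr_numeral)
          ultimately show ?thesis using m by (simp add: powr_mult c_def mult.assoc)
        qed
        have "?m\<^sup>2 * L1 * (c * ?R) powr (q - 2) * (norm (?\<eta>' - ?\<eta>))\<^sup>2 \<le> ?m\<^sup>2 * L1 * (c * ?R) powr (q - 2) * (?m\<^sup>2 * (d\<^sup>2 * ?R\<^sup>2) * r\<^sup>2)"
          using L1 by (intro mult_left_mono S2) auto
        also have "\<dots> = ?m\<^sup>2 * L1 * ((c * ?R) powr (q - 2) * ?R\<^sup>2) * ?m\<^sup>2 * d\<^sup>2 * r\<^sup>2" by (simp only: mult_ac)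
        also have "\<dots> = ?m\<^sup>2 * L1 * c powr (q - 2) * ?m\<^sup>2 * d\<^sup>2 * ?R powr q * r\<^sup>2" unfolding p2 by (simp only: mult_ac)
        finally have A: "?m\<^sup>2 * L1 * (c * ?R) powr (q - 2) * (norm (?\<eta>' - ?\<eta>))\<^sup>2 \<le> ?m\<^sup>2 * L1 * c powr (q - 2) * ?m\<^sup>2 * d\<^sup>2 * ?R powr q * r\<^sup>2" .
        have "?m * (2 * L1 * (c * ?R) powr (q - 1)) * (d\<^sup>2 * ?R) * r\<^sup>2 = ?m * 2 * L1 * ((c * ?R) powr (q - 1) * ?R) * d\<^sup>2 * r\<^sup>2" by (simp only: mult_ac)
        also have "\<dots> = ?m * 2 * L1 * c powr (q - 1) * d\<^sup>2 * ?R powr q * r\<^sup>2" unfolding p1 by (simp only: mult_ac)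
        finally have B: "?m * (2 * L1 * (c * ?R) powr (q - 1)) * (d\<^sup>2 * ?R) * r\<^sup>2 = ?m * 2 * L1 * c powr (q - 1) * d\<^sup>2 * ?R powr q * r\<^sup>2" .
        have "K1 * d\<^sup>2 * ?R powr q * r\<^sup>2 = ?m * 2 * L1 * c powr (q - 1) * d\<^sup>2 * ?R powr q * r\<^sup>2 + ?m\<^sup>2 * L1 * c powr (q - 2) * ?m\<^sup>2 * d\<^sup>2 * ?R powr q * r\<^sup>2"
          by (simp only: K1_def distrib_right)
        with T S1 A B show ?thesis by linarith
      qed
      also have "K1 * d\<^sup>2 * ?R powr q * r\<^sup>2 \<le> K1 * d\<^sup>2 * (3 powr p * (1 + norm s powr p + norm g powr p)) * r\<^sup>2"
        using K1 q by (intro mult_right_mono mult_left_mono powr_le_one_plus) auto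
      finally have GG: "G (?\<sigma>, ?\<eta>') \<le> G (?\<sigma>, ?\<eta>) + (\<Sum>\<alpha>\<in>UNIV. d_xi \<alpha> G (?\<sigma>, ?\<eta>) * l2 \<alpha>) * r + K1 * 3 powr p * d\<^sup>2 * (1 + norm s powr p + norm g powr p) * r\<^sup>2"
        by (simp add: mult_ac)
      have "(\<Sum>\<alpha>\<in>UNIV. norm (?g $ \<alpha>) powr p) \<le> (\<Sum>\<alpha>\<in>UNIV. norm (g $ \<alpha>) powr p + l1 \<alpha> * r + P * d\<^sup>2 * (1 + norm s powr p + norm g powr p) * r\<^sup>2)"
      proof (rule sum_mono)
        fix \<alpha>
        have "norm (g $ \<alpha>) powr p \<le> norm g powr p" using q by (intro powr_mono2 Finite_Cartesian_Product.norm_nth_le) auto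
        then have "norm (g $ \<alpha>) powr p \<le> 1 + norm s powr p + norm g powr p" using powr_ge_zero[of "norm s" p] by linarith
        then have "P * d\<^sup>2 * norm (g $ \<alpha>) powr p * r\<^sup>2 \<le> P * d\<^sup>2 * (1 + norm s powr p + norm g powr p) * r\<^sup>2"
          using P by (intro mult_right_mono mult_left_mono) auto
        with l1[OF r, of \<alpha>] show "norm (?g $ \<alpha>) powr p \<le> norm (g $ \<alpha>) powr p + l1 \<alpha> * r + P * d\<^sup>2 * (1 + norm s powr p + norm g powr p) * r\<^sup>2" by simp
      qed
      also have "\<dots> = (\<Sum>\<alpha>\<in>UNIV. norm (g $ \<alpha>) powr p) + (\<Sum>\<alpha>\<in>UNIV. l1 \<alpha>) * r + ?m * (P * d\<^sup>2 * (1 + norm s powr p + norm g powr p) * r\<^sup>2)"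
        by (simp add: sum.distrib sum_distrib_right)
      finally have "\<epsilon> * (\<Sum>\<alpha>\<in>UNIV. norm (?g $ \<alpha>) powr p) \<le> \<epsilon> * ((\<Sum>\<alpha>\<in>UNIV. norm (g $ \<alpha>) powr p) + (\<Sum>\<alpha>\<in>UNIV. l1 \<alpha>) * r + ?m * (P * d\<^sup>2 * (1 + norm s powr p + norm g powr p) * r\<^sup>2))"
        using eps by (intro mult_left_mono) auto
      also have "\<dots> = \<epsilon> * (\<Sum>\<alpha>\<in>UNIV. norm (g $ \<alpha>) powr p) + \<epsilon> * (\<Sum>\<alpha>\<in>UNIV. l1 \<alpha>) * r + \<epsilon> * (?m * (P * d\<^sup>2 * (1 + norm s powr p + norm g powr p) * r\<^sup>2))"
        by (simp only: distrib_left mult.assoc)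
      also have "\<epsilon> * (?m * (P * d\<^sup>2 * (1 + norm s powr p + norm g powr p) * r\<^sup>2)) \<le> 1 * (?m * (P * d\<^sup>2 * (1 + norm s powr p + norm g powr p) * r\<^sup>2))"
        using eps P by (intro mult_right_mono) auto
      finally have PP: "\<epsilon> * (\<Sum>\<alpha>\<in>UNIV. norm (?g $ \<alpha>) powr p) \<le> \<epsilon> * (\<Sum>\<alpha>\<in>UNIV. norm (g $ \<alpha>) powr p) + \<epsilon> * (\<Sum>\<alpha>\<in>UNIV. l1 \<alpha>) * r + ?m * P * d\<^sup>2 * (1 + norm s powr p + norm g powr p) * r\<^sup>2"
        by (simp add: mult_ac)
      have KE: "K * d\<^sup>2 * (1 + norm s powr p + norm g powr p) * r\<^sup>2 = ?m * P * d\<^sup>2 * (1 + norm s powr p + norm g powr p) * r\<^sup>2 + K1 * 3 powr p * d\<^sup>2 * (1 + norm s powr p + norm g powr p) * r\<^sup>2"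
        by (simp only: K_def distrib_right)
      have LE: "l * r = \<epsilon> * (\<Sum>\<alpha>\<in>UNIV. l1 \<alpha>) * r + (\<Sum>\<alpha>\<in>UNIV. d_xi \<alpha> G (?\<sigma>, ?\<eta>) * l2 \<alpha>) * r"
        by (simp only: l_def distrib_right)
      show ?thesis unfolding integrand_def KE LE using GG PP by linarith
    qed
    then show ?thesis by blast
  qed
  then show thesis using that[of K] K by blast
qed

lemma continuous_integrand: "continuous_on UNIV (\<lambda>z :: (real^'m) \<times> (('a::euclidean_space)^'m). integrand (fst z) (snd z))"
proof -
  have cm: "continuous_on UNIV (moduli \<epsilon> :: ('c::real_normed_vector)^'m \<Rightarrow> real^'m)"
    unfolding moduli_def[abs_def] modulus_def by (intro continuous_intros)
  have cG: "continuous_on quadrant G" by (rule differentiable_imp_continuous_on[OF G_differentiable(1)])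
  have cx: "continuous_on UNIV (\<lambda>z :: (real^'m) \<times> ('a^'m). (moduli \<epsilon> (fst z), moduli \<epsilon> (snd z)))"
    by (intro continuous_on_Pair continuous_on_compose2[OF cm] continuous_on_fst continuous_on_snd continuous_on_id) auto
  have "continuous_on UNIV (\<lambda>z :: (real^'m) \<times> ('a^'m). G (moduli \<epsilon> (fst z), moduli \<epsilon> (snd z)))"
    by (rule continuous_on_compose2[OF cG cx]) (auto simp: moduli_orthant)
  moreover have "continuous_on UNIV (\<lambda>z :: (real^'m) \<times> ('a^'m). norm (snd z $ \<alpha>) powr p)" for \<alpha>
    by (rule continuous_on_powr') (use q in \<open>auto intro!: continuous_intros\<close>)
  ultimately show ?thesis unfolding integrand_def
    by (intro continuous_on_add continuous_on_mult continuous_on_const continuous_on_sum)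
qed

lemma measurable_integrand [measurable (raw)]:
  fixes D :: "'x \<Rightarrow> ('a::euclidean_space)^'m"
  assumes [measurable]: "u \<in> borel_measurable N" "D \<in> borel_measurable N"
  shows "(\<lambda>x. integrand (u x) (D x)) \<in> borel_measurable N"
proof -
  have "(\<lambda>x. (u x, D x)) \<in> borel_measurable N" by simp
  from measurable_compose[OF this borel_measurable_continuous_onI[OF continuous_integrand]] show ?thesis by simp
qed

end

section \<open>Integrability from difference quotients\<close>

lemma ennreal_finiteE:
  assumes "(x::ennreal) \<noteq> \<infinity>" obtains z where "0 \<le> z" "x = ennreal z"
  using assms by (cases x rule: ennreal_cases) auto

lemma ball_borel [measurable]: "ball (c::'a::euclidean_space) s \<in> sets borel"
  by simp

lemma measure_ball_scale:
  fixes x :: "'a::euclidean_space"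
  assumes "r \<ge> 0" shows "emeasure lborel (ball x r) = ennreal (r ^ DIM('a)) * emeasure lborel (ball (0::'a) 1)"
  using emeasure_ball[of r x] emeasure_ball[of 1 "0::'a"] assms
  by (simp add: ennreal_mult' mult.commute unit_ball_vol_nonneg)

lemma Jensen_average:
  fixes g :: "'a::euclidean_space \<Rightarrow> 'b::euclidean_space"
  assumes A: "A \<in> sets borel" "0 < emeasure lborel A" "emeasure lborel A < \<infinity>"
    and [measurable]: "g \<in> borel_measurable borel" and i: "integrable lborel (\<lambda>x. indicator A x *\<^sub>R g x)" and p: "p \<ge> 1"
  shows "ennreal (norm ((1 / measure lborel A) *\<^sub>R (LINT x|lborel. indicator A x *\<^sub>R g x)) powr p)
    \<le> ennreal (1 / measure lborel A) * (\<integral>\<^sup>+x\<in>A. ennreal (norm (g x) powr p) \<partial>lborel)"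
proof -
  let ?m = "measure lborel A"
  have [measurable]: "A \<in> sets borel" by fact
  have m: "?m > 0" using A by (simp add: measure_def enn2real_positive_iff)
  let ?w = "\<lambda>x. indicator A x / ?m"
  have w: "integrable lborel ?w" "(LINT x|lborel. ?w x) = 1"
    using A m by (auto intro!: integrable_divide integrable_real_indicator)
  have e: "(LINT x|lborel. ?w x *\<^sub>R g x) = (1 / ?m) *\<^sub>R (LINT x|lborel. indicator A x *\<^sub>R g x)"
    by (subst integral_scaleR_right[symmetric]) (auto intro!: Bochner_Integration.integral_cong)
  have i': "integrable lborel (\<lambda>x. ?w x *\<^sub>R g x)"
  proof -
    have "integrable lborel (\<lambda>x. (1 / ?m) *\<^sub>R (indicator A x *\<^sub>R g x))" by (intro integrable_scaleR_right i)
    then show ?thesis by simp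
  qed
  have "ennreal (norm (LINT x|lborel. ?w x *\<^sub>R g x) powr p) \<le> (\<integral>\<^sup>+x. ennreal (?w x) * ennreal (norm (g x) powr p) \<partial>lborel)"
    by (rule Jensen_powr) (use w i' p m in auto)
  also have "\<dots> = (\<integral>\<^sup>+x. ennreal (1 / ?m) * (ennreal (norm (g x) powr p) * indicator A x) \<partial>lborel)"
    by (intro nn_integral_cong) (auto simp: indicator_def)
  also have "\<dots> = ennreal (1 / ?m) * (\<integral>\<^sup>+x\<in>A. ennreal (norm (g x) powr p) \<partial>lborel)"
    by (rule nn_integral_cmult) measurable
  finally show ?thesis unfolding e .
qed

text \<open>Translation differences of order \<open>norm h powr (2/p)\<close> in \<open>L\<^sup>p\<close>: membership in a Nikolskii space of smoothness \<open>2/p\<close>. It embeds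
  into \<open>L\<^sup>s\<close> for all \<open>s < p n / (n - 2)\<close>. The averages of \<open>f\<close> over balls of dyadic radii \<open>scale k\<close> converge to \<open>f\<close>, and the
  differences of consecutive averages are estimated both pointwise and in the mean.\<close>

locale difference_bound =
  fixes f :: "'a::euclidean_space \<Rightarrow> 'b::euclidean_space" and x0 :: 'a and r C p :: real
  assumes f_borel [measurable]: "f \<in> borel_measurable borel"
    and r: "0 < r" and C: "0 \<le> C" and p: "1 \<le> p"
    and fin: "pmass p (ball x0 (2 * r)) f < \<infinity>"
    and diff: "\<And>h. norm h \<le> r \<Longrightarrow> pmass p (ball x0 r) (\<lambda>x. f (x + h) - f x) \<le> ennreal (C * (norm h)\<^sup>2)"
begin

definition scale :: "nat \<Rightarrow> real" where "scale k = r / 4 * (1/2) ^ k"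
definition vol :: "nat \<Rightarrow> real" where "vol k = measure lborel (ball (0::'a) (scale k))"
definition avg :: "nat \<Rightarrow> 'a \<Rightarrow> 'b" where
  "avg k x = (1 / vol k) *\<^sub>R (LINT y|lborel. indicator (ball 0 (scale k)) y *\<^sub>R f (x + y))"

lemma scale_pos: "0 < scale k" using r by (simp add: scale_def)
lemma scale_le: "scale k \<le> r / 4" using r by (simp add: scale_def power_le_one)
lemma scale_Suc: "scale (Suc k) = scale k / 2" by (simp add: scale_def)

lemma emeasure_scale: "emeasure lborel (ball (0::'a) (scale k)) = ennreal (vol k)"
  unfolding vol_def by (rule emeasure_eq_ennreal_measure) (use emeasure_bounded_finite[OF bounded_ball, of "0::'a" "scale k"] in \<open>simp add: less_top\<close>)

lemma vol_pos: "0 < vol k" unfolding vol_def using content_ball_pos[OF scale_pos] .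

lemma vol_eq: "vol k = scale k ^ DIM('a) * measure lborel (ball (0::'a) 1)"
proof -
  have "ennreal (vol k) = ennreal (scale k ^ DIM('a)) * emeasure lborel (ball (0::'a) 1)"
    using measure_ball_scale[of "scale k" "0::'a"] scale_pos[of k] by (simp add: emeasure_scale)
  also have "emeasure lborel (ball (0::'a) 1) = ennreal (measure lborel (ball (0::'a) 1))"
    by (rule emeasure_eq_ennreal_measure) (use emeasure_bounded_finite[OF bounded_ball, of "0::'a" 1] in \<open>simp add: less_top\<close>)
  also have "ennreal (scale k ^ DIM('a)) * ennreal (measure lborel (ball (0::'a) 1)) = ennreal (scale k ^ DIM('a) * measure lborel (ball (0::'a) 1))"
    using scale_pos[of k] by (simp add: ennreal_mult)
  finally show ?thesis using scale_pos[of k] vol_pos[of k] by (subst (asm) ennreal_inj) auto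
qed

lemma integrable_shifted:
  assumes x: "x \<in> ball x0 r" shows "integrable lborel (\<lambda>y. indicator (ball 0 (scale k)) y *\<^sub>R f (x + y))"
proof -
  have "integrable lborel (\<lambda>y. indicator (ball x (scale k)) y *\<^sub>R f y)"
  proof -
    have "(\<integral>\<^sup>+y. ennreal (norm (indicator (ball x (scale k)) y *\<^sub>R f y)) \<partial>lborel) \<le> (\<integral>\<^sup>+y. indicator (ball x0 (2 * r)) y + ennreal (norm (f y) powr p) * indicator (ball x0 (2 * r)) y \<partial>lborel)"
    proof (intro nn_integral_mono)
      fix y
      have "y \<in> ball x (scale k) \<Longrightarrow> y \<in> ball x0 (2 * r)"
        using x scale_le[of k] r dist_triangle[of x0 y x] by auto
      moreover have "norm (f y) \<le> 1 + norm (f y) powr p"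
      proof (cases "norm (f y) \<le> 1")
        case False
        then show ?thesis using powr_mono[OF p, of "norm (f y)"] by simp
      qed (use powr_ge_zero[of "norm (f y)" p] in linarith)
      then have "ennreal (norm (f y)) \<le> 1 + ennreal (norm (f y) powr p)"
        by (metis ennreal_1 ennreal_leI ennreal_plus powr_ge_zero zero_le_one)
      ultimately show "ennreal (norm (indicator (ball x (scale k)) y *\<^sub>R f y)) \<le> indicator (ball x0 (2 * r)) y + ennreal (norm (f y) powr p) * indicator (ball x0 (2 * r)) y"
        by (auto simp: indicator_def)
    qed
    also have "\<dots> = emeasure lborel (ball x0 (2 * r)) + pmass p (ball x0 (2 * r)) f"
      unfolding pmass_def by (subst nn_integral_add) auto
    also have "\<dots> < \<infinity>" using fin emeasure_bounded_finite[OF bounded_ball, of x0 "2 * r"] by simp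
    finally show ?thesis by (intro integrableI_bounded) auto
  qed
  moreover have "(lborel :: 'a measure) = distr lborel borel ((+) x)" by (simp add: lborel_distr_plus)
  ultimately have "integrable (distr lborel borel ((+) x)) (\<lambda>y. indicator (ball x (scale k)) y *\<^sub>R f y)" by simp
  then have "integrable lborel (\<lambda>y. indicator (ball x (scale k)) (x + y) *\<^sub>R f (x + y))"
    by (subst (asm) integrable_distr_eq) auto
  moreover have "indicator (ball x (scale k)) (x + y) = (indicator (ball 0 (scale k)) y :: real)" for y
    by (simp add: indicator_def dist_norm)
  ultimately show ?thesis by simp
qed

lemma avg_sub:
  assumes x: "x \<in> ball x0 r"
  shows "avg k x - c = (1 / vol k) *\<^sub>R (LINT y|lborel. indicator (ball 0 (scale k)) y *\<^sub>R (f (x + y) - c))"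
proof -
  have i: "integrable lborel (\<lambda>y::'a. indicator (ball 0 (scale k)) y *\<^sub>R c)"
    by (intro integrable_scaleR_left integrable_real_indicator) (auto simp: emeasure_scale)
  have "(LINT y|lborel. indicator (ball 0 (scale k)) y *\<^sub>R (f (x + y) - c)) =
    (LINT y|lborel. indicator (ball 0 (scale k)) y *\<^sub>R f (x + y)) - vol k *\<^sub>R c"
    unfolding scaleR_diff_right using integrable_shifted[OF x, of k] i
    by (subst Bochner_Integration.integral_diff) (auto simp: vol_def emeasure_scale)
  then show ?thesis using vol_pos[of k] by (simp add: avg_def scaleR_diff_right)
qed

lemma avg_sub_powr:
  assumes x: "x \<in> ball x0 r"
  shows "ennreal (norm (avg k x - c) powr p) \<le> ennreal (1 / vol k) * (\<integral>\<^sup>+y\<in>ball 0 (scale k). ennreal (norm (f (x + y) - c) powr p) \<partial>lborel)"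
proof -
  have i: "integrable lborel (\<lambda>y::'a. indicator (ball 0 (scale k)) y *\<^sub>R c)"
    by (intro integrable_scaleR_left integrable_real_indicator) (auto simp: emeasure_scale)
  show ?thesis unfolding avg_sub[OF x] vol_def
    by (rule Jensen_average)
      (use scale_pos[of k] vol_pos[of k] p integrable_shifted[OF x, of k] i in \<open>auto simp: emeasure_scale scaleR_diff_right\<close>)
qed

text \<open>The mean oscillation of \<open>f\<close> between two consecutive scales, which dominates the difference of the averages by two
  applications of Jensen's inequality.\<close>

definition osc :: "nat \<Rightarrow> 'a \<Rightarrow> ennreal" where
  "osc k x = ennreal (1 / (vol k * vol (Suc k))) *
    (\<integral>\<^sup>+z\<in>ball 0 (scale (Suc k)). \<integral>\<^sup>+y\<in>ball 0 (scale k). ennreal (norm (f (x + y) - f (x + z)) powr p) \<partial>lborel \<partial>lborel)"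

lemma osc_measurable [measurable]: "osc k \<in> borel_measurable borel"
  unfolding osc_def by measurable

lemma avg_step_le_osc:
  assumes x: "x \<in> ball x0 r"
  shows "ennreal (norm (avg (Suc k) x - avg k x) powr p) \<le> osc k x"
proof -
  have "ennreal (norm (avg (Suc k) x - avg k x) powr p) \<le> ennreal (1 / vol (Suc k)) * (\<integral>\<^sup>+z\<in>ball 0 (scale (Suc k)). ennreal (norm (f (x + z) - avg k x) powr p) \<partial>lborel)"
    by (rule avg_sub_powr[OF x])
  also have "\<dots> \<le> ennreal (1 / vol (Suc k)) * (\<integral>\<^sup>+z\<in>ball 0 (scale (Suc k)). ennreal (1 / vol k) * (\<integral>\<^sup>+y\<in>ball 0 (scale k). ennreal (norm (f (x + y) - f (x + z)) powr p) \<partial>lborel) \<partial>lborel)"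
    unfolding norm_minus_commute[of _ "avg k x"]
    by (intro mult_left_mono nn_integral_mono mult_right_mono avg_sub_powr[OF x]) auto
  also have "\<dots> = ennreal (1 / vol (Suc k)) * (ennreal (1 / vol k) * (\<integral>\<^sup>+z\<in>ball 0 (scale (Suc k)). \<integral>\<^sup>+y\<in>ball 0 (scale k). ennreal (norm (f (x + y) - f (x + z)) powr p) \<partial>lborel \<partial>lborel))"
    unfolding mult.assoc by (subst nn_integral_cmult) (auto, measurable)
  also have "\<dots> = osc k x" unfolding osc_def mult.assoc[symmetric] using vol_pos[of k] vol_pos[of "Suc k"]
    by (simp add: ennreal_mult[symmetric] mult.commute)
  finally show ?thesis .
qed

lemma pmass_shifted_diff:
  assumes z: "norm z \<le> r / 2" and y: "norm y \<le> r / 2"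
  shows "(\<integral>\<^sup>+x\<in>ball x0 (r/2). ennreal (norm (f (x + y) - f (x + z)) powr p) \<partial>lborel) \<le> ennreal (C * (norm (y - z))\<^sup>2)"
proof -
  have "(\<integral>\<^sup>+x\<in>ball x0 (r/2). ennreal (norm (f (x + y) - f (x + z)) powr p) \<partial>lborel)
    \<le> (\<integral>\<^sup>+x. (\<lambda>x. ennreal (norm (f (x + (y - z)) - f x) powr p) * indicator (ball x0 r) x) (x + z) \<partial>lborel)"
  proof (intro nn_integral_mono)
    fix x
    have "x \<in> ball x0 (r/2) \<Longrightarrow> x + z \<in> ball x0 r"
      using z norm_triangle_ineq4[of "x0 - x" z] by (simp add: dist_norm algebra_simps)
    then show "ennreal (norm (f (x + y) - f (x + z)) powr p) * indicator (ball x0 (r/2)) x \<le> ennreal (norm (f (x + z + (y - z)) - f (x + z)) powr p) * indicator (ball x0 r) (x + z)"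
      by (auto simp: indicator_def)
  qed
  also have "\<dots> = pmass p (ball x0 r) (\<lambda>x. f (x + (y - z)) - f x)"
    unfolding pmass_def by (rule nn_integral_lborel_shift) measurable
  also have "\<dots> \<le> ennreal (C * (norm (y - z))\<^sup>2)"
    by (rule diff) (use norm_triangle_ineq4[of y z] y z in simp)
  finally show ?thesis .
qed

text \<open>In the mean: integrate in \<open>x\<close> first and use the difference hypothesis for each pair of shifts.\<close>

lemma integral_osc_le: "(\<integral>\<^sup>+x\<in>ball x0 (r/2). osc k x \<partial>lborel) \<le> ennreal (C * (2 * scale k)\<^sup>2)"
proof -
  let ?B = "ball x0 (r/2)" and ?Z = "ball (0::'a) (scale (Suc k))" and ?Y = "ball (0::'a) (scale k)"
  let ?g = "\<lambda>x y z. ennreal (norm (f (x + y) - f (x + z)) powr p)"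
  have "(\<integral>\<^sup>+x\<in>?B. osc k x \<partial>lborel) = (\<integral>\<^sup>+x. ennreal (1 / (vol k * vol (Suc k))) * (\<integral>\<^sup>+z. \<integral>\<^sup>+y. ?g x y z * indicator ?Y y * indicator ?Z z * indicator ?B x \<partial>lborel \<partial>lborel) \<partial>lborel)"
    unfolding osc_def by (intro nn_integral_cong) (auto simp: indicator_def nn_integral_multc intro!: arg_cong2[where f="(*)"] nn_integral_cong)
  also have "\<dots> = ennreal (1 / (vol k * vol (Suc k))) * (\<integral>\<^sup>+x. \<integral>\<^sup>+z. \<integral>\<^sup>+y. ?g x y z * indicator ?Y y * indicator ?Z z * indicator ?B x \<partial>lborel \<partial>lborel \<partial>lborel)"
    by (rule nn_integral_cmult) measurable
  also have "(\<integral>\<^sup>+x. \<integral>\<^sup>+z. \<integral>\<^sup>+y. ?g x y z * indicator ?Y y * indicator ?Z z * indicator ?B x \<partial>lborel \<partial>lborel \<partial>lborel)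
     = (\<integral>\<^sup>+z. \<integral>\<^sup>+x. \<integral>\<^sup>+y. ?g x y z * indicator ?Y y * indicator ?Z z * indicator ?B x \<partial>lborel \<partial>lborel \<partial>lborel)"
    by (rule lborel_pair.Fubini') measurable
  also have "\<dots> = (\<integral>\<^sup>+z. \<integral>\<^sup>+y. \<integral>\<^sup>+x. ?g x y z * indicator ?Y y * indicator ?Z z * indicator ?B x \<partial>lborel \<partial>lborel \<partial>lborel)"
    by (intro nn_integral_cong lborel_pair.Fubini') measurable
  also have "\<dots> \<le> (\<integral>\<^sup>+z. \<integral>\<^sup>+y. ennreal (C * (2 * scale k)\<^sup>2) * (indicator ?Y y * indicator ?Z z) \<partial>lborel \<partial>lborel)"
  proof (intro nn_integral_mono)
    fix z y
    show "(\<integral>\<^sup>+x. ?g x y z * indicator ?Y y * indicator ?Z z * indicator ?B x \<partial>lborel) \<le> ennreal (C * (2 * scale k)\<^sup>2) * (indicator ?Y y * indicator ?Z z)"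
    proof (cases "y \<in> ?Y \<and> z \<in> ?Z")
      case True
      then have n: "norm y \<le> scale k" "norm z \<le> scale k" using scale_pos[of k] by (auto simp: scale_Suc)
      then have "(\<integral>\<^sup>+x\<in>?B. ?g x y z \<partial>lborel) \<le> ennreal (C * (norm (y - z))\<^sup>2)"
        using scale_le[of k] r by (intro pmass_shifted_diff) auto
      also have "\<dots> \<le> ennreal (C * (2 * scale k)\<^sup>2)"
        using n norm_triangle_ineq4[of y z] C by (intro ennreal_leI mult_left_mono power_mono) auto
      finally show ?thesis using True by simp
    qed (auto simp: indicator_def)
  qed
  also have "\<dots> = ennreal (C * (2 * scale k)\<^sup>2) * (ennreal (vol k) * ennreal (vol (Suc k)))"
    by (simp add: nn_integral_cmult nn_integral_multc emeasure_scale)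
  finally have "(\<integral>\<^sup>+x\<in>?B. osc k x \<partial>lborel) \<le> ennreal (1 / (vol k * vol (Suc k))) * (ennreal (C * (2 * scale k)\<^sup>2) * (ennreal (vol k) * ennreal (vol (Suc k))))"
    by (simp only: mult_left_mono zero_le)
  also have "\<dots> = ennreal (C * (2 * scale k)\<^sup>2)"
    using vol_pos[of k] vol_pos[of "Suc k"] C by (simp add: ennreal_mult[symmetric])
  finally show ?thesis .
qed

text \<open>Pointwise: for fixed \<open>x\<close> put \<open>y = z + h\<close>; integrating in \<open>z\<close> first is again an integral of a translation difference, and only
  the volume of the smaller ball is lost.\<close>

lemma osc_le:
  assumes x: "x \<in> ball x0 (r/2)"
  shows "osc k x \<le> ennreal (2 ^ DIM('a) * C * (2 * scale k)\<^sup>2 / vol (Suc k))"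
proof -
  let ?Z = "ball (0::'a) (scale (Suc k))" and ?Y = "ball (0::'a) (scale k)" and ?H = "ball (0::'a) (2 * scale k)"
  let ?g = "\<lambda>h z. ennreal (norm (f (x + z + h) - f (x + z)) powr p)"
  have "(\<integral>\<^sup>+z\<in>?Z. \<integral>\<^sup>+y\<in>?Y. ennreal (norm (f (x + y) - f (x + z)) powr p) \<partial>lborel \<partial>lborel) \<le> (\<integral>\<^sup>+z. \<integral>\<^sup>+h. ?g h z * indicator ?H h * indicator ?Z z \<partial>lborel \<partial>lborel)"
  proof (intro nn_integral_mono)
    fix z
    show "(\<integral>\<^sup>+y\<in>?Y. ennreal (norm (f (x + y) - f (x + z)) powr p) \<partial>lborel) * indicator ?Z z \<le> (\<integral>\<^sup>+h. ?g h z * indicator ?H h * indicator ?Z z \<partial>lborel)"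
    proof (cases "z \<in> ?Z")
      case True
      have "(\<integral>\<^sup>+y\<in>?Y. ennreal (norm (f (x + y) - f (x + z)) powr p) \<partial>lborel) = (\<integral>\<^sup>+h. ennreal (norm (f (x + (h + z)) - f (x + z)) powr p) * indicator ?Y (h + z) \<partial>lborel)"
        by (rule nn_integral_lborel_shift[symmetric]) measurable
      also have "\<dots> \<le> (\<integral>\<^sup>+h. ?g h z * indicator ?H h * indicator ?Z z \<partial>lborel)"
      proof (intro nn_integral_mono)
        fix h
        have "h + z \<in> ?Y \<Longrightarrow> h \<in> ?H" using True norm_triangle_ineq4[of "h + z" z] scale_pos[of k] by (simp add: scale_Suc)
        then show "ennreal (norm (f (x + (h + z)) - f (x + z)) powr p) * indicator ?Y (h + z) \<le> ?g h z * indicator ?H h * indicator ?Z z"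
          using True by (auto simp: indicator_def ac_simps)
      qed
      finally show ?thesis using True by simp
    qed (simp add: indicator_def)
  qed
  also have "\<dots> = (\<integral>\<^sup>+h. \<integral>\<^sup>+z. ?g h z * indicator ?H h * indicator ?Z z \<partial>lborel \<partial>lborel)"
    by (rule lborel_pair.Fubini') measurable
  also have "\<dots> \<le> (\<integral>\<^sup>+h. ennreal (C * (2 * scale k)\<^sup>2) * indicator ?H h \<partial>lborel)"
  proof (intro nn_integral_mono)
    fix h
    show "(\<integral>\<^sup>+z. ?g h z * indicator ?H h * indicator ?Z z \<partial>lborel) \<le> ennreal (C * (2 * scale k)\<^sup>2) * indicator ?H h"
    proof (cases "h \<in> ?H")
      case True
      then have h: "norm h \<le> 2 * scale k" by simp
      have "(\<integral>\<^sup>+z. ?g h z * indicator ?H h * indicator ?Z z \<partial>lborel) \<le> (\<integral>\<^sup>+z. (\<lambda>v. ennreal (norm (f (v + h) - f v) powr p) * indicator (ball x0 r) v) (z + x) \<partial>lborel)"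
      proof (intro nn_integral_mono)
        fix z
        have "z \<in> ?Z \<Longrightarrow> z + x \<in> ball x0 r"
          using x scale_le[of "Suc k"] norm_triangle_ineq4[of "x0 - x" z] r by (simp add: dist_norm algebra_simps)
        then show "?g h z * indicator ?H h * indicator ?Z z \<le> ennreal (norm (f (z + x + h) - f (z + x)) powr p) * indicator (ball x0 r) (z + x)"
          by (auto simp: indicator_def ac_simps)
      qed
      also have "\<dots> = pmass p (ball x0 r) (\<lambda>v. f (v + h) - f v)" unfolding pmass_def by (rule nn_integral_lborel_shift) measurable
      also have "\<dots> \<le> ennreal (C * (norm h)\<^sup>2)" by (rule diff) (use h scale_le[of k] r in simp)
      also have "\<dots> \<le> ennreal (C * (2 * scale k)\<^sup>2)" using h C by (intro ennreal_leI mult_left_mono power_mono) auto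
      finally show ?thesis using True by simp
    qed (simp add: indicator_def)
  qed
  also have "\<dots> = ennreal (C * (2 * scale k)\<^sup>2) * emeasure lborel ?H" by (rule nn_integral_cmult_indicator) simp
  also have "emeasure lborel ?H = ennreal (2 ^ DIM('a) * vol k)"
  proof -
    have "emeasure lborel ?H = ennreal ((2 * scale k) ^ DIM('a)) * emeasure lborel (ball (0::'a) 1)"
      by (rule measure_ball_scale) (use scale_pos[of k] in simp)
    also have "\<dots> = ennreal (2 ^ DIM('a)) * (ennreal (scale k ^ DIM('a)) * emeasure lborel (ball (0::'a) 1))"
      using scale_pos[of k] by (simp add: power_mult_distrib ennreal_mult mult.assoc)
    also have "ennreal (scale k ^ DIM('a)) * emeasure lborel (ball (0::'a) 1) = ennreal (vol k)"
      using measure_ball_scale[of "scale k" "0::'a"] scale_pos[of k] by (simp add: emeasure_scale)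
    finally show ?thesis using vol_pos[of k] by (simp add: ennreal_mult)
  qed
  finally have "osc k x \<le> ennreal (1 / (vol k * vol (Suc k))) * (ennreal (C * (2 * scale k)\<^sup>2) * ennreal (2 ^ DIM('a) * vol k))"
    unfolding osc_def by (intro mult_left_mono) auto
  also have "\<dots> = ennreal (1 / (vol k * vol (Suc k)) * (C * (2 * scale k)\<^sup>2 * (2 ^ DIM('a) * vol k)))"
  proof -
    have e: "ennreal a * (ennreal b * ennreal c) = ennreal (a * (b * c))" if "0 \<le> a" "0 \<le> b" "0 \<le> c" for a b c
      using that by (simp add: ennreal_mult)
    show ?thesis by (rule e) (use vol_pos[of k] vol_pos[of "Suc k"] C in auto)
  qed
  also have "1 / (vol k * vol (Suc k)) * (C * (2 * scale k)\<^sup>2 * (2 ^ DIM('a) * vol k)) = 2 ^ DIM('a) * C * (2 * scale k)\<^sup>2 / vol (Suc k)"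
    using vol_pos[of k] by simp
  finally show ?thesis .
qed

text \<open>The \<open>p\<close>-th powers of \<open>avg k - f\<close> have integrals of order \<open>(scale k)\<^sup>2\<close>, which are summable. So they are summable at almost
  every point.\<close>

lemma avg_LIMSEQ: "AE x in lborel. x \<in> ball x0 (r/2) \<longrightarrow> (\<lambda>k. avg k x) \<longlonglongrightarrow> f x"
proof -
  let ?B = "ball x0 (r/2)"
  define V where "V k x = ennreal (1 / vol k) * (\<integral>\<^sup>+y\<in>ball 0 (scale k). ennreal (norm (f (x + y) - f x) powr p) \<partial>lborel)" for k x
  have [measurable]: "V k \<in> borel_measurable borel" for k unfolding V_def[abs_def] by measurable
  have V: "(\<integral>\<^sup>+x\<in>?B. V k x \<partial>lborel) \<le> ennreal (C * (scale k)\<^sup>2)" for k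
  proof -
    let ?Y = "ball (0::'a) (scale k)"
    let ?g = "\<lambda>x y. ennreal (norm (f (x + y) - f x) powr p)"
    have "(\<integral>\<^sup>+x\<in>?B. V k x \<partial>lborel) = (\<integral>\<^sup>+x. ennreal (1 / vol k) * (\<integral>\<^sup>+y. ?g x y * indicator ?Y y * indicator ?B x \<partial>lborel) \<partial>lborel)"
      unfolding V_def by (intro nn_integral_cong) (auto simp: indicator_def intro!: arg_cong2[where f="(*)"] nn_integral_cong)
    also have "\<dots> = ennreal (1 / vol k) * (\<integral>\<^sup>+x. \<integral>\<^sup>+y. ?g x y * indicator ?Y y * indicator ?B x \<partial>lborel \<partial>lborel)"
      by (rule nn_integral_cmult) measurable
    also have "(\<integral>\<^sup>+x. \<integral>\<^sup>+y. ?g x y * indicator ?Y y * indicator ?B x \<partial>lborel \<partial>lborel) = (\<integral>\<^sup>+y. \<integral>\<^sup>+x. ?g x y * indicator ?Y y * indicator ?B x \<partial>lborel \<partial>lborel)"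
      by (rule lborel_pair.Fubini') measurable
    also have "\<dots> \<le> (\<integral>\<^sup>+y. ennreal (C * (scale k)\<^sup>2) * indicator ?Y y \<partial>lborel)"
    proof (intro nn_integral_mono)
      fix y
      show "(\<integral>\<^sup>+x. ?g x y * indicator ?Y y * indicator ?B x \<partial>lborel) \<le> ennreal (C * (scale k)\<^sup>2) * indicator ?Y y"
      proof (cases "y \<in> ?Y")
        case True
        then have n: "norm y \<le> scale k" by simp
        have "(\<integral>\<^sup>+x\<in>?B. ennreal (norm (f (x + y) - f (x + 0)) powr p) \<partial>lborel) \<le> ennreal (C * (norm (y - 0))\<^sup>2)"
          by (rule pmass_shifted_diff) (use n scale_le[of k] r in auto)
        also have "\<dots> \<le> ennreal (C * (scale k)\<^sup>2)" using n C by (intro ennreal_leI mult_left_mono power_mono) auto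
        finally show ?thesis using True by simp
      qed (simp add: indicator_def)
    qed
    also have "\<dots> = ennreal (C * (scale k)\<^sup>2) * ennreal (vol k)" by (simp add: nn_integral_cmult_indicator emeasure_scale)
    finally have "(\<integral>\<^sup>+x\<in>?B. V k x \<partial>lborel) \<le> ennreal (1 / vol k) * (ennreal (C * (scale k)\<^sup>2) * ennreal (vol k))"
      by (simp only: mult_left_mono zero_le)
    also have "\<dots> = ennreal (C * (scale k)\<^sup>2)" using vol_pos[of k] C by (simp add: ennreal_mult[symmetric])
    finally show ?thesis .
  qed
  have "(\<integral>\<^sup>+x. (\<Sum>k. V k x * indicator ?B x) \<partial>lborel) = (\<Sum>k. \<integral>\<^sup>+x\<in>?B. V k x \<partial>lborel)"
    by (rule nn_integral_suminf) measurable
  also have "\<dots> \<le> (\<Sum>k. ennreal (C * (scale k)\<^sup>2))" by (intro suminf_le V) auto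
  also have "\<dots> < \<infinity>"
  proof -
    have e: "C * (scale k)\<^sup>2 = C * (r/4)\<^sup>2 * (1/4) ^ k" for k
      by (simp add: scale_def power_mult_distrib power_mult[symmetric] power2_eq_square power_divide)
        (simp add: power_mult_distrib[symmetric] flip: power_add mult_2)
    have "summable (\<lambda>k. C * (scale k)\<^sup>2)" unfolding e by (intro summable_mult summable_geometric) simp
    then show ?thesis using C by (subst suminf_ennreal2) auto
  qed
  finally have "AE x in lborel. (\<Sum>k. V k x * indicator ?B x) \<noteq> \<infinity>"
    by (intro nn_integral_PInf_AE) auto
  then show ?thesis
  proof (rule eventually_mono, intro impI)
    fix x assume s: "(\<Sum>k. V k x * indicator ?B x) \<noteq> \<infinity>" and x: "x \<in> ?B"
    have xr: "x \<in> ball x0 r" using x r by simp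
    have fin: "(\<Sum>k. ennreal (norm (avg k x - f x) powr p)) < \<infinity>"
    proof -
      have "(\<Sum>k. ennreal (norm (avg k x - f x) powr p)) \<le> (\<Sum>k. V k x * indicator ?B x)"
        using x avg_sub_powr[OF xr, of _ "f x"] by (intro suminf_le) (auto simp: V_def)
      also have "\<dots> < \<infinity>" using s by (simp add: less_top)
      finally show ?thesis .
    qed
    have "summable (\<lambda>k. norm (avg k x - f x) powr p)"
      by (rule summable_suminf_not_top) (use fin in auto)
    then have "(\<lambda>k. norm (avg k x - f x) powr p) \<longlonglongrightarrow> 0" by (rule summable_LIMSEQ_zero)
    then have "(\<lambda>k. (norm (avg k x - f x) powr p) powr (1/p)) \<longlonglongrightarrow> 0 powr (1/p)"
      by (intro tendsto_powr') (use p in auto)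
    then have "(\<lambda>k. norm (avg k x - f x)) \<longlonglongrightarrow> 0" using p by (simp add: powr_powr)
    then show "(\<lambda>k. avg k x) \<longlonglongrightarrow> f x" by (simp add: tendsto_norm_zero_iff LIM_zero_iff)
  qed
qed

lemma avg_0_bounded:
  obtains M where "0 \<le> M" "\<And>x. x \<in> ball x0 (r/2) \<Longrightarrow> norm (avg 0 x) \<le> M"
proof -
  have "ennreal (1 / vol 0) * pmass p (ball x0 (2 * r)) f < \<infinity>" using fin by (simp add: ennreal_mult_less_top)
  then obtain m where m: "0 \<le> m" "ennreal (1 / vol 0) * pmass p (ball x0 (2 * r)) f = ennreal m"
    using ennreal_finiteE[of "ennreal (1 / vol 0) * pmass p (ball x0 (2 * r)) f"] by (metis order_less_irrefl)
  have "norm (avg 0 x) \<le> m powr (1/p)" if x: "x \<in> ball x0 (r/2)" for x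
  proof -
    have xr: "x \<in> ball x0 r" using x r by simp
    have "ennreal (norm (avg 0 x - 0) powr p) \<le> ennreal (1 / vol 0) * (\<integral>\<^sup>+y\<in>ball 0 (scale 0). ennreal (norm (f (x + y) - 0) powr p) \<partial>lborel)"
      by (rule avg_sub_powr[OF xr])
    also have "\<dots> \<le> ennreal (1 / vol 0) * pmass p (ball x0 (2 * r)) f"
    proof (intro mult_left_mono)
      have "(\<integral>\<^sup>+y\<in>ball 0 (scale 0). ennreal (norm (f (x + y) - 0) powr p) \<partial>lborel)
        \<le> (\<integral>\<^sup>+y. (\<lambda>v. ennreal (norm (f v) powr p) * indicator (ball x0 (2 * r)) v) (y + x) \<partial>lborel)"
      proof (intro nn_integral_mono)
        fix y :: 'a
        have "y \<in> ball 0 (scale 0) \<Longrightarrow> y + x \<in> ball x0 (2 * r)"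
          using x scale_le[of 0] norm_triangle_ineq4[of "x0 - x" y] r by (simp add: dist_norm algebra_simps)
        then show "ennreal (norm (f (x + y) - 0) powr p) * indicator (ball 0 (scale 0)) y \<le> ennreal (norm (f (y + x)) powr p) * indicator (ball x0 (2 * r)) (y + x)"
          by (auto simp: indicator_def ac_simps)
      qed
      also have "\<dots> = pmass p (ball x0 (2 * r)) f" unfolding pmass_def by (rule nn_integral_lborel_shift) measurable
      finally show "(\<integral>\<^sup>+y\<in>ball 0 (scale 0). ennreal (norm (f (x + y) - 0) powr p) \<partial>lborel) \<le> pmass p (ball x0 (2 * r)) f" .
    qed simp
    finally have "norm (avg 0 x) powr p \<le> m" unfolding m(2) using m(1) by (simp add: ennreal_le_iff)
    then have "(norm (avg 0 x) powr p) powr (1/p) \<le> m powr (1/p)" using p by (intro powr_mono2) auto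
    then show ?thesis using p by (simp add: powr_powr)
  qed
  then show thesis using that[of "m powr (1/p)"] by simp
qed

text \<open>Each weighted step \<open>norm (a (Suc k) - a k) / l ^ k\<close> is at most the \<open>t\<close>-th root of the sum of all \<open>t\<close>-th powers, so the telescoping
  series is dominated by a geometric one. This replaces Hoelder's inequality for series.\<close>

lemma telescoping_powr_bound:
  fixes a :: "nat \<Rightarrow> 'b" and M l t :: real
  assumes a: "a \<longlonglongrightarrow> b" "norm (a 0) \<le> M" and l: "0 < l" "l < 1" and t: "t > 0" and M: "0 \<le> M"
  shows "ennreal (norm b powr t) \<le> ennreal (2 powr t) * (ennreal (M powr t) + ennreal ((1 / (1 - l)) powr t) * (\<Sum>k. ennreal ((norm (a (Suc k) - a k) / l ^ k) powr t)))"
proof (cases "(\<Sum>k. ennreal ((norm (a (Suc k) - a k) / l ^ k) powr t)) = \<infinity>")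
  case True
  then show ?thesis using l by (simp add: ennreal_mult_top)
next
  case False
  let ?c = "\<lambda>k. (norm (a (Suc k) - a k) / l ^ k) powr t"
  obtain z where z: "0 \<le> z" "(\<Sum>k. ennreal (?c k)) = ennreal z"
    by (rule ennreal_finiteE[OF False])
  have step: "norm (a (Suc k) - a k) \<le> z powr (1/t) * l ^ k" for k
  proof -
    have "ennreal (?c k) = (\<Sum>i\<in>{k}. ennreal (?c i))" by simp
    also have "\<dots> \<le> (\<Sum>k. ennreal (?c k))" by (rule sum_le_suminf) auto
    finally have "?c k \<le> z" unfolding z(2) using z(1) by (simp add: ennreal_le_iff)
    then have "?c k powr (1/t) \<le> z powr (1/t)" using t by (intro powr_mono2) auto
    then have "norm (a (Suc k) - a k) / l ^ k \<le> z powr (1/t)" using t l by (simp add: powr_powr)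
    then show ?thesis using l by (simp add: pos_divide_le_eq)
  qed
  have part: "norm (a k) \<le> M + z powr (1/t) * (1 / (1 - l))" for k
  proof -
    have "norm (a k) \<le> M + z powr (1/t) * (\<Sum>j<k. l ^ j)"
    proof (induction k)
      case 0 then show ?case using a(2) by simp
    next
      case (Suc k)
      have "norm (a (Suc k)) \<le> norm (a k) + norm (a (Suc k) - a k)" using norm_triangle_ineq[of "a k" "a (Suc k) - a k"] by simp
      then show ?case using Suc.IH step[of k] by (simp add: distrib_left)
    qed
    also have "(\<Sum>j<k. l ^ j) \<le> 1 / (1 - l)"
      using sum_le_suminf[of "\<lambda>j. l ^ j" "{..<k}"] l by (simp add: suminf_geometric summable_geometric)
    finally show ?thesis by (simp add: mult_left_mono)
  qed
  have "norm b \<le> M + z powr (1/t) * (1 / (1 - l))"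
    by (rule Lim_norm_ubound[OF _ a(1)]) (use part in auto)
  then have "norm b powr t \<le> norm (M + z powr (1/t) * (1 / (1 - l))) powr t"
    using t by (intro powr_mono2) auto
  also have "\<dots> \<le> 2 powr t * (norm M powr t + norm (z powr (1/t) * (1 / (1 - l))) powr t)"
    by (rule powr_norm_add_le) (use t in simp)
  also have "\<dots> = 2 powr t * (M powr t + (1 / (1 - l)) powr t * z)"
    using M l t z(1) by (simp add: powr_mult powr_powr powr_divide)
  finally have "ennreal (norm b powr t) \<le> ennreal (2 powr t * (M powr t + (1 / (1 - l)) powr t * z))" by (rule ennreal_leI)
  also have "\<dots> = ennreal (2 powr t) * (ennreal (M powr t) + ennreal ((1 / (1 - l)) powr t) * ennreal z)"
    using z(1) by (simp add: ennreal_mult ennreal_plus)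
  finally show ?thesis unfolding z(2) .
qed

lemma scale_powr: "scale k = r / 4 * 2 powr (- real k)"
  by (simp add: scale_def powr_minus powr_realpow power_one_over inverse_eq_divide)

text \<open>The pointwise bound; its growth rate in \<open>k\<close> is \<open>2 powr (n - 2)\<close>.\<close>

definition osc_bound :: "nat \<Rightarrow> real" where "osc_bound k = 2 ^ DIM('a) * C * (2 * scale k)\<^sup>2 / vol (Suc k)"

lemma osc_bound_nonneg: "0 \<le> osc_bound k" unfolding osc_bound_def using C vol_pos[of "Suc k"] by simp

lemma osc_bound_eq: "osc_bound k = osc_bound 0 * 2 powr ((real DIM('a) - 2) * real k)"
proof -
  let ?n = "DIM('a)"
  have s: "scale k = scale 0 * 2 powr (- real k)" "scale (Suc k) = scale (Suc 0) * 2 powr (- real k)"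
    unfolding scale_Suc by (simp_all add: scale_powr)
  have v: "vol (Suc k) = vol (Suc 0) * 2 powr (- (real ?n * real k))"
    unfolding vol_eq s(2) by (simp add: power_mult_distrib powr_power mult.commute)
  have q: "(2 * scale k)\<^sup>2 = (2 * scale 0)\<^sup>2 * 2 powr (- (2 * real k))"
    unfolding s(1) by (simp add: power_mult_distrib powr_power mult.commute)
  have "osc_bound k = osc_bound 0 * (2 powr (- (2 * real k)) / 2 powr (- (real ?n * real k)))"
    unfolding osc_bound_def v q by simp
  also have "2 powr (- (2 * real k)) / 2 powr (- (real ?n * real k)) = 2 powr ((real ?n - 2) * real k)"
    by (simp add: powr_diff[symmetric] algebra_simps)
  finally show ?thesis .
qed

text \<open>Interpolate between the two bounds on the step \<open>w\<close> from scale \<open>k\<close> to the next: in \<open>w powr s = w powr (s - p) * w powr p\<close> the first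
  factor is bounded pointwise by a power growing like \<open>2 powr (k (n - 2) (s - p) / p)\<close>, the second in the mean by a constant times
  \<open>2 powr (-2 k)\<close>. The exponents add up to \<open>k E\<close> with \<open>E < 0\<close>, precisely under the hypothesis on \<open>s\<close>.\<close>

theorem higher_integrability:
  assumes s: "p \<le> s" "s * (real DIM('a) - 2) < p * real DIM('a)"
  shows "pmass s (ball x0 (r/2)) f < \<infinity>"
proof -
  let ?n = "real DIM('a)" and ?B = "ball x0 (r/2)"
  have s0: "s > 0" using s p by simp
  define E where "E = (?n - 2) * ((s - p) / p) - 2"
  have E: "E < 0"
  proof -
    have "p * E = s * (?n - 2) - p * ?n" using p by (simp add: E_def field_simps)
    then have "p * E < 0" using s(2) by simp
    then show ?thesis using p by (simp add: mult_less_0_iff)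
  qed
  \<comment> \<open>Half of the decay \<open>E\<close> is spent on the geometric weights \<open>l ^ k\<close> of the telescoping bound.\<close>
  define l where "l = 2 powr (E / (2 * s))"
  have l: "0 < l" "l < 1" using E s0 by (auto simp: l_def powr_less_one divide_neg_pos intro!: powr_less_one)
  obtain M where M: "0 \<le> M" "\<And>x. x \<in> ?B \<Longrightarrow> norm (avg 0 x) \<le> M" using avg_0_bounded by blast
  define d where "d k = (osc_bound k powr ((s - p) / p)) * ((1 / l ^ k) powr s)" for k
  have d0: "0 \<le> d k" for k by (simp add: d_def)
  have osc_term: "ennreal ((norm (avg (Suc k) x - avg k x) / l ^ k) powr s) \<le> ennreal (d k) * osc k x" if x: "x \<in> ?B" for k x
  proof -
    let ?w = "norm (avg (Suc k) x - avg k x)"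
    have xr: "x \<in> ball x0 r" using x r by simp
    have w1: "ennreal (?w powr p) \<le> osc k x" by (rule avg_step_le_osc[OF xr])
    also have "osc k x \<le> ennreal (osc_bound k)" unfolding osc_bound_def by (rule osc_le[OF x])
    finally have w2: "?w powr p \<le> osc_bound k" using osc_bound_nonneg by (simp add: ennreal_le_iff)
    have "?w powr s = (?w powr p) powr ((s - p) / p) * ?w powr p"
    proof -
      have "?w powr s = ?w powr (s - p) * ?w powr p" by (simp add: powr_add[symmetric])
      then show ?thesis using p by (simp add: powr_powr)
    qed
    also have "\<dots> \<le> osc_bound k powr ((s - p) / p) * ?w powr p"
      using w2 s p by (intro mult_right_mono powr_mono2) auto
    finally have "(?w / l ^ k) powr s \<le> d k * ?w powr p"
      using l by (simp add: d_def powr_divide divide_right_mono mult.commute)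
    then have "ennreal ((?w / l ^ k) powr s) \<le> ennreal (d k) * ennreal (?w powr p)"
      using d0 by (simp add: ennreal_mult[symmetric] ennreal_leI)
    also have "\<dots> \<le> ennreal (d k) * osc k x" by (intro mult_left_mono w1) simp
    finally show ?thesis .
  qed
  have dk: "d k * (C * (2 * scale k)\<^sup>2) = osc_bound 0 powr ((s - p) / p) * (C * (2 * scale 0)\<^sup>2) * (2 powr (E / 2)) ^ k" for k
  proof -
    have a: "osc_bound k powr ((s - p) / p) = osc_bound 0 powr ((s - p) / p) * 2 powr ((?n - 2) * real k * ((s - p) / p))"
      unfolding osc_bound_eq[of k] using osc_bound_nonneg[of 0] by (simp add: powr_mult powr_powr)
    have b: "(1 / l ^ k) powr s = 2 powr (- (E / 2) * real k)"
    proof -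
      have "l ^ k = 2 powr (E / (2 * s) * real k)" by (simp add: l_def powr_power mult.commute)
      then have "1 / l ^ k = 2 powr (- (E / (2 * s) * real k))" by (simp add: powr_minus inverse_eq_divide)
      then show ?thesis using s0 by (simp add: powr_powr)
    qed
    have c: "(2 * scale k)\<^sup>2 = (2 * scale 0)\<^sup>2 * 2 powr (- 2 * real k)"
    proof -
      have "scale k = scale 0 * 2 powr (- real k)" by (simp add: scale_powr)
      then show ?thesis by (simp add: power_mult_distrib powr_power mult.commute)
    qed
    have e: "2 powr ((?n - 2) * real k * ((s - p) / p)) * 2 powr (- (E / 2) * real k) * 2 powr (- 2 * real k) = (2 powr (E / 2)) ^ k"
    proof -
      have "(2 powr (E / 2)) ^ k = 2 powr (E / 2 * real k)" by (simp add: powr_power mult.commute)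
      moreover have "(?n - 2) * real k * ((s - p) / p) + - (E / 2) * real k + - 2 * real k = E / 2 * real k"
      proof -
        have "(?n - 2) * real k * ((s - p) / p) = (E + 2) * real k" by (simp add: E_def)
        then show ?thesis by (simp add: algebra_simps)
      qed
      ultimately show ?thesis by (simp only: powr_add[symmetric])
    qed
    have "d k * (C * (2 * scale k)\<^sup>2) = osc_bound 0 powr ((s - p) / p) * (C * (2 * scale 0)\<^sup>2) *
      (2 powr ((?n - 2) * real k * ((s - p) / p)) * 2 powr (- (E / 2) * real k) * 2 powr (- 2 * real k))"
      unfolding d_def a b c by (simp only: mult_ac)
    then show ?thesis by (simp only: e)
  qed
  let ?Z = "\<lambda>x. \<Sum>k. ennreal (d k) * osc k x"
  have Z: "(\<integral>\<^sup>+x\<in>?B. ?Z x \<partial>lborel) < \<infinity>"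
  proof -
    have "(\<integral>\<^sup>+x\<in>?B. ?Z x \<partial>lborel) = (\<integral>\<^sup>+x. (\<Sum>k. ennreal (d k) * (osc k x * indicator ?B x)) \<partial>lborel)"
      by (intro nn_integral_cong) (simp add: ennreal_suminf_multc mult.assoc flip: ennreal_suminf_multc)
    also have "\<dots> = (\<Sum>k. \<integral>\<^sup>+x. ennreal (d k) * (osc k x * indicator ?B x) \<partial>lborel)"
      by (rule nn_integral_suminf) measurable
    also have "\<dots> = (\<Sum>k. ennreal (d k) * (\<integral>\<^sup>+x\<in>?B. osc k x \<partial>lborel))"
      by (subst nn_integral_cmult) auto
    also have "\<dots> \<le> (\<Sum>k. ennreal (d k * (C * (2 * scale k)\<^sup>2)))"
    proof (intro suminf_le)
      fix k
      have "ennreal (d k) * (\<integral>\<^sup>+x\<in>?B. osc k x \<partial>lborel) \<le> ennreal (d k) * ennreal (C * (2 * scale k)\<^sup>2)"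
        by (intro mult_left_mono integral_osc_le) simp
      also have "\<dots> = ennreal (d k * (C * (2 * scale k)\<^sup>2))" using d0[of k] C by (simp add: ennreal_mult)
      finally show "ennreal (d k) * (\<integral>\<^sup>+x\<in>?B. osc k x \<partial>lborel) \<le> ennreal (d k * (C * (2 * scale k)\<^sup>2))" .
    qed auto
    also have "\<dots> < \<infinity>"
    proof -
      have "summable (\<lambda>k. osc_bound 0 powr ((s - p) / p) * (C * (2 * scale 0)\<^sup>2) * (2 powr (E / 2)) ^ k)"
        using E by (intro summable_mult summable_geometric) (simp add: powr_less_one)
      then have "summable (\<lambda>k. d k * (C * (2 * scale k)\<^sup>2))" by (simp only: dk)
      then show ?thesis using d0 C by (subst suminf_ennreal2) auto
    qed
    finally show ?thesis .
  qed
  have "pmass s ?B f \<le> (\<integral>\<^sup>+x. ennreal (2 powr s) * (ennreal (M powr s) * indicator ?B x + ennreal ((1 / (1 - l)) powr s) * (?Z x * indicator ?B x)) \<partial>lborel)"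
    unfolding pmass_def
  proof (rule nn_integral_mono_AE, rule eventually_mono[OF avg_LIMSEQ])
    fix x assume lim: "x \<in> ?B \<longrightarrow> (\<lambda>k. avg k x) \<longlonglongrightarrow> f x"
    show "ennreal (norm (f x) powr s) * indicator ?B x \<le> ennreal (2 powr s) * (ennreal (M powr s) * indicator ?B x + ennreal ((1 / (1 - l)) powr s) * (?Z x * indicator ?B x))"
    proof (cases "x \<in> ?B")
      case True
      have "ennreal (norm (f x) powr s) \<le> ennreal (2 powr s) * (ennreal (M powr s) + ennreal ((1 / (1 - l)) powr s) * (\<Sum>k. ennreal ((norm (avg (Suc k) x - avg k x) / l ^ k) powr s)))"
        by (rule telescoping_powr_bound) (use lim True M l s0 in auto)
      also have "\<dots> \<le> ennreal (2 powr s) * (ennreal (M powr s) + ennreal ((1 / (1 - l)) powr s) * ?Z x)"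
        by (intro mult_left_mono add_left_mono suminf_le osc_term[OF True]) auto
      finally show ?thesis using True by simp
    qed simp
  qed
  also have "\<dots> = ennreal (2 powr s) * (ennreal (M powr s) * emeasure lborel ?B + ennreal ((1 / (1 - l)) powr s) * (\<integral>\<^sup>+x\<in>?B. ?Z x \<partial>lborel))"
    by (simp add: nn_integral_cmult nn_integral_add)
  also have "\<dots> < \<infinity>"
    using Z emeasure_bounded_finite[OF bounded_ball, of x0 "r/2"] by (simp add: ennreal_mult_less_top)
  finally show ?thesis .
qed

end

section \<open>Difference estimate for minimizers\<close>

context convex_integrand
begin

lemma F_eps_eq:
  fixes v v' :: "real^'n \<Rightarrow> real^'m"
  assumes S: "open S" and w: "has_weak_gradient S v E"
    and m [measurable]: "v' \<in> borel_measurable borel" "E' \<in> borel_measurable borel"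
    and ae: "AE x in lborel. x \<in> S \<longrightarrow> v x = v' x" "AE x in lborel. x \<in> S \<longrightarrow> E x = E' x"
  shows "F_eps p G \<epsilon> v S = enn2real (\<integral>\<^sup>+x\<in>S. ennreal (integrand (v' x) (E' x)) \<partial>lborel)"
proof -
  have [measurable]: "S \<in> sets borel" using S by simp
  have "F_eps p G \<epsilon> v S = (LINT x:S|lebesgue. integrand (v x) (weak_gradient S v x))"
    unfolding F_eps_def integrand_def moduli_def modulus_def by simp
  also have "\<dots> = (LINT x:S|lebesgue. integrand (v' x) (E' x))"
  proof (rule set_integral_AE_cong[symmetric])
    show "AE x in lborel. x \<in> S \<longrightarrow> integrand (v' x) (E' x) = integrand (v x) (weak_gradient S v x)"
      using ae weak_gradient_eq_AE[OF S w] by eventually_elim auto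
    have "(\<lambda>x. indicator S x *\<^sub>R integrand (v' x) (E' x)) \<in> borel_measurable borel" by measurable
    then show "set_borel_measurable lebesgue S (\<lambda>x. integrand (v' x) (E' x))"
      unfolding set_borel_measurable_def by (intro measurable_completion) simp
  qed
  also have "\<dots> = (LINT x|lborel. indicator S x * integrand (v' x) (E' x))"
    by (subst set_integral_lebesgue_lborel) (auto simp: set_lebesgue_integral_def)
  also have "\<dots> = enn2real (\<integral>\<^sup>+x. ennreal (indicator S x * integrand (v' x) (E' x)) \<partial>lborel)"
    by (rule integral_eq_nn_integral) (auto intro!: mult_nonneg_nonneg integrand_nonneg)
  also have "(\<integral>\<^sup>+x. ennreal (indicator S x * integrand (v' x) (E' x)) \<partial>lborel) = (\<integral>\<^sup>+x\<in>S. ennreal (integrand (v' x) (E' x)) \<partial>lborel)"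
    by (intro nn_integral_cong) (auto simp: indicator_def)
  finally show ?thesis .
qed

lemma energy_finite:
  fixes v :: "real^'n \<Rightarrow> real^'m" and E :: "real^'n \<Rightarrow> real^'n^'m"
  assumes [measurable]: "v \<in> borel_measurable borel" "E \<in> borel_measurable borel" "S \<in> sets borel"
    and fin: "emeasure lborel S < \<infinity>" "pmass p S v < \<infinity>" "pmass p S E < \<infinity>"
  shows "(\<integral>\<^sup>+x\<in>S. ennreal (integrand (v x) (E x)) \<partial>lborel) < \<infinity>"
    "(\<integral>\<^sup>+x\<in>S. ennreal (1 + norm (v x) powr p + norm (E x) powr p) \<partial>lborel) < \<infinity>"
proof -
  have "(\<integral>\<^sup>+x\<in>S. ennreal (1 + norm (v x) powr p + norm (E x) powr p) \<partial>lborel)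
    = (\<integral>\<^sup>+x. indicator S x + ennreal (norm (v x) powr p) * indicator S x + ennreal (norm (E x) powr p) * indicator S x \<partial>lborel)"
    by (intro nn_integral_cong) (auto simp: indicator_def ennreal_plus)
  also have "\<dots> = emeasure lborel S + pmass p S v + pmass p S E"
    unfolding pmass_def by (simp add: nn_integral_add)
  also have "\<dots> < \<infinity>" using fin by simp
  finally show A: "(\<integral>\<^sup>+x\<in>S. ennreal (1 + norm (v x) powr p + norm (E x) powr p) \<partial>lborel) < \<infinity>" .
  obtain C where C: "C \<ge> 0" "\<And>s (\<xi> :: real^'n^'m). integrand s \<xi> \<le> C * (1 + norm s powr p + norm \<xi> powr p)"
    using integrand_growth by blast
  have "(\<integral>\<^sup>+x\<in>S. ennreal (integrand (v x) (E x)) \<partial>lborel) \<le> (\<integral>\<^sup>+x. ennreal C * (ennreal (1 + norm (v x) powr p + norm (E x) powr p) * indicator S x) \<partial>lborel)"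
  proof (intro nn_integral_mono)
    fix x
    have "ennreal (integrand (v x) (E x)) \<le> ennreal (C * (1 + norm (v x) powr p + norm (E x) powr p))" by (intro ennreal_leI C)
    also have "\<dots> = ennreal C * ennreal (1 + norm (v x) powr p + norm (E x) powr p)" using C(1) by (intro ennreal_mult) auto
    finally show "ennreal (integrand (v x) (E x)) * indicator S x \<le> ennreal C * (ennreal (1 + norm (v x) powr p + norm (E x) powr p) * indicator S x)"
      unfolding mult.assoc[symmetric] by (rule mult_right_mono) simp
  qed
  also have "\<dots> = ennreal C * (\<integral>\<^sup>+x\<in>S. ennreal (1 + norm (v x) powr p + norm (E x) powr p) \<partial>lborel)"
    by (rule nn_integral_cmult) measurable
  also have "\<dots> < \<infinity>" using A by (simp add: ennreal_mult_less_top)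
  finally show "(\<integral>\<^sup>+x\<in>S. ennreal (integrand (v x) (E x)) \<partial>lborel) < \<infinity>" .
qed

text \<open>With \<open>c = h \<bullet> grad \<zeta> y\<close> the two Jacobians are \<open>1 - c\<close> and \<open>1 + c\<close>, and the two transported gradients lie on the line through
  \<open>g\<close> in a common direction, at the parameters \<open>1 / (1 - c)\<close> and \<open>-1 / (1 + c)\<close>. So the first-order terms cancel.\<close>

lemma shifted_integrand_le:
  obtains K where "K \<ge> 0" "\<And>(\<zeta> :: real^'n \<Rightarrow> real) h L s g y.
    localised_shift \<zeta> h L \<Longrightarrow> localised_shift \<zeta> (- h) L \<Longrightarrow> norm h * L \<le> 1/4 \<Longrightarrow>
    localised_shift.jac \<zeta> h y * integrand s (localised_shift.transport \<zeta> h y g)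
    + localised_shift.jac \<zeta> (- h) y * integrand s (localised_shift.transport \<zeta> (- h) y g)
    \<le> 2 * integrand s g + K * (norm h * L)\<^sup>2 * (1 + norm s powr p + norm g powr p)"
proof -
  obtain K where K: "K \<ge> 0" "\<And>s (g :: (real^'n)^'m) w d. 0 \<le> d \<Longrightarrow> d \<le> 1/4 \<Longrightarrow> (\<And>\<alpha>. norm (w $ \<alpha>) \<le> d * norm (g $ \<alpha>)) \<Longrightarrow>
    \<exists>l. \<forall>r. \<bar>r\<bar> \<le> 2 \<longrightarrow> integrand s (\<chi> \<alpha>. g $ \<alpha> + r *\<^sub>R w $ \<alpha>) \<le> integrand s g + l * r + K * d\<^sup>2 * (1 + norm s powr p + norm g powr p) * r\<^sup>2"
    using integrand_line_quadratic_upper[where 'a="real^'n"] by blast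
  have "localised_shift.jac \<zeta> h y * integrand s (localised_shift.transport \<zeta> h y g)
    + localised_shift.jac \<zeta> (- h) y * integrand s (localised_shift.transport \<zeta> (- h) y g)
    \<le> 2 * integrand s g + (4 * K) * (norm h * L)\<^sup>2 * (1 + norm s powr p + norm g powr p)"
    if P: "localised_shift \<zeta> h L" and M: "localised_shift \<zeta> (- h) L" and d: "norm h * L \<le> 1/4"
    for \<zeta> :: "real^'n \<Rightarrow> real" and h L s g y
  proof -
    let ?b = "grad \<zeta> y" and ?c = "h \<bullet> grad \<zeta> y" and ?d = "norm h * L"
    define w where "w = (\<chi> \<alpha>. (h \<bullet> g $ \<alpha>) *\<^sub>R ?b)"
    have L: "norm ?b \<le> L" by (rule localised_shift.L[OF P])
    then have L0: "0 \<le> L" using norm_ge_zero order_trans by blast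
    have d0: "0 \<le> ?d" using L0 by simp
    have "norm (w $ \<alpha>) \<le> ?d * norm (g $ \<alpha>)" for \<alpha>
    proof -
      have "norm (w $ \<alpha>) \<le> (norm h * norm (g $ \<alpha>)) * L"
        unfolding w_def using L Cauchy_Schwarz_ineq2[of h "g $ \<alpha>"] by (auto intro!: mult_mono)
      then show ?thesis by (simp add: mult_ac)
    qed
    from K(2)[OF d0 d this] obtain l where l: "\<And>r. \<bar>r\<bar> \<le> 2 \<Longrightarrow> integrand s (\<chi> \<alpha>. g $ \<alpha> + r *\<^sub>R w $ \<alpha>) \<le> integrand s g + l * r + K * ?d\<^sup>2 * (1 + norm s powr p + norm g powr p) * r\<^sup>2"
      by blast
    have c: "\<bar>?c\<bar> \<le> 1/2" using Cauchy_Schwarz_ineq2[of h ?b] mult_left_mono[OF L norm_ge_zero[of h]] d by linarith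
    have tP: "localised_shift.transport \<zeta> h y g = (\<chi> \<alpha>. g $ \<alpha> + (1 / (1 - ?c)) *\<^sub>R w $ \<alpha>)"
      by (simp add: localised_shift.transport_def[OF P] localised_shift.jac_def[OF P] w_def vec_eq_iff inverse_eq_divide)
    have tM: "localised_shift.transport \<zeta> (- h) y g = (\<chi> \<alpha>. g $ \<alpha> + (- 1 / (1 + ?c)) *\<^sub>R w $ \<alpha>)"
      by (simp add: localised_shift.transport_def[OF M] localised_shift.jac_def[OF M] w_def vec_eq_iff inverse_eq_divide)
    have "(1 - ?c) * integrand s (\<chi> \<alpha>. g $ \<alpha> + (1 / (1 - ?c)) *\<^sub>R w $ \<alpha>) + (1 + ?c) * integrand s (\<chi> \<alpha>. g $ \<alpha> + (- 1 / (1 + ?c)) *\<^sub>R w $ \<alpha>)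
      \<le> 2 * integrand s g + 4 * (K * ?d\<^sup>2 * (1 + norm s powr p + norm g powr p))"
      by (rule perspective_two_sided[OF l c]) (use K(1) in auto)
    then show ?thesis unfolding tP tM by (simp add: localised_shift.jac_def[OF P] localised_shift.jac_def[OF M])
  qed
  then show thesis using that[of "4 * K"] K(1) by simp
qed

lemma norm_powr_le_sum:
  fixes v :: "('a::euclidean_space)^'m"
  shows "norm v powr p \<le> real CARD('m) powr p * (\<Sum>\<alpha>\<in>UNIV. norm (v $ \<alpha>) powr p)"
proof -
  let ?M = "Max (range (\<lambda>\<alpha>. norm (v $ \<alpha>)))"
  have M: "norm (v $ \<alpha>) \<le> ?M" for \<alpha> by (rule Max_ge) auto
  have "?M \<in> range (\<lambda>\<alpha>. norm (v $ \<alpha>))" by (rule Max_in) auto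
  then obtain \<beta> where b: "?M = norm (v $ \<beta>)" by blast
  have "norm v \<le> (\<Sum>\<alpha>\<in>UNIV. norm (v $ \<alpha>))" by (rule norm_le_sum_norm)
  also have "\<dots> \<le> (\<Sum>\<alpha>\<in>(UNIV::'m set). norm (v $ \<beta>))" using M unfolding b by (rule sum_mono)
  finally have "norm v \<le> real CARD('m) * norm (v $ \<beta>)" by simp
  then have "norm v powr p \<le> (real CARD('m) * norm (v $ \<beta>)) powr p" using q by (intro powr_mono2) auto
  also have "\<dots> = real CARD('m) powr p * norm (v $ \<beta>) powr p" by (simp add: powr_mult)
  also have "norm (v $ \<beta>) powr p \<le> (\<Sum>\<alpha>\<in>UNIV. norm (v $ \<alpha>) powr p)" by (rule member_le_sum) auto
  finally show ?thesis by (simp add: mult_left_mono)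
qed

text \<open>Midpoint convexity bounds the energy of the mean, with the gain, by the energies of the two shifted maps. A change of variables
  turns these into weighted energies of \<open>u\<close>, which exceed \<open>2 J\<close> at most by a second-order term. Minimality bounds \<open>2 J\<close> by the energy
  of the mean, and the finite \<open>2 J\<close> cancels.\<close>

lemma two_sided_energy_inequality:
  fixes u :: "real^'n \<Rightarrow> real^'m" and D :: "real^'n \<Rightarrow> real^'n^'m"
  assumes T: "two_sided_shift \<zeta> h L S" and d: "norm h * L \<le> 1/4"
    and m [measurable]: "u \<in> borel_measurable borel" "D \<in> borel_measurable borel"
    and fin: "emeasure lborel S < \<infinity>" "pmass p S u < \<infinity>" "pmass p S D < \<infinity>"
    and K: "0 \<le> K" "\<And>s g y. localised_shift.jac \<zeta> h y * integrand s (localised_shift.transport \<zeta> h y g)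
      + localised_shift.jac \<zeta> (- h) y * integrand s (localised_shift.transport \<zeta> (- h) y g)
      \<le> 2 * integrand s g + K * (norm h * L)\<^sup>2 * (1 + norm s powr p + norm (g :: real^'n^'m) powr p)"
    and minim: "(\<integral>\<^sup>+x\<in>S. ennreal (integrand (u x) (D x)) \<partial>lborel)
      \<le> (\<integral>\<^sup>+x\<in>S. ennreal (integrand (two_sided_shift.mean \<zeta> h u x) (two_sided_shift.mean_gradient \<zeta> h D x)) \<partial>lborel)"
  shows "(\<integral>\<^sup>+x\<in>S. ennreal (2 * \<epsilon> * (\<Sum>\<alpha>\<in>UNIV. norm ((1/2) *\<^sub>R (localised_shift.transport \<zeta> h (localised_shift.pull \<zeta> h x) (D (localised_shift.pull \<zeta> h x)) $ \<alpha>
        - localised_shift.transport \<zeta> (- h) (localised_shift.pull \<zeta> (- h) x) (D (localised_shift.pull \<zeta> (- h) x)) $ \<alpha>)) powr p)) \<partial>lborel)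
    \<le> ennreal (K * (norm h * L)\<^sup>2) * (\<integral>\<^sup>+x\<in>S. ennreal (1 + norm (u x) powr p + norm (D x) powr p) \<partial>lborel)"
proof -
  interpret T: two_sided_shift \<zeta> h L S by (rule T)
  have tm [measurable]: "(\<lambda>y. T.P.transport y (D y)) \<in> borel_measurable borel" "(\<lambda>y. T.M.transport y (D y)) \<in> borel_measurable borel"
    by (rule T.P.measurable_transport[OF m(2)], rule T.M.measurable_transport[OF m(2)])
  have pm [measurable]: "(\<lambda>x. T.P.transport (T.P.pull x) (D (T.P.pull x))) \<in> borel_measurable borel"
      "(\<lambda>x. T.M.transport (T.M.pull x) (D (T.M.pull x))) \<in> borel_measurable borel"
    using measurable_compose[OF T.P.measurable_pull tm(1)] measurable_compose[OF T.M.measurable_pull tm(2)] by auto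
  have [measurable]: "T.mean u \<in> borel_measurable borel" "T.mean_gradient D \<in> borel_measurable borel"
    by (rule T.measurable_mean[OF m(1)], rule T.measurable_mean_gradient[OF m(2)])
  define Dp where "Dp x = T.P.transport (T.P.pull x) (D (T.P.pull x))" for x
  define Dm where "Dm x = T.M.transport (T.M.pull x) (D (T.M.pull x))" for x
  have [measurable]: "Dp \<in> borel_measurable borel" "Dm \<in> borel_measurable borel" using pm by (simp_all add: Dp_def[abs_def] Dm_def[abs_def])
  define A where "A = (\<integral>\<^sup>+x\<in>S. ennreal (1 + norm (u x) powr p + norm (D x) powr p) \<partial>lborel)"
  define J where "J = (\<integral>\<^sup>+x\<in>S. ennreal (integrand (u x) (D x)) \<partial>lborel)"
  define e where "e x = \<epsilon> * (\<Sum>\<alpha>\<in>UNIV. norm ((1/2) *\<^sub>R (Dp x $ \<alpha> - Dm x $ \<alpha>)) powr p)" for x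
  have e0: "0 \<le> e x" for x unfolding e_def using eps by (intro mult_nonneg_nonneg sum_nonneg) auto
  have [measurable]: "e \<in> borel_measurable borel" unfolding e_def[abs_def] by measurable
  have J: "J < \<infinity>" unfolding J_def by (rule energy_finite(1)) (use fin in auto)
  have pt: "2 * integrand (T.mean u x) (T.mean_gradient D x) + 2 * e x \<le> integrand (u (T.P.pull x)) (Dp x) + integrand (u (T.M.pull x)) (Dm x)" for x
  proof -
    have half: "2 * a + 2 * b \<le> c + d" if "a + b \<le> (c + d) / 2" for a b c d :: real using that by simp
    show ?thesis
      using half[OF integrand_midpoint[of "u (T.P.pull x)" "u (T.M.pull x)" "Dp x" "Dm x"]]
      unfolding T.mean_def T.mean_gradient_def e_def Dp_def Dm_def .
  qed
  have cv: "(\<integral>\<^sup>+x\<in>S. ennreal (integrand (u (T.P.pull x)) (Dp x)) \<partial>lborel) = (\<integral>\<^sup>+y\<in>S. ennreal (T.P.jac y) * ennreal (integrand (u y) (T.P.transport y (D y))) \<partial>lborel)"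
    "(\<integral>\<^sup>+x\<in>S. ennreal (integrand (u (T.M.pull x)) (Dm x)) \<partial>lborel) = (\<integral>\<^sup>+y\<in>S. ennreal (T.M.jac y) * ennreal (integrand (u y) (T.M.transport y (D y))) \<partial>lborel)"
    unfolding Dp_def Dm_def
    by (rule T.P.set_nn_integral_pull[OF _ _ T.supp', where f="\<lambda>y. ennreal (integrand (u y) (T.P.transport y (D y)))"]; measurable)
      (rule T.M.set_nn_integral_pull[OF _ _ T.supp', where f="\<lambda>y. ennreal (integrand (u y) (T.M.transport y (D y)))"]; measurable)
  have "2 * J + (\<integral>\<^sup>+x\<in>S. ennreal (2 * e x) \<partial>lborel) \<le> 2 * (\<integral>\<^sup>+x\<in>S. ennreal (integrand (T.mean u x) (T.mean_gradient D x)) \<partial>lborel) + (\<integral>\<^sup>+x\<in>S. ennreal (2 * e x) \<partial>lborel)"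
    unfolding J_def by (intro add_right_mono mult_left_mono minim) simp
  also have "\<dots> = (\<integral>\<^sup>+x. 2 * (ennreal (integrand (T.mean u x) (T.mean_gradient D x)) * indicator S x) + ennreal (2 * e x) * indicator S x \<partial>lborel)"
    by (simp add: nn_integral_add nn_integral_cmult)
  also have "\<dots> \<le> (\<integral>\<^sup>+x. ennreal (integrand (u (T.P.pull x)) (Dp x)) * indicator S x + ennreal (integrand (u (T.M.pull x)) (Dm x)) * indicator S x \<partial>lborel)"
  proof (intro nn_integral_mono)
    fix x
    have "ennreal (2 * integrand (T.mean u x) (T.mean_gradient D x) + 2 * e x) \<le> ennreal (integrand (u (T.P.pull x)) (Dp x) + integrand (u (T.M.pull x)) (Dm x))"
      by (rule ennreal_leI[OF pt])
    then have "2 * ennreal (integrand (T.mean u x) (T.mean_gradient D x)) + ennreal (2 * e x) \<le> ennreal (integrand (u (T.P.pull x)) (Dp x)) + ennreal (integrand (u (T.M.pull x)) (Dm x))"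
    proof -
      have "ennreal (2 * a + b) = 2 * ennreal a + ennreal b" "ennreal (c + d) = ennreal c + ennreal d"
        if "0 \<le> a" "0 \<le> b" "0 \<le> c" "0 \<le> d" for a b c d
        using that by (simp_all add: ennreal_plus ennreal_mult)
      note split = this[OF integrand_nonneg _ integrand_nonneg integrand_nonneg]
      have e2: "0 \<le> 2 * e x" using e0 by simp
      show ?thesis using \<open>ennreal (_ + _) \<le> _\<close> unfolding split[OF e2] .
    qed
    then show "2 * (ennreal (integrand (T.mean u x) (T.mean_gradient D x)) * indicator S x) + ennreal (2 * e x) * indicator S x
      \<le> ennreal (integrand (u (T.P.pull x)) (Dp x)) * indicator S x + ennreal (integrand (u (T.M.pull x)) (Dm x)) * indicator S x"
      by (cases "x \<in> S") auto
  qed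
  also have "\<dots> = (\<integral>\<^sup>+y\<in>S. ennreal (T.P.jac y) * ennreal (integrand (u y) (T.P.transport y (D y))) \<partial>lborel)
     + (\<integral>\<^sup>+y\<in>S. ennreal (T.M.jac y) * ennreal (integrand (u y) (T.M.transport y (D y))) \<partial>lborel)"
    by (simp add: nn_integral_add cv)
  also have "\<dots> = (\<integral>\<^sup>+y. ennreal (T.P.jac y) * ennreal (integrand (u y) (T.P.transport y (D y))) * indicator S y
     + ennreal (T.M.jac y) * ennreal (integrand (u y) (T.M.transport y (D y))) * indicator S y \<partial>lborel)"
    by (simp add: nn_integral_add)
  also have "\<dots> \<le> (\<integral>\<^sup>+y. 2 * (ennreal (integrand (u y) (D y)) * indicator S y) + ennreal (K * (norm h * L)\<^sup>2) * (ennreal (1 + norm (u y) powr p + norm (D y) powr p) * indicator S y) \<partial>lborel)"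
  proof (intro nn_integral_mono)
    fix y
    have j: "0 \<le> T.P.jac y" "0 \<le> T.M.jac y" using T.P.jac_bounds[of y] T.M.jac_bounds[of y] by auto
    have "ennreal (T.P.jac y * integrand (u y) (T.P.transport y (D y)) + T.M.jac y * integrand (u y) (T.M.transport y (D y)))
      \<le> ennreal (2 * integrand (u y) (D y) + K * (norm h * L)\<^sup>2 * (1 + norm (u y) powr p + norm (D y) powr p))"
      by (rule ennreal_leI[OF K(2)])
    then have "ennreal (T.P.jac y) * ennreal (integrand (u y) (T.P.transport y (D y))) + ennreal (T.M.jac y) * ennreal (integrand (u y) (T.M.transport y (D y)))
      \<le> 2 * ennreal (integrand (u y) (D y)) + ennreal (K * (norm h * L)\<^sup>2) * ennreal (1 + norm (u y) powr p + norm (D y) powr p)"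
    proof -
      have a: "ennreal (T.P.jac y * integrand (u y) (T.P.transport y (D y)) + T.M.jac y * integrand (u y) (T.M.transport y (D y)))
        = ennreal (T.P.jac y) * ennreal (integrand (u y) (T.P.transport y (D y))) + ennreal (T.M.jac y) * ennreal (integrand (u y) (T.M.transport y (D y)))"
        (is "ennreal (?a * ?b + ?c * ?d) = _")
      proof -
        have "0 \<le> ?b" "0 \<le> ?d" by (rule integrand_nonneg)+
        with j show ?thesis by (simp add: ennreal_plus ennreal_mult)
      qed
      have b: "ennreal (2 * integrand (u y) (D y) + K * (norm h * L)\<^sup>2 * (1 + norm (u y) powr p + norm (D y) powr p))
        = 2 * ennreal (integrand (u y) (D y)) + ennreal (K * (norm h * L)\<^sup>2) * ennreal (1 + norm (u y) powr p + norm (D y) powr p)"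
      proof -
        have "ennreal (2 * X + k * Y) = 2 * ennreal X + ennreal k * ennreal Y" if "0 \<le> X" "0 \<le> k" "0 \<le> Y" for X k Y
          using that by (simp add: ennreal_plus ennreal_mult)
        then show ?thesis by this (use K(1) integrand_nonneg in auto)
      qed
      show ?thesis using \<open>ennreal (_ + _) \<le> _\<close> unfolding a b .
    qed
    then show "ennreal (T.P.jac y) * ennreal (integrand (u y) (T.P.transport y (D y))) * indicator S y
       + ennreal (T.M.jac y) * ennreal (integrand (u y) (T.M.transport y (D y))) * indicator S y
       \<le> 2 * (ennreal (integrand (u y) (D y)) * indicator S y) + ennreal (K * (norm h * L)\<^sup>2) * (ennreal (1 + norm (u y) powr p + norm (D y) powr p) * indicator S y)"
      by (cases "y \<in> S") auto
  qed
  also have "\<dots> = 2 * J + ennreal (K * (norm h * L)\<^sup>2) * A"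
    unfolding J_def A_def by (simp add: nn_integral_add nn_integral_cmult)
  finally have "2 * J + (\<integral>\<^sup>+x\<in>S. ennreal (2 * e x) \<partial>lborel) \<le> 2 * J + ennreal (K * (norm h * L)\<^sup>2) * A" .
  then have "(\<integral>\<^sup>+x\<in>S. ennreal (2 * e x) \<partial>lborel) \<le> ennreal (K * (norm h * L)\<^sup>2) * A"
    using J by (subst (asm) ennreal_add_left_cancel_le) (auto simp: ennreal_mult_eq_top_iff)
  then show ?thesis unfolding A_def e_def Dp_def Dm_def by (simp add: mult.assoc)
qed

text \<open>The cutoff is \<open>1\<close> on the ball of radius \<open>2 R\<close>, so on the ball of radius \<open>R\<close> the two shifted gradients are \<open>D (x + h)\<close> and
  \<open>D (x - h)\<close>, and the gain in the energy inequality is the integral of their difference.\<close>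

theorem symmetric_difference_estimate:
  fixes u :: "real^'n \<Rightarrow> real^'m" and D :: "real^'n \<Rightarrow> real^'n^'m"
  assumes w: "Borel_weak_gradient \<Omega> u D" and off: "\<And>x. x \<notin> \<Omega> \<Longrightarrow> u x = 0" "\<And>x. x \<notin> \<Omega> \<Longrightarrow> D x = 0"
    and fin: "\<And>r. r \<in> {1,p} \<Longrightarrow> pmass r \<Omega> u < \<infinity>" "\<And>r. r \<in> {1,p} \<Longrightarrow> pmass r \<Omega> D < \<infinity>"
    and O: "open \<Omega>" and R: "R > 0" "cball x0 (4 * R) \<subseteq> \<Omega>"
    and minim: "\<And>v V. (\<lambda>x. v x - u x) \<in> W1p_0 p (ball x0 (4 * R)) \<Longrightarrow>
      Borel_weak_gradient (ball x0 (4 * R)) (\<lambda>x. v x - u x) (\<lambda>x. V x - D x) \<Longrightarrow>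
      v \<in> borel_measurable borel \<Longrightarrow> V \<in> borel_measurable borel \<Longrightarrow>
      pmass p (ball x0 (4 * R)) v < \<infinity> \<Longrightarrow> pmass p (ball x0 (4 * R)) V < \<infinity> \<Longrightarrow>
      (\<integral>\<^sup>+x\<in>ball x0 (4 * R). ennreal (integrand (u x) (D x)) \<partial>lborel) \<le> (\<integral>\<^sup>+x\<in>ball x0 (4 * R). ennreal (integrand (v x) (V x)) \<partial>lborel)"
  obtains C h0 where "0 \<le> C" "0 < h0"
    "\<And>h. norm h \<le> h0 \<Longrightarrow> pmass p (ball x0 R) (\<lambda>x. D (x + h) - D (x - h)) \<le> ennreal (C * (norm h)\<^sup>2)"
proof -
  let ?S = "ball x0 (4 * R)"
  have p1: "p \<ge> 1" using q by simp
  note m [measurable] = Borel_weak_gradientD(1,2)[OF w]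
  have sub: "cball x0 (2 * R) \<subseteq> ball x0 (3 * R)" using R(1) by (auto simp: subset_iff)
  obtain \<zeta> :: "real^'n \<Rightarrow> real" where z: "smooth \<zeta>" "\<And>x. x \<in> cball x0 (2 * R) \<Longrightarrow> \<zeta> x = 1"
    "compact (closure {x. \<zeta> x \<noteq> 0})" "closure {x. \<zeta> x \<noteq> 0} \<subseteq> ball x0 (3 * R)"
    by (rule exists_cutoff[OF compact_cball[of x0 "2 * R"] open_ball[of x0 "3 * R"] sub]) blast
  have cs: "compact_smooth \<zeta>" using z(1) bounded_subset[OF compact_imp_bounded[OF z(3)] closure_subset[of "{x. \<zeta> x \<noteq> 0}"]] by (intro conjI)
  have "continuous_on UNIV (grad \<zeta>)" unfolding grad_def
    by (intro continuous_intros smooth_continuous smooth_partial z(1))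
  moreover have "bounded {x. grad \<zeta> x \<noteq> 0}"
  proof (rule bounded_subset[OF compact_imp_bounded[OF z(3)]])
    show "{x. grad \<zeta> x \<noteq> 0} \<subseteq> closure {x. \<zeta> x \<noteq> 0}"
    proof
      fix x assume "x \<in> {x. grad \<zeta> x \<noteq> 0}"
      then show "x \<in> closure {x. \<zeta> x \<noteq> 0}"
        using partial_eq_0_off_support[of x \<zeta>] by (auto simp: grad_def vec_eq_iff)
    qed
  qed
  ultimately obtain L where L: "L > 0" "\<And>x. norm (grad \<zeta> x) \<le> L"
    using compact_support_bounded[of "grad \<zeta>"] by metis
  have grad0: "grad \<zeta> x = 0" if x: "x \<in> ball x0 (2 * R)" for x
  proof -
    have "((\<lambda>x. 1) has_derivative (\<lambda>v. 0)) (at x)" by simp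
    then have "(\<zeta> has_derivative (\<lambda>v. 0)) (at x)"
      by (rule has_derivative_transform_within_open[where s="ball x0 (2 * R)"]) (use x z(2) in auto)
    then show ?thesis using partial_on_UNIV by (auto simp: grad_def vec_eq_iff)
  qed
  \<comment> \<open>Shifts by at most \<open>R\<close> stay inside the region where \<open>\<zeta> = 1\<close>; the other bound makes the shift admissible.\<close>
  define h0 where "h0 = min R (1 / (4 * L))"
  have h0: "h0 > 0" "h0 \<le> R" "h0 * L \<le> 1/4" using R L by (auto simp: h0_def min_def field_simps)
  obtain K where K: "K \<ge> 0" "\<And>(\<zeta> :: real^'n \<Rightarrow> real) h L s g y.
    localised_shift \<zeta> h L \<Longrightarrow> localised_shift \<zeta> (- h) L \<Longrightarrow> norm h * L \<le> 1/4 \<Longrightarrow>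
    localised_shift.jac \<zeta> h y * integrand s (localised_shift.transport \<zeta> h y g)
    + localised_shift.jac \<zeta> (- h) y * integrand s (localised_shift.transport \<zeta> (- h) y g)
    \<le> 2 * integrand s g + K * (norm h * L)\<^sup>2 * (1 + norm s powr p + norm g powr p)"
    using shifted_integrand_le by blast
  have S4: "?S \<subseteq> \<Omega>" using R(2) ball_subset_cball by blast
  have finS: "pmass r ?S u < \<infinity>" "pmass r ?S D < \<infinity>" if r: "r \<in> {1,p}" for r
    using le_less_trans[OF pmass_mono_set[OF S4] fin(1)[OF r]] le_less_trans[OF pmass_mono_set[OF S4] fin(2)[OF r]] by auto
  have emS: "emeasure lborel ?S < \<infinity>" using emeasure_bounded_finite[OF bounded_ball] .
  have clS: "closure ?S = cball x0 (4 * R)" using R by (intro closure_ball) simp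
  have app: "approximated p ?S {\<psi>. smooth \<psi>} u D"
    by (rule local_smooth_approximation[OF w off fin O p1]) (use clS R in auto)
  have "(\<integral>\<^sup>+x\<in>?S. ennreal (1 + norm (u x) powr p + norm (D x) powr p) \<partial>lborel) \<noteq> \<infinity>"
    using energy_finite(2)[OF m _ emS finS(1) finS(2)] by simp
  then obtain A where A: "0 \<le> A" "(\<integral>\<^sup>+x\<in>?S. ennreal (1 + norm (u x) powr p + norm (D x) powr p) \<partial>lborel) = ennreal A"
    by (rule ennreal_finiteE)
  define c where "c = real CARD('m) powr p * 2 powr p / (2 * \<epsilon>)"
  have c0: "c \<ge> 0" using eps by (simp add: c_def)
  have est: "pmass p (ball x0 R) (\<lambda>x. D (x + h) - D (x - h)) \<le> ennreal (c * K * L\<^sup>2 * A * (norm h)\<^sup>2)" if h: "norm h \<le> h0" for h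
  proof -
    have hL: "norm h * L \<le> 1/4" by (rule order_trans[OF mult_right_mono[OF h] h0(3)]) (use L(1) in simp)
    have lP: "localised_shift \<zeta> h L" by unfold_locales (use cs L hL in auto)
    have lM: "localised_shift \<zeta> (- h) L" by unfold_locales (use cs L hL in auto)
    have TS: "two_sided_shift \<zeta> h L ?S"
    proof -
      have "closure {x. \<zeta> x \<noteq> 0} \<subseteq> ?S" by (rule order_trans[OF z(4) subset_ball]) (use R(1) in simp)
      then show ?thesis using lP lM z(3) by (auto simp: two_sided_shift_def two_sided_shift_axioms_def)
    qed
    interpret T: two_sided_shift \<zeta> h L ?S by (rule TS)
    have [measurable]: "T.mean u \<in> borel_measurable borel" "T.mean_gradient D \<in> borel_measurable borel"
      by (rule T.measurable_mean[OF m(1)], rule T.measurable_mean_gradient[OF m(2)])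
    have pp: "0 \<le> p" "p \<le> p" using p1 by auto
    have f1: "pmass p ?S (T.mean u) < \<infinity>"
    proof -
      have "pmass p ?S (\<lambda>x. (T.mean u x - u x) + u x) \<le> ennreal (2 powr p) * (pmass p ?S (\<lambda>x. T.mean u x - u x) + pmass p ?S u)"
        by (rule pmass_add_le) (use pp in measurable)
      also have "\<dots> < \<infinity>" using le_less_trans[OF T.pmass_mean_diff_le[OF m(1) pp]] finS(1)[of p] by (simp add: ennreal_mult_less_top)
      finally show ?thesis by simp
    qed
    have f2: "pmass p ?S (T.mean_gradient D) < \<infinity>"
    proof -
      have "pmass p ?S (\<lambda>x. (T.mean_gradient D x - D x) + D x) \<le> ennreal (2 powr p) * (pmass p ?S (\<lambda>x. T.mean_gradient D x - D x) + pmass p ?S D)"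
        by (rule pmass_add_le) (use pp in measurable)
      also have "\<dots> < \<infinity>" using le_less_trans[OF T.pmass_mean_gradient_diff_le[OF m(2) pp]] finS(2)[of p] by (simp add: ennreal_mult_less_top)
      finally show ?thesis by simp
    qed
    have mi: "(\<integral>\<^sup>+x\<in>?S. ennreal (integrand (u x) (D x)) \<partial>lborel) \<le> (\<integral>\<^sup>+x\<in>?S. ennreal (integrand (T.mean u x) (T.mean_gradient D x)) \<partial>lborel)"
      by (rule minim[OF T.mean_competitor(1)[OF m p1 app finS] T.mean_competitor(2)[OF m p1 app finS] _ _ f1 f2]) measurable
    have K': "T.P.jac y * integrand s (T.P.transport y g) + T.M.jac y * integrand s (T.M.transport y g)
      \<le> 2 * integrand s g + K * (norm h * L)\<^sup>2 * (1 + norm s powr p + norm (g :: real^'n^'m) powr p)" for s g y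
      by (rule K(2)[OF lP lM hL])
    let ?e = "\<lambda>x. \<Sum>\<alpha>\<in>UNIV. norm ((1/2) *\<^sub>R (T.P.transport (T.P.pull x) (D (T.P.pull x)) $ \<alpha> - T.M.transport (T.M.pull x) (D (T.M.pull x)) $ \<alpha>)) powr p"
    have E: "(\<integral>\<^sup>+x\<in>?S. ennreal (2 * \<epsilon> * ?e x) \<partial>lborel) \<le> ennreal (K * (norm h * L)\<^sup>2) * ennreal A"
      unfolding A(2)[symmetric] by (rule two_sided_energy_inequality[OF TS hL m emS finS(1) finS(2) K(1) K' mi]) auto
    have me: "(\<lambda>x. ennreal (2 * \<epsilon> * ?e x)) \<in> borel_measurable borel"
    proof -
      have [measurable]: "(\<lambda>x. T.P.transport (T.P.pull x) (D (T.P.pull x))) \<in> borel_measurable borel"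
        "(\<lambda>x. T.M.transport (T.M.pull x) (D (T.M.pull x))) \<in> borel_measurable borel"
        using measurable_compose[OF T.P.measurable_pull T.P.measurable_transport[OF m(2)]]
          measurable_compose[OF T.M.measurable_pull T.M.measurable_transport[OF m(2)]] by auto
      show ?thesis by measurable
    qed
    have "pmass p (ball x0 R) (\<lambda>x. D (x + h) - D (x - h)) \<le> (\<integral>\<^sup>+x. ennreal c * (ennreal (2 * \<epsilon> * ?e x) * indicator ?S x) \<partial>lborel)"
      unfolding pmass_def
    proof (intro nn_integral_mono)
      fix x
      show "ennreal (norm (D (x + h) - D (x - h)) powr p) * indicator (ball x0 R) x \<le> ennreal c * (ennreal (2 * \<epsilon> * ?e x) * indicator ?S x)"
      proof (cases "x \<in> ball x0 R")
        case True
        have b: "x + h \<in> ball x0 (2 * R)" "x + - h \<in> ball x0 (2 * R)"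
          using True h h0 norm_triangle_ineq4[of "x0 - x" h] norm_triangle_ineq[of "x0 - x" h] by (auto simp: dist_norm algebra_simps)
        have "T.P.push (x + h) = x" "T.M.push (x + - h) = x"
          using z(2)[of "x + h"] z(2)[of "x + - h"] b by (auto simp: T.P.push_def T.M.push_def)
        then have pl: "T.P.pull x = x + h" "T.M.pull x = x - h"
          using T.P.pull_push[of "x + h"] T.M.pull_push[of "x + - h"] by auto
        have tr: "T.P.transport (x + h) g = g" "T.M.transport (x - h) g = g" for g :: "real^'n^'m"
          using grad0[of "x + h"] grad0[of "x + - h"] b by (auto simp: T.P.transport_def T.M.transport_def vec_eq_iff)
        have ex: "?e x = (\<Sum>\<alpha>\<in>UNIV. norm ((1/2) *\<^sub>R (D (x + h) - D (x - h)) $ \<alpha>) powr p)"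
          unfolding pl tr by simp
        have "norm (D (x + h) - D (x - h)) powr p \<le> real CARD('m) powr p * (\<Sum>\<alpha>\<in>UNIV. norm ((D (x + h) - D (x - h)) $ \<alpha>) powr p)"
          by (rule norm_powr_le_sum)
        also have "(\<Sum>\<alpha>\<in>UNIV. norm ((D (x + h) - D (x - h)) $ \<alpha>) powr p) = 2 powr p * ?e x"
        proof -
          have "norm v powr p = 2 powr p * norm ((1/2) *\<^sub>R v) powr p" for v :: "real^'n"
            by (simp add: powr_mult powr_divide)
          then show ?thesis unfolding ex sum_distrib_left by (intro sum.cong) auto
        qed
        also have "real CARD('m) powr p * (2 powr p * ?e x) = c * (2 * \<epsilon> * ?e x)" using eps by (simp add: c_def)
        finally have "ennreal (norm (D (x + h) - D (x - h)) powr p) \<le> ennreal (c * (2 * \<epsilon> * ?e x))" by (rule ennreal_leI)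
        also have "\<dots> = ennreal c * ennreal (2 * \<epsilon> * ?e x)"
          using c0 eps by (intro ennreal_mult mult_nonneg_nonneg sum_nonneg) auto
        finally show ?thesis using True R by simp
      qed simp
    qed
    also have "\<dots> = ennreal c * (\<integral>\<^sup>+x\<in>?S. ennreal (2 * \<epsilon> * ?e x) \<partial>lborel)"
      by (rule nn_integral_cmult) (use me in measurable)
    also have "\<dots> \<le> ennreal c * (ennreal (K * (norm h * L)\<^sup>2) * ennreal A)" by (intro mult_left_mono E) simp
    also have "\<dots> = ennreal (c * (K * (norm h * L)\<^sup>2 * A))"
    proof -
      have "ennreal a * (ennreal b * ennreal d) = ennreal (a * (b * d))" if "0 \<le> a" "0 \<le> b" "0 \<le> d" for a b d
        using that by (simp add: ennreal_mult)
      then show ?thesis by this (use c0 K(1) A(1) in auto)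
    qed
    also have "c * (K * (norm h * L)\<^sup>2 * A) = c * K * L\<^sup>2 * A * (norm h)\<^sup>2" by (simp add: power_mult_distrib)
    finally show ?thesis .
  qed
  show thesis by (rule that[OF _ h0(1) est]) (use c0 K(1) A(1) in auto)
qed

end

section \<open>Higher integrability of minimizers\<close>

lemma pmass_le_measure_plus:
  fixes f :: "'a::euclidean_space \<Rightarrow> 'b::euclidean_space"
  assumes [measurable]: "f \<in> borel_measurable borel" "S \<in> sets borel" and t: "0 \<le> t" "t \<le> s"
  shows "pmass t S f \<le> emeasure lborel S + pmass s S f"
proof -
  have "pmass t S f \<le> (\<integral>\<^sup>+x. indicator S x + ennreal (norm (f x) powr s) * indicator S x \<partial>lborel)"
    unfolding pmass_def
  proof (intro nn_integral_mono)
    fix x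
    have "norm (f x) powr t \<le> 1 + norm (f x) powr s"
    proof (cases "norm (f x) \<le> 1")
      case True
      then have "norm (f x) powr t \<le> 1" using powr_mono2[OF t(1) norm_ge_zero True] by simp
      then show ?thesis using powr_ge_zero[of "norm (f x)" s] by linarith
    next
      case False
      then have "norm (f x) powr t \<le> norm (f x) powr s" by (intro powr_mono t) simp
      then show ?thesis by linarith
    qed
    then have "ennreal (norm (f x) powr t) \<le> ennreal (1 + norm (f x) powr s)" by (rule ennreal_leI)
    then show "ennreal (norm (f x) powr t) * indicator S x \<le> indicator S x + ennreal (norm (f x) powr s) * indicator S x"
      by (cases "x \<in> S") (auto simp: ennreal_plus)
  qed
  also have "\<dots> = emeasure lborel S + pmass s S f" unfolding pmass_def by (simp add: nn_integral_add)
  finally show ?thesis .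
qed

lemma local_to_compact_pmass:
  fixes f :: "'a::euclidean_space \<Rightarrow> 'b::euclidean_space"
  assumes K: "compact K" and loc: "\<And>x. x \<in> K \<Longrightarrow> \<exists>r>0. pmass t (ball x r) f < \<infinity>"
    and [measurable]: "f \<in> borel_measurable borel"
  shows "pmass t K f < \<infinity>"
proof -
  obtain r where r: "\<And>x. x \<in> K \<Longrightarrow> r x > 0" "\<And>x. x \<in> K \<Longrightarrow> pmass t (ball x (r x)) f < \<infinity>" using loc by metis
  have "K \<subseteq> (\<Union>x\<in>K. ball x (r x))" using r(1) by auto
  then obtain F where F: "F \<subseteq> K" "finite F" "K \<subseteq> (\<Union>x\<in>F. ball x (r x))"
    using compactE_image[OF K, of K "\<lambda>x. ball x (r x)"] by auto
  have "pmass t K f \<le> (\<integral>\<^sup>+y. (\<Sum>x\<in>F. ennreal (norm (f y) powr t) * indicator (ball x (r x)) y) \<partial>lborel)"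
    unfolding pmass_def
  proof (intro nn_integral_mono)
    fix y
    show "ennreal (norm (f y) powr t) * indicator K y \<le> (\<Sum>x\<in>F. ennreal (norm (f y) powr t) * indicator (ball x (r x)) y)"
    proof (cases "y \<in> K")
      case True
      then obtain x where x: "x \<in> F" "y \<in> ball x (r x)" using F(3) by auto
      have "ennreal (norm (f y) powr t) * indicator K y = ennreal (norm (f y) powr t) * indicator (ball x (r x)) y" using x True by simp
      also have "\<dots> \<le> (\<Sum>x\<in>F. ennreal (norm (f y) powr t) * indicator (ball x (r x)) y)"
        by (rule member_le_sum[OF x(1)]) (use F(2) in auto)
      finally show ?thesis .
    qed simp
  qed
  also have "\<dots> = (\<Sum>x\<in>F. pmass t (ball x (r x)) f)" unfolding pmass_def by (rule nn_integral_sum) measurable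
  also have "\<dots> < \<infinity>" using F r(2) by (simp add: less_top[symmetric] subset_iff)
  finally show ?thesis .
qed

lemma enn2real_le_cancel:
  assumes "enn2real a \<le> enn2real b" "a < \<infinity>" "b < \<infinity>"
  shows "a \<le> b"
proof -
  have "ennreal (enn2real a) = a" "ennreal (enn2real b) = b" using assms(2,3) by simp_all
  then show ?thesis using ennreal_leI[OF assms(1)] by (simp only:)
qed

text \<open>What remains is to pass from \<open>u\<close> to a Borel representative, to read off the properties of \<open>G\<close>, and to choose the exponent.\<close>

theorem theorem5:
  fixes \<Omega> :: "(real^'n) set"
    and G :: "(real^'m) \<times> (real^'m) \<Rightarrow> real"
    and u :: "real^'n \<Rightarrow> real^'m"
    and p q \<epsilon> :: real
  assumes "2 \<le> CARD('n)"
    and "2 \<le> q" and "q < p" and "p < real CARD('n)"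
    and "open \<Omega>" and "bounded \<Omega>"
    and "hyp_H1 \<Omega> q G" and "hyp_H2 q G"
    and "0 < \<epsilon>" and "\<epsilon> \<le> 1"
    and "local_minimizer p G \<epsilon> \<Omega> u"
  shows "(\<lambda>x. norm (weak_gradient \<Omega> u x))
           \<in> Lp_loc ((2 * real CARD('n) / (real CARD('n) - 2)) / 2 * q) \<Omega>"
proof -
  let ?n = "real CARD('n)"
  let ?t = "(2 * ?n / (?n - 2)) / 2 * q"
  note q = \<open>2 \<le> q\<close> \<open>q < p\<close> \<open>p < real CARD('n)\<close>
  have O: "open \<Omega>" by fact
  have p1: "1 \<le> p" using q by simp
  have uW: "u \<in> W1p p \<Omega>" using \<open>local_minimizer p G \<epsilon> \<Omega> u\<close> by (simp add: local_minimizer_def)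
  then obtain D0 where D0: "u \<in> Lp p \<Omega>" "has_weak_gradient \<Omega> u D0" "D0 \<in> Lp p \<Omega>" by (auto simp: W1p_def)
  obtain v D where v: "Borel_weak_gradient \<Omega> v D" "\<forall>x. x \<notin> \<Omega> \<longrightarrow> v x = 0" "\<forall>x. x \<notin> \<Omega> \<longrightarrow> D x = 0"
    "AE x in lborel. x \<in> \<Omega> \<longrightarrow> u x = v x" "AE x in lborel. x \<in> \<Omega> \<longrightarrow> D0 x = D x"
    by (rule has_weak_gradient_Borel_representatives[OF O D0(2)])
  note m [measurable] = Borel_weak_gradientD(1,2)[OF v(1)]
  have Ob [measurable]: "\<Omega> \<in> sets borel" using O by simp
  have wg: "AE x in lborel. x \<in> \<Omega> \<longrightarrow> weak_gradient \<Omega> u x = D x"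
    using weak_gradient_eq_AE[OF O D0(2)] v(5) by eventually_elim auto
  have finp: "pmass p \<Omega> v < \<infinity>" "pmass p \<Omega> D < \<infinity>"
    using D0(1,3) Lp_AE_cong[OF v(4)] Lp_AE_cong[OF v(5)] Lp_Borel_iff[OF m(1) Ob] Lp_Borel_iff[OF m(2) Ob] by auto
  have emO: "emeasure lborel \<Omega> < \<infinity>" by (rule emeasure_bounded_finite) fact
  have fin: "pmass r \<Omega> v < \<infinity>" "pmass r \<Omega> D < \<infinity>" if "r \<in> {1,p}" for r
    using le_less_trans[OF pmass_le_measure_plus[OF m(1) Ob, of r p]] le_less_trans[OF pmass_le_measure_plus[OF m(2) Ob, of r p]]
      that p1 finp emO by auto
  have local: "\<exists>r>0. pmass ?t (ball x0 r) D < \<infinity>" if x0: "x0 \<in> \<Omega>" for x0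
  proof -
    have conv: "strictly_convex_on (orthant \<times> orthant) G"
      using \<open>hyp_H1 \<Omega> q G\<close> unfolding hyp_H1_def by (rule conjunct1)
    \<comment> \<open>The lower bound on \<open>G\<close> is given for almost every point of \<open>\<Omega>\<close>; it holds at one because the open set \<open>\<Omega>\<close> is not null.\<close>
    have G0: "0 \<le> G (s, \<xi>)" if o: "s \<in> orthant" "\<xi> \<in> orthant" for s \<xi>
    proof -
      have "AE x in lebesgue. x \<in> \<Omega> \<longrightarrow> (\<Sum>\<alpha>\<in>UNIV. (\<xi> $ \<alpha>) powr q) + (\<Sum>\<alpha>\<in>UNIV. (s $ \<alpha>) powr q) \<le> G (s, \<xi>)"
      proof -
        obtain L0 a where "\<forall>s\<in>orthant. \<forall>\<xi>\<in>orthant. AE x in lebesgue. x \<in> \<Omega> \<longrightarrow>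
           (\<Sum>\<alpha>\<in>UNIV. (\<xi> $ \<alpha>) powr q) + (\<Sum>\<alpha>\<in>UNIV. (s $ \<alpha>) powr q) \<le> G (s, \<xi>) \<and>
           G (s, \<xi>) \<le> L0 * ((\<Sum>\<alpha>\<in>UNIV. (\<xi> $ \<alpha>) powr q) + (\<Sum>\<alpha>\<in>UNIV. (s $ \<alpha>) powr q) + a x)"
          using \<open>hyp_H1 \<Omega> q G\<close> unfolding hyp_H1_def by blast
        from bspec[OF bspec[OF this o(1)] o(2)] show ?thesis by (rule eventually_mono) blast
      qed
      then have ae: "AE x in lborel. x \<in> \<Omega> \<longrightarrow> (\<Sum>\<alpha>\<in>UNIV. (\<xi> $ \<alpha>) powr q) + (\<Sum>\<alpha>\<in>UNIV. (s $ \<alpha>) powr q) \<le> G (s, \<xi>)"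
        by (simp only: AE_completion_iff)
      show ?thesis
      proof (rule ccontr)
        assume neg: "\<not> ?thesis"
        have "AE x in lborel. x \<notin> \<Omega>" using ae
        proof (rule eventually_mono)
          fix x assume "x \<in> \<Omega> \<longrightarrow> (\<Sum>\<alpha>\<in>UNIV. (\<xi> $ \<alpha>) powr q) + (\<Sum>\<alpha>\<in>UNIV. (s $ \<alpha>) powr q) \<le> G (s, \<xi>)"
          moreover have "0 \<le> (\<Sum>\<alpha>\<in>UNIV. (\<xi> $ \<alpha>) powr q) + (\<Sum>\<alpha>\<in>UNIV. (s $ \<alpha>) powr q)"
            by (intro add_nonneg_nonneg sum_nonneg) auto
          ultimately show "x \<notin> \<Omega>" using neg by linarith
        qed
        then have "emeasure lborel \<Omega> = 0" by (subst (asm) AE_iff_measurable[where N=\<Omega>]) auto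
        moreover obtain e where e: "e > 0" "ball x0 e \<subseteq> \<Omega>" using O x0 open_contains_ball by blast
        ultimately have "emeasure lborel (ball x0 e) = 0" using emeasure_mono[OF e(2), of lborel] by simp
        then show False using content_ball_pos[OF e(1), of x0] by (simp add: measure_def)
      qed
    qed
    have C2: "Ck_on 2 (orthant \<times> orthant) G" using \<open>hyp_H2 q G\<close> unfolding hyp_H2_def by (rule conjunct1)
    obtain L1 where L1: "L1 > 1" "\<forall>\<alpha> \<beta>. \<forall>s\<in>orthant. \<forall>\<xi>\<in>orthant.
        0 \<le> d_xi \<alpha> G (s, \<xi>) \<and>
        d_xi \<alpha> G (s, \<xi>) \<le> L1 * (rpow (norm s) (q - 1) + rpow (norm \<xi>) (q - 1)) \<and>
        0 \<le> d_s \<alpha> G (s, \<xi>) \<and>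
        d_s \<alpha> G (s, \<xi>) \<le> L1 * (rpow (norm s) (q - 1) + rpow (norm \<xi>) (q - 1)) \<and>
        \<bar>d_s \<beta> (d_s \<alpha> G) (s, \<xi>)\<bar> \<le> L1 * (rpow (norm s) (q - 2) + rpow (norm \<xi>) (q - 2)) \<and>
        \<bar>d_s \<beta> (d_xi \<alpha> G) (s, \<xi>)\<bar> \<le> L1 * (rpow (norm s) (q - 2) + rpow (norm \<xi>) (q - 2)) \<and>
        \<bar>d_xi \<beta> (d_xi \<alpha> G) (s, \<xi>)\<bar> \<le> L1 * (rpow (norm s) (q - 2) + rpow (norm \<xi>) (q - 2))"
      using \<open>hyp_H2 q G\<close> unfolding hyp_H2_def by (elim conjE exE) blast
    interpret I: convex_integrand G p q L1 \<epsilon>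
    proof unfold_locales
      fix \<alpha> \<beta> :: 'm and s \<xi> :: "real^'m" assume o: "s \<in> orthant" "\<xi> \<in> orthant"
      note * = L1(2)[rule_format, OF o, of \<alpha> \<beta>]
      show "0 \<le> d_xi \<alpha> G (s, \<xi>) \<and>
        d_xi \<alpha> G (s, \<xi>) \<le> L1 * (rpow (norm s) (q - 1) + rpow (norm \<xi>) (q - 1)) \<and>
        0 \<le> d_s \<alpha> G (s, \<xi>) \<and>
        d_s \<alpha> G (s, \<xi>) \<le> L1 * (rpow (norm s) (q - 1) + rpow (norm \<xi>) (q - 1)) \<and>
        \<bar>d_xi \<beta> (d_xi \<alpha> G) (s, \<xi>)\<bar> \<le> L1 * (rpow (norm s) (q - 2) + rpow (norm \<xi>) (q - 2))"
        using * by argo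
    qed (fact q C2 conv G0 L1(1) \<open>0 < \<epsilon>\<close> \<open>\<epsilon> \<le> 1\<close>)+
    obtain e where e: "e > 0" "cball x0 e \<subseteq> \<Omega>" using O x0 open_contains_cball by blast
    define R where "R = e / 4"
    have R: "R > 0" "cball x0 (4 * R) \<subseteq> \<Omega>" using e by (auto simp: R_def)
    let ?S = "ball x0 (4 * R)"
    have SO: "?S \<subseteq> \<Omega>" using R(2) ball_subset_cball by blast
    have emS: "emeasure lborel ?S < \<infinity>" using emeasure_bounded_finite[OF bounded_ball] .
    have wS: "has_weak_gradient ?S u D0" by (rule has_weak_gradient_subset[OF D0(2) SO open_ball O])
    have aeS: "AE x in lborel. x \<in> ?S \<longrightarrow> u x = v x" "AE x in lborel. x \<in> ?S \<longrightarrow> D0 x = D x"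
      by (rule eventually_mono[OF v(4)], use SO in blast, rule eventually_mono[OF v(5)], use SO in blast)
    have bwS: "Borel_weak_gradient ?S v D"
      using has_weak_gradient_AE_imp[OF open_ball aeS wS] has_weak_gradient_Borel_iff[OF m, of ?S] by simp
    have minim: "(\<integral>\<^sup>+x\<in>?S. ennreal (I.integrand (v x) (D x)) \<partial>lborel) \<le> (\<integral>\<^sup>+x\<in>?S. ennreal (I.integrand (w x) (W x)) \<partial>lborel)"
      if w: "(\<lambda>x. w x - v x) \<in> W1p_0 p ?S" "Borel_weak_gradient ?S (\<lambda>x. w x - v x) (\<lambda>x. W x - D x)"
        and wm: "w \<in> borel_measurable borel" "W \<in> borel_measurable borel" "pmass p ?S w < \<infinity>" "pmass p ?S W < \<infinity>" for w W
    proof -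
      have "Borel_weak_gradient ?S (\<lambda>x. v x + (w x - v x)) (\<lambda>x. D x + (W x - D x))" by (rule Borel_weak_gradient_add[OF bwS w(2)])
      then have "has_weak_gradient ?S w W" using has_weak_gradient_Borel_iff[OF wm(1,2), of ?S] by simp
      moreover have ae1: "AE x in lborel. x \<in> ?S \<longrightarrow> w x = u x + (w x - v x)" using aeS(1) by (rule eventually_mono) simp
      ultimately have hw: "has_weak_gradient ?S (\<lambda>x. u x + (w x - v x)) W"
        by (intro has_weak_gradient_AE_imp[OF open_ball ae1]) auto
      have ae2: "AE x in lborel. x \<in> ?S \<longrightarrow> u x + (w x - v x) = w x" using ae1 by (rule eventually_mono) simp
      have "compactly_inside ?S \<Omega>" using R unfolding compactly_inside_def by simp
      then have "F_eps p G \<epsilon> u ?S \<le> F_eps p G \<epsilon> (\<lambda>x. u x + (w x - v x)) ?S"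
        using \<open>local_minimizer p G \<epsilon> \<Omega> u\<close> w(1)
        unfolding local_minimizer_def by (elim conjE allE[where x="?S"] allE[where x="\<lambda>x. w x - v x"] impE) (intro conjI open_ball)
      then have "enn2real (\<integral>\<^sup>+x\<in>?S. ennreal (I.integrand (v x) (D x)) \<partial>lborel) \<le> enn2real (\<integral>\<^sup>+x\<in>?S. ennreal (I.integrand (w x) (W x)) \<partial>lborel)"
        by (simp only: I.F_eps_eq[OF open_ball wS m aeS] I.F_eps_eq[OF open_ball hw wm(1,2) ae2 AE_I2[OF impI[OF refl]]])
      moreover have "(\<integral>\<^sup>+x\<in>?S. ennreal (I.integrand (v x) (D x)) \<partial>lborel) < \<infinity>"
        by (rule I.energy_finite(1)[OF m _ emS le_less_trans[OF pmass_mono_set[OF SO] finp(1)] le_less_trans[OF pmass_mono_set[OF SO] finp(2)]]) simp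
      moreover have "(\<integral>\<^sup>+x\<in>?S. ennreal (I.integrand (w x) (W x)) \<partial>lborel) < \<infinity>"
        by (rule I.energy_finite(1)[OF wm(1,2) _ emS wm(3,4)]) simp
      ultimately show ?thesis by (rule enn2real_le_cancel)
    qed
    obtain C h0 where C: "0 \<le> C" "0 < h0"
      "\<And>h. norm h \<le> h0 \<Longrightarrow> pmass p (ball x0 R) (\<lambda>x. D (x + h) - D (x - h)) \<le> ennreal (C * (norm h)\<^sup>2)"
    proof (rule I.symmetric_difference_estimate[OF v(1) v(2)[rule_format] v(3)[rule_format] fin O R minim])
      fix C h0 assume a: "0 \<le> C" "0 < h0"
        "\<And>h. norm h \<le> h0 \<Longrightarrow> pmass p (ball x0 R) (\<lambda>x. D (x + h) - D (x - h)) \<le> ennreal (C * (norm h)\<^sup>2)"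
      show thesis by (rule that[OF a])
    qed
    define r where "r = min (R/2) h0"
    have r: "r > 0" "r \<le> R/2" "r \<le> h0" using R C by (auto simp: r_def)
    interpret B: difference_bound D x0 r C p
    proof
      have "ball x0 (2 * r) \<subseteq> \<Omega>" using SO r R by (intro order_trans[OF _ SO] subset_ball) auto
      from le_less_trans[OF pmass_mono_set[OF this] finp(2)] show "pmass p (ball x0 (2 * r)) D < \<infinity>" .
      fix h :: "real^'n" assume h: "norm h \<le> r"
      \<comment> \<open>A difference with step \<open>h\<close> is a symmetric difference with step \<open>h/2\<close> about the midpoint.\<close>
      let ?k = "(1/2) *\<^sub>R h"
      have k: "norm ?k \<le> h0" using h r by simp
      have "pmass p (ball x0 r) (\<lambda>x. D (x + h) - D x) \<le> (\<integral>\<^sup>+x. (\<lambda>x. ennreal (norm (D (x + ?k) - D (x - ?k)) powr p) * indicator (ball x0 R) x) (x + ?k) \<partial>lborel)"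
        unfolding pmass_def
      proof (intro nn_integral_mono)
        fix x
        have "x \<in> ball x0 r \<Longrightarrow> x + ?k \<in> ball x0 R"
          using h r norm_triangle_ineq4[of "x0 - x" ?k] by (simp add: dist_norm algebra_simps)
        moreover have "x + ?k + ?k = x + h" by (simp add: scaleR_add_left[symmetric] add.assoc)
        ultimately show "ennreal (norm (D (x + h) - D x) powr p) * indicator (ball x0 r) x \<le> ennreal (norm (D (x + ?k + ?k) - D (x + ?k - ?k)) powr p) * indicator (ball x0 R) (x + ?k)"
          by (cases "x \<in> ball x0 r") (auto simp: add.commute)
      qed
      also have "\<dots> = pmass p (ball x0 R) (\<lambda>x. D (x + ?k) - D (x - ?k))" unfolding pmass_def by (rule nn_integral_lborel_shift) measurable
      also have "\<dots> \<le> ennreal (C * (norm ?k)\<^sup>2)" by (rule C(3)[OF k])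
      also have "\<dots> \<le> ennreal (C * (norm h)\<^sup>2)" using C(1) by (intro ennreal_leI mult_left_mono power_mono) auto
      finally show "pmass p (ball x0 r) (\<lambda>x. D (x + h) - D x) \<le> ennreal (C * (norm h)\<^sup>2)" .
    qed (use r C p1 m in auto)
    \<comment> \<open>The embedding needs an exponent above \<open>p\<close>, while \<open>?t\<close> may be below \<open>p\<close>.\<close>
    define s where "s = max p ?t"
    have n2: "?n - 2 > 0" using q by simp
    have t: "?t * (?n - 2) = ?n * q" using n2 by (simp add: field_simps)
    have t0: "0 \<le> ?t" using n2 q by simp
    have "s * (?n - 2) < p * ?n"
    proof (cases "p \<le> ?t")
      case True
      have "?n * q < ?n * p" using q by (intro mult_strict_left_mono) auto
      then show ?thesis using True t by (simp add: s_def max_def mult.commute)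
    next
      case False
      then show ?thesis using q by (simp add: s_def max_def algebra_simps)
    qed
    then have "pmass s (ball x0 (r/2)) D < \<infinity>" by (intro B.higher_integrability) (auto simp: s_def)
    moreover have "pmass ?t (ball x0 (r/2)) D \<le> emeasure lborel (ball x0 (r/2)) + pmass s (ball x0 (r/2)) D"
      by (rule pmass_le_measure_plus) (use t0 in \<open>auto simp: s_def\<close>)
    ultimately have "pmass ?t (ball x0 (r/2)) D < \<infinity>"
      using emeasure_bounded_finite[OF bounded_ball, of x0 "r/2"] by (auto intro: le_less_trans)
    then show ?thesis using r by (intro exI[of _ "r/2"]) auto
  qed
  show ?thesis unfolding Lp_loc_def
  proof (intro CollectI allI impI)
    fix K assume K: "compact K \<and> K \<subseteq> \<Omega>"
    have [measurable]: "K \<in> sets borel" using K by (auto intro: borel_compact)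
    have "pmass ?t K D < \<infinity>" by (rule local_to_compact_pmass) (use K local in auto)
    then have "pmass ?t K (\<lambda>x. norm (D x)) < \<infinity>" by (simp add: pmass_def)
    then have L: "(\<lambda>x. norm (D x)) \<in> Lp ?t K" by (subst Lp_Borel_iff) auto
    have ae: "AE x in lborel. x \<in> K \<longrightarrow> norm (D x) = norm (weak_gradient \<Omega> u x)"
      using wg by (rule eventually_mono) (use K in auto)
    show "(\<lambda>x. norm (weak_gradient \<Omega> u x)) \<in> Lp ?t K" by (rule Lp_AE_imp[OF ae L])
  qed
qed

end
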